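(* Let $\Omega=\mathbb{R}^2$ or $\Omega=\mathbb{R}^2_+=\mathbb{R}\times(0,\infty)$. Let $\mathbf{v}=(v_1,v_2)\in H^1_{\rm loc}(\overline{\Omega})$ and $P\in H^1_{\rm loc}(\overline{\Omega})$ satisfy $$\mathbf{v}\cdot\nabla\mathbf{v}+\nabla P=0,\qquad \operatorname{div}\mathbf{v}=0\quad\text{in }\Omega,$$ and, if $\Omega=\mathbb{R}^2_+$, also $v_2=0$ on $\partial\Omega$ in the sense of trace. Suppose that $\mathbf{v}$ has no essential stagnation points in $\overline{\Omega}$: for every compact $K\subset\overline{\Omega}$ there is $c_K>0$ such that $|\mathbf{v}|\ge c_K$ a.e. in $K$. If $\nabla P\in L^q(\Omega)$ for some $q\in[1,2]$, then $P$ is constant; equivalently, $\mathbf{v}$ is a parallel shear flow.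
   Context: $H^1_{\rm loc}(\overline\Omega)$ is the set of functions belonging to $H^1(\Omega\cap B)$ for every ball $B$. The equations are understood in the sense of distributions (equivalently a.e.). A vector field $\mathbf{v}$ on $\Omega$ is called a parallel shear flow if there exist a unit vector $\mathbf{e}$ and a scalar function $V$ such that $\mathbf{v}(x)=V(x\cdot\mathbf{e}^\perp)\mathbf{e}$, where $\mathbf{e}^\perp$ is $\mathbf{e}$ rotated by $90$ degrees; in the half-plane with slip condition this means $\mathbf{v}(x_1,x_2)=(V(x_2),0)$. *)

theory Defs
  imports "HOL-Analysis.Analysis"
begin

definition partial_deriv :: "'a::euclidean_space \<Rightarrow> ('a \<Rightarrow> real) \<Rightarrow> 'a \<Rightarrow> real" where
  "partial_deriv b f x = frechet_derivative f (at x) b"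

primrec C_k :: "nat \<Rightarrow> ('a::euclidean_space \<Rightarrow> real) \<Rightarrow> bool" where
  "C_k 0 f \<longleftrightarrow> continuous_on UNIV f"
| "C_k (Suc k) f \<longleftrightarrow> (\<forall>x. f differentiable (at x)) \<and> (\<forall>b\<in>Basis. C_k k (partial_deriv b f))"

definition C_infinity :: "('a::euclidean_space \<Rightarrow> real) \<Rightarrow> bool" where
  "C_infinity f \<longleftrightarrow> (\<forall>k. C_k k f)"

definition test_functions :: "'a::euclidean_space set \<Rightarrow> ('a \<Rightarrow> real) set" where
  "test_functions U = {\<phi>. C_infinity \<phi> \<and> compact (closure {x. \<phi> x \<noteq> 0}) \<and> closure {x. \<phi> x \<noteq> 0} \<subseteq> U}"

definition loc_integrable_on :: "('a::euclidean_space \<Rightarrow> real) \<Rightarrow> 'a set \<Rightarrow> bool" where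
  "loc_integrable_on f U \<longleftrightarrow> (\<forall>K. compact K \<and> K \<subseteq> U \<longrightarrow> f absolutely_integrable_on K)"

(* Functions in Lebesgue and Sobolev spaces are represented by total functions whose values
   outside U are irrelevant; no quotient by almost-everywhere equality is taken. *)

definition Lp_space :: "real \<Rightarrow> 'a::euclidean_space set \<Rightarrow> ('a \<Rightarrow> 'b::euclidean_space) set" where
  "Lp_space p U = {f. f \<in> borel_measurable (lebesgue_on U) \<and>
                      integrable (lebesgue_on U) (\<lambda>x. norm (f x) powr p)}"

definition has_weak_partial ::
    "'a::euclidean_space set \<Rightarrow> 'a \<Rightarrow> ('a \<Rightarrow> real) \<Rightarrow> ('a \<Rightarrow> real) \<Rightarrow> bool" where
  "has_weak_partial U b f g \<longleftrightarrow>
     loc_integrable_on f U \<and> loc_integrable_on g U \<and>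
     (\<forall>\<phi>\<in>test_functions U.
        (LINT x|lebesgue_on U. f x * partial_deriv b \<phi> x) = - (LINT x|lebesgue_on U. g x * \<phi> x))"

(* Unique only up to almost-everywhere equality on U, and arbitrary if no weak derivative exists. *)
definition weak_partial :: "'a::euclidean_space set \<Rightarrow> 'a \<Rightarrow> ('a \<Rightarrow> real) \<Rightarrow> 'a \<Rightarrow> real" where
  "weak_partial U b f = (SOME g. has_weak_partial U b f g)"

definition weak_grad :: "'a::euclidean_space set \<Rightarrow> ('a \<Rightarrow> real) \<Rightarrow> 'a \<Rightarrow> 'a" where
  "weak_grad U f x = (\<Sum>b\<in>Basis. weak_partial U b f x *\<^sub>R b)"

definition H1 :: "'a::euclidean_space set \<Rightarrow> ('a \<Rightarrow> real) set" where
  "H1 U = {f. f \<in> Lp_space 2 U \<and> (\<forall>b\<in>Basis. \<exists>g\<in>Lp_space 2 U. has_weak_partial U b f g)}"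

(* Local up to the boundary of U: the balls are not required to lie inside U. *)
definition H1_loc_closure :: "'a::euclidean_space set \<Rightarrow> ('a \<Rightarrow> real) set" where
  "H1_loc_closure U = {f. \<forall>c r. f \<in> H1 (U \<inter> ball c r)}"

definition half_plane :: "(real \<times> real) set" where
  "half_plane = UNIV \<times> {0<..}"

(* The trace operator on the boundary line of the half-plane, as the continuous extension of
   restriction: g is the trace of f if some smooth functions on the whole plane converge to f in
   H1 of (half-plane intersected with B) for every ball B, while their restrictions to the line
   converge to g in L2 of every bounded interval. *)
definition has_trace :: "(real \<times> real \<Rightarrow> real) \<Rightarrow> (real \<Rightarrow> real) \<Rightarrow> bool" where
  "has_trace f g \<longleftrightarrow>
     f \<in> H1_loc_closure half_plane \<and> (\<forall>r. g \<in> Lp_space 2 {-r..r}) \<and>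
     (\<exists>u :: nat \<Rightarrow> real \<times> real \<Rightarrow> real.
        (\<forall>n. C_infinity (u n)) \<and>
        (\<forall>c r.
           (\<lambda>n. LINT x|lebesgue_on (half_plane \<inter> ball c r). (u n x - f x)\<^sup>2) \<longlonglongrightarrow> 0 \<and>
           (\<forall>b\<in>Basis. (\<lambda>n. LINT x|lebesgue_on (half_plane \<inter> ball c r).
              (partial_deriv b (u n) x - weak_partial half_plane b f x)\<^sup>2) \<longlonglongrightarrow> 0)) \<and>
        (\<forall>r. (\<lambda>n. LINT s|lebesgue_on {-r..r}. (u n (s, 0) - g s)\<^sup>2) \<longlonglongrightarrow> 0))"

definition steady_euler ::
    "(real \<times> real) set \<Rightarrow> (real \<times> real \<Rightarrow> real \<times> real) \<Rightarrow> (real \<times> real \<Rightarrow> real) \<Rightarrow> bool" where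
  "steady_euler \<Omega> v P \<longleftrightarrow>
     (AE x in lebesgue_on \<Omega>. \<forall>j\<in>Basis.
        (\<Sum>i\<in>Basis. (v x \<bullet> i) * weak_partial \<Omega> i (\<lambda>y. v y \<bullet> j) x) + weak_partial \<Omega> j P x = 0) \<and>
     (AE x in lebesgue_on \<Omega>. (\<Sum>i\<in>Basis. weak_partial \<Omega> i (\<lambda>y. v y \<bullet> i) x) = 0)"

definition no_essential_stagnation ::
    "(real \<times> real) set \<Rightarrow> (real \<times> real \<Rightarrow> real \<times> real) \<Rightarrow> bool" where
  "no_essential_stagnation \<Omega> v \<longleftrightarrow>
     (\<forall>K. compact K \<and> K \<subseteq> closure \<Omega> \<longrightarrow> (\<exists>c>0. AE x in lebesgue_on K. c \<le> norm (v x)))"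

definition perp :: "real \<times> real \<Rightarrow> real \<times> real" where
  "perp e = (- snd e, fst e)"

definition parallel_shear_flow ::
    "(real \<times> real) set \<Rightarrow> (real \<times> real \<Rightarrow> real \<times> real) \<Rightarrow> bool" where
  "parallel_shear_flow \<Omega> v \<longleftrightarrow>
     (\<exists>e V. norm e = 1 \<and> (AE x in lebesgue_on \<Omega>. v x = V (x \<bullet> perp e) *\<^sub>R e))"

end

theory Submission
  imports Defs
begin

text \<open>Writing \<open>v = |v| (cos \<phi>, sin \<phi>)\<close>, the equations say \<open>\<partial>\<^sub>1 P = |v|\<^sup>2 \<partial>\<^sub>2 \<phi>\<close> and
  \<open>\<partial>\<^sub>2 P = - |v|\<^sup>2 \<partial>\<^sub>1 \<phi>\<close>, so that \<open>div (|v|\<^sup>2 \<nabla>\<phi>) = 0\<close> and \<open>|v|\<^sup>2 |\<nabla>\<phi>| = |\<nabla>P|\<close>. Testing with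
  \<open>\<chi> arctan \<phi>\<close> for a cutoff \<open>\<chi>\<close> at scale \<open>R\<close> bounds
  \<open>\<integral> \<chi> |\<nabla>P|\<^sup>2 / (|v|\<^sup>2 (1 + \<phi>\<^sup>2))\<close> by a multiple of \<open>\<integral> |\<nabla>P| |\<nabla>\<chi>|\<close>, which tends to zero as
  \<open>R\<close> grows because \<open>|\<nabla>P|\<close> is in \<open>L\<^sup>q\<close> with \<open>q \<le> 2\<close>. Hence \<open>\<nabla>P = 0\<close> and \<open>\<nabla>\<phi> = 0\<close>.

  Since \<open>v\<close> is merely in \<open>H\<^sup>1\<close>, the differential \<open>\<omega> = (v\<^sub>1 \<nabla>v\<^sub>2 - v\<^sub>2 \<nabla>v\<^sub>1) / |v|\<^sup>2\<close> replaces \<open>\<nabla>\<phi>\<close>. It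
  is weakly closed, because away from the origin it is the pullback of the angle form, so its
  mollifications are gradients of potentials \<open>\<phi>\<^sub>n\<close>; along a subsequence these stay bounded almost
  everywhere, and Fatou's lemma suffices to pass to the limit. The half-plane is reduced to the plane
  by reflecting \<open>v\<^sub>1\<close> and \<open>P\<close> evenly and \<open>v\<^sub>2\<close> oddly, the latter being possible because its trace vanishes.\<close>

section \<open>A smooth kernel supported in the open first quadrant\<close>

text \<open>The weight \<open>|v|^2\<close> has no bounds uniform at infinity, and mollifying a
  product with it would spoil the divergence equation. That equation is therefore used as
  \<open>curl \<nabla>P = 0\<close>, which mollification preserves exactly: two closed smooth fields
  are paired, the mollified \<open>\<nabla>P\<close> and the mollified \<omega>, and the relation
  \<open>|v|^2 |\<omega>| = |\<nabla>P|\<close> enters only in the limit. No growth of the angle is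
  known, hence the \<open>arctan\<close>: the test function stays bounded, while the weight
  \<open>1 / (1 + \<phi>^2)\<close> stays away from zero wherever the potentials are bounded. The
  range of \<open>q\<close> comes from scaling: by Hoelder, the integral of
  \<open>|\<nabla>P| |\<nabla>\<chi>|\<close> is at most a multiple of \<open>R^(1 - 2/q)\<close>.
  At \<open>q = 2\<close> this is merely bounded; the decay then comes from a cutoff whose slope is
  of size \<open>|z| / R^2\<close>, small on each bounded set. Smooth test functions are constructed
  only as translated kernels, for which an explicit family closed under differentiation suffices;
  class \<open>C^1\<close> is enough for all other auxiliary functions.\<close>

definition flat_exp :: "real poly \<Rightarrow> real \<Rightarrow> real" where
  "flat_exp p t = (if t > 0 then poly p (1 / t) * exp (- (1 / t)) else 0)"

lemma poly_times_exp_minus_tendsto_0: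
  fixes p :: "real poly"
  shows "((\<lambda>x. poly p x * exp (- x)) \<longlongrightarrow> 0) at_top"
proof -
  have "((\<lambda>x::real. \<Sum>i\<le>degree p. coeff p i * (x ^ i / exp x)) \<longlongrightarrow> (\<Sum>i\<le>degree p. coeff p i * 0)) at_top"
    by (intro tendsto_intros tendsto_power_div_exp_0)
  then show ?thesis
    by (simp add: poly_altdef sum_distrib_right exp_minus divide_inverse mult.assoc)
qed

text \<open>In the variable \<open>x = 1/t\<close> the derivative of \<open>p(x) exp (-x)\<close> is
  \<open>x^2 (p - p')(x) exp (-x)\<close>. The family is thus closed under differentiation, and the
  junction at \<open>t = 0\<close> needs one limit for all orders.\<close>

lemma DERIV_flat_exp:
  "(flat_exp p has_real_derivative flat_exp (monom 1 2 * (p - pderiv p)) t) (at t)"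
proof -
  consider "t > 0" | "t < 0" | "t = 0" by linarith
  then show ?thesis
  proof cases
    case 1
    have "((\<lambda>t. poly p (1 / t) * exp (- (1 / t))) has_real_derivative
        flat_exp (monom 1 2 * (p - pderiv p)) t) (at t)"
      using 1
      by (auto intro!: derivative_eq_intros DERIV_chain2[OF poly_DERIV]
          simp: flat_exp_def poly_monom field_simps power2_eq_square)
    moreover have "eventually (\<lambda>s. s > 0) (nhds t)"
      using 1 eventually_nhds_in_open[of "{0<..}" t] by simp
    then have "eventually (\<lambda>s. poly p (1 / s) * exp (- (1 / s)) = flat_exp p s) (nhds t)"
      by eventually_elim (simp add: flat_exp_def)
    ultimately show ?thesis by (subst (asm) DERIV_cong_ev) auto
  next
    case 2
    have "eventually (\<lambda>s. s < 0) (nhds t)"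
      using 2 eventually_nhds_in_open[of "{..<0}" t] by simp
    then have "eventually (\<lambda>s. 0 = flat_exp p s) (nhds t)"
      by eventually_elim (simp add: flat_exp_def)
    moreover have "((\<lambda>s. 0) has_real_derivative 0) (at t)" by simp
    ultimately show ?thesis using 2 by (subst (asm) DERIV_cong_ev) (auto simp: flat_exp_def)
  next
    case 3
    \<comment> \<open>The difference quotient at 0 brings a further factor \<open>1/h\<close>; the
      polynomial \<open>pCons 0 p\<close>, that is \<open>x p(x)\<close>, absorbs it.\<close>
    have "((\<lambda>x. poly (pCons 0 p) x * exp (- x)) \<longlongrightarrow> 0) at_top"
      by (rule poly_times_exp_minus_tendsto_0)
    then have "((\<lambda>h. poly (pCons 0 p) (inverse h) * exp (- (inverse h))) \<longlongrightarrow> 0) (at_right (0::real))"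
      by (rule filterlim_compose[OF _ filterlim_inverse_at_top_right])
    then have r: "((\<lambda>h. (flat_exp p (0 + h) - flat_exp p 0) / h) \<longlongrightarrow> 0) (at_right 0)"
      by (rule Lim_transform_eventually)
         (auto simp: eventually_at_right_less flat_exp_def field_simps inverse_eq_divide
           intro: eventually_at_rightI[of 0 1])
    have l: "((\<lambda>h. (flat_exp p (0 + h) - flat_exp p 0) / h) \<longlongrightarrow> 0) (at_left 0)"
      by (rule Lim_transform_eventually[OF tendsto_const])
         (auto simp: flat_exp_def intro: eventually_at_leftI[of "-1" 0])
    from l r show ?thesis unfolding 3 DERIV_def
      by (simp add: filterlim_split_at flat_exp_def)
  qed
qed

text \<open>Products of two flat functions, glued to zero at 1 and at 2. Sums are taken because the
  product rule turns one product into two; a list of pairs of polynomials then stands for a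
  function.\<close>

definition bump_sum :: "(real poly \<times> real poly) list \<Rightarrow> real \<Rightarrow> real" where
  "bump_sum L t = (\<Sum>(p, q)\<leftarrow>L. flat_exp p (t - 1) * flat_exp q (2 - t))"

lemma DERIV_bump_sum: "\<exists>L'. \<forall>t. (bump_sum L has_real_derivative bump_sum L' t) (at t)"
proof (induction L)
  case Nil
  show ?case by (rule exI[of _ "[]"]) (simp add: bump_sum_def[abs_def])
next
  case (Cons pq L)
  obtain p q where pq: "pq = (p, q)" by fastforce
  obtain L' where L': "\<And>t. (bump_sum L has_real_derivative bump_sum L' t) (at t)"
    using Cons by blast
  let ?d = "\<lambda>p. monom 1 2 * (p - pderiv p)"
  have "((\<lambda>t. flat_exp p (t - 1) * flat_exp q (2 - t) + bump_sum L t) has_real_derivative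
     bump_sum ((?d p, q) # (p, - ?d q) # L') t) (at t)" for t
    by (rule derivative_eq_intros DERIV_chain2[OF DERIV_flat_exp] L' refl)+
       (simp add: bump_sum_def flat_exp_def)
  moreover have "bump_sum (pq # L) = (\<lambda>t. flat_exp p (t - 1) * flat_exp q (2 - t) + bump_sum L t)"
    by (auto simp: bump_sum_def pq)
  ultimately show ?case by metis
qed

lemma bump_sum_eq_0: "t \<notin> {1<..<2} \<Longrightarrow> bump_sum L t = 0"
  by (induction L) (auto simp: bump_sum_def flat_exp_def)

text \<open>A choice function \<open>D\<close> makes differentiation an operator on lists, so the
  whole sequence of derivatives arises by iterating \<open>D\<close> on the list of
  \<open>exp (-1/(t-1)) * exp (-1/(2-t))\<close>. This function is positive on the open interval
  from 1 to 2, so its mass \<open>Z\<close> can be divided out.\<close>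

lemma bump_exists:
  "\<exists>B :: nat \<Rightarrow> real \<Rightarrow> real. (\<forall>k t. (B k has_real_derivative B (Suc k) t) (at t)) \<and>
     (\<forall>k t. t \<notin> {1<..<2} \<longrightarrow> B k t = 0) \<and> (\<forall>t. 0 \<le> B 0 t) \<and>
     integrable lborel (B 0) \<and> (LINT t|lborel. B 0 t) = 1"
proof -
  obtain D where D: "\<And>L t. (bump_sum L has_real_derivative bump_sum (D L) t) (at t)"
    using DERIV_bump_sum by metis
  define f where "f = bump_sum [(1, 1)]"
  have f: "f t = flat_exp 1 (t - 1) * flat_exp 1 (2 - t)" for t
    by (simp add: f_def bump_sum_def)
  have cont: "continuous_on S f" for S
    unfolding f_def by (intro DERIV_continuous_on[OF DERIV_subset[OF D]]) auto
  have f0: "0 \<le> f t" for t by (simp add: f flat_exp_def)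
  have supp: "f t = indicator {1..2} t *\<^sub>R f t" for t
    using bump_sum_eq_0[of t "[(1, 1)]"] by (cases "t \<in> {1<..<2}") (auto simp: f_def)
  have int: "integrable lborel f"
    using borel_integrable_atLeastAtMost'[OF cont[of "{1..2}"]]
    unfolding set_integrable_def supp[symmetric] .
  define Z where "Z = (LINT t|lborel. f t)"
  have "Z \<noteq> 0"
  proof
    assume "Z = 0"
    then have "AE t in lborel. f t = 0"
      using integral_nonneg_eq_0_iff_AE[OF int] f0 by (simp add: Z_def)
    then have "emeasure lborel {t. f t \<noteq> 0} = 0"
      using int by (subst (asm) AE_iff_measurable[OF _ refl]) auto
    moreover have "{1<..<2} \<subseteq> {t. f t \<noteq> 0}" by (auto simp: f flat_exp_def)
    then have "emeasure lborel {1<..<2::real} \<le> emeasure lborel {t. f t \<noteq> 0}"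
      using int by (intro emeasure_mono) auto
    ultimately show False by simp
  qed
  moreover have "0 \<le> Z" unfolding Z_def using f0 by simp
  ultimately have "Z > 0" by simp
  define B where "B k t = bump_sum ((D ^^ k) [(1, 1)]) t / Z" for k t
  have "B 0 = (\<lambda>t. f t / Z)" by (auto simp: B_def f_def)
  then have "integrable lborel (B 0)" "(LINT t|lborel. B 0 t) = 1"
    using int \<open>Z > 0\<close> by (auto simp: Z_def)
  moreover have "\<forall>k t. (B k has_real_derivative B (Suc k) t) (at t)"
    unfolding B_def[abs_def] by (auto intro!: DERIV_cdivide D)
  ultimately show ?thesis
    using \<open>Z > 0\<close> f0 by (intro exI[of _ B]) (auto simp: B_def bump_sum_eq_0 f_def)
qed

definition bump :: "nat \<Rightarrow> real \<Rightarrow> real" where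
  "bump = (SOME B. (\<forall>k t. (B k has_real_derivative B (Suc k) t) (at t)) \<and>
     (\<forall>k t. t \<notin> {1<..<2} \<longrightarrow> B k t = 0) \<and> (\<forall>t. 0 \<le> B 0 t) \<and>
     integrable lborel (B 0) \<and> (LINT t|lborel. B 0 t) = 1)"

lemma
  shows DERIV_bump: "(bump k has_real_derivative bump (Suc k) t) (at t)"
    and bump_eq_0: "t \<notin> {1<..<2} \<Longrightarrow> bump k t = 0"
    and bump_nonneg: "0 \<le> bump 0 t"
    and integrable_bump: "integrable lborel (bump 0)"
    and integral_bump: "(LINT t|lborel. bump 0 t) = 1"
  using someI_ex[OF bump_exists] unfolding bump_def[symmetric] by blast+

text \<open>The \<open>k\<close>-th derivative of the rescaling \<open>(n+1) B((n+1) t)\<close>,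
  which keeps mass one; hence the power \<open>k + 1\<close>.\<close>

definition bump_at :: "nat \<Rightarrow> nat \<Rightarrow> real \<Rightarrow> real" where
  "bump_at n k t = real (Suc n) ^ Suc k * bump k (real (Suc n) * t)"

lemma DERIV_bump_at: "(bump_at n k has_real_derivative bump_at n (Suc k) t) (at t)"
  unfolding bump_at_def[abs_def]
  by (rule derivative_eq_intros DERIV_chain2[OF DERIV_bump] refl)+ simp

lemma continuous_on_bump_at: "continuous_on S (bump_at n k)"
  by (intro DERIV_continuous_on[OF DERIV_subset[OF DERIV_bump_at]]) auto

lemma bump_at_eq_0: "t \<notin> {1 / real (Suc n)<..<2 / real (Suc n)} \<Longrightarrow> bump_at n k t = 0"
  unfolding bump_at_def by (subst bump_eq_0) (auto simp: field_simps)

lemma bump_at_nonneg: "0 \<le> bump_at n 0 t"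
  by (simp add: bump_at_def bump_nonneg)

lemma integral_bump_at: "integrable lborel (bump_at n 0)" "(LINT t|lborel. bump_at n 0 t) = 1"
proof -
  show "integrable lborel (bump_at n 0)"
    using lborel_integrable_real_affine[OF integrable_bump, of "real (Suc n)" 0]
    unfolding bump_at_def by (simp del: of_nat_Suc)
  show "(LINT t|lborel. bump_at n 0 t) = 1"
    using lborel_integral_real_affine[of "real (Suc n)" "bump 0" 0] integral_bump
    unfolding bump_at_def by (simp del: of_nat_Suc)
qed

lemma bounded_bump_at: "\<exists>M. \<forall>t. \<bar>bump_at n k t\<bar> \<le> M"
proof -
  have "bounded (bump_at n k ` {1 / real (Suc n)..2 / real (Suc n)})"
    by (intro compact_imp_bounded compact_continuous_image continuous_on_bump_at) auto
  then obtain M where "\<forall>y\<in>bump_at n k ` {1 / real (Suc n)..2 / real (Suc n)}. norm y \<le> M"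
    unfolding bounded_iff by blast
  then have M: "\<And>t. t \<in> {1 / real (Suc n)..2 / real (Suc n)} \<Longrightarrow> \<bar>bump_at n k t\<bar> \<le> M"
    by auto
  have "\<bar>bump_at n k t\<bar> \<le> max M 0" for t
    using M[of t] bump_at_eq_0[of t n k] by (cases "t \<in> {1 / real (Suc n)<..<2 / real (Suc n)}") auto
  then show ?thesis by blast
qed

text \<open>The kernel sits in the open first quadrant, so that mollification at a point of the closed
  upper half-plane only involves values taken in the open half-plane.\<close>

definition kern :: "nat \<Rightarrow> nat \<Rightarrow> nat \<Rightarrow> real \<times> real \<Rightarrow> real" where
  "kern n i j z = bump_at n i (fst z) * bump_at n j (snd z)"

lemma Basis_plane: "Basis = {(1, 0), (0, 1) :: real \<times> real}"
  by (auto simp: Basis_prod_def)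

lemma has_derivative_kern:
  "((\<lambda>y. kern n i j (y - x)) has_derivative
     (\<lambda>h. kern n (Suc i) j (y - x) * fst h + kern n i (Suc j) (y - x) * snd h)) (at y)"
proof -
  have D: "(bump_at n k has_derivative (*) (bump_at n (Suc k) t)) (at t)" for k t
    using DERIV_bump_at unfolding has_field_derivative_def .
  have 1: "((\<lambda>y. bump_at n i (fst y - fst x)) has_derivative
      (\<lambda>h. bump_at n (Suc i) (fst y - fst x) * fst h)) (at y)"
    by (rule has_derivative_compose[OF _ D, of "\<lambda>y. fst y - fst x"])
       (auto intro!: derivative_eq_intros)
  have 2: "((\<lambda>y. bump_at n j (snd y - snd x)) has_derivative
      (\<lambda>h. bump_at n (Suc j) (snd y - snd x) * snd h)) (at y)"
    by (rule has_derivative_compose[OF _ D, of "\<lambda>y. snd y - snd x"])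
       (auto intro!: derivative_eq_intros)
  show ?thesis
    unfolding kern_def
    by (rule has_derivative_eq_rhs, use has_derivative_mult[OF 1 2] in simp)
       (auto simp: fun_eq_iff algebra_simps)
qed

lemma partial_deriv_kern:
  "partial_deriv (1, 0) (\<lambda>y. kern n i j (y - x)) = (\<lambda>y. kern n (Suc i) j (y - x))"
  "partial_deriv (0, 1) (\<lambda>y. kern n i j (y - x)) = (\<lambda>y. kern n i (Suc j) (y - x))"
  unfolding partial_deriv_def frechet_derivative_at[OF has_derivative_kern, symmetric] by auto

lemma continuous_on_kern: "continuous_on S (kern n i j)"
  unfolding kern_def
  by (intro continuous_intros continuous_on_compose2[OF continuous_on_bump_at[of UNIV]]) auto

text \<open>The indices \<open>i\<close> and \<open>j\<close> count derivatives in each variable, so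
  a partial derivative of a kernel is again a kernel, and the recursion of \<open>C_k\<close>
  becomes a plain induction over all \<open>i\<close> and \<open>j\<close>.\<close>

lemma C_infinity_kern: "C_infinity (\<lambda>y. kern n i j (y - x))"
proof -
  have "C_k k (\<lambda>y. kern n i j (y - x))" for k i j
  proof (induction k arbitrary: i j)
    case 0
    show ?case
      by (auto intro!: continuous_intros continuous_on_compose2[OF continuous_on_kern[of UNIV]])
  next
    case (Suc k)
    then show ?case
      using has_derivative_kern[of n i j x]
      unfolding differentiable_def Basis_plane C_k.simps by (auto simp only: partial_deriv_kern) blast
  qed
  then show ?thesis by (simp add: C_infinity_def)
qed

lemma kern_eq_0:
  assumes "\<not> (1 / real (Suc n) < fst z \<and> fst z < 2 / real (Suc n) \<and>
    1 / real (Suc n) < snd z \<and> snd z < 2 / real (Suc n))"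
  shows "kern n i j z = 0"
  using assms bump_at_eq_0[of "fst z" n i] bump_at_eq_0[of "snd z" n j] by (auto simp: kern_def)

text \<open>The hypothesis concerns a closed square, although the kernel vanishes off the open one,
  because \<open>test_functions\<close> constrains the closure of the support.\<close>

lemma kern_test_function:
  assumes "\<And>y. 1 / real (Suc n) \<le> fst y - fst x \<Longrightarrow> fst y - fst x \<le> 2 / real (Suc n) \<Longrightarrow>
    1 / real (Suc n) \<le> snd y - snd x \<Longrightarrow> snd y - snd x \<le> 2 / real (Suc n) \<Longrightarrow> y \<in> U"
  shows "(\<lambda>y. kern n i j (y - x)) \<in> test_functions U"
proof -
  define d where "d = 1 / real (Suc n)"
  let ?S = "{y. kern n i j (y - x) \<noteq> 0}"
  let ?B = "cbox (fst x + d, snd x + d) (fst x + 2 * d, snd x + 2 * d)"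
  have sub: "?S \<subseteq> ?B"
  proof
    fix y assume "y \<in> ?S"
    then show "y \<in> ?B"
      using kern_eq_0[of n "y - x" i j]
      by (cases y; cases "1 / real (Suc n) < fst (y - x) \<and> fst (y - x) < 2 / real (Suc n) \<and>
        1 / real (Suc n) < snd (y - x) \<and> snd (y - x) < 2 / real (Suc n)")
        (auto simp: d_def cbox_Pair_eq simp del: of_nat_Suc)
  qed
  then have *: "closure ?S \<subseteq> ?B" by (intro closure_minimal) auto
  moreover have "?B \<subseteq> U"
    using assms by (auto simp: d_def cbox_Pair_eq algebra_simps)
  moreover have "compact (closure ?S)"
    using * by (intro compact_closure[THEN iffD2] bounded_subset[OF bounded_cbox sub])
  ultimately show ?thesis
    unfolding test_functions_def using C_infinity_kern by auto
qed

section \<open>Mollification of locally integrable functions\<close>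

text \<open>Boxes instead of balls: their sections along coordinate lines are intervals, which suits
  Fubini.\<close>

definition bx :: "real \<Rightarrow> (real \<times> real) set" where
  "bx R = {z. \<bar>fst z\<bar> \<le> R \<and> \<bar>snd z\<bar> \<le> R}"

lemma bx_cbox: "bx R = cbox (- R, - R) (R, R)"
  by (auto simp: bx_def cbox_Pair_eq)

lemma bx_mono: "R \<le> S \<Longrightarrow> bx R \<subseteq> bx S"
  by (auto simp: bx_def)

lemma bx_sets [measurable]: "bx R \<in> sets borel"
  by (simp add: bx_cbox)

lemma compact_bx: "compact (bx R)"
  by (simp add: bx_cbox)

lemma emeasure_bx: "emeasure lborel (bx R) < \<infinity>"
  unfolding bx_cbox by (rule emeasure_lborel_cbox_finite)

lemma integrable_indicator_bx: "integrable lborel (indicator (bx R) :: _ \<Rightarrow> real)"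
  using emeasure_bx by (auto simp: integrable_indicator_iff)

lemma bounded_subset_bx: "bounded S \<Longrightarrow> \<exists>R>0. S \<subseteq> bx R"
proof -
  assume "bounded S"
  then obtain R where R: "R > 0" "\<And>x. x \<in> S \<Longrightarrow> norm x \<le> R"
    using bounded_pos by blast
  have "S \<subseteq> bx R"
  proof
    fix x assume "x \<in> S"
    with R have "norm x \<le> R" by auto
    with norm_fst_le[of "fst x" "snd x"] norm_snd_le[of "snd x" "fst x"]
    show "x \<in> bx R" by (auto simp: bx_def)
  qed
  with R show ?thesis by blast
qed

text \<open>Borel rather than Lebesgue measurability, so that compositions and restrictions to lines
  stay measurable.\<close>

definition L1loc :: "(real \<times> real \<Rightarrow> real) \<Rightarrow> bool" where
  "L1loc f \<longleftrightarrow> f \<in> borel_measurable borel \<and> (\<forall>R. integrable lborel (\<lambda>z. indicator (bx R) z * f z))"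

lemma L1loc_measurable [measurable_dest]: "L1loc f \<Longrightarrow> f \<in> borel_measurable borel"
  by (simp add: L1loc_def)

lemma integrable_imp_L1loc: "integrable lborel f \<Longrightarrow> L1loc f"
  unfolding L1loc_def
  by (auto intro!: integrable_mult_indicator[where 'b=real, simplified] dest: borel_measurable_integrable)

lemma L1loc_times_bounded:
  assumes f: "L1loc f" and w[measurable]: "w \<in> borel_measurable borel"
    and M: "\<And>z. \<bar>w z\<bar> \<le> M" and R: "\<And>z. z \<notin> bx R \<Longrightarrow> w z = 0"
  shows "integrable lborel (\<lambda>z. f z * w z)"
proof (rule Bochner_Integration.integrable_bound)
  show "integrable lborel (\<lambda>z. M * (indicator (bx R) z * f z))"
    using f by (auto simp: L1loc_def)
  show "AE z in lborel. norm (f z * w z) \<le> norm (M * (indicator (bx R) z * f z))"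
  proof (rule AE_I2)
    fix z show "norm (f z * w z) \<le> norm (M * (indicator (bx R) z * f z))"
      using M[of z] R[of z] by (cases "z \<in> bx R") (auto simp: abs_mult mult.commute[of M] intro!: mult_left_mono)
  qed
  show "(\<lambda>z. f z * w z) \<in> borel_measurable lborel"
    using f by measurable
qed

lemma continuous_imp_L1loc:
  assumes "continuous_on UNIV f" shows "L1loc f"
proof -
  have "integrable lborel (\<lambda>z. indicator (bx R) z *\<^sub>R f z)" for R
    by (intro borel_integrable_compact compact_bx continuous_on_subset[OF assms]) auto
  then show ?thesis
    using assms by (simp add: L1loc_def borel_measurable_continuous_onI)
qed

text \<open>An average of \<open>f\<close> over a small square above and to the right of
  \<open>x\<close>. The indices differentiate the kernel in \<open>y\<close>, so
  \<open>moll n i j f\<close> is \<open>(-1)^(i+j)\<close> times a mixed derivative of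
  \<open>moll n 0 0 f\<close>; this is the origin of the minus signs below.\<close>

definition moll :: "nat \<Rightarrow> nat \<Rightarrow> nat \<Rightarrow> (real \<times> real \<Rightarrow> real) \<Rightarrow> real \<times> real \<Rightarrow> real" where
  "moll n i j f x = (LINT y|lborel. f y * kern n i j (y - x))"

lemma kern_measurable [measurable]: "kern n i j \<in> borel_measurable borel"
  by (intro borel_measurable_continuous_onI continuous_on_kern)

lemma kern_bounded: "\<exists>M\<ge>0. \<forall>z. \<bar>kern n i j z\<bar> \<le> M"
proof -
  obtain A B where A: "\<And>t. \<bar>bump_at n i t\<bar> \<le> A" and B: "\<And>t. \<bar>bump_at n j t\<bar> \<le> B"
    using bounded_bump_at by meson
  have "\<bar>kern n i j z\<bar> \<le> A * B" for z
    using A[of "fst z"] B[of "snd z"] by (auto simp: kern_def abs_mult intro!: mult_mono)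
  moreover have "0 \<le> A * B"
    using A[of 0] B[of 0] by (intro mult_nonneg_nonneg) auto
  ultimately show ?thesis by blast
qed

lemma kern_nonneg: "0 \<le> kern n 0 0 z"
  by (simp add: kern_def bump_at_nonneg)

lemma kern_eq_0_bx: "z \<notin> bx (2 / real (Suc n)) \<Longrightarrow> kern n i j z = 0"
  by (rule kern_eq_0) (auto simp: bx_def abs_if)

lemma kern_eq_0_bx2: "z \<notin> bx 2 \<Longrightarrow> kern n i j z = 0"
  using bx_mono[of "2 / real (Suc n)" 2] by (intro kern_eq_0_bx) (auto simp: field_simps)

lemma bx_shift: "y - x \<in> bx R \<Longrightarrow> x \<in> bx S \<Longrightarrow> y \<in> bx (R + S)"
  unfolding bx_def by (cases x; cases y) auto

lemma kern_shift_eq_0: "x \<in> bx R \<Longrightarrow> y \<notin> bx (2 + R) \<Longrightarrow> kern n i j (y - x) = 0"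
  using bx_shift kern_eq_0_bx2 by blast

lemma bx_self: "x \<in> bx (norm x)"
  using norm_fst_le[of "fst x" "snd x"] norm_snd_le[of "snd x" "fst x"] by (auto simp: bx_def)

lemma integrable_times_kern:
  assumes "L1loc f" shows "integrable lborel (\<lambda>y. f y * kern n i j (y - x))"
proof -
  obtain M where "\<And>z. \<bar>kern n i j z\<bar> \<le> M" using kern_bounded by blast
  with assms show ?thesis
    by (intro L1loc_times_bounded[where R="2 + norm x" and M=M])
       (auto intro: kern_shift_eq_0[OF bx_self])
qed

lemma continuous_on_moll:
  assumes f: "L1loc f" shows "continuous_on UNIV (moll n i j f)"
proof -
  obtain M where M: "\<And>z. \<bar>kern n i j z\<bar> \<le> M" using kern_bounded by blast
  note [measurable] = L1loc_measurable[OF f]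
  have "(\<lambda>m. moll n i j f (x m)) \<longlonglongrightarrow> moll n i j f a" if x: "x \<longlonglongrightarrow> a" for x a
  proof -
    have "bounded (range x)" using x by (intro convergent_imp_bounded) (auto simp: convergent_def)
    from bounded_subset_bx[OF this] obtain R where R: "\<And>m. x m \<in> bx R" by blast
    show ?thesis
      unfolding moll_def
    proof (rule integral_dominated_convergence)
      show "integrable lborel (\<lambda>y. M * \<bar>indicator (bx (2 + R)) y * f y\<bar>)"
        using f by (intro integrable_mult_right integrable_abs) (auto simp: L1loc_def)
      have "(\<lambda>m. f y * kern n i j (y - x m)) \<longlonglongrightarrow> f y * kern n i j (y - a)" for y
        by (intro tendsto_intros x continuous_on_tendsto_compose[OF continuous_on_kern[of UNIV]]) auto
      then show "AE y in lborel. (\<lambda>m. f y * kern n i j (y - x m)) \<longlonglongrightarrow> f y * kern n i j (y - a)"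
        by simp
      fix m
      have "norm (f y * kern n i j (y - x m)) \<le> M * \<bar>indicator (bx (2 + R)) y * f y\<bar>" for y
        using M[of "y - x m"] kern_shift_eq_0[OF R, of y n i j m]
        by (cases "y \<in> bx (2 + R)") (auto simp: abs_mult mult.commute[of M] intro!: mult_left_mono)
      then show "AE y in lborel. norm (f y * kern n i j (y - x m)) \<le> M * \<bar>indicator (bx (2 + R)) y * f y\<bar>"
        by simp
    qed measurable
  qed
  then show ?thesis
    by (auto simp: continuous_on_sequentially o_def)
qed

lemma moll_measurable [measurable]:
  "L1loc f \<Longrightarrow> moll n i j f \<in> borel_measurable borel"
  by (intro borel_measurable_continuous_onI continuous_on_moll)

lemma DERIV_kern_line:
  "((\<lambda>t. kern n i j (y - (x + t *\<^sub>R e))) has_real_derivative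
     - (fst e * kern n (Suc i) j (y - (x + t *\<^sub>R e)) + snd e * kern n i (Suc j) (y - (x + t *\<^sub>R e)))) (at t)"
proof -
  have "((\<lambda>t. kern n i j ((y - t *\<^sub>R e) - x)) has_derivative
     (\<lambda>h. kern n (Suc i) j ((y - t *\<^sub>R e) - x) * fst (- h *\<^sub>R e) +
          kern n i (Suc j) ((y - t *\<^sub>R e) - x) * snd (- h *\<^sub>R e))) (at t)"
    by (rule has_derivative_compose[OF _ has_derivative_kern]) (auto intro!: derivative_eq_intros)
  moreover have "y - t *\<^sub>R e - x = y - (x + t *\<^sub>R e)" for t by simp
  ultimately show ?thesis
    unfolding has_field_derivative_def by (simp only:) (erule has_derivative_eq_rhs, simp add: fun_eq_iff algebra_simps)
qed

text \<open>Differentiation under the integral: by the mean value theorem the difference quotients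
  of the kernel are bounded by \<open>M\<close>, so \<open>M |f|\<close> on a box dominates. The
  form along a general direction \<open>e\<close> gives both partial derivatives and, at the end,
  the derivative along the streamlines.\<close>

lemma DERIV_moll_line:
  assumes f: "L1loc f"
  shows "((\<lambda>t. moll n i j f (x + t *\<^sub>R e)) has_real_derivative
     - (fst e * moll n (Suc i) j f (x + t *\<^sub>R e) + snd e * moll n i (Suc j) f (x + t *\<^sub>R e))) (at t)"
proof -
  define K' where "K' z = - (fst e * kern n (Suc i) j z + snd e * kern n i (Suc j) z)" for z
  obtain A B where A: "\<And>z. \<bar>kern n (Suc i) j z\<bar> \<le> A" and B: "\<And>z. \<bar>kern n i (Suc j) z\<bar> \<le> B"
    using kern_bounded by meson
  define M where "M = \<bar>fst e\<bar> * A + \<bar>snd e\<bar> * B"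
  have M: "\<bar>K' z\<bar> \<le> M" for z
    unfolding K'_def M_def abs_minus_cancel using A[of z] B[of z]
    by (intro order_trans[OF abs_triangle_ineq]) (auto simp: abs_mult intro!: add_mono mult_left_mono)
  note [measurable] = L1loc_measurable[OF f]
  have K': "((\<lambda>t. kern n i j (y - (x + t *\<^sub>R e))) has_real_derivative K' (y - (x + t *\<^sub>R e))) (at t)" for y t
    unfolding K'_def by (rule DERIV_kern_line)
  let ?I = "\<lambda>t. LINT y|lborel. f y * K' (y - (x + t *\<^sub>R e))"
  have I: "?I t = - (fst e * moll n (Suc i) j f (x + t *\<^sub>R e) + snd e * moll n i (Suc j) f (x + t *\<^sub>R e))"
  proof -
    have "?I t = (LINT y|lborel. - (fst e * (f y * kern n (Suc i) j (y - (x + t *\<^sub>R e)))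
         + snd e * (f y * kern n i (Suc j) (y - (x + t *\<^sub>R e)))))"
      by (simp add: K'_def algebra_simps)
    also have "\<dots> = - (fst e * moll n (Suc i) j f (x + t *\<^sub>R e) + snd e * moll n i (Suc j) f (x + t *\<^sub>R e))"
      unfolding moll_def
      by (subst Bochner_Integration.integral_minus, subst Bochner_Integration.integral_add)
         (auto intro!: integrable_times_kern f)
    finally show ?thesis .
  qed
  have "(\<lambda>m. (moll n i j f (x + (t + h m) *\<^sub>R e) - moll n i j f (x + t *\<^sub>R e)) / h m) \<longlonglongrightarrow> ?I t"
    if h: "\<And>m. h m \<noteq> 0" "h \<longlonglongrightarrow> 0" for h
  proof -
    have "bounded (range h)" using h by (intro convergent_imp_bounded) (auto simp: convergent_def)
    then have "bounded ((\<lambda>s. x + (t + s) *\<^sub>R e) ` closure (range h))"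
      by (intro compact_imp_bounded compact_continuous_image continuous_intros) auto
    then have "bounded (range (\<lambda>m. x + (t + h m) *\<^sub>R e))"
      by (rule bounded_subset) (use closure_subset in blast)
    then have "bounded (insert (x + t *\<^sub>R e) (range (\<lambda>m. x + (t + h m) *\<^sub>R e)))" by simp
    from bounded_subset_bx[OF this] obtain R
      where R: "\<And>m. x + (t + h m) *\<^sub>R e \<in> bx R" "x + t *\<^sub>R e \<in> bx R" by blast
    have eq: "(moll n i j f (x + (t + h m) *\<^sub>R e) - moll n i j f (x + t *\<^sub>R e)) / h m =
       (LINT y|lborel. f y * ((kern n i j (y - (x + (t + h m) *\<^sub>R e)) - kern n i j (y - (x + t *\<^sub>R e))) / h m))" for m
    proof -
      have "(LINT y|lborel. f y * ((kern n i j (y - (x + (t + h m) *\<^sub>R e)) - kern n i j (y - (x + t *\<^sub>R e))) / h m))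
        = (LINT y|lborel. (f y * kern n i j (y - (x + (t + h m) *\<^sub>R e)) - f y * kern n i j (y - (x + t *\<^sub>R e))) / h m)"
        by (intro Bochner_Integration.integral_cong refl) (simp add: right_diff_distrib)
      also have "\<dots> = (moll n i j f (x + (t + h m) *\<^sub>R e) - moll n i j f (x + t *\<^sub>R e)) / h m"
        unfolding moll_def integral_divide_zero
        by (subst Bochner_Integration.integral_diff) (auto intro!: integrable_times_kern f)
      finally show ?thesis by (rule sym)
    qed
    show ?thesis
      unfolding eq
    proof (rule integral_dominated_convergence)
      show "integrable lborel (\<lambda>y. M * \<bar>indicator (bx (2 + R)) y * f y\<bar>)"
        using f by (intro integrable_mult_right integrable_abs) (auto simp: L1loc_def)
      have "(\<lambda>m. f y * ((kern n i j (y - (x + (t + h m) *\<^sub>R e)) - kern n i j (y - (x + t *\<^sub>R e))) / h m))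
         \<longlonglongrightarrow> f y * K' (y - (x + t *\<^sub>R e))" for y
        using K'[of y t, unfolded DERIV_def tendsto_at_iff_sequentially, rule_format, of h] h
        by (intro tendsto_mult_left) (simp add: o_def)
      then show "AE y in lborel. (\<lambda>m. f y * ((kern n i j (y - (x + (t + h m) *\<^sub>R e)) - kern n i j (y - (x + t *\<^sub>R e))) / h m))
         \<longlonglongrightarrow> f y * K' (y - (x + t *\<^sub>R e))"
        by simp
      fix m
      have "norm (f y * ((kern n i j (y - (x + (t + h m) *\<^sub>R e)) - kern n i j (y - (x + t *\<^sub>R e))) / h m))
         \<le> M * \<bar>indicator (bx (2 + R)) y * f y\<bar>" for y
      proof (cases "y \<in> bx (2 + R)")
        case True
        have "norm (kern n i j (y - (x + (t + h m) *\<^sub>R e)) - kern n i j (y - (x + t *\<^sub>R e)))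
           \<le> M * norm ((t + h m) - t)"
          using M by (intro field_differentiable_bound[of UNIV _ "\<lambda>t. K' (y - (x + t *\<^sub>R e))"]) (auto intro: K')
        then have "\<bar>(kern n i j (y - (x + (t + h m) *\<^sub>R e)) - kern n i j (y - (x + t *\<^sub>R e))) / h m\<bar> \<le> M"
          using h(1)[of m] by (simp add: field_simps)
        from mult_left_mono[OF this abs_ge_zero[of "f y"]] True show ?thesis
          by (simp add: abs_mult mult.commute[of M])
      next
        case False
        with R show ?thesis by (simp add: kern_shift_eq_0[of _ R])
      qed
      then show "AE y in lborel. norm (f y * ((kern n i j (y - (x + (t + h m) *\<^sub>R e)) - kern n i j (y - (x + t *\<^sub>R e))) / h m))
         \<le> M * \<bar>indicator (bx (2 + R)) y * f y\<bar>"
        by simp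
    qed (unfold K'_def, measurable)
  qed
  then have "((\<lambda>t. moll n i j f (x + t *\<^sub>R e)) has_real_derivative ?I t) (at t)"
    unfolding DERIV_def by (subst tendsto_at_iff_sequentially) (auto simp: o_def)
  then show ?thesis unfolding I .
qed

text \<open>The partial derivatives are carried as data; product and chain rules then produce
  explicit formulas, and equality of mixed derivatives can be expressed by sharing one
  function.\<close>

definition C1 :: "(real \<times> real \<Rightarrow> real) \<Rightarrow> (real \<times> real \<Rightarrow> real) \<Rightarrow> (real \<times> real \<Rightarrow> real) \<Rightarrow> bool" where
  "C1 u u1 u2 \<longleftrightarrow> continuous_on UNIV u \<and> continuous_on UNIV u1 \<and> continuous_on UNIV u2 \<and>
     (\<forall>x y. ((\<lambda>s. u (s, y)) has_real_derivative u1 (x, y)) (at x)) \<and>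
     (\<forall>x y. ((\<lambda>s. u (x, s)) has_real_derivative u2 (x, y)) (at y))"

lemma C1_moll:
  assumes f: "L1loc f"
  shows "C1 (moll n i j f) (\<lambda>x. - moll n (Suc i) j f x) (\<lambda>x. - moll n i (Suc j) f x)"
proof -
  have "((\<lambda>s. moll n i j f (s, y)) has_real_derivative - moll n (Suc i) j f (x, y)) (at x)" for x y
    using DERIV_moll_line[OF f, of n i j "(0, y)" "(1, 0)" x] by simp
  moreover have "((\<lambda>s. moll n i j f (x, s)) has_real_derivative - moll n i (Suc j) f (x, y)) (at y)" for x y
    using DERIV_moll_line[OF f, of n i j "(x, 0)" "(0, 1)" y] by simp
  ultimately show ?thesis
    unfolding C1_def by (auto intro!: continuous_on_moll f continuous_intros)
qed

section \<open>Tonelli, the mass of the kernel and bounds for mollification\<close>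

lemma nn_integral_reflect_shift:
  fixes t :: "'a::euclidean_space"
  assumes [measurable]: "f \<in> borel_measurable borel" and c: "\<bar>c\<bar> = 1"
  shows "(\<integral>\<^sup>+x. f (t + c *\<^sub>R x) \<partial>lborel) = (\<integral>\<^sup>+x. f x \<partial>lborel)"
proof -
  have "c \<noteq> 0" using c by auto
  have "lborel = density (distr lborel borel (\<lambda>x. t + c *\<^sub>R x)) (\<lambda>_. \<bar>c\<bar> ^ DIM('a))"
    by (rule lborel_affine[OF \<open>c \<noteq> 0\<close>])
  then have "lborel = distr lborel borel (\<lambda>x. t + c *\<^sub>R x)"
    using c by (simp add: density_1)
  then have "(\<integral>\<^sup>+x. f x \<partial>lborel) = (\<integral>\<^sup>+x. f x \<partial>distr lborel borel (\<lambda>x. t + c *\<^sub>R x))"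
    by simp
  also have "\<dots> = (\<integral>\<^sup>+x. f (t + c *\<^sub>R x) \<partial>lborel)"
    by (subst nn_integral_distr) auto
  finally show ?thesis by simp
qed

lemma nn_integral_plane:
  fixes f :: "real \<times> real \<Rightarrow> ennreal"
  assumes [measurable]: "f \<in> borel_measurable borel"
  shows "(\<integral>\<^sup>+z. f z \<partial>lborel) = (\<integral>\<^sup>+x. (\<integral>\<^sup>+y. f (x, y) \<partial>lborel) \<partial>lborel)"
    and "(\<integral>\<^sup>+z. f z \<partial>lborel) = (\<integral>\<^sup>+y. (\<integral>\<^sup>+x. f (x, y) \<partial>lborel) \<partial>lborel)"
proof -
  have f: "f \<in> borel_measurable (lborel \<Otimes>\<^sub>M lborel)" by (simp add: lborel_prod)
  show "(\<integral>\<^sup>+z. f z \<partial>lborel) = (\<integral>\<^sup>+x. (\<integral>\<^sup>+y. f (x, y) \<partial>lborel) \<partial>lborel)"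
    using lborel.nn_integral_fst[OF f] by (simp add: lborel_prod)
  show "(\<integral>\<^sup>+z. f z \<partial>lborel) = (\<integral>\<^sup>+y. (\<integral>\<^sup>+x. f (x, y) \<partial>lborel) \<partial>lborel)"
    using lborel_pair.nn_integral_snd[OF f] by (simp add: lborel_prod)
qed

lemma nn_integral_kern: "(\<integral>\<^sup>+z. kern n 0 0 z \<partial>lborel) = 1"
proof -
  have 1: "(\<integral>\<^sup>+t. bump_at n 0 t \<partial>lborel) = 1"
    using nn_integral_eq_integral[OF integral_bump_at(1)] integral_bump_at(2) bump_at_nonneg by simp
  have [measurable]: "bump_at n 0 \<in> borel_measurable borel"
    by (intro borel_measurable_continuous_onI continuous_on_bump_at)
  have "(\<integral>\<^sup>+z. kern n 0 0 z \<partial>lborel)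
      = (\<integral>\<^sup>+x. (\<integral>\<^sup>+y. ennreal (bump_at n 0 x) * ennreal (bump_at n 0 y) \<partial>lborel) \<partial>lborel)"
    using nn_integral_plane(1)[of "\<lambda>z. ennreal (kern n 0 0 z)"]
    by (simp add: kern_def[of n 0 0 "(_, _)"] ennreal_mult bump_at_nonneg)
  also have "\<dots> = 1"
    by (simp add: nn_integral_cmult nn_integral_multc 1)
  finally show ?thesis .
qed

lemma nn_integral_kern_shift:
  "(\<integral>\<^sup>+y. kern n 0 0 (y - x) \<partial>lborel) = 1" "(\<integral>\<^sup>+x. kern n 0 0 (y - x) \<partial>lborel) = 1"
  using nn_integral_reflect_shift[of "\<lambda>z. kern n 0 0 z" 1 "- x"]
    nn_integral_reflect_shift[of "\<lambda>z. kern n 0 0 z" "-1" y]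
  by (simp_all add: nn_integral_kern)

lemma integral_kern:
  "integrable lborel (\<lambda>y. kern n 0 0 (y - x))" "(LINT y|lborel. kern n 0 0 (y - x)) = 1"
proof -
  show "integrable lborel (\<lambda>y. kern n 0 0 (y - x))"
    by (rule integrableI_nonneg) (auto simp: kern_nonneg nn_integral_kern_shift)
  then show "(LINT y|lborel. kern n 0 0 (y - x)) = 1"
    using nn_integral_eq_integral[of lborel "\<lambda>y. kern n 0 0 (y - x)"] nn_integral_kern_shift(1)[of n x]
    by (simp add: kern_nonneg)
qed

lemma moll_add: "L1loc f \<Longrightarrow> L1loc g \<Longrightarrow> moll n i j (\<lambda>x. f x + g x) x = moll n i j f x + moll n i j g x"
  by (simp add: moll_def distrib_right integrable_times_kern)

lemma moll_diff: "L1loc f \<Longrightarrow> L1loc g \<Longrightarrow> moll n i j (\<lambda>x. f x - g x) x = moll n i j f x - moll n i j g x"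
  by (simp add: moll_def left_diff_distrib integrable_times_kern)

lemma moll_cmult: "moll n i j (\<lambda>x. c * f x) x = c * moll n i j f x"
  by (simp add: moll_def mult.assoc)

lemma moll_const: "moll n 0 0 (\<lambda>x. c) x = c"
  by (simp add: moll_def integral_kern)

lemma moll_abs_le:
  assumes f: "L1loc f" shows "\<bar>moll n 0 0 f x\<bar> \<le> moll n 0 0 (\<lambda>x. \<bar>f x\<bar>) x"
  unfolding moll_def using integral_norm_bound[of lborel "\<lambda>y. f y * kern n 0 0 (y - x)"]
  by (simp add: abs_mult kern_nonneg)

lemma moll_mono:
  assumes "L1loc f" "L1loc g" "\<And>y. f y \<le> g y" shows "moll n 0 0 f x \<le> moll n 0 0 g x"
  unfolding moll_def
  by (intro integral_mono integrable_times_kern assms mult_right_mono kern_nonneg)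

lemma moll_cong_bx:
  assumes "x \<in> bx R" "\<And>y. y \<in> bx (2 + R) \<Longrightarrow> f y = g y"
  shows "moll n i j f x = moll n i j g x"
  unfolding moll_def using kern_shift_eq_0[OF assms(1)] assms(2)
  by (intro Bochner_Integration.integral_cong refl) (metis mult_zero_right)

lemma L1loc_add: "L1loc f \<Longrightarrow> L1loc g \<Longrightarrow> L1loc (\<lambda>x. f x + g x)"
  by (auto simp: L1loc_def distrib_left)

lemma L1loc_diff: "L1loc f \<Longrightarrow> L1loc g \<Longrightarrow> L1loc (\<lambda>x. f x - g x)"
  by (auto simp: L1loc_def right_diff_distrib)

lemma L1loc_cmult: "L1loc f \<Longrightarrow> L1loc (\<lambda>x. c * f x)"
  by (auto simp: L1loc_def mult.left_commute[of _ c])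

lemma L1loc_abs: "L1loc f \<Longrightarrow> L1loc (\<lambda>x. \<bar>f x\<bar>)"
  unfolding L1loc_def using integrable_abs[of lborel "\<lambda>z. indicator (bx _) z * f z"]
  by (auto simp: abs_mult)

lemma L1loc_bound:
  assumes "L1loc g" "f \<in> borel_measurable borel" "\<And>x. \<bar>f x\<bar> \<le> g x"
  shows "L1loc f"
  unfolding L1loc_def
proof safe
  fix R
  have [measurable]: "f \<in> borel_measurable borel" by fact
  show "integrable lborel (\<lambda>z. indicator (bx R) z * f z)"
  proof (rule Bochner_Integration.integrable_bound)
    show "integrable lborel (\<lambda>z. indicator (bx R) z * g z)" using assms by (simp add: L1loc_def)
    show "AE z in lborel. norm (indicator (bx R) z * f z) \<le> norm (indicator (bx R) z * g z)"
      using assms(3) by (intro AE_I2) (auto simp: indicator_def intro: order_trans[OF _ abs_ge_self])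
  qed measurable
qed (use assms in auto)

lemma L1loc_const: "L1loc (\<lambda>_. c)"
  by (intro continuous_imp_L1loc continuous_intros)

text \<open>By Tonelli, since the kernel has mass one also in \<open>x\<close> for fixed
  \<open>y\<close>. Mollification is thus a contraction of \<open>L^1\<close>, uniformly in
  \<open>n\<close>, which lets convergence pass from a dense class to its limits.\<close>

lemma moll_integrable:
  assumes f: "integrable lborel f"
  shows "integrable lborel (moll n 0 0 f)" "(LINT x|lborel. \<bar>moll n 0 0 f x\<bar>) \<le> (LINT x|lborel. \<bar>f x\<bar>)"
proof -
  have f': "L1loc f" using f by (rule integrable_imp_L1loc)
  note [measurable] = L1loc_measurable[OF f']
  have "(\<integral>\<^sup>+x. ennreal \<bar>moll n 0 0 f x\<bar> \<partial>lborel)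
     \<le> (\<integral>\<^sup>+x. (\<integral>\<^sup>+y. ennreal (\<bar>f y\<bar>) * kern n 0 0 (y - x) \<partial>lborel) \<partial>lborel)"
  proof (rule nn_integral_mono)
    fix x
    have "ennreal \<bar>moll n 0 0 f x\<bar> \<le> ennreal (moll n 0 0 (\<lambda>x. \<bar>f x\<bar>) x)"
      by (intro ennreal_leI moll_abs_le f')
    also have "\<dots> = (\<integral>\<^sup>+y. ennreal (\<bar>f y\<bar> * kern n 0 0 (y - x)) \<partial>lborel)"
      unfolding moll_def
      by (subst nn_integral_eq_integral) (auto intro!: integrable_times_kern L1loc_abs f' mult_nonneg_nonneg kern_nonneg)
    finally show "ennreal \<bar>moll n 0 0 f x\<bar> \<le> (\<integral>\<^sup>+y. ennreal (\<bar>f y\<bar>) * kern n 0 0 (y - x) \<partial>lborel)"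
      by (simp add: ennreal_mult kern_nonneg)
  qed
  also have "\<dots> = (\<integral>\<^sup>+y. (\<integral>\<^sup>+x. ennreal (\<bar>f y\<bar>) * kern n 0 0 (y - x) \<partial>lborel) \<partial>lborel)"
    by (rule lborel_pair.Fubini') measurable
  also have "\<dots> = (\<integral>\<^sup>+y. ennreal (\<bar>f y\<bar>) \<partial>lborel)"
    by (simp add: nn_integral_cmult nn_integral_kern_shift)
  also have "\<dots> = ennreal (LINT x|lborel. \<bar>f x\<bar>)"
    using f by (intro nn_integral_eq_integral) auto
  finally have le: "(\<integral>\<^sup>+x. ennreal \<bar>moll n 0 0 f x\<bar> \<partial>lborel) \<le> ennreal (LINT x|lborel. \<bar>f x\<bar>)" .
  show int: "integrable lborel (moll n 0 0 f)"
    using le by (intro integrableI_bounded) (auto simp: f' intro: le_less_trans)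
  show "(LINT x|lborel. \<bar>moll n 0 0 f x\<bar>) \<le> (LINT x|lborel. \<bar>f x\<bar>)"
    using le int by (subst (asm) nn_integral_eq_integral) auto
qed

section \<open>Convergence of mollifications in \<open>L^1\<close> on boxes\<close>

definition conv1 :: "(nat \<Rightarrow> real \<times> real \<Rightarrow> real) \<Rightarrow> (real \<times> real \<Rightarrow> real) \<Rightarrow> bool" where
  "conv1 F f \<longleftrightarrow> (\<forall>n. L1loc (F n)) \<and> L1loc f \<and>
     (\<forall>R. (\<lambda>n. LINT z|lborel. indicator (bx R) z * \<bar>F n z - f z\<bar>) \<longlonglongrightarrow> 0)"

lemma L1loc_moll: "L1loc f \<Longrightarrow> L1loc (moll n i j f)"
  by (rule continuous_imp_L1loc[OF continuous_on_moll])

lemma integrable_bx_times: "L1loc f \<Longrightarrow> integrable lborel (\<lambda>z. indicator (bx R) z * f z)"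
  by (simp add: L1loc_def)

lemma conv1_moll_continuous:
  assumes g: "continuous_on UNIV g"
  shows "conv1 (\<lambda>n. moll n 0 0 g) g"
proof -
  have gl: "L1loc g" using g by (rule continuous_imp_L1loc)
  have "(\<lambda>n. LINT z|lborel. indicator (bx R) z * \<bar>moll n 0 0 g z - g z\<bar>) \<longlonglongrightarrow> 0" for R
  proof (rule LIMSEQ_I)
    fix e :: real assume "e > 0"
    define I where "I = (LINT z|lborel. indicat_real (bx R) z)"
    have "I \<ge> 0" by (simp add: I_def)
    define d where "d = e / (I + 1)"
    have "d > 0" using \<open>e > 0\<close> \<open>I \<ge> 0\<close> by (simp add: d_def)
    have "uniformly_continuous_on (bx (2 + R)) g"
      by (intro compact_uniformly_continuous continuous_on_subset[OF g] compact_bx) auto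
    then obtain s where s: "s > 0"
      "\<And>x y. x \<in> bx (2 + R) \<Longrightarrow> y \<in> bx (2 + R) \<Longrightarrow> dist y x < s \<Longrightarrow> dist (g y) (g x) < d"
      using \<open>d > 0\<close> unfolding uniformly_continuous_on_def by blast
    \<comment> \<open>Both coordinates of a displacement inside the kernel's support are at most
      \<open>2 / (n+1)\<close>, so its length is at most \<open>4 / (n+1)\<close>; this has to stay
      below \<open>s\<close>.\<close>
    obtain N where N: "4 / s < real (Suc N)"
      using reals_Archimedean2 by (meson less_Suc_eq less_trans of_nat_less_iff)
    have "norm ((LINT z|lborel. indicator (bx R) z * \<bar>moll n 0 0 g z - g z\<bar>) - 0) < e" if "n \<ge> N" for n
    proof -
      have nN: "4 < s * real (Suc n)" using N that s(1) by (simp add: field_simps del: of_nat_Suc) (smt (verit, best) mult_left_mono of_nat_mono Suc_le_mono)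
      have bd: "\<bar>moll n 0 0 g z - g z\<bar> \<le> d" if z: "z \<in> bx R" for z
      proof -
        have "\<bar>moll n 0 0 g z - g z\<bar> = \<bar>moll n 0 0 (\<lambda>y. g y - g z) z\<bar>"
          by (subst moll_diff) (auto intro: gl L1loc_const simp: moll_const)
        also have "\<dots> \<le> moll n 0 0 (\<lambda>y. \<bar>g y - g z\<bar>) z"
          by (intro moll_abs_le L1loc_diff gl L1loc_const)
        also have "\<dots> \<le> moll n 0 0 (\<lambda>_. d) z"
          unfolding moll_def
        proof (rule integral_mono)
          fix y
          show "\<bar>g y - g z\<bar> * kern n 0 0 (y - z) \<le> d * kern n 0 0 (y - z)"
          proof (cases "y - z \<in> bx (2 / real (Suc n))")
            case True
            have "norm (y - z) \<le> \<bar>fst (y - z)\<bar> + \<bar>snd (y - z)\<bar>"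
              using norm_Pair_le[of "fst (y - z)" "snd (y - z)"] by (simp del: fst_diff snd_diff)
            also have "\<dots> \<le> 2 / real (Suc n) + 2 / real (Suc n)"
              using True by (intro add_mono) (auto simp: bx_def)
            also have "\<dots> < s" using nN by (simp add: field_simps del: of_nat_Suc)
            finally have "dist y z < s" by (simp add: dist_norm)
            moreover have "y \<in> bx (2 + R)"
              using bx_shift[of y z 2 R] bx_mono[of "2 / real (Suc n)" 2] True z by (auto simp: field_simps)
            moreover have "z \<in> bx (2 + R)" using bx_mono[of R "2 + R"] z by auto
            ultimately have "dist (g y) (g z) < d" by (intro s)
            then show ?thesis by (intro mult_right_mono kern_nonneg) (auto simp: dist_real_def)
          qed (simp add: kern_eq_0_bx)
        qed (auto intro!: integrable_times_kern L1loc_abs L1loc_diff gl L1loc_const integral_kern)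
        also have "\<dots> = d" by (rule moll_const)
        finally show ?thesis .
      qed
      have "(LINT z|lborel. indicator (bx R) z * \<bar>moll n 0 0 g z - g z\<bar>) \<le> (LINT z|lborel. indicator (bx R) z * d)"
        using bd by (intro integral_mono integrable_bx_times L1loc_abs L1loc_diff L1loc_moll gl L1loc_const)
          (auto simp: indicator_def)
      also have "\<dots> = I * d" by (simp add: I_def)
      also have "\<dots> < e" using \<open>I \<ge> 0\<close> \<open>e > 0\<close> by (simp add: d_def field_simps)
      finally show ?thesis by (simp add: abs_of_nonneg)
    qed
    then show "\<exists>no. \<forall>n\<ge>no. norm ((LINT z|lborel. indicator (bx R) z * \<bar>moll n 0 0 g z - g z\<bar>) - 0) < e"
      by blast
  qed
  then show ?thesis by (auto simp: conv1_def gl L1loc_moll)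
qed

lemma integral_bx_le:
  fixes f :: "real \<times> real \<Rightarrow> real"
  assumes "integrable lborel f" "\<And>z. 0 \<le> f z"
  shows "(LINT z|lborel. indicator (bx R) z * f z) \<le> (LINT z|lborel. f z)"
proof (rule integral_mono)
  show "integrable lborel (\<lambda>z. indicator (bx R) z * f z)"
    by (intro integrable_bx_times integrable_imp_L1loc assms)
qed (use assms in \<open>auto simp: indicator_def\<close>)

text \<open>A three-term splitting through \<open>g\<close>: as mollification is a contraction, both
  terms comparing \<open>f\<close> with \<open>g\<close> are at most the \<open>L^1\<close> distance
  of the two.\<close>

lemma conv1_moll_approx:
  fixes f :: "real \<times> real \<Rightarrow> real"
  assumes f: "integrable lborel f"
    and approx: "\<And>e. e > 0 \<Longrightarrow> \<exists>g. integrable lborel g \<and> conv1 (\<lambda>n. moll n 0 0 g) g \<and> (LINT x|lborel. \<bar>f x - g x\<bar>) < e"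
  shows "conv1 (\<lambda>n. moll n 0 0 f) f"
proof -
  have fl: "L1loc f" using f by (rule integrable_imp_L1loc)
  have "(\<lambda>n. LINT z|lborel. indicator (bx R) z * \<bar>moll n 0 0 f z - f z\<bar>) \<longlonglongrightarrow> 0" for R
  proof (rule LIMSEQ_I)
    fix e :: real assume "e > 0"
    then obtain g where g: "integrable lborel g" "conv1 (\<lambda>n. moll n 0 0 g) g" "(LINT x|lborel. \<bar>f x - g x\<bar>) < e / 3"
      using approx[of "e / 3"] by auto
    have gl: "L1loc g" using g(1) by (rule integrable_imp_L1loc)
    obtain N where N: "\<And>n. n \<ge> N \<Longrightarrow> \<bar>LINT z|lborel. indicator (bx R) z * \<bar>moll n 0 0 g z - g z\<bar>\<bar> < e / 3"
      using LIMSEQ_D[of _ 0 "e / 3"] g(2) \<open>e > 0\<close> unfolding conv1_def by fastforce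
    have "norm ((LINT z|lborel. indicator (bx R) z * \<bar>moll n 0 0 f z - f z\<bar>) - 0) < e" if "n \<ge> N" for n
    proof -
      let ?h = "\<lambda>z. f z - g z"
      have h: "integrable lborel ?h" using f g by auto
      have i1: "integrable lborel (\<lambda>z. indicator (bx R) z * \<bar>moll n 0 0 g z - g z\<bar>)"
        by (intro integrable_bx_times L1loc_abs L1loc_diff L1loc_moll gl)
      have i2: "integrable lborel (\<lambda>z. indicator (bx R) z * \<bar>moll n 0 0 ?h z\<bar>)"
        by (intro integrable_bx_times L1loc_abs L1loc_moll L1loc_diff fl gl)
      have i3: "integrable lborel (\<lambda>z. indicator (bx R) z * \<bar>?h z\<bar>)"
        by (intro integrable_bx_times L1loc_abs L1loc_diff fl gl)
      have "(LINT z|lborel. indicator (bx R) z * \<bar>moll n 0 0 f z - f z\<bar>)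
         \<le> (LINT z|lborel. (indicator (bx R) z * \<bar>moll n 0 0 g z - g z\<bar> + indicator (bx R) z * \<bar>moll n 0 0 ?h z\<bar>)
             + indicator (bx R) z * \<bar>?h z\<bar>)"
        by (intro integral_mono integrable_bx_times Bochner_Integration.integrable_add i1 i2 i3 L1loc_abs L1loc_diff L1loc_moll fl)
           (auto simp: indicator_def moll_diff[OF fl gl])
      also have "\<dots> = (LINT z|lborel. indicator (bx R) z * \<bar>moll n 0 0 g z - g z\<bar>)
          + (LINT z|lborel. indicator (bx R) z * \<bar>moll n 0 0 ?h z\<bar>) + (LINT z|lborel. indicator (bx R) z * \<bar>?h z\<bar>)"
        using i1 i2 i3 by simp
      also have "(LINT z|lborel. indicator (bx R) z * \<bar>moll n 0 0 ?h z\<bar>) \<le> (LINT z|lborel. \<bar>moll n 0 0 ?h z\<bar>)"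
        using moll_integrable(1)[OF h] by (intro integral_bx_le) auto
      also have "\<dots> \<le> (LINT z|lborel. \<bar>?h z\<bar>)"
        by (rule moll_integrable(2)[OF h])
      also have "(LINT z|lborel. indicator (bx R) z * \<bar>?h z\<bar>) \<le> (LINT z|lborel. \<bar>?h z\<bar>)"
        using h by (intro integral_bx_le) auto
      finally show ?thesis using g(3) N[OF that] by (simp add: abs_of_nonneg)
    qed
    then show "\<exists>no. \<forall>n\<ge>no. norm ((LINT z|lborel. indicator (bx R) z * \<bar>moll n 0 0 f z - f z\<bar>) - 0) < e"
      by blast
  qed
  then show ?thesis by (auto simp: conv1_def fl L1loc_moll)
qed

text \<open>Regularity of the measure squeezes \<open>A\<close> between a closed \<open>K\<close>
  and an open \<open>U\<close>, and Urysohn's function for \<open>K\<close> and the complement of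
  \<open>U\<close> differs from the indicator only on the two small differences.\<close>

lemma indicator_approx_continuous:
  fixes A :: "(real \<times> real) set" and e :: real
  assumes A: "A \<in> sets borel" "emeasure lborel A < \<infinity>" and e: "e > 0"
  shows "\<exists>g. continuous_on UNIV g \<and> integrable lborel g \<and> (LINT x|lborel. \<bar>indicator A x - g x\<bar>) < e"
proof -
  have Al: "A \<in> sets lebesgue" using A by auto
  obtain U where U: "open U" "A \<subseteq> U" "U - A \<in> lmeasurable" "emeasure lebesgue (U - A) < ennreal (e / 3)"
    using sets_lebesgue_outer_open[OF Al, of "e / 3"] e by auto
  obtain K where K: "closed K" "K \<subseteq> A" "A - K \<in> lmeasurable" "emeasure lebesgue (A - K) < ennreal (e / 3)"
    using sets_lebesgue_inner_closed[OF Al, of "e / 3"] e by auto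
  have [measurable]: "U \<in> sets borel" "K \<in> sets borel" "A \<in> sets borel" using U K A by auto
  have disj: "K \<inter> - U = {}" using U K by auto
  obtain g :: "real \<times> real \<Rightarrow> real" where g: "continuous_on UNIV g" "\<And>x. g x \<in> closed_segment 1 0"
    "\<And>x. x \<in> K \<Longrightarrow> g x = 1" "\<And>x. x \<in> - U \<Longrightarrow> g x = 0"
    using Urysohn[of K "- U" 1 "0::real"] U(1) K(1) disj by (auto simp: closed_Compl)
  have g01: "0 \<le> g x" "g x \<le> 1" for x
    using g(2)[of x] by (auto simp: closed_segment_eq_real_ivl)
  have [measurable]: "g \<in> borel_measurable borel" using g(1) by (rule borel_measurable_continuous_onI)
  have le: "\<bar>indicator A x - g x\<bar> \<le> indicator ((U - A) \<union> (A - K)) x" for x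
    using g01[of x] g(3,4)[of x] U K by (auto simp: indicator_def)
  have m1: "emeasure lborel (U - A) < ennreal (e / 3)" "emeasure lborel (A - K) < ennreal (e / 3)"
    using U(4) K(4) by auto
  have "emeasure lborel ((U - A) \<union> (A - K)) \<le> emeasure lborel (U - A) + emeasure lborel (A - K)"
    by (intro emeasure_subadditive) auto
  also have "\<dots> \<le> ennreal (e / 3) + ennreal (e / 3)"
    using m1 by (intro add_mono) auto
  also have "\<dots> < ennreal e" using e by (simp flip: ennreal_plus add: ennreal_less_iff)
  finally have m: "emeasure lborel ((U - A) \<union> (A - K)) < ennreal e" .
  have i1: "integrable lborel (indicat_real ((U - A) \<union> (A - K)))"
    using m by (auto simp: integrable_indicator_iff less_top[symmetric] intro: less_trans)
  have i2: "integrable lborel (\<lambda>x. indicat_real A x - g x)"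
    by (rule Bochner_Integration.integrable_bound[OF i1]) (use le in \<open>auto\<close>)
  have "integrable lborel (\<lambda>x. indicat_real A x - (indicat_real A x - g x))"
    using A by (intro Bochner_Integration.integrable_diff i2) (auto simp: integrable_indicator_iff)
  then have "integrable lborel g" by simp
  moreover have "(LINT x|lborel. \<bar>indicator A x - g x\<bar>) \<le> (LINT x|lborel. indicat_real ((U - A) \<union> (A - K)) x)"
    using le i2 by (intro integral_mono i1) auto
  then have "ennreal (LINT x|lborel. \<bar>indicator A x - g x\<bar>) \<le> emeasure lborel ((U - A) \<union> (A - K))"
    using m i1 by (auto simp: integrable_indicator_iff emeasure_eq_ennreal_measure intro: ennreal_leI)
  then have "(LINT x|lborel. \<bar>indicator A x - g x\<bar>) < e"
    using m e by (meson ennreal_less_iff integral_nonneg abs_ge_zero order_le_less_trans Bochner_Integration.integral_nonneg)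
  ultimately show ?thesis using g(1) by blast
qed

text \<open>Density of continuous functions, cast as induction over integrable functions: indicators
  by continuous approximation, sums by linearity, limits through
  \<open>conv1_moll_approx\<close>.\<close>

lemma conv1_moll_integrable:
  fixes f :: "real \<times> real \<Rightarrow> real"
  assumes "integrable lborel f" shows "conv1 (\<lambda>n. moll n 0 0 f) f"
  using assms
proof (induction rule: integrable_induct)
  case (base A c)
  show ?case
  proof (rule conv1_moll_approx)
    show "integrable lborel (\<lambda>x. indicat_real A x *\<^sub>R c)" using base by (auto simp: integrable_indicator_iff)
    fix e :: real assume "e > 0"
    then have "e / (\<bar>c\<bar> + 1) > 0" by simp
    then obtain g where g: "continuous_on UNIV g" "integrable lborel g" "(LINT x|lborel. \<bar>indicator A x - g x\<bar>) < e / (\<bar>c\<bar> + 1)"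
      using indicator_approx_continuous[of A] base by auto
    let ?g = "\<lambda>x. g x * c"
    have "(LINT x|lborel. \<bar>indicat_real A x *\<^sub>R c - ?g x\<bar>) = (LINT x|lborel. \<bar>indicat_real A x - g x\<bar> * \<bar>c\<bar>)"
      by (intro Bochner_Integration.integral_cong refl) (simp add: abs_mult[symmetric] left_diff_distrib)
    also have "\<dots> = (LINT x|lborel. \<bar>indicat_real A x - g x\<bar>) * \<bar>c\<bar>" by simp
    also have "\<dots> \<le> e / (\<bar>c\<bar> + 1) * \<bar>c\<bar>" using g(3) by (intro mult_right_mono) auto
    also have "\<dots> < e" using \<open>e > 0\<close> by (simp add: field_simps)
    finally have "(LINT x|lborel. \<bar>indicat_real A x *\<^sub>R c - ?g x\<bar>) < e" .
    moreover have "conv1 (\<lambda>n. moll n 0 0 ?g) ?g" by (intro conv1_moll_continuous continuous_intros g(1))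
    ultimately show "\<exists>g. integrable lborel g \<and> conv1 (\<lambda>n. moll n 0 0 g) g \<and> (LINT x|lborel. \<bar>indicat_real A x *\<^sub>R c - g x\<bar>) < e"
      using g(2) by (intro exI[of _ ?g]) auto
  qed
next
  case (add f g)
  have fl: "L1loc f" "L1loc g" using add by (auto simp: integrable_imp_L1loc)
  have "(\<lambda>n. LINT z|lborel. indicator (bx R) z * \<bar>moll n 0 0 (\<lambda>z. f z + g z) z - (f z + g z)\<bar>) \<longlonglongrightarrow> 0" for R
  proof (rule real_tendsto_sandwich[OF _ _ tendsto_const])
    show "(\<lambda>n. (LINT z|lborel. indicator (bx R) z * \<bar>moll n 0 0 f z - f z\<bar>) +
       (LINT z|lborel. indicator (bx R) z * \<bar>moll n 0 0 g z - g z\<bar>)) \<longlonglongrightarrow> 0"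
      using add by (intro tendsto_add_zero) (auto simp: conv1_def)
    have i: "integrable lborel (\<lambda>z. indicator (bx R) z * \<bar>moll n 0 0 f z - f z\<bar>)"
      "integrable lborel (\<lambda>z. indicator (bx R) z * \<bar>moll n 0 0 g z - g z\<bar>)" for n
      by (intro integrable_bx_times L1loc_abs L1loc_diff L1loc_moll fl)+
    have "(LINT z|lborel. indicator (bx R) z * \<bar>moll n 0 0 (\<lambda>z. f z + g z) z - (f z + g z)\<bar>)
       \<le> (LINT z|lborel. indicator (bx R) z * \<bar>moll n 0 0 f z - f z\<bar> + indicator (bx R) z * \<bar>moll n 0 0 g z - g z\<bar>)" for n
      by (intro integral_mono integrable_bx_times Bochner_Integration.integrable_add i L1loc_abs L1loc_diff L1loc_moll L1loc_add fl)
         (auto simp: indicator_def moll_add[OF fl])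
    then show "eventually (\<lambda>n. (LINT z|lborel. indicator (bx R) z * \<bar>moll n 0 0 (\<lambda>z. f z + g z) z - (f z + g z)\<bar>)
       \<le> (LINT z|lborel. indicator (bx R) z * \<bar>moll n 0 0 f z - f z\<bar>) +
         (LINT z|lborel. indicator (bx R) z * \<bar>moll n 0 0 g z - g z\<bar>)) sequentially"
      using i by (auto intro!: always_eventually)
  qed auto
  then show ?case by (auto simp: conv1_def L1loc_add L1loc_moll fl)
next
  case (lim f s)
  show ?case
  proof (rule conv1_moll_approx)
    show f: "integrable lborel f" using lim by simp
    fix e :: real assume "e > 0"
    have "(\<lambda>i. LINT x|lborel. \<bar>f x - s i x\<bar>) \<longlonglongrightarrow> (LINT x|(lborel :: (real \<times> real) measure). 0::real)"
    proof (rule integral_dominated_convergence)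
      \<comment> \<open>The induction principle supplies \<open>|s i| \<le> 2 |f|\<close>, whence
        the factor 3.\<close>
      show "integrable lborel (\<lambda>x. 3 * \<bar>f x\<bar>)" using f by auto
      show "AE x in lborel. (\<lambda>i. \<bar>f x - s i x\<bar>) \<longlonglongrightarrow> 0"
      proof (rule AE_I2)
        fix x :: "real \<times> real"
        have "(\<lambda>i. \<bar>f x - s i x\<bar>) \<longlonglongrightarrow> \<bar>f x - f x\<bar>" using lim by (intro tendsto_intros) auto
        then show "(\<lambda>i. \<bar>f x - s i x\<bar>) \<longlonglongrightarrow> 0" by simp
      qed
      show "AE x in lborel. norm (\<bar>f x - s i x\<bar>) \<le> 3 * \<bar>f x\<bar>" for i
        using lim(3)[of _ i] by (auto intro!: AE_I2 simp: abs_if split: if_splits) (smt (verit, best))+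
    qed (use lim in \<open>auto\<close>)
    then have "(\<lambda>i. LINT x|lborel. \<bar>f x - s i x\<bar>) \<longlonglongrightarrow> 0" by simp
    from LIMSEQ_D[OF this \<open>e > 0\<close>] obtain i where "(LINT x|lborel. \<bar>f x - s i x\<bar>) < e" by auto
    then show "\<exists>g. integrable lborel g \<and> conv1 (\<lambda>n. moll n 0 0 g) g \<and> (LINT x|lborel. \<bar>f x - g x\<bar>) < e"
      using lim by (intro exI[of _ "s i"]) auto
  qed
qed

text \<open>Every kernel is supported in \<open>bx 2\<close>, so on \<open>bx R\<close> only the
  values of \<open>f\<close> in \<open>bx (2 + R)\<close> matter, and \<open>f\<close> may be cut
  off there to become integrable.\<close>

theorem conv1_moll:
  assumes f: "L1loc f" shows "conv1 (\<lambda>n. moll n 0 0 f) f"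
proof -
  have "(\<lambda>n. LINT z|lborel. indicator (bx R) z * \<bar>moll n 0 0 f z - f z\<bar>) \<longlonglongrightarrow> 0" for R
  proof -
    let ?g = "\<lambda>z. indicator (bx (2 + R)) z * f z"
    have "conv1 (\<lambda>n. moll n 0 0 ?g) ?g"
      using f by (intro conv1_moll_integrable) (simp add: L1loc_def)
    then have "(\<lambda>n. LINT z|lborel. indicator (bx R) z * \<bar>moll n 0 0 ?g z - ?g z\<bar>) \<longlonglongrightarrow> 0"
      unfolding conv1_def by blast
    moreover have "indicat_real (bx R) z * \<bar>moll n 0 0 ?g z - ?g z\<bar> = indicator (bx R) z * \<bar>moll n 0 0 f z - f z\<bar>" for n z
      using moll_cong_bx[of z R f ?g n 0 0] bx_mono[of R "2 + R"] by (auto simp: indicator_def)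
    ultimately show ?thesis by (simp only:)
  qed
  then show ?thesis by (auto simp: conv1_def f L1loc_moll)
qed

section \<open>Square-integrable functions on boxes\<close>

definition L2loc :: "(real \<times> real \<Rightarrow> real) \<Rightarrow> bool" where
  "L2loc f \<longleftrightarrow> f \<in> borel_measurable borel \<and> L1loc (\<lambda>z. (f z)\<^sup>2)"

lemma L2loc_measurable [measurable_dest]: "L2loc f \<Longrightarrow> f \<in> borel_measurable borel"
  by (simp add: L2loc_def)

text \<open>A weighted form of the arithmetic-geometric inequality. The free weight \<open>t\<close>
  does the work of the Cauchy-Schwarz inequality in the later estimates, without square roots of
  integrals.\<close>

lemma abs_mult_le_sq: "\<bar>a * b\<bar> \<le> t * a\<^sup>2 + b\<^sup>2 / t" if "t > 0" for a b t :: real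
proof -
  have "0 \<le> (t * \<bar>a\<bar> - \<bar>b\<bar>)\<^sup>2 / t" using that by simp
  also have "\<dots> = t * a\<^sup>2 + b\<^sup>2 / t - 2 * \<bar>a * b\<bar>"
    using that by (simp add: power2_eq_square abs_mult field_simps)
  finally show ?thesis by linarith
qed

lemma L2loc_mult:
  assumes f: "L2loc f" and g: "L2loc g" shows "L1loc (\<lambda>z. f z * g z)"
proof (rule L1loc_bound)
  note [measurable] = L2loc_measurable[OF f] L2loc_measurable[OF g]
  show "L1loc (\<lambda>z. (f z)\<^sup>2 + (g z)\<^sup>2)" using f g by (intro L1loc_add) (auto simp: L2loc_def)
  show "(\<lambda>z. f z * g z) \<in> borel_measurable borel" by measurable
  show "\<bar>f z * g z\<bar> \<le> (f z)\<^sup>2 + (g z)\<^sup>2" for z using abs_mult_le_sq[of 1 "f z" "g z"] by simp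
qed

lemma L2loc_const: "L2loc (\<lambda>_. c)"
  by (simp add: L2loc_def L1loc_const)

lemma L2loc_imp_L1loc: "L2loc f \<Longrightarrow> L1loc f"
  using L2loc_mult[of f "\<lambda>_. 1"] by (simp add: L2loc_const)

lemma continuous_imp_L2loc: "continuous_on UNIV f \<Longrightarrow> L2loc f"
  unfolding L2loc_def
  by (intro conjI borel_measurable_continuous_onI continuous_imp_L1loc continuous_intros)

lemma L2loc_add: assumes "L2loc f" "L2loc g" shows "L2loc (\<lambda>z. f z + g z)"
proof -
  have "L1loc (\<lambda>z. 2 * ((f z)\<^sup>2 + (g z)\<^sup>2))"
    using assms by (intro L1loc_cmult L1loc_add) (auto simp: L2loc_def)
  moreover have "(f z + g z)\<^sup>2 \<le> 2 * ((f z)\<^sup>2 + (g z)\<^sup>2)" for z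
    using zero_le_power2[of "f z - g z"] by (simp add: power2_eq_square algebra_simps)
  then have "\<bar>(f z + g z)\<^sup>2\<bar> \<le> 2 * ((f z)\<^sup>2 + (g z)\<^sup>2)" for z
    by simp
  moreover have [measurable]: "f \<in> borel_measurable borel" "g \<in> borel_measurable borel"
    using assms by (auto simp: L2loc_def)
  ultimately show ?thesis unfolding L2loc_def by (auto intro: L1loc_bound)
qed

lemma L2loc_cmult: "L2loc f \<Longrightarrow> L2loc (\<lambda>z. c * f z)"
  unfolding L2loc_def by (auto simp: power_mult_distrib intro: L1loc_cmult)

lemma L2loc_diff: "L2loc f \<Longrightarrow> L2loc g \<Longrightarrow> L2loc (\<lambda>z. f z - g z)"
  using L2loc_add[of f "\<lambda>z. -1 * g z"] L2loc_cmult[of g "-1"] by simp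

lemma L2loc_bound:
  assumes "L2loc g" "f \<in> borel_measurable borel" "\<And>x. \<bar>f x\<bar> \<le> \<bar>g x\<bar>"
  shows "L2loc f"
proof -
  have [measurable]: "f \<in> borel_measurable borel" by fact
  have "L1loc (\<lambda>z. (f z)\<^sup>2)"
  proof (rule L1loc_bound)
    show "L1loc (\<lambda>z. (g z)\<^sup>2)" using assms by (simp add: L2loc_def)
    show "\<bar>(f z)\<^sup>2\<bar> \<le> (g z)\<^sup>2" for z
      using assms(3)[of z] by (simp add: abs_le_square_iff)
  qed measurable
  then show ?thesis by (simp add: L2loc_def)
qed

definition conv2 :: "(nat \<Rightarrow> real \<times> real \<Rightarrow> real) \<Rightarrow> (real \<times> real \<Rightarrow> real) \<Rightarrow> bool" where
  "conv2 F f \<longleftrightarrow> (\<forall>n. L2loc (F n)) \<and> L2loc f \<and>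
     (\<forall>R. (\<lambda>n. LINT z|lborel. indicator (bx R) z * (F n z - f z)\<^sup>2) \<longlonglongrightarrow> 0)"

lemma L2loc_sq: "L2loc f \<Longrightarrow> L1loc (\<lambda>z. (f z)\<^sup>2)"
  by (simp add: L2loc_def)

text \<open>Jensen's inequality: the variance of \<open>f\<close> under the probability density
  \<open>kern n 0 0 (y - x)\<close> is nonnegative.\<close>

lemma moll_sq_le:
  assumes f: "L2loc f" shows "(moll n 0 0 f x)\<^sup>2 \<le> moll n 0 0 (\<lambda>z. (f z)\<^sup>2) x"
proof -
  let ?m = "moll n 0 0 f x"
  have "0 \<le> (LINT y|lborel. (f y - ?m)\<^sup>2 * kern n 0 0 (y - x))"
    by (simp add: kern_nonneg)
  also have "\<dots> = moll n 0 0 (\<lambda>y. ((f y)\<^sup>2 - (2 * ?m) * f y) + ?m\<^sup>2) x"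
    unfolding moll_def[of _ _ _ "\<lambda>y. ((f y)\<^sup>2 - _ * f y) + _"] by (simp add: power2_eq_square algebra_simps)
  also have "\<dots> = moll n 0 0 (\<lambda>y. (f y)\<^sup>2) x - 2 * ?m * ?m + ?m\<^sup>2"
    by (simp add: moll_add moll_diff moll_cmult moll_const L1loc_diff L1loc_cmult L1loc_const L2loc_sq L2loc_imp_L1loc f)
  finally show ?thesis by (simp add: power2_eq_square)
qed

lemma L2loc_moll: "L1loc f \<Longrightarrow> L2loc (moll n i j f)"
  by (rule continuous_imp_L2loc[OF continuous_on_moll])

lemma integral_bx_moll_le:
  assumes f: "L1loc f" "\<And>z. 0 \<le> f z"
  shows "(LINT z|lborel. indicator (bx R) z * moll n 0 0 f z) \<le> (LINT z|lborel. indicator (bx (2 + R)) z * f z)"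
proof -
  let ?g = "\<lambda>z. indicator (bx (2 + R)) z * f z"
  have g: "integrable lborel ?g" using f by (simp add: L1loc_def)
  have eq: "indicat_real (bx R) z * moll n 0 0 f z = indicator (bx R) z * \<bar>moll n 0 0 ?g z\<bar>" for z
  proof -
    have "0 \<le> moll n 0 0 ?g z" using f by (simp add: moll_def kern_nonneg)
    then show ?thesis using moll_cong_bx[of z R f ?g n 0 0] by (auto simp: indicator_def)
  qed
  have "(LINT z|lborel. indicator (bx R) z * moll n 0 0 f z) \<le> (LINT z|lborel. \<bar>moll n 0 0 ?g z\<bar>)"
    unfolding eq using moll_integrable(1)[OF g] by (intro integral_bx_le) auto
  also have "\<dots> \<le> (LINT z|lborel. \<bar>?g z\<bar>)" by (rule moll_integrable(2)[OF g])
  also have "\<dots> = (LINT z|lborel. ?g z)" using f by (simp add: abs_mult)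
  finally show ?thesis .
qed

text \<open>Reduction to \<open>L^1\<close> convergence by truncation. For the function truncated at
  height \<open>M\<close>, the squared error is at most \<open>2 M\<close> times the error; the rest
  \<open>f - t M\<close> is small in \<open>L^2\<close>, and by Jensen so is its mollification,
  uniformly in \<open>n\<close>.\<close>

theorem conv2_moll:
  assumes f: "L2loc f" shows "conv2 (\<lambda>n. moll n 0 0 f) f"
proof -
  have fl: "L1loc f" using f by (rule L2loc_imp_L1loc)
  note [measurable] = L1loc_measurable[OF fl]
  define t where "t M z = max (- real M) (min (real M) (f z))" for M z
  have tm[measurable]: "t M \<in> borel_measurable borel" for M unfolding t_def by measurable
  have t_le: "\<bar>t M z\<bar> \<le> real M" "\<bar>t M z\<bar> \<le> \<bar>f z\<bar>" "\<bar>f z - t M z\<bar> \<le> \<bar>f z\<bar>" for M z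
    by (auto simp: t_def max_def min_def)
  have tl: "L2loc (t M)" for M by (rule L2loc_bound[OF f tm t_le(2)])
  have hl: "L2loc (\<lambda>z. f z - t M z)" for M by (intro L2loc_diff f tl)
  have "(\<lambda>n. LINT z|lborel. indicator (bx R) z * (moll n 0 0 f z - f z)\<^sup>2) \<longlonglongrightarrow> 0" for R
  proof (rule LIMSEQ_I)
    fix e :: real assume e: "e > 0"
    have "(\<lambda>M. LINT z|lborel. indicator (bx (2 + R)) z * (f z - t M z)\<^sup>2) \<longlonglongrightarrow>
       (LINT z|(lborel :: (real \<times> real) measure). 0::real)"
    proof (rule integral_dominated_convergence)
      show "integrable lborel (\<lambda>z. indicator (bx (2 + R)) z * (f z)\<^sup>2)"
        by (intro integrable_bx_times L2loc_sq f)
      show "AE z in lborel. (\<lambda>M. indicator (bx (2 + R)) z * (f z - t M z)\<^sup>2) \<longlonglongrightarrow> 0"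
      proof (rule AE_I2)
        fix z
        obtain M0 where "\<bar>f z\<bar> \<le> real M0" using real_arch_simple by blast
        then have "\<forall>M\<ge>M0. indicator (bx (2 + R)) z * (f z - t M z)\<^sup>2 = 0"
          by (auto simp: t_def max_def min_def)
        then show "(\<lambda>M. indicator (bx (2 + R)) z * (f z - t M z)\<^sup>2) \<longlonglongrightarrow> 0"
          by (intro tendsto_eventually) (auto simp: eventually_sequentially)
      qed
      show "AE z in lborel. norm (indicator (bx (2 + R)) z * (f z - t M z)\<^sup>2) \<le> indicator (bx (2 + R)) z * (f z)\<^sup>2" for M
        using t_le(3)[of _ M] by (intro AE_I2) (auto simp: indicator_def abs_le_square_iff[symmetric])
    qed measurable
    then have lim0: "(\<lambda>M. LINT z|lborel. indicator (bx (2 + R)) z * (f z - t M z)\<^sup>2) \<longlonglongrightarrow> 0" by simp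
    \<comment> \<open>The two remainder terms enter with factor 3 each and give at most
      \<open>6 e / 12\<close>; the truncated term enters with factor \<open>6 M\<close>, which
      matches the threshold \<open>e / (12 (M + 1))\<close>.\<close>
    have "e / 12 > 0" using e by simp
    from LIMSEQ_D[OF lim0 this] obtain M where M: "(LINT z|lborel. indicator (bx (2 + R)) z * (f z - t M z)\<^sup>2) < e / 12"
      by auto
    let ?h = "\<lambda>z. f z - t M z"
    have lim1: "(\<lambda>n. LINT z|lborel. indicator (bx R) z * \<bar>moll n 0 0 (t M) z - t M z\<bar>) \<longlonglongrightarrow> 0"
      using conv1_moll[OF L2loc_imp_L1loc[OF tl]] by (simp add: conv1_def)
    have "e / (12 * (real M + 1)) > 0" using e by simp
    from LIMSEQ_D[OF lim1 this] obtain N where N: "\<And>n. n \<ge> N \<Longrightarrow>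
        (LINT z|lborel. indicator (bx R) z * \<bar>moll n 0 0 (t M) z - t M z\<bar>) < e / (12 * (real M + 1))"
      by auto
    have "norm ((LINT z|lborel. indicator (bx R) z * (moll n 0 0 f z - f z)\<^sup>2) - 0) < e" if "n \<ge> N" for n
    proof -
      have i1: "integrable lborel (\<lambda>z. indicator (bx R) z * \<bar>moll n 0 0 (t M) z - t M z\<bar>)"
        by (intro integrable_bx_times L1loc_abs L1loc_diff L1loc_moll L2loc_imp_L1loc tl)
      have i2: "integrable lborel (\<lambda>z. indicator (bx R) z * moll n 0 0 (\<lambda>z. (?h z)\<^sup>2) z)"
        by (intro integrable_bx_times L1loc_moll L2loc_sq hl)
      have i3: "integrable lborel (\<lambda>z. indicator (bx R) z * (?h z)\<^sup>2)" for R
        by (intro integrable_bx_times L2loc_sq hl)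
      have "(LINT z|lborel. indicator (bx R) z * (moll n 0 0 f z - f z)\<^sup>2)
         \<le> (LINT z|lborel. 6 * real M * (indicator (bx R) z * \<bar>moll n 0 0 (t M) z - t M z\<bar>)
             + 3 * (indicator (bx R) z * moll n 0 0 (\<lambda>z. (?h z)\<^sup>2) z) + 3 * (indicator (bx R) z * (?h z)\<^sup>2))"
      proof (rule integral_mono)
        show "integrable lborel (\<lambda>z. indicator (bx R) z * (moll n 0 0 f z - f z)\<^sup>2)"
          by (intro integrable_bx_times L2loc_sq L2loc_diff L2loc_moll fl f)
        fix z
        \<comment> \<open>The right side exceeds the left by
          \<open>(a - b)^2 + (a + c)^2 + (b + c)^2\<close>.\<close>
        have s3: "(a + b - c)\<^sup>2 \<le> 3 * a\<^sup>2 + 3 * b\<^sup>2 + 3 * c\<^sup>2" for a b c :: real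
          using sum_squares_ge_zero[of "a - b" "a + c"] zero_le_power2[of "b + c"]
          by (simp add: power2_eq_square algebra_simps)
        have mt: "\<bar>moll n 0 0 (t M) z\<bar> \<le> real M"
        proof -
          have "\<bar>moll n 0 0 (t M) z\<bar> \<le> moll n 0 0 (\<lambda>z. \<bar>t M z\<bar>) z"
            by (intro moll_abs_le L2loc_imp_L1loc tl)
          also have "\<dots> \<le> moll n 0 0 (\<lambda>_. real M) z"
            by (intro moll_mono L1loc_abs L2loc_imp_L1loc tl L1loc_const t_le)
          finally show ?thesis by (simp add: moll_const)
        qed
        have "(moll n 0 0 f z - f z)\<^sup>2 = ((moll n 0 0 (t M) z - t M z) + moll n 0 0 ?h z - ?h z)\<^sup>2"
          by (simp add: moll_diff fl L2loc_imp_L1loc tl)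
        also have "\<dots> \<le> 3 * (moll n 0 0 (t M) z - t M z)\<^sup>2 + 3 * (moll n 0 0 ?h z)\<^sup>2 + 3 * (?h z)\<^sup>2"
          by (rule s3)
        also have "(moll n 0 0 (t M) z - t M z)\<^sup>2 = \<bar>moll n 0 0 (t M) z - t M z\<bar> * \<bar>moll n 0 0 (t M) z - t M z\<bar>"
          by (simp add: power2_eq_square)
        also have "\<dots> \<le> (2 * real M) * \<bar>moll n 0 0 (t M) z - t M z\<bar>"
          using mt t_le(1)[of M z] by (intro mult_right_mono) auto
        also have "(moll n 0 0 ?h z)\<^sup>2 \<le> moll n 0 0 (\<lambda>z. (?h z)\<^sup>2) z"
          by (rule moll_sq_le[OF hl])
        finally show "indicator (bx R) z * (moll n 0 0 f z - f z)\<^sup>2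
           \<le> 6 * real M * (indicator (bx R) z * \<bar>moll n 0 0 (t M) z - t M z\<bar>)
             + 3 * (indicator (bx R) z * moll n 0 0 (\<lambda>z. (?h z)\<^sup>2) z) + 3 * (indicator (bx R) z * (?h z)\<^sup>2)"
          by (cases "z \<in> bx R") auto
      qed (intro Bochner_Integration.integrable_add integrable_mult_right i1 i2 i3)
      also have "\<dots> = 6 * real M * (LINT z|lborel. indicator (bx R) z * \<bar>moll n 0 0 (t M) z - t M z\<bar>)
          + 3 * (LINT z|lborel. indicator (bx R) z * moll n 0 0 (\<lambda>z. (?h z)\<^sup>2) z)
          + 3 * (LINT z|lborel. indicator (bx R) z * (?h z)\<^sup>2)"
        using i1 i2 i3[of R] by simp
      also have "(LINT z|lborel. indicator (bx R) z * moll n 0 0 (\<lambda>z. (?h z)\<^sup>2) z) \<le> (LINT z|lborel. indicator (bx (2 + R)) z * (?h z)\<^sup>2)"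
        by (intro integral_bx_moll_le L2loc_sq hl) auto
      also have "(LINT z|lborel. indicator (bx R) z * (?h z)\<^sup>2) \<le> (LINT z|lborel. indicator (bx (2 + R)) z * (?h z)\<^sup>2)"
        using bx_mono[of R "2 + R"] by (intro integral_mono i3) (auto simp: indicator_def)
      also have "6 * real M * (LINT z|lborel. indicator (bx R) z * \<bar>moll n 0 0 (t M) z - t M z\<bar>)
         \<le> 6 * real M * (e / (12 * (real M + 1)))"
        using N[OF that] by (intro mult_left_mono) auto
      also have "\<dots> \<le> e / 2" using e by (simp add: field_simps)
      finally show ?thesis using M e by simp
    qed
    then show "\<exists>no. \<forall>n\<ge>no. norm ((LINT z|lborel. indicator (bx R) z * (moll n 0 0 f z - f z)\<^sup>2) - 0) < e"
      by blast
  qed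
  then show ?thesis by (simp add: conv2_def f L2loc_moll fl)
qed

section \<open>Products, bounded factors and pairings of convergent sequences\<close>

lemma conv1_from_bound:
  assumes "\<And>n. L1loc (F n)" "L1loc f"
    and "\<And>R e. e > 0 \<Longrightarrow> \<exists>N. \<forall>n\<ge>N. (LINT z|lborel. indicator (bx R) z * \<bar>F n z - f z\<bar>) < e"
  shows "conv1 F f"
  unfolding conv1_def using assms by (auto intro!: LIMSEQ_I)

text \<open>The product difference is expanded around \<open>f\<close> and \<open>g\<close>. In the
  mixed terms the fixed factors get the weight \<open>t\<close> and the errors \<open>1 / t\<close>;
  as \<open>t\<close> is fixed before \<open>n\<close>, the factor \<open>1 / t\<close> does no
  harm.\<close>

lemma conv1_mult:
  assumes F: "conv2 F f" and G: "conv2 G g"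
  shows "conv1 (\<lambda>n z. F n z * G n z) (\<lambda>z. f z * g z)"
proof (rule conv1_from_bound)
  have l: "L2loc (F n)" "L2loc (G n)" "L2loc f" "L2loc g" for n using F G by (auto simp: conv2_def)
  show "L1loc (\<lambda>z. F n z * G n z)" "L1loc (\<lambda>z. f z * g z)" for n by (intro L2loc_mult l)+
  fix R e :: real assume e: "e > 0"
  define C where "C = (LINT z|lborel. indicator (bx R) z * (f z)\<^sup>2) + (LINT z|lborel. indicator (bx R) z * (g z)\<^sup>2)"
  have "C \<ge> 0" unfolding C_def by (intro add_nonneg_nonneg Bochner_Integration.integral_nonneg) auto
  define t where "t = e / (2 * (C + 1))"
  have t: "t > 0" using e \<open>C \<ge> 0\<close> by (simp add: t_def)
  define d where "d n = (LINT z|lborel. indicator (bx R) z * (F n z - f z)\<^sup>2) + (LINT z|lborel. indicator (bx R) z * (G n z - g z)\<^sup>2)" for n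
  have "d \<longlonglongrightarrow> 0" unfolding d_def using F G by (intro tendsto_add_zero) (auto simp: conv2_def)
  have "e / (2 * (1 + 1 / t)) > 0" using e t by (intro divide_pos_pos mult_pos_pos add_pos_pos) auto
  from LIMSEQ_D[OF \<open>d \<longlonglongrightarrow> 0\<close> this] obtain N where "\<And>n. n \<ge> N \<Longrightarrow> norm (d n - 0) < e / (2 * (1 + 1 / t))"
    by blast
  then have N: "\<And>n. n \<ge> N \<Longrightarrow> d n < e / (2 * (1 + 1 / t))" by fastforce
  have "(LINT z|lborel. indicator (bx R) z * \<bar>F n z * G n z - f z * g z\<bar>) < e" if "n \<ge> N" for n
  proof -
    have i: "integrable lborel (\<lambda>z. indicator (bx R) z * (f z)\<^sup>2)"
      "integrable lborel (\<lambda>z. indicator (bx R) z * (g z)\<^sup>2)"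
      "integrable lborel (\<lambda>z. indicator (bx R) z * (F n z - f z)\<^sup>2)"
      "integrable lborel (\<lambda>z. indicator (bx R) z * (G n z - g z)\<^sup>2)"
      by (intro integrable_bx_times L2loc_sq L2loc_diff l)+
    have "(LINT z|lborel. indicator (bx R) z * \<bar>F n z * G n z - f z * g z\<bar>)
      \<le> (LINT z|lborel. t * (indicator (bx R) z * (f z)\<^sup>2 + indicator (bx R) z * (g z)\<^sup>2)
          + (1 + 1 / t) * (indicator (bx R) z * (F n z - f z)\<^sup>2 + indicator (bx R) z * (G n z - g z)\<^sup>2))"
    proof (rule integral_mono)
      fix z
      have "F n z * G n z - f z * g z = (F n z - f z) * (G n z - g z) + f z * (G n z - g z) + g z * (F n z - f z)"
        by (simp add: algebra_simps)
      then have "\<bar>F n z * G n z - f z * g z\<bar> \<le> \<bar>(F n z - f z) * (G n z - g z)\<bar> + \<bar>f z * (G n z - g z)\<bar> + \<bar>g z * (F n z - f z)\<bar>"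
        by linarith
      also have "\<dots> \<le> (1 * (F n z - f z)\<^sup>2 + (G n z - g z)\<^sup>2 / 1) + (t * (f z)\<^sup>2 + (G n z - g z)\<^sup>2 / t) + (t * (g z)\<^sup>2 + (F n z - f z)\<^sup>2 / t)"
        by (intro add_mono abs_mult_le_sq t) auto
      finally show "indicator (bx R) z * \<bar>F n z * G n z - f z * g z\<bar> \<le> t * (indicator (bx R) z * (f z)\<^sup>2 + indicator (bx R) z * (g z)\<^sup>2)
          + (1 + 1 / t) * (indicator (bx R) z * (F n z - f z)\<^sup>2 + indicator (bx R) z * (G n z - g z)\<^sup>2)"
        by (cases "z \<in> bx R") (auto simp: algebra_simps)
    qed (intro Bochner_Integration.integrable_add integrable_mult_right i integrable_bx_times L1loc_abs L1loc_diff L2loc_mult l)+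
    also have "\<dots> = t * C + (1 + 1 / t) * d n"
      unfolding C_def d_def
      using i by simp
    also have "t * C < e / 2" using e \<open>C \<ge> 0\<close> by (simp add: t_def field_simps)
    also have "(1 + 1 / t) * d n < (1 + 1 / t) * (e / (2 * (1 + 1 / t)))"
      using N[OF that] t by (intro mult_strict_left_mono) (auto simp: add_pos_pos)
    also have "\<dots> = e / 2"
    proof -
      have "1 + 1 / t > 0" using t by (simp add: add_pos_pos)
      then show ?thesis by (simp add: field_simps)
    qed
    finally show ?thesis by simp
  qed
  then show "\<exists>N. \<forall>n\<ge>N. (LINT z|lborel. indicator (bx R) z * \<bar>F n z * G n z - f z * g z\<bar>) < e" by blast
qed

lemma conv2_const: "L2loc f \<Longrightarrow> conv2 (\<lambda>_. f) f"
  by (simp add: conv2_def)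

lemma conv2_imp_conv1: "conv2 F f \<Longrightarrow> conv1 F f"
  using conv1_mult[OF _ conv2_const[OF L2loc_const[of 1]]] by simp

lemma conv1_add:
  assumes F: "conv1 F f" and G: "conv1 G g"
  shows "conv1 (\<lambda>n z. F n z + G n z) (\<lambda>z. f z + g z)"
proof -
  have l: "L1loc (F n)" "L1loc (G n)" "L1loc f" "L1loc g" for n using F G by (auto simp: conv1_def)
  have "(\<lambda>n. LINT z|lborel. indicator (bx R) z * \<bar>F n z + G n z - (f z + g z)\<bar>) \<longlonglongrightarrow> 0" for R
  proof (rule real_tendsto_sandwich[OF _ _ tendsto_const])
    show "(\<lambda>n. (LINT z|lborel. indicator (bx R) z * \<bar>F n z - f z\<bar>) +
       (LINT z|lborel. indicator (bx R) z * \<bar>G n z - g z\<bar>)) \<longlonglongrightarrow> 0"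
      using F G by (intro tendsto_add_zero) (auto simp: conv1_def)
    have i: "integrable lborel (\<lambda>z. indicator (bx R) z * \<bar>F n z - f z\<bar>)"
      "integrable lborel (\<lambda>z. indicator (bx R) z * \<bar>G n z - g z\<bar>)" for n
      by (intro integrable_bx_times L1loc_abs L1loc_diff l)+
    have "(LINT z|lborel. indicator (bx R) z * \<bar>F n z + G n z - (f z + g z)\<bar>)
       \<le> (LINT z|lborel. indicator (bx R) z * \<bar>F n z - f z\<bar> + indicator (bx R) z * \<bar>G n z - g z\<bar>)" for n
      by (intro integral_mono integrable_bx_times Bochner_Integration.integrable_add i L1loc_abs L1loc_diff L1loc_add l)
         (auto simp: indicator_def)
    then show "eventually (\<lambda>n. (LINT z|lborel. indicator (bx R) z * \<bar>F n z + G n z - (f z + g z)\<bar>)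
       \<le> (LINT z|lborel. indicator (bx R) z * \<bar>F n z - f z\<bar>) +
         (LINT z|lborel. indicator (bx R) z * \<bar>G n z - g z\<bar>)) sequentially"
      using i by (auto intro!: always_eventually)
  qed auto
  then show ?thesis by (auto simp: conv1_def L1loc_add l)
qed

text \<open>Split into \<open>w n (F n - f)\<close> and \<open>(w n - w') f\<close>: the first is
  controlled by the uniform bound, the second by dominated convergence. Hence coefficients that
  converge only almost everywhere are admissible as long as they stay bounded.\<close>

lemma conv1_bounded_mult:
  assumes F: "conv1 F f" and w[measurable]: "\<And>n. w n \<in> borel_measurable borel" "w' \<in> borel_measurable borel"
    and M: "\<And>n z. \<bar>w n z\<bar> \<le> M" "\<And>z. \<bar>w' z\<bar> \<le> M" and lim: "AE z in lborel. (\<lambda>n. w n z) \<longlonglongrightarrow> w' z"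
  shows "conv1 (\<lambda>n z. w n z * F n z) (\<lambda>z. w' z * f z)"
proof -
  have l: "L1loc (F n)" "L1loc f" for n using F by (auto simp: conv1_def)
  note [measurable] = L1loc_measurable[OF l(1)] L1loc_measurable[OF l(2)]
  have wl: "L1loc (\<lambda>z. v z * g z)" if "L1loc g" "v \<in> borel_measurable borel" "\<And>z. \<bar>v z\<bar> \<le> M" for v g
  proof (rule L1loc_bound)
    have [measurable]: "g \<in> borel_measurable borel" "v \<in> borel_measurable borel" using that by auto
    show "L1loc (\<lambda>z. M * \<bar>g z\<bar>)" by (intro L1loc_cmult L1loc_abs that)
    show "(\<lambda>z. v z * g z) \<in> borel_measurable borel" by measurable
    show "\<bar>v z * g z\<bar> \<le> M * \<bar>g z\<bar>" for z using that(3)[of z] by (simp add: abs_mult mult_right_mono)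
  qed
  have "(\<lambda>n. LINT z|lborel. indicator (bx R) z * \<bar>w n z * F n z - w' z * f z\<bar>) \<longlonglongrightarrow> 0" for R
  proof (rule real_tendsto_sandwich[OF _ _ tendsto_const])
    have "(\<lambda>n. LINT z|lborel. indicator (bx R) z * \<bar>(w n z - w' z) * f z\<bar>) \<longlonglongrightarrow> (LINT z|(lborel :: (real \<times> real) measure). 0::real)"
    proof (rule integral_dominated_convergence)
      show "integrable lborel (\<lambda>z. (2 * M) * (indicator (bx R) z * \<bar>f z\<bar>))"
        by (intro integrable_mult_right integrable_bx_times L1loc_abs l)
      show "AE z in lborel. (\<lambda>n. indicator (bx R) z * \<bar>(w n z - w' z) * f z\<bar>) \<longlonglongrightarrow> 0"
        using lim
      proof eventually_elim
        case (elim z)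
        have "(\<lambda>n. indicator (bx R) z * \<bar>(w n z - w' z) * f z\<bar>) \<longlonglongrightarrow> indicator (bx R) z * \<bar>(w' z - w' z) * f z\<bar>"
          by (intro tendsto_intros elim)
        then show ?case by simp
      qed
      show "AE z in lborel. norm (indicator (bx R) z * \<bar>(w n z - w' z) * f z\<bar>) \<le> (2 * M) * (indicator (bx R) z * \<bar>f z\<bar>)" for n
      proof (rule AE_I2)
        fix z
        have "\<bar>w n z - w' z\<bar> \<le> 2 * M" using M(1)[of n z] M(2)[of z] by linarith
        then show "norm (indicator (bx R) z * \<bar>(w n z - w' z) * f z\<bar>) \<le> (2 * M) * (indicator (bx R) z * \<bar>f z\<bar>)"
          by (auto simp: indicator_def abs_mult intro!: mult_right_mono)
      qed
    qed measurable
    then show "(\<lambda>n. M * (LINT z|lborel. indicator (bx R) z * \<bar>F n z - f z\<bar>) +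
       (LINT z|lborel. indicator (bx R) z * \<bar>(w n z - w' z) * f z\<bar>)) \<longlonglongrightarrow> 0"
      using F by (intro tendsto_add_zero tendsto_mult_right_zero) (auto simp: conv1_def)
    have i: "integrable lborel (\<lambda>z. indicator (bx R) z * \<bar>F n z - f z\<bar>)"
      "integrable lborel (\<lambda>z. indicator (bx R) z * \<bar>(w n z - w' z) * f z\<bar>)" for n
    proof -
      have "L1loc (\<lambda>z. (w n z - w' z) * f z)"
        using L1loc_diff[OF wl[of f "w n"] wl[of f w']] M l by (simp add: left_diff_distrib)
      then show "integrable lborel (\<lambda>z. indicator (bx R) z * \<bar>(w n z - w' z) * f z\<bar>)"
        by (intro integrable_bx_times L1loc_abs)
      show "integrable lborel (\<lambda>z. indicator (bx R) z * \<bar>F n z - f z\<bar>)"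
        by (intro integrable_bx_times L1loc_abs L1loc_diff l)
    qed
    have "(LINT z|lborel. indicator (bx R) z * \<bar>w n z * F n z - w' z * f z\<bar>)
       \<le> (LINT z|lborel. M * (indicator (bx R) z * \<bar>F n z - f z\<bar>) + indicator (bx R) z * \<bar>(w n z - w' z) * f z\<bar>)" for n
    proof (rule integral_mono)
      show "integrable lborel (\<lambda>z. indicator (bx R) z * \<bar>w n z * F n z - w' z * f z\<bar>)"
        using M by (intro integrable_bx_times L1loc_abs L1loc_diff wl l) auto
      fix z
      have "w n z * F n z - w' z * f z = w n z * (F n z - f z) + (w n z - w' z) * f z" by (simp add: algebra_simps)
      then have "\<bar>w n z * F n z - w' z * f z\<bar> \<le> \<bar>w n z\<bar> * \<bar>F n z - f z\<bar> + \<bar>(w n z - w' z) * f z\<bar>"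
        using abs_triangle_ineq[of "w n z * (F n z - f z)" "(w n z - w' z) * f z"] by (simp only: abs_mult)
      also have "\<bar>w n z\<bar> * \<bar>F n z - f z\<bar> \<le> M * \<bar>F n z - f z\<bar>" using M by (intro mult_right_mono) auto
      finally show "indicator (bx R) z * \<bar>w n z * F n z - w' z * f z\<bar> \<le> M * (indicator (bx R) z * \<bar>F n z - f z\<bar>) + indicator (bx R) z * \<bar>(w n z - w' z) * f z\<bar>"
        by (cases "z \<in> bx R") auto
    qed (intro Bochner_Integration.integrable_add integrable_mult_right i)
    then show "eventually (\<lambda>n. (LINT z|lborel. indicator (bx R) z * \<bar>w n z * F n z - w' z * f z\<bar>)
       \<le> M * (LINT z|lborel. indicator (bx R) z * \<bar>F n z - f z\<bar>) +
       (LINT z|lborel. indicator (bx R) z * \<bar>(w n z - w' z) * f z\<bar>)) sequentially"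
      using i by (auto intro!: always_eventually)
  qed auto
  then show ?thesis using M by (auto simp: conv1_def intro!: wl l)
qed

lemma conv1_bounded_const_mult:
  assumes F: "conv1 F f" and w: "w \<in> borel_measurable borel" and M: "\<And>z. \<bar>w z\<bar> \<le> M"
  shows "conv1 (\<lambda>n z. w z * F n z) (\<lambda>z. w z * f z)"
  by (rule conv1_bounded_mult[where M=M]) (use assms in auto)

lemma conv1_cmult: "conv1 F f \<Longrightarrow> conv1 (\<lambda>n z. c * F n z) (\<lambda>z. c * f z)"
  by (rule conv1_bounded_const_mult[where M="\<bar>c\<bar>"]) auto

lemma conv1_diff:
  "conv1 F f \<Longrightarrow> conv1 G g \<Longrightarrow> conv1 (\<lambda>n z. F n z - G n z) (\<lambda>z. f z - g z)"
  using conv1_add[of F f "\<lambda>n z. -1 * G n z" "\<lambda>z. -1 * g z"] conv1_cmult[of G g "-1"] by simp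

lemma conv1_integral:
  assumes F: "conv1 F f" and w[measurable]: "w \<in> borel_measurable borel"
    and M: "\<And>z. \<bar>w z\<bar> \<le> M" and R: "\<And>z. z \<notin> bx R \<Longrightarrow> w z = 0"
  shows "(\<lambda>n. LINT z|lborel. F n z * w z) \<longlonglongrightarrow> (LINT z|lborel. f z * w z)"
proof -
  have l: "L1loc (F n)" "L1loc f" for n using F by (auto simp: conv1_def)
  have i: "integrable lborel (\<lambda>z. F n z * w z)" "integrable lborel (\<lambda>z. f z * w z)" for n
    by (intro L1loc_times_bounded[OF _ w M R] l; assumption)+
  have "(\<lambda>n. (LINT z|lborel. F n z * w z) - (LINT z|lborel. f z * w z)) \<longlonglongrightarrow> 0"
  proof (rule Lim_null_comparison)
    show "(\<lambda>n. M * (LINT z|lborel. indicator (bx R) z * \<bar>F n z - f z\<bar>)) \<longlonglongrightarrow> 0"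
      using F by (intro tendsto_mult_right_zero) (auto simp: conv1_def)
    have "norm ((LINT z|lborel. F n z * w z) - (LINT z|lborel. f z * w z)) \<le> M * (LINT z|lborel. indicator (bx R) z * \<bar>F n z - f z\<bar>)" for n
    proof -
      have "norm ((LINT z|lborel. F n z * w z) - (LINT z|lborel. f z * w z)) = norm (LINT z|lborel. F n z * w z - f z * w z)"
        using i by simp
      also have "\<dots> \<le> (LINT z|lborel. norm (F n z * w z - f z * w z))" by (rule integral_norm_bound)
      also have "\<dots> \<le> (LINT z|lborel. M * (indicator (bx R) z * \<bar>F n z - f z\<bar>))"
      proof (rule integral_mono)
        fix z
        have "norm (F n z * w z - f z * w z) = \<bar>w z\<bar> * \<bar>F n z - f z\<bar>"
          by (simp add: abs_mult[symmetric] algebra_simps)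
        then show "norm (F n z * w z - f z * w z) \<le> M * (indicator (bx R) z * \<bar>F n z - f z\<bar>)"
          using M[of z] R[of z] by (cases "z \<in> bx R") (auto intro!: mult_right_mono)
      qed (use i in \<open>auto intro!: integrable_mult_right integrable_bx_times L1loc_abs L1loc_diff l\<close>)
      finally show ?thesis by simp
    qed
    then show "eventually (\<lambda>n. norm ((LINT z|lborel. F n z * w z) - (LINT z|lborel. f z * w z)) \<le> M * (LINT z|lborel. indicator (bx R) z * \<bar>F n z - f z\<bar>)) sequentially"
      by (rule always_eventually[OF allI])
  qed
  then show ?thesis by (rule LIM_zero_cancel)
qed

section \<open>Rapidly converging subsequences\<close>

lemma conv2_subseq: "conv2 F f \<Longrightarrow> strict_mono r \<Longrightarrow> conv2 (\<lambda>n. F (r n)) f"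
  unfolding conv2_def using LIMSEQ_subseq_LIMSEQ[unfolded o_def] by blast

text \<open>The \<open>k\<close>-th index is chosen so that the error integrated over the
  \<open>k\<close>-th box is below \<open>2^(-k)\<close>; one sequence then serves all boxes.
  Integrability of the summed errors is more than almost everywhere convergence: it can be
  restricted to lines.\<close>

lemma fast_subsequence:
  assumes D: "\<And>n. L1loc (D n)" "\<And>n z. 0 \<le> D n z"
    and lim: "\<And>R. (\<lambda>n. LINT z|lborel. indicator (bx R) z * D n z) \<longlonglongrightarrow> 0"
  shows "\<exists>r :: nat \<Rightarrow> nat. strict_mono r \<and>
    (\<integral>\<^sup>+z. (\<Sum>k. ennreal (indicator (bx (real k)) z * D (r k) z)) \<partial>lborel) < \<infinity>"
proof -
  define I where "I k n = (LINT z|lborel. indicator (bx (real k)) z * D n z)" for k n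
  have ex: "\<exists>n>m. I k n < (1 / 2) ^ k" for k m
  proof -
    have "((1 / 2) ^ k :: real) > 0" by simp
    from LIMSEQ_D[OF lim[of "real k"] this] obtain N where N: "\<And>n. n \<ge> N \<Longrightarrow> \<bar>I k n\<bar> < (1 / 2) ^ k"
      by (auto simp: I_def)
    then show ?thesis by (intro exI[of _ "max N (Suc m)"]) (auto simp: abs_less_iff)
  qed
  have "\<exists>r. \<forall>k. I k (r k) < (1 / 2) ^ k \<and> r k < r (Suc k)"
  proof (rule dependent_nat_choice)
    show "\<exists>n. I 0 n < (1 / 2) ^ 0" using ex[of 0 0] by blast
  next
    fix x k show "\<exists>n. I (Suc k) n < (1 / 2) ^ Suc k \<and> x < n" using ex[of x "Suc k"] by blast
  qed
  then obtain r where r: "\<And>k. I k (r k) < (1 / 2) ^ k" "\<And>k. r k < r (Suc k)" by blast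
  have int: "integrable lborel (\<lambda>z. indicator (bx (real k)) z * D (r k) z)" for k
    by (intro integrable_bx_times D)
  note [measurable] = L1loc_measurable[OF D(1)]
  have "(\<integral>\<^sup>+z. (\<Sum>k. ennreal (indicator (bx (real k)) z * D (r k) z)) \<partial>lborel)
     = (\<Sum>k. \<integral>\<^sup>+z. ennreal (indicator (bx (real k)) z * D (r k) z) \<partial>lborel)"
    by (rule nn_integral_suminf) measurable
  also have "\<dots> = (\<Sum>k. ennreal (I k (r k)))"
    unfolding I_def using D by (subst nn_integral_eq_integral[OF int]) auto
  also have "\<dots> \<le> (\<Sum>k. ennreal ((1 / 2) ^ k))"
    using r(1) by (intro suminf_le ennreal_leI) (auto intro: less_imp_le)
  also have "\<dots> = ennreal (\<Sum>k. (1 / 2) ^ k)"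
    by (rule suminf_ennreal2) (auto intro: summable_geometric)
  also have "\<dots> < \<infinity>" by simp
  finally show ?thesis using r(2) strict_mono_Suc_iff by blast
qed

lemma fast_AE:
  assumes D: "\<And>n. L1loc (D n)" "\<And>n z. 0 \<le> D n z"
    and fin: "(\<integral>\<^sup>+z. (\<Sum>k. ennreal (indicator (bx (real k)) z * D k z)) \<partial>lborel) < \<infinity>"
  shows "AE z in lborel. (\<lambda>k. D k z) \<longlonglongrightarrow> 0"
proof -
  note [measurable] = L1loc_measurable[OF D(1)]
  have "AE z in lborel. (\<Sum>k. ennreal (indicator (bx (real k)) z * D k z)) \<noteq> \<infinity>"
    using fin by (intro nn_integral_PInf_AE) auto
  then show ?thesis
  proof eventually_elim
    case (elim z)
    then have "summable (\<lambda>k. indicator (bx (real k)) z * D k z)"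
      using D by (intro summable_suminf_not_top) auto
    then have "(\<lambda>k. indicator (bx (real k)) z * D k z) \<longlonglongrightarrow> 0" by (rule summable_LIMSEQ_zero)
    moreover have "eventually (\<lambda>k. indicator (bx (real k)) z * D k z = D k z) sequentially"
    proof -
      obtain k0 where "norm z \<le> real k0" using real_arch_simple by blast
      have "\<forall>k\<ge>k0. z \<in> bx (real k)"
      proof (intro allI impI)
        fix k assume "k \<ge> k0"
        then have "norm z \<le> real k" using \<open>norm z \<le> real k0\<close> by simp
        then show "z \<in> bx (real k)" using bx_self[of z] bx_mono by blast
      qed
      then show ?thesis unfolding eventually_sequentially by (intro exI[of _ k0]) auto
    qed
    ultimately show ?case by (rule Lim_transform_eventually)
  qed
qed

text \<open>By Tonelli the summed error is integrable on almost every horizontal and vertical line,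
  and it dominates every single term. The bound \<open>C\<close> is thus uniform in
  \<open>k\<close>, which later bounds line integrals of the mollified form.\<close>

lemma fast_lines:
  assumes D: "\<And>n. L1loc (D n)" "\<And>n z. 0 \<le> D n z"
    and fin: "(\<integral>\<^sup>+z. (\<Sum>k. ennreal (indicator (bx (real k)) z * D k z)) \<partial>lborel) < \<infinity>"
  shows "AE y in lborel. \<exists>C<\<infinity>. \<forall>R k. R \<le> real k \<and> \<bar>y\<bar> \<le> real k \<longrightarrow>
           (\<integral>\<^sup>+s. indicator {-R..R} s * ennreal (D k (s, y)) \<partial>lborel) \<le> C"
    and "AE x in lborel. \<exists>C<\<infinity>. \<forall>R k. R \<le> real k \<and> \<bar>x\<bar> \<le> real k \<longrightarrow>
           (\<integral>\<^sup>+t. indicator {-R..R} t * ennreal (D k (x, t)) \<partial>lborel) \<le> C"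
proof -
  note [measurable] = L1loc_measurable[OF D(1)]
  define S where "S z = (\<Sum>k. ennreal (indicator (bx (real k)) z * D k z))" for z
  have [measurable]: "S \<in> borel_measurable borel" unfolding S_def by measurable
  have term_le: "ennreal (indicator (bx (real k)) z * D k z) \<le> S z" for k z
  proof -
    have "sum (\<lambda>k. ennreal (indicator (bx (real k)) z * D k z)) {k} \<le> S z"
      unfolding S_def by (rule sum_le_suminf) auto
    then show ?thesis by simp
  qed
  have "(\<integral>\<^sup>+y. (\<integral>\<^sup>+s. S (s, y) \<partial>lborel) \<partial>lborel) < \<infinity>"
    using fin nn_integral_plane(2)[of S] by (simp add: S_def)
  then have "AE y in lborel. (\<integral>\<^sup>+s. S (s, y) \<partial>lborel) \<noteq> \<infinity>"
    by (intro nn_integral_PInf_AE) auto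
  then show "AE y in lborel. \<exists>C<\<infinity>. \<forall>R k. R \<le> real k \<and> \<bar>y\<bar> \<le> real k \<longrightarrow>
           (\<integral>\<^sup>+s. indicator {-R..R} s * ennreal (D k (s, y)) \<partial>lborel) \<le> C"
  proof eventually_elim
    case (elim y)
    have "(\<integral>\<^sup>+s. indicator {-R..R} s * ennreal (D k (s, y)) \<partial>lborel) \<le> (\<integral>\<^sup>+s. S (s, y) \<partial>lborel)"
      if "R \<le> real k" "\<bar>y\<bar> \<le> real k" for R k
    proof (rule nn_integral_mono)
      fix s
      have "s \<in> {-R..R} \<Longrightarrow> \<bar>s\<bar> \<le> real k" using that by auto
      then show "indicator {-R..R} s * ennreal (D k (s, y)) \<le> S (s, y)"
        using that term_le[of k "(s, y)"] by (cases "s \<in> {-R..R}") (auto simp: indicator_def bx_def)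
    qed
    with elim show ?case by (intro exI[of _ "\<integral>\<^sup>+s. S (s, y) \<partial>lborel"]) (auto simp: less_top[symmetric])
  qed
  have "(\<integral>\<^sup>+x. (\<integral>\<^sup>+t. S (x, t) \<partial>lborel) \<partial>lborel) < \<infinity>"
    using fin nn_integral_plane(1)[of S] by (simp add: S_def)
  then have "AE x in lborel. (\<integral>\<^sup>+t. S (x, t) \<partial>lborel) \<noteq> \<infinity>"
    by (intro nn_integral_PInf_AE) auto
  then show "AE x in lborel. \<exists>C<\<infinity>. \<forall>R k. R \<le> real k \<and> \<bar>x\<bar> \<le> real k \<longrightarrow>
           (\<integral>\<^sup>+t. indicator {-R..R} t * ennreal (D k (x, t)) \<partial>lborel) \<le> C"
  proof eventually_elim
    case (elim x)
    have "(\<integral>\<^sup>+t. indicator {-R..R} t * ennreal (D k (x, t)) \<partial>lborel) \<le> (\<integral>\<^sup>+t. S (x, t) \<partial>lborel)"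
      if "R \<le> real k" "\<bar>x\<bar> \<le> real k" for R k
    proof (rule nn_integral_mono)
      fix t
      have "t \<in> {-R..R} \<Longrightarrow> \<bar>t\<bar> \<le> real k" using that by auto
      then show "indicator {-R..R} t * ennreal (D k (x, t)) \<le> S (x, t)"
        using that term_le[of k "(x, t)"] by (cases "t \<in> {-R..R}") (auto simp: indicator_def bx_def)
    qed
    with elim show ?case by (intro exI[of _ "\<integral>\<^sup>+t. S (x, t) \<partial>lborel"]) (auto simp: less_top[symmetric])
  qed
qed

text \<open>Two sequences are treated together so that one subsequence serves both components of a
  velocity, or two functions to be compared.\<close>

lemma conv1_AE_subseq:
  assumes "conv1 F f" "conv1 G g"
  shows "\<exists>r :: nat \<Rightarrow> nat. strict_mono r \<and> (AE z in lborel. (\<lambda>k. F (r k) z) \<longlonglongrightarrow> f z) \<and>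
    (AE z in lborel. (\<lambda>k. G (r k) z) \<longlonglongrightarrow> g z)"
proof -
  have l: "L1loc (F n)" "L1loc (G n)" "L1loc f" "L1loc g" for n using assms by (auto simp: conv1_def)
  define D where "D n z = \<bar>F n z - f z\<bar> + \<bar>G n z - g z\<bar>" for n z
  have D: "L1loc (D n)" "0 \<le> D n z" for n z
    unfolding D_def by (auto intro!: L1loc_add L1loc_abs L1loc_diff l)
  have "(LINT z|lborel. indicator (bx R) z * D n z) = (LINT z|lborel. indicator (bx R) z * \<bar>F n z - f z\<bar>)
      + (LINT z|lborel. indicator (bx R) z * \<bar>G n z - g z\<bar>)" for R n
    unfolding D_def distrib_left
    by (intro Bochner_Integration.integral_add integrable_bx_times L1loc_abs L1loc_diff l)
  then have "(\<lambda>n. LINT z|lborel. indicator (bx R) z * D n z) \<longlonglongrightarrow> 0" for R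
    using assms by (auto intro!: tendsto_add_zero simp: conv1_def)
  from fast_subsequence[OF D this] obtain r where r: "strict_mono r"
    "(\<integral>\<^sup>+z. (\<Sum>k. ennreal (indicator (bx (real k)) z * D (r k) z)) \<partial>lborel) < \<infinity>" by blast
  have AE: "AE z in lborel. (\<lambda>k. D (r k) z) \<longlonglongrightarrow> 0"
    by (rule fast_AE[OF D r(2)])
  have "AE z in lborel. (\<lambda>k. F (r k) z) \<longlonglongrightarrow> f z"
    using AE by eventually_elim (rule LIM_zero_cancel, erule Lim_null_comparison[rotated], simp add: D_def)
  moreover have "AE z in lborel. (\<lambda>k. G (r k) z) \<longlonglongrightarrow> g z"
    using AE by eventually_elim (rule LIM_zero_cancel, erule Lim_null_comparison[rotated], simp add: D_def)
  ultimately show ?thesis using r(1) by blast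
qed

section \<open>Calculus of continuously differentiable functions of two variables\<close>

text \<open>Continuous partial derivatives yield a total derivative, and that in turn the joint
  continuity of \<open>u\<close>.\<close>

lemma C1I:
  assumes c: "continuous_on UNIV u1" "continuous_on UNIV u2"
    and d: "\<And>x y. ((\<lambda>s. u (s, y)) has_real_derivative u1 (x, y)) (at x)"
      "\<And>x y. ((\<lambda>s. u (x, s)) has_real_derivative u2 (x, y)) (at y)"
  shows "C1 u u1 u2" "(u has_derivative (\<lambda>h. u1 z * fst h + u2 z * snd h)) (at z)"
proof -
  have D: "(u has_derivative (\<lambda>h. u1 z * fst h + u2 z * snd h)) (at z)" for z
  proof -
    obtain x y where z: "z = (x, y)" by fastforce
    have "((\<lambda>(x, y). u (x, y)) has_derivative
       (\<lambda>(tx, ty). u1 (x, y) * tx + blinfun_apply (blinfun_mult_right (u2 (x, y))) ty)) (at (x, y) within UNIV \<times> UNIV)"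
    proof (rule has_derivative_partialsI)
      show "((\<lambda>x. u (x, y)) has_derivative (*) (u1 (x, y))) (at x within UNIV)"
        using d(1) unfolding has_field_derivative_def by simp
      show "((\<lambda>y. u (x, y)) has_derivative blinfun_apply (blinfun_mult_right (u2 (x, y)))) (at y within UNIV)" for x y
        using d(2)[of x y] unfolding has_field_derivative_def by simp
      have "isCont (\<lambda>z. blinfun_mult_right (u2 z)) (x, y)"
        using c(2) by (intro continuous_intros) (auto simp: continuous_on_eq_continuous_at)
      then show "continuous (at (x, y) within UNIV \<times> UNIV) (\<lambda>(x, y). blinfun_mult_right (u2 (x, y)))"
        by (simp add: split_beta')
    qed auto
    then show ?thesis by (simp add: z split_beta')
  qed
  show "(u has_derivative (\<lambda>h. u1 z * fst h + u2 z * snd h)) (at z)" by (rule D)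
  have "continuous_on UNIV u"
    by (intro has_derivative_continuous_on[of _ u "\<lambda>z h. u1 z * fst h + u2 z * snd h"]) (simp add: D)
  then show "C1 u u1 u2" using c d by (auto simp: C1_def)
qed

lemma C1_has_derivative: "C1 u u1 u2 \<Longrightarrow> (u has_derivative (\<lambda>h. u1 z * fst h + u2 z * snd h)) (at z)"
  by (rule C1I(2)) (auto simp: C1_def)

lemma C1D:
  assumes "C1 u u1 u2"
  shows "continuous_on S u" "continuous_on S u1" "continuous_on S u2"
    "((\<lambda>s. u (s, y)) has_real_derivative u1 (x, y)) (at x)"
    "((\<lambda>s. u (x, s)) has_real_derivative u2 (x, y)) (at y)"
  using assms by (auto simp: C1_def intro: continuous_on_subset)

lemma has_derivative_imp_C1:
  assumes "\<And>z. (u has_derivative (\<lambda>h. u1 z * fst h + u2 z * snd h)) (at z)"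
    and "continuous_on UNIV u1" "continuous_on UNIV u2"
  shows "C1 u u1 u2"
proof (rule C1I(1)[OF assms(2,3)])
  fix x y :: real
  have "((\<lambda>s. (s, y)) has_derivative (\<lambda>h. (h, 0))) (at x)" by (auto intro!: derivative_eq_intros)
  from has_derivative_compose[OF this assms(1)[of "(x, y)"]] show "((\<lambda>s. u (s, y)) has_real_derivative u1 (x, y)) (at x)"
    by (simp add: has_field_derivative_def mult_commute_abs)
  have "((\<lambda>s. (x, s)) has_derivative (\<lambda>h. (0, h))) (at y)" by (auto intro!: derivative_eq_intros)
  from has_derivative_compose[OF this assms(1)[of "(x, y)"]] show "((\<lambda>s. u (x, s)) has_real_derivative u2 (x, y)) (at y)"
    by (simp add: has_field_derivative_def mult_commute_abs)
qed

lemma C1_mult: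
  assumes "C1 u u1 u2" "C1 w w1 w2"
  shows "C1 (\<lambda>z. u z * w z) (\<lambda>z. u1 z * w z + u z * w1 z) (\<lambda>z. u2 z * w z + u z * w2 z)"
proof (rule C1I(1))
  show "((\<lambda>s. u (s, y) * w (s, y)) has_real_derivative u1 (x, y) * w (x, y) + u (x, y) * w1 (x, y)) (at x)" for x y
    using DERIV_mult'[OF C1D(4)[OF assms(1)] C1D(4)[OF assms(2)]] by (simp add: add.commute)
  show "((\<lambda>s. u (x, s) * w (x, s)) has_real_derivative u2 (x, y) * w (x, y) + u (x, y) * w2 (x, y)) (at y)" for x y
    using DERIV_mult'[OF C1D(5)[OF assms(1)] C1D(5)[OF assms(2)]] by (simp add: add.commute)
qed (intro continuous_intros C1D[OF assms(1)] C1D[OF assms(2)])+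

lemma C1_compose:
  assumes "C1 u u1 u2" "\<And>s. (g has_real_derivative g' s) (at s)" "continuous_on UNIV g'"
  shows "C1 (\<lambda>z. g (u z)) (\<lambda>z. g' (u z) * u1 z) (\<lambda>z. g' (u z) * u2 z)"
  using C1D[OF assms(1)]
  by (intro C1I continuous_intros continuous_on_compose2[OF assms(3)])
     (auto intro!: DERIV_chain2[OF assms(2)])

lemma C1_support:
  assumes u: "C1 u u1 u2" and supp: "\<And>z. z \<notin> bx R \<Longrightarrow> u z = 0" and z: "z \<notin> bx R"
  shows "u1 z = 0" "u2 z = 0"
proof -
  have op: "open (- bx R)" using compact_bx by (simp add: compact_imp_closed open_Compl)
  have "eventually (\<lambda>s. (s, snd z) \<in> - bx R) (nhds (fst z))"
  proof (rule topological_tendstoD[OF _ op])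
    show "((\<lambda>s. (s, snd z)) \<longlongrightarrow> (fst z, snd z)) (nhds (fst z))" by (intro tendsto_intros filterlim_ident)
  qed (use z in simp)
  then have "eventually (\<lambda>s. u (s, snd z) = 0) (nhds (fst z))" by eventually_elim (simp add: supp)
  then have "((\<lambda>s. u (s, snd z)) has_real_derivative u1 z) (at (fst z)) \<longleftrightarrow> ((\<lambda>s. 0) has_real_derivative u1 z) (at (fst z))"
    by (intro DERIV_cong_ev) auto
  with C1D(4)[OF u, of "snd z" "fst z"] have "((\<lambda>s. 0) has_real_derivative u1 z) (at (fst z))" by simp
  then show "u1 z = 0" using DERIV_unique DERIV_const by blast
  have "eventually (\<lambda>s. (fst z, s) \<in> - bx R) (nhds (snd z))"
  proof (rule topological_tendstoD[OF _ op])
    show "((\<lambda>s. (fst z, s)) \<longlongrightarrow> (fst z, snd z)) (nhds (snd z))" by (intro tendsto_intros filterlim_ident)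
  qed (use z in simp)
  then have "eventually (\<lambda>s. u (fst z, s) = 0) (nhds (snd z))" by eventually_elim (simp add: supp)
  then have "((\<lambda>s. u (fst z, s)) has_real_derivative u2 z) (at (snd z)) \<longleftrightarrow> ((\<lambda>s. 0) has_real_derivative u2 z) (at (snd z))"
    by (intro DERIV_cong_ev) auto
  with C1D(5)[OF u, of "fst z" "snd z"] have "((\<lambda>s. 0) has_real_derivative u2 z) (at (snd z))" by simp
  then show "u2 z = 0" using DERIV_unique DERIV_const by blast
qed

lemma continuous_supp_integrable:
  assumes f: "continuous_on UNIV f" and supp: "\<And>z. z \<notin> bx R \<Longrightarrow> f z = 0"
  shows "integrable lborel (f :: real \<times> real \<Rightarrow> real)"
proof -
  have "f = (\<lambda>z. indicator (bx R) z * f z)" using supp by (auto simp: fun_eq_iff indicator_def)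
  with integrable_bx_times[OF continuous_imp_L1loc[OF f], of R] show ?thesis by simp
qed

lemma continuous_supp_bounded:
  assumes f: "continuous_on UNIV f" and supp: "\<And>z. z \<notin> bx R \<Longrightarrow> f z = 0"
  shows "\<exists>M. \<forall>z. \<bar>f z :: real\<bar> \<le> M"
proof -
  have "bounded (f ` bx R)"
    by (intro compact_imp_bounded compact_continuous_image compact_bx continuous_on_subset[OF f]) auto
  then obtain M where "\<forall>y\<in>f ` bx R. norm y \<le> M" unfolding bounded_iff by blast
  then have "\<bar>f z\<bar> \<le> max M 0" for z using supp[of z] by (cases "z \<in> bx R") auto
  then show ?thesis by blast
qed

section \<open>Integration by parts on the plane and on the half-plane\<close>

lemma integral_plane:
  fixes f :: "real \<times> real \<Rightarrow> real"
  assumes "integrable lborel f"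
  shows "(LINT z|lborel. f z) = (LINT x|lborel. (LINT y|lborel. f (x, y)))"
    and "(LINT z|lborel. f z) = (LINT y|lborel. (LINT x|lborel. f (x, y)))"
proof -
  have f: "integrable (lborel \<Otimes>\<^sub>M lborel) f" using assms by (simp add: lborel_prod)
  show "(LINT z|lborel. f z) = (LINT x|lborel. (LINT y|lborel. f (x, y)))"
    using lborel_pair.integral_fst'[OF f] by (simp add: lborel_prod)
  have f': "integrable (lborel \<Otimes>\<^sub>M lborel) (case_prod (\<lambda>x y. f (x, y)))" using f by simp
  show "(LINT z|lborel. f z) = (LINT y|lborel. (LINT x|lborel. f (x, y)))"
    using lborel_pair.integral_snd[OF f'] by (simp add: lborel_prod)
qed

lemma integral_derivative_line:
  fixes F f :: "real \<Rightarrow> real"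
  assumes F: "\<And>s. (F has_real_derivative f s) (at s)" and f: "continuous_on UNIV f"
    and supp: "\<And>s. s \<notin> {-R..R} \<Longrightarrow> F s = 0" "\<And>s. s \<notin> {-R..R} \<Longrightarrow> f s = 0"
  shows "(LINT s|lborel. f s) = 0" "(LINT s|lborel. indicator {0<..} s * f s) = - F 0"
proof -
  \<comment> \<open>Larger than \<open>R\<close>, so that \<open>F\<close> vanishes at
    \<open>S\<close> and \<open>-S\<close>, and positive even if \<open>R\<close> is
    negative.\<close>
  define S where "S = max R 0 + 1"
  have R: "R < S" "0 < S" by (auto simp: S_def)
  have v: "(F has_vector_derivative f s) (at s within T)" for s T
    using F[of s] by (auto simp: has_real_derivative_iff_has_vector_derivative intro: has_vector_derivative_at_within)
  have "(LINT s|lborel. f s) = (LINT s|lborel. indicator {-S..S} s *\<^sub>R f s)"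
  proof (intro Bochner_Integration.integral_cong refl)
    fix s show "f s = indicator {-S..S} s *\<^sub>R f s"
      using supp(2)[of s] R by (cases "s \<in> {-R..R}") auto
  qed
  also have "\<dots> = F S - F (-S)"
    using R v by (intro integral_FTC_atLeastAtMost continuous_on_subset[OF f]) auto
  also have "\<dots> = 0" using supp(1) R by simp
  finally show "(LINT s|lborel. f s) = 0" .
  have "(LINT s|lborel. indicator {0<..} s * f s) = (LINT s|lborel. indicator {0..S} s *\<^sub>R f s)"
  proof (rule integral_cong_AE)
    show "AE s in lborel. indicator {0<..} s * f s = indicator {0..S} s *\<^sub>R f s"
      using AE_lborel_singleton[of 0] 
    proof eventually_elim
      case (elim s)
      then show ?case using supp(2)[of s] R by (cases "s \<in> {-R..R}") (auto simp: indicator_def)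
    qed
  qed (use borel_measurable_continuous_onI[OF f] in auto)
  also have "\<dots> = F S - F 0"
    using R v by (intro integral_FTC_atLeastAtMost continuous_on_subset[OF f]) auto
  also have "\<dots> = - F 0" using supp(1) R by simp
  finally show "(LINT s|lborel. indicator {0<..} s * f s) = - F 0" .
qed

lemma half_measurable [measurable]:
  "(\<lambda>z :: real \<times> real. indicator {0<..} (snd z) :: real) \<in> borel_measurable borel"
proof -
  have "(\<lambda>z :: real \<times> real. indicator {0<..} (snd z) :: real) = indicator (UNIV \<times> {0<..})"
    by (auto simp: fun_eq_iff indicator_def)
  then show ?thesis
    by (simp add: open_Times borel_open)
qed

lemma integrable_half:
  fixes f :: "real \<times> real \<Rightarrow> real"
  assumes "integrable lborel f"
  shows "integrable lborel (\<lambda>z. indicator {0<..} (snd z) * f z)"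
proof (rule Bochner_Integration.integrable_bound[OF assms])
  have [measurable]: "f \<in> borel_measurable borel" using assms by (auto dest: borel_measurable_integrable)
  have "(\<lambda>z. indicator {0<..} (snd z) * f z) \<in> borel_measurable borel"
    by (intro borel_measurable_times half_measurable) measurable
  then show "(\<lambda>z. indicator {0<..} (snd z) * f z) \<in> borel_measurable lborel" by simp
qed (auto simp: indicator_def)

text \<open>Fubini and the fundamental theorem on lines. Horizontal lines never meet the boundary of
  the half-plane, so only the vertical derivative leaves a boundary term.\<close>

lemma integral_partial_eq_0:
  assumes w: "C1 w w1 w2" and supp: "\<And>z. z \<notin> bx R \<Longrightarrow> w z = 0"
  shows "(LINT z|lborel. w1 z) = 0" "(LINT z|lborel. w2 z) = 0"
    and "(LINT z|lborel. indicator {0<..} (snd z) * w1 z) = 0"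
    and "(LINT z|lborel. indicator {0<..} (snd z) * w2 z) = - (LINT s|lborel. w (s, 0))"
proof -
  have s: "w1 z = 0" "w2 z = 0" if "z \<notin> bx R" for z using C1_support[OF w supp that] by auto
  have i1: "integrable lborel w1" and i2: "integrable lborel w2"
    using continuous_supp_integrable C1D(2,3)[OF w] s by blast+
  have [measurable]: "w1 \<in> borel_measurable borel" "w2 \<in> borel_measurable borel"
    using C1D(2,3)[OF w] by (auto intro: borel_measurable_continuous_onI)
  have i3: "integrable lborel (\<lambda>z. indicator {0<..} (snd z) * w1 z)" "integrable lborel (\<lambda>z. indicator {0<..} (snd z) * w2 z)"
    by (intro integrable_half i1 i2)+
  have c1: "continuous_on UNIV (\<lambda>x. w1 (x, y))" for y
    by (intro continuous_on_compose2[OF C1D(2)[OF w, of UNIV]] continuous_intros) auto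
  have c2: "continuous_on UNIV (\<lambda>y. w2 (x, y))" for x
    by (intro continuous_on_compose2[OF C1D(3)[OF w, of UNIV]] continuous_intros) auto
  have out1: "(x, y) \<notin> bx R" if "x \<notin> {-R..R}" for x y using that by (auto simp: bx_def)
  have out2: "(x, y) \<notin> bx R" if "y \<notin> {-R..R}" for x y using that by (auto simp: bx_def)
  have l1: "(LINT x|lborel. w1 (x, y)) = 0" for y
    by (rule integral_derivative_line(1)[OF C1D(4)[OF w] c1, of R]) (auto intro!: supp s out1)
  have l2: "(LINT y|lborel. w2 (x, y)) = 0" "(LINT y|lborel. indicator {0<..} y * w2 (x, y)) = - w (x, 0)" for x
    by (rule integral_derivative_line[OF C1D(5)[OF w] c2, of R]; auto intro!: supp s out2)+
  show "(LINT z|lborel. w1 z) = 0" using integral_plane(2)[OF i1] by (simp add: l1)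
  show "(LINT z|lborel. w2 z) = 0" using integral_plane(1)[OF i2] by (simp add: l2)
  show "(LINT z|lborel. indicator {0<..} (snd z) * w1 z) = 0" using integral_plane(2)[OF i3(1)] by (simp add: l1)
  show "(LINT z|lborel. indicator {0<..} (snd z) * w2 z) = - (LINT s|lborel. w (s, 0))"
    using integral_plane(1)[OF i3(2)] by (simp add: l2)
qed

lemma integration_by_parts_plane:
  assumes u: "C1 u u1 u2" and w: "C1 w w1 w2" and supp: "\<And>z. z \<notin> bx R \<Longrightarrow> w z = 0"
  shows "(LINT z|lborel. u z * w1 z) = - (LINT z|lborel. u1 z * w z)"
    and "(LINT z|lborel. u z * w2 z) = - (LINT z|lborel. u2 z * w z)"
    and "(LINT z|lborel. indicator {0<..} (snd z) * (u z * w1 z)) = - (LINT z|lborel. indicator {0<..} (snd z) * (u1 z * w z))"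
    and "(LINT z|lborel. indicator {0<..} (snd z) * (u z * w2 z)) =
      - (LINT z|lborel. indicator {0<..} (snd z) * (u2 z * w z)) - (LINT s|lborel. u (s, 0) * w (s, 0))"
proof -
  note p = C1_mult[OF u w]
  have supp': "u z * w z = 0" if "z \<notin> bx R" for z using supp[OF that] by simp
  note i = integral_partial_eq_0[OF p supp']
  have s: "w1 z = 0" "w2 z = 0" if "z \<notin> bx R" for z using C1_support[OF w supp that] by auto
  have int: "integrable lborel (\<lambda>z. u1 z * w z)" "integrable lborel (\<lambda>z. u2 z * w z)"
     "integrable lborel (\<lambda>z. u z * w1 z)" "integrable lborel (\<lambda>z. u z * w2 z)"
    by (rule continuous_supp_integrable[of _ R]; use C1D[OF u] C1D[OF w] s supp in \<open>auto intro!: continuous_intros\<close>)+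
  note int' = integrable_half
  show "(LINT z|lborel. u z * w1 z) = - (LINT z|lborel. u1 z * w z)" using i(1)[of R] int by simp
  show "(LINT z|lborel. u z * w2 z) = - (LINT z|lborel. u2 z * w z)" using i(2)[of R] int by simp
  show "(LINT z|lborel. indicator {0<..} (snd z) * (u z * w1 z)) = - (LINT z|lborel. indicator {0<..} (snd z) * (u1 z * w z))"
    using i(3)[of R] int' int by (simp add: distrib_left)
  show "(LINT z|lborel. indicator {0<..} (snd z) * (u z * w2 z)) =
      - (LINT z|lborel. indicator {0<..} (snd z) * (u2 z * w z)) - (LINT s|lborel. u (s, 0) * w (s, 0))"
    using i(4)[of R] int' int by (simp add: distrib_left)
qed

text \<open>The shared function \<open>c\<close> expresses that the field \<open>(b1, b2)\<close> is
  closed. This is the weak form of the statement that the rotated field has divergence zero; it is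
  later applied to the mollified pressure gradient.\<close>

lemma curl_pairing_eq_0:
  assumes w: "C1 w w1 w2" and supp: "\<And>z. z \<notin> bx R \<Longrightarrow> w z = 0"
    and b: "C1 b1 b11 c" "C1 b2 c b22"
  shows "(LINT z|lborel. b2 z * w1 z - b1 z * w2 z) = 0"
proof -
  have s: "w1 z = 0" "w2 z = 0" if "z \<notin> bx R" for z using C1_support[OF w supp that] by auto
  have int: "integrable lborel (\<lambda>z. b2 z * w1 z)" "integrable lborel (\<lambda>z. b1 z * w2 z)"
    by (rule continuous_supp_integrable[of _ R]; use C1D[OF b(1)] C1D[OF b(2)] C1D[OF w] s in \<open>auto intro!: continuous_intros\<close>)+
  show ?thesis
    using int integration_by_parts_plane(1)[OF b(2) w supp] integration_by_parts_plane(2)[OF b(1) w supp] by simp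
qed

section \<open>Oriented line integrals and potentials of closed forms\<close>

definition slint :: "(real \<Rightarrow> real) \<Rightarrow> real \<Rightarrow> real \<Rightarrow> real" where
  "slint f a b = (if a \<le> b then integral {a..b} f else - integral {b..a} f)"

lemma slint_eq:
  assumes "continuous_on UNIV f" "c \<le> a" "c \<le> b"
  shows "slint f a b = integral {c..b} f - integral {c..a} f"
proof -
  have i: "f integrable_on {s..t}" for s t
    by (intro integrable_continuous_real continuous_on_subset[OF assms(1)]) auto
  show ?thesis
    using Henstock_Kurzweil_Integration.integral_combine[of c a b f]
      Henstock_Kurzweil_Integration.integral_combine[of c b a f] i assms(2,3)
    by (auto simp: slint_def)
qed

lemma DERIV_slint:
  assumes f: "continuous_on UNIV f"
  shows "((\<lambda>t. slint f a t) has_real_derivative f b) (at b)"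
proof -
  define c where "c = min a b - 1"
  have c: "c < a" "c < b" by (auto simp: c_def)
  have "((\<lambda>t. integral {c..t} f) has_real_derivative f b) (at b within {c..b + 1})"
    using c by (intro integral_has_real_derivative continuous_on_subset[OF f]) auto
  then have "((\<lambda>t. integral {c..t} f) has_real_derivative f b) (at b)"
    using c by (simp add: at_within_Icc_at)
  then have "((\<lambda>t. integral {c..t} f - integral {c..a} f) has_real_derivative f b) (at b)"
    by (auto intro!: derivative_eq_intros)
  moreover have "eventually (\<lambda>t. integral {c..t} f - integral {c..a} f = slint f a t) (nhds b)"
    using eventually_nhds_in_open[of "{c<..}" b] c
    by (auto elim!: eventually_mono simp: slint_eq[OF f, of c])
  ultimately show ?thesis by (subst (asm) DERIV_cong_ev) auto
qed

lemma slint_FTC: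
  assumes "\<And>t. (F has_real_derivative f t) (at t)"
  shows "slint f a b = F b - F a"
proof -
  have "(f has_integral F t - F s) {s..t}" if "s \<le> t" for s t
    using that assms by (intro fundamental_theorem_of_calculus)
      (auto simp: has_real_derivative_iff_has_vector_derivative[symmetric] intro: has_field_derivative_at_within)
  from this[of a b] this[of b a] show ?thesis
    by (cases "a \<le> b") (auto simp: slint_def integral_unique)
qed

lemma slint_bound:
  assumes f: "continuous_on UNIV f" and ab: "\<bar>a\<bar> \<le> R" "\<bar>b\<bar> \<le> R"
  shows "ennreal \<bar>slint f a b\<bar> \<le> (\<integral>\<^sup>+s. indicator {-R..R} s * ennreal \<bar>f s\<bar> \<partial>lborel)"
proof -
  have "ennreal \<bar>integral {s..t} f\<bar> \<le> (\<integral>\<^sup>+s. indicator {-R..R} s * ennreal \<bar>f s\<bar> \<partial>lborel)"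
    if "-R \<le> s" "t \<le> R" for s t
  proof -
    have i: "set_integrable lborel {s..t} f"
      by (intro borel_integrable_atLeastAtMost' continuous_on_subset[OF f]) auto
    have "ennreal \<bar>integral {s..t} f\<bar> = ennreal (norm (LINT x|lborel. indicator {s..t} x *\<^sub>R f x))"
      using set_borel_integral_eq_integral(2)[OF i] by (simp add: set_lebesgue_integral_def)
    also have "\<dots> \<le> (\<integral>\<^sup>+x. norm (indicator {s..t} x *\<^sub>R f x) \<partial>lborel)"
      using i unfolding set_integrable_def by (rule integral_norm_bound_ennreal)
    also have "\<dots> \<le> (\<integral>\<^sup>+s. indicator {-R..R} s * ennreal \<bar>f s\<bar> \<partial>lborel)"
      using that by (intro nn_integral_mono) (auto simp: indicator_def)
    finally show ?thesis .
  qed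
  then show ?thesis using ab by (auto simp: slint_def abs_le_iff)
qed

text \<open>Integrate along the horizontal line at height \<open>q\<close>, then vertically.
  Differentiating the vertical part in \<open>x\<close> gives the integral of \<open>c\<close>, that
  is \<open>a1 (x, y) - a1 (x, q)\<close>, which combines with the derivative
  \<open>a1 (x, q)\<close> of the horizontal part.\<close>

lemma closed_form_potential:
  assumes a: "C1 a1 a11 c" "C1 a2 c a22"
  shows "C1 (\<lambda>z. slint (\<lambda>s. a1 (s, q)) p (fst z) + slint (\<lambda>t. a2 (fst z, t)) q (snd z)) a1 a2"
proof (rule C1I(1)[OF C1D(1)[OF a(1)] C1D(1)[OF a(2)]])
  fix x y
  have c1: "continuous_on UNIV (\<lambda>s. a1 (s, q))"
    by (intro continuous_on_compose2[OF C1D(1)[OF a(1), of UNIV]] continuous_intros) auto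
  have c2: "continuous_on S (\<lambda>t. a2 (x, t))" for x S
    by (intro continuous_on_compose2[OF C1D(1)[OF a(2), of UNIV]] continuous_intros) auto
  have L: "((\<lambda>x. integral (cbox s t) (\<lambda>t. a2 (x, t))) has_real_derivative integral (cbox s t) (\<lambda>t. c (x, t))) (at x within UNIV)" for s t
    by (rule leibniz_rule_field_derivative)
       (use C1D(2)[OF a(2), of UNIV] C1D(4)[OF a(2)] c2 in \<open>auto intro!: integrable_continuous_real simp: split_beta' intro: continuous_on_subset\<close>)
  have "((\<lambda>x. slint (\<lambda>t. a2 (x, t)) q y) has_real_derivative slint (\<lambda>t. c (x, t)) q y) (at x)"
    using L by (auto simp: slint_def intro!: DERIV_minus)
  moreover have "slint (\<lambda>t. c (x, t)) q y = a1 (x, y) - a1 (x, q)"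
    by (rule slint_FTC[OF C1D(5)[OF a(1)]])
  ultimately have "((\<lambda>s. slint (\<lambda>s. a1 (s, q)) p s + slint (\<lambda>t. a2 (s, t)) q y) has_real_derivative
      a1 (x, q) + (a1 (x, y) - a1 (x, q))) (at x)"
    by (intro DERIV_add DERIV_slint[OF c1]) simp
  then show "((\<lambda>s. slint (\<lambda>s. a1 (s, q)) p (fst (s, y)) + slint (\<lambda>t. a2 (fst (s, y), t)) q (snd (s, y))) has_real_derivative
      a1 (x, y)) (at x)" by simp
  have "((\<lambda>s. slint (\<lambda>s. a1 (s, q)) p x + slint (\<lambda>t. a2 (x, t)) q s) has_real_derivative 0 + a2 (x, y)) (at y)"
    by (intro DERIV_add DERIV_const DERIV_slint[OF c2])
  then show "((\<lambda>s. slint (\<lambda>s. a1 (s, q)) p (fst (x, s)) + slint (\<lambda>t. a2 (fst (x, s), t)) q (snd (x, s))) has_real_derivative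
      a2 (x, y)) (at y)" by simp
qed

section \<open>Weak gradients and the pullback of differential forms\<close>

lemma C1_kern: "C1 (\<lambda>y. kern n i j (y - x)) (\<lambda>y. kern n (Suc i) j (y - x)) (\<lambda>y. kern n i (Suc j) (y - x))"
  by (rule has_derivative_imp_C1[OF has_derivative_kern])
     (auto intro!: continuous_intros continuous_on_compose2[OF continuous_on_kern[of UNIV]])

lemma C1_add:
  assumes "C1 u u1 u2" "C1 w w1 w2"
  shows "C1 (\<lambda>z. u z + w z) (\<lambda>z. u1 z + w1 z) (\<lambda>z. u2 z + w2 z)"
proof (rule C1I(1))
  show "((\<lambda>s. u (s, y) + w (s, y)) has_real_derivative u1 (x, y) + w1 (x, y)) (at x)" for x y
    by (intro DERIV_add C1D[OF assms(1)] C1D[OF assms(2)])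
  show "((\<lambda>s. u (x, s) + w (x, s)) has_real_derivative u2 (x, y) + w2 (x, y)) (at y)" for x y
    by (intro DERIV_add C1D[OF assms(1)] C1D[OF assms(2)])
qed (intro continuous_intros C1D[OF assms(1)] C1D[OF assms(2)])+

lemma C1_compose_pair:
  assumes u: "C1 u u1 u2" and w: "C1 w w1 w2" and g: "C1 g g1 g2"
  shows "C1 (\<lambda>z. g (u z, w z)) (\<lambda>z. g1 (u z, w z) * u1 z + g2 (u z, w z) * w1 z)
      (\<lambda>z. g1 (u z, w z) * u2 z + g2 (u z, w z) * w2 z)"
proof (rule has_derivative_imp_C1)
  fix z
  have "((\<lambda>z. (u z, w z)) has_derivative (\<lambda>h. (u1 z * fst h + u2 z * snd h, w1 z * fst h + w2 z * snd h))) (at z)"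
    by (intro has_derivative_Pair C1_has_derivative u w)
  from has_derivative_compose[OF this C1_has_derivative[OF g]]
  show "((\<lambda>z. g (u z, w z)) has_derivative (\<lambda>h. (g1 (u z, w z) * u1 z + g2 (u z, w z) * w1 z) * fst h
      + (g1 (u z, w z) * u2 z + g2 (u z, w z) * w2 z) * snd h)) (at z)"
    by (rule has_derivative_eq_rhs) (simp add: fun_eq_iff algebra_simps)
qed (intro continuous_intros continuous_on_compose2[OF C1D(1)[OF g, of UNIV]]
    continuous_on_compose2[OF C1D(2)[OF g, of UNIV]] continuous_on_compose2[OF C1D(3)[OF g, of UNIV]]
    C1D[OF u] C1D[OF w] subset_UNIV)+

text \<open>Only the mollifier kernels and their derivatives serve as test functions for this notion of weak
  gradient.\<close>

definition wgrad :: "(real \<times> real \<Rightarrow> real) \<Rightarrow> (real \<times> real \<Rightarrow> real) \<Rightarrow> (real \<times> real \<Rightarrow> real) \<Rightarrow> bool" where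
  "wgrad f g1 g2 \<longleftrightarrow> L2loc f \<and> L2loc g1 \<and> L2loc g2 \<and>
     (\<forall>n i j x. moll n (Suc i) j f x = - moll n i j g1 x \<and> moll n i (Suc j) f x = - moll n i j g2 x)"

lemma wgradI:
  assumes "L2loc f" "L2loc g1" "L2loc g2"
    and ibp: "\<And>\<psi> \<psi>1 \<psi>2 R. C1 \<psi> \<psi>1 \<psi>2 \<Longrightarrow> (\<And>z. z \<notin> bx R \<Longrightarrow> \<psi> z = 0) \<Longrightarrow>
      (LINT z|lborel. f z * \<psi>1 z) = - (LINT z|lborel. g1 z * \<psi> z) \<and>
      (LINT z|lborel. f z * \<psi>2 z) = - (LINT z|lborel. g2 z * \<psi> z)"
  shows "wgrad f g1 g2"
  unfolding wgrad_def moll_def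
  using assms(1-3) ibp[OF C1_kern, of "2 + norm _", OF kern_shift_eq_0[OF bx_self]] by blast

lemma wgradD:
  assumes "wgrad f g1 g2"
  shows "L2loc f" "L2loc g1" "L2loc g2" "L1loc f" "L1loc g1" "L1loc g2"
  using assms by (auto simp: wgrad_def L2loc_imp_L1loc)

text \<open>Both mixed derivatives come from \<open>moll n (Suc 0) (Suc 0) f\<close>, by taking
  either derivative off the kernel; so a mollified weak gradient is a closed field.\<close>

lemma wgrad_moll:
  assumes f: "wgrad f g1 g2"
  shows "C1 (moll n 0 0 f) (moll n 0 0 g1) (moll n 0 0 g2)"
    and "\<exists>u11 u12 u22. C1 (moll n 0 0 g1) u11 u12 \<and> C1 (moll n 0 0 g2) u12 u22"
proof -
  have eq: "moll n (Suc i) j f x = - moll n i j g1 x" "moll n i (Suc j) f x = - moll n i j g2 x" for i j x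
    using f unfolding wgrad_def by blast+
  show "C1 (moll n 0 0 f) (moll n 0 0 g1) (moll n 0 0 g2)"
    using C1_moll[OF wgradD(4)[OF f], of n 0 0] by (simp add: eq)
  have "moll n 0 (Suc 0) g1 x = moll n (Suc 0) 0 g2 x" for x
    using eq(1)[of 0 "Suc 0" x] eq(2)[of "Suc 0" 0 x] by simp
  then show "\<exists>u11 u12 u22. C1 (moll n 0 0 g1) u11 u12 \<and> C1 (moll n 0 0 g2) u12 u22"
    using C1_moll[OF wgradD(5)[OF f], of n 0 0] C1_moll[OF wgradD(6)[OF f], of n 0 0] by (metis (no_types, lifting) ext)
qed

text \<open>The identity \<open>d (p du + r dw) = (r1 - p2) du \<and> dw\<close>, with coefficients
  depending on \<open>(u, w)\<close>, tested against \<psi>. After integration by parts the second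
  derivatives of \<open>u\<close> and \<open>w\<close> cancel.\<close>

lemma pullback_curl:
  assumes u: "C1 u u1 u2" "C1 u1 u11 u12" "C1 u2 u12 u22"
    and w: "C1 w w1 w2" "C1 w1 w11 w12" "C1 w2 w12 w22"
    and p: "C1 p p1 p2" and r: "C1 r r1 r2"
    and \<psi>: "C1 \<psi> \<psi>1 \<psi>2" and supp: "\<And>z. z \<notin> bx R \<Longrightarrow> \<psi> z = 0"
  shows "(LINT z|lborel. (p (u z, w z) * u1 z + r (u z, w z) * w1 z) * \<psi>2 z)
       - (LINT z|lborel. (p (u z, w z) * u2 z + r (u z, w z) * w2 z) * \<psi>1 z)
     = (LINT z|lborel. (r1 (u z, w z) - p2 (u z, w z)) * (u1 z * w2 z - u2 z * w1 z) * \<psi> z)"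
proof -
  note P = C1_compose_pair[OF u(1) w(1) p] and Q = C1_compose_pair[OF u(1) w(1) r]
  note A1 = C1_add[OF C1_mult[OF P u(2)] C1_mult[OF Q w(2)]]
  note A2 = C1_add[OF C1_mult[OF P u(3)] C1_mult[OF Q w(3)]]
  have ibp: "(LINT z|lborel. f z * \<psi>1 z) = - (LINT z|lborel. f1 z * \<psi> z)"
    "(LINT z|lborel. f z * \<psi>2 z) = - (LINT z|lborel. f2 z * \<psi> z)" if "C1 f f1 f2" for f f1 f2
    by (rule integration_by_parts_plane[OF that \<psi> supp]; assumption)+
  note i1 = ibp(2)[OF A1] and i2 = ibp(1)[OF A2]
  have int: "integrable lborel (\<lambda>z. f z * \<psi> z)" if "continuous_on UNIV f" for f
    using supp by (intro continuous_supp_integrable[of _ R] continuous_intros that C1D[OF \<psi>]) auto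
  show ?thesis
    unfolding i1 i2 minus_diff_minus neg_equal_iff_equal
    by (subst Bochner_Integration.integral_diff[symmetric], (intro int C1D(3)[OF A1] C1D(2)[OF A2])+,
        subst Bochner_Integration.integral_minus[symmetric])
       (intro Bochner_Integration.integral_cong refl, simp add: algebra_simps)
qed

section \<open>From mollifications to weak gradients\<close>

context
  fixes v1 v2 a1 a2 b1 b2 :: "real \<times> real \<Rightarrow> real"
  assumes v1: "wgrad v1 a1 a2" and v2: "wgrad v2 b1 b2"
begin

lemma approx_subseq:
  obtains s :: "nat \<Rightarrow> nat" where "strict_mono s"
    "AE z in lborel. (\<lambda>k. moll (s k) 0 0 v1 z) \<longlonglongrightarrow> v1 z"
    "AE z in lborel. (\<lambda>k. moll (s k) 0 0 v2 z) \<longlonglongrightarrow> v2 z"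
  using conv1_AE_subseq[OF conv1_moll[OF wgradD(4)[OF v1]] conv1_moll[OF wgradD(4)[OF v2]]] by blast

lemma AE_compose:
  assumes g: "continuous_on UNIV g"
    and "AE z in lborel. (\<lambda>k. F k z) \<longlonglongrightarrow> v1 z" "AE z in lborel. (\<lambda>k. G k z) \<longlonglongrightarrow> v2 z"
  shows "AE z in lborel. (\<lambda>k. g (F k z, G k z) :: real) \<longlonglongrightarrow> g (v1 z, v2 z)"
  using assms(2,3)
proof eventually_elim
  case (elim z)
  then show ?case by (intro continuous_on_tendsto_compose[OF g] tendsto_intros) auto
qed

lemma conv1_coeff:
  assumes g: "continuous_on UNIV g" and M: "\<And>z. \<bar>g z\<bar> \<le> M"
    and s: "strict_mono s" "AE z in lborel. (\<lambda>k. moll (s k) 0 0 v1 z) \<longlonglongrightarrow> v1 z"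
      "AE z in lborel. (\<lambda>k. moll (s k) 0 0 v2 z) \<longlonglongrightarrow> v2 z"
    and F: "conv1 F f"
  shows "conv1 (\<lambda>k z. g (moll (s k) 0 0 v1 z, moll (s k) 0 0 v2 z) * F k z) (\<lambda>z. g (v1 z, v2 z) * f z)"
proof (rule conv1_bounded_mult[OF F _ _ M M])
  note [measurable] = wgradD(4)[OF v1, THEN L1loc_measurable] wgradD(4)[OF v2, THEN L1loc_measurable]
    moll_measurable[OF wgradD(4)[OF v1]] moll_measurable[OF wgradD(4)[OF v2]] borel_measurable_continuous_onI[OF g]
  show "(\<lambda>z. g (moll (s k) 0 0 v1 z, moll (s k) 0 0 v2 z)) \<in> borel_measurable borel" for k by measurable
  show "(\<lambda>z. g (v1 z, v2 z)) \<in> borel_measurable borel" by measurable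
  show "AE z in lborel. (\<lambda>k. g (moll (s k) 0 0 v1 z, moll (s k) 0 0 v2 z)) \<longlonglongrightarrow> g (v1 z, v2 z)"
    by (rule AE_compose[OF g s(2,3)])
qed

lemma conv2_moll_subseq: "L2loc f \<Longrightarrow> strict_mono s \<Longrightarrow> conv2 (\<lambda>k. moll (s k) 0 0 f) f"
  by (rule conv2_subseq[OF conv2_moll])

text \<open>The mollified fields satisfy the smooth identity. Along a subsequence the coefficients
  converge boundedly almost everywhere, the gradients in \<open>L^2\<close> on boxes and therefore
  the Jacobian in \<open>L^1\<close>. Accordingly the bounds concern the coefficients
  \<open>p\<close> and \<open>r\<close> and the combination \<open>r1 - p2\<close>.\<close>

lemma weak_pullback:
  assumes p: "C1 p p1 p2" "\<And>z. \<bar>p z\<bar> \<le> M" and r: "C1 r r1 r2" "\<And>z. \<bar>r z\<bar> \<le> M"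
    and c: "\<And>z. \<bar>r1 z - p2 z\<bar> \<le> M"
    and \<psi>: "C1 \<psi> \<psi>1 \<psi>2" and supp: "\<And>z. z \<notin> bx R \<Longrightarrow> \<psi> z = 0"
  shows "(LINT z|lborel. (p (v1 z, v2 z) * a1 z + r (v1 z, v2 z) * b1 z) * \<psi>2 z)
       - (LINT z|lborel. (p (v1 z, v2 z) * a2 z + r (v1 z, v2 z) * b2 z) * \<psi>1 z)
     = (LINT z|lborel. (r1 (v1 z, v2 z) - p2 (v1 z, v2 z)) * (a1 z * b2 z - a2 z * b1 z) * \<psi> z)"
proof -
  obtain s where s: "strict_mono s"
    "AE z in lborel. (\<lambda>k. moll (s k) 0 0 v1 z) \<longlonglongrightarrow> v1 z"
    "AE z in lborel. (\<lambda>k. moll (s k) 0 0 v2 z) \<longlonglongrightarrow> v2 z" by (rule approx_subseq)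
  define V where "V k z = (moll (s k) 0 0 v1 z, moll (s k) 0 0 v2 z)" for k z
  have ca: "conv2 (\<lambda>k. moll (s k) 0 0 f) f" if "f \<in> {a1, a2, b1, b2}" for f
    using that wgradD[OF v1] wgradD[OF v2] s(1) by (auto intro: conv2_moll_subseq)
  note cf = conv1_coeff[OF _ _ s]
  have c1: "continuous_on UNIV (\<lambda>z. r1 z - p2 z)"
    by (intro continuous_intros C1D(2)[OF r(1)] C1D(3)[OF p(1)])
  have conv: "conv1 (\<lambda>k z. p (V k z) * moll (s k) 0 0 a1 z + r (V k z) * moll (s k) 0 0 b1 z)
       (\<lambda>z. p (v1 z, v2 z) * a1 z + r (v1 z, v2 z) * b1 z)"
     "conv1 (\<lambda>k z. p (V k z) * moll (s k) 0 0 a2 z + r (V k z) * moll (s k) 0 0 b2 z)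
       (\<lambda>z. p (v1 z, v2 z) * a2 z + r (v1 z, v2 z) * b2 z)"
     "conv1 (\<lambda>k z. (r1 (V k z) - p2 (V k z)) * (moll (s k) 0 0 a1 z * moll (s k) 0 0 b2 z - moll (s k) 0 0 a2 z * moll (s k) 0 0 b1 z))
       (\<lambda>z. (r1 (v1 z, v2 z) - p2 (v1 z, v2 z)) * (a1 z * b2 z - a2 z * b1 z))"
    unfolding V_def
    by (intro conv1_add cf[OF C1D(1)[OF p(1)] p(2)] cf[OF C1D(1)[OF r(1)] r(2)] cf[OF c1 c] conv1_diff conv1_mult conv2_imp_conv1 ca; simp)+
  have s12: "\<psi>1 z = 0" "\<psi>2 z = 0" if "z \<notin> bx R" for z using C1_support[OF \<psi> supp that] by auto
  obtain M0 M1 M2 where M: "\<And>z. \<bar>\<psi> z\<bar> \<le> M0" "\<And>z. \<bar>\<psi>1 z\<bar> \<le> M1" "\<And>z. \<bar>\<psi>2 z\<bar> \<le> M2"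
    using continuous_supp_bounded[OF C1D(1)[OF \<psi>] supp] continuous_supp_bounded[OF C1D(2)[OF \<psi>] s12(1)]
      continuous_supp_bounded[OF C1D(3)[OF \<psi>] s12(2)] by meson
  have m: "\<psi> \<in> borel_measurable borel" "\<psi>1 \<in> borel_measurable borel" "\<psi>2 \<in> borel_measurable borel"
    by (intro borel_measurable_continuous_onI C1D[OF \<psi>])+
  have l: "(\<lambda>k. (LINT z|lborel. (p (V k z) * moll (s k) 0 0 a1 z + r (V k z) * moll (s k) 0 0 b1 z) * \<psi>2 z)
     - (LINT z|lborel. (p (V k z) * moll (s k) 0 0 a2 z + r (V k z) * moll (s k) 0 0 b2 z) * \<psi>1 z)) \<longlonglongrightarrow>
     (LINT z|lborel. (p (v1 z, v2 z) * a1 z + r (v1 z, v2 z) * b1 z) * \<psi>2 z)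
       - (LINT z|lborel. (p (v1 z, v2 z) * a2 z + r (v1 z, v2 z) * b2 z) * \<psi>1 z)"
    by (intro tendsto_diff conv1_integral[OF conv(1) m(3) M(3) s12(2)] conv1_integral[OF conv(2) m(2) M(2) s12(1)])
  have r: "(\<lambda>k. LINT z|lborel. (r1 (V k z) - p2 (V k z)) * (moll (s k) 0 0 a1 z * moll (s k) 0 0 b2 z - moll (s k) 0 0 a2 z * moll (s k) 0 0 b1 z) * \<psi> z)
    \<longlonglongrightarrow> (LINT z|lborel. (r1 (v1 z, v2 z) - p2 (v1 z, v2 z)) * (a1 z * b2 z - a2 z * b1 z) * \<psi> z)"
    by (rule conv1_integral[OF conv(3) m(1) M(1) supp])
  have eq: "(LINT z|lborel. (p (V k z) * moll (s k) 0 0 a1 z + r (V k z) * moll (s k) 0 0 b1 z) * \<psi>2 z)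
     - (LINT z|lborel. (p (V k z) * moll (s k) 0 0 a2 z + r (V k z) * moll (s k) 0 0 b2 z) * \<psi>1 z)
     = (LINT z|lborel. (r1 (V k z) - p2 (V k z)) * (moll (s k) 0 0 a1 z * moll (s k) 0 0 b2 z - moll (s k) 0 0 a2 z * moll (s k) 0 0 b1 z) * \<psi> z)" for k
  proof -
    obtain u11 u12 u22 w11 w12 w22 where *: "C1 (moll (s k) 0 0 a1) u11 u12" "C1 (moll (s k) 0 0 a2) u12 u22"
      "C1 (moll (s k) 0 0 b1) w11 w12" "C1 (moll (s k) 0 0 b2) w12 w22"
      using wgrad_moll(2)[OF v1, of "s k"] wgrad_moll(2)[OF v2, of "s k"] by blast
    show ?thesis
      unfolding V_def
      by (rule pullback_curl[OF wgrad_moll(1)[OF v1] *(1,2) wgrad_moll(1)[OF v2] *(3,4) p(1) assms(3) \<psi> supp])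
  qed
  show ?thesis using l r unfolding eq by (rule LIMSEQ_unique)
qed

text \<open>The same passage to the limit for a single function of the velocity; bounded derivatives
  of \<open>g\<close> are what makes their products with the mollified gradients converge in
  \<open>L^1\<close>.\<close>

lemma weak_chain_rule:
  assumes g: "C1 g g1 g2" "\<And>z. \<bar>g z\<bar> \<le> M" "\<And>z. \<bar>g1 z\<bar> \<le> M" "\<And>z. \<bar>g2 z\<bar> \<le> M"
    and \<psi>: "C1 \<psi> \<psi>1 \<psi>2" and supp: "\<And>z. z \<notin> bx R \<Longrightarrow> \<psi> z = 0"
  shows "(LINT z|lborel. g (v1 z, v2 z) * \<psi>1 z) = - (LINT z|lborel. (g1 (v1 z, v2 z) * a1 z + g2 (v1 z, v2 z) * b1 z) * \<psi> z)"
    and "(LINT z|lborel. g (v1 z, v2 z) * \<psi>2 z) = - (LINT z|lborel. (g1 (v1 z, v2 z) * a2 z + g2 (v1 z, v2 z) * b2 z) * \<psi> z)"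
proof -
  obtain s where s: "strict_mono s"
    "AE z in lborel. (\<lambda>k. moll (s k) 0 0 v1 z) \<longlonglongrightarrow> v1 z"
    "AE z in lborel. (\<lambda>k. moll (s k) 0 0 v2 z) \<longlonglongrightarrow> v2 z" by (rule approx_subseq)
  define V where "V k z = (moll (s k) 0 0 v1 z, moll (s k) 0 0 v2 z)" for k z
  have ca: "conv1 (\<lambda>k. moll (s k) 0 0 f) f" if "f \<in> {a1, a2, b1, b2}" for f
    using that wgradD[OF v1] wgradD[OF v2] s(1) by (auto intro: conv2_imp_conv1 conv2_moll_subseq)
  note cf = conv1_coeff[OF _ _ s]
  have conv: "conv1 (\<lambda>k z. g (V k z)) (\<lambda>z. g (v1 z, v2 z))"
    using cf[OF C1D(1)[OF g(1)] g(2), of "\<lambda>_ _. 1" "\<lambda>_. 1"] conv2_imp_conv1[OF conv2_const[OF L2loc_const[of 1]]]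
    by (simp add: V_def)
  have conv': "conv1 (\<lambda>k z. g1 (V k z) * moll (s k) 0 0 a1 z + g2 (V k z) * moll (s k) 0 0 b1 z)
       (\<lambda>z. g1 (v1 z, v2 z) * a1 z + g2 (v1 z, v2 z) * b1 z)"
     "conv1 (\<lambda>k z. g1 (V k z) * moll (s k) 0 0 a2 z + g2 (V k z) * moll (s k) 0 0 b2 z)
       (\<lambda>z. g1 (v1 z, v2 z) * a2 z + g2 (v1 z, v2 z) * b2 z)"
    unfolding V_def
    by (intro conv1_add cf[OF C1D(2)[OF g(1)] g(3)] cf[OF C1D(3)[OF g(1)] g(4)] ca; simp)+
  have s12: "\<psi>1 z = 0" "\<psi>2 z = 0" if "z \<notin> bx R" for z using C1_support[OF \<psi> supp that] by auto
  obtain M0 M1 M2 where M: "\<And>z. \<bar>\<psi> z\<bar> \<le> M0" "\<And>z. \<bar>\<psi>1 z\<bar> \<le> M1" "\<And>z. \<bar>\<psi>2 z\<bar> \<le> M2"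
    using continuous_supp_bounded[OF C1D(1)[OF \<psi>] supp] continuous_supp_bounded[OF C1D(2)[OF \<psi>] s12(1)]
      continuous_supp_bounded[OF C1D(3)[OF \<psi>] s12(2)] by meson
  have m: "\<psi> \<in> borel_measurable borel" "\<psi>1 \<in> borel_measurable borel" "\<psi>2 \<in> borel_measurable borel"
    by (intro borel_measurable_continuous_onI C1D[OF \<psi>])+
  have C: "C1 (\<lambda>z. g (V k z)) (\<lambda>z. g1 (V k z) * moll (s k) 0 0 a1 z + g2 (V k z) * moll (s k) 0 0 b1 z)
      (\<lambda>z. g1 (V k z) * moll (s k) 0 0 a2 z + g2 (V k z) * moll (s k) 0 0 b2 z)" for k
    unfolding V_def by (rule C1_compose_pair[OF wgrad_moll(1)[OF v1] wgrad_moll(1)[OF v2] g(1)])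
  have ibp: "(LINT z|lborel. f z * \<psi>1 z) = - (LINT z|lborel. f1 z * \<psi> z)"
    "(LINT z|lborel. f z * \<psi>2 z) = - (LINT z|lborel. f2 z * \<psi> z)" if "C1 f f1 f2" for f f1 f2
    by (rule integration_by_parts_plane[OF that \<psi> supp]; assumption)+
  have ci: "(\<lambda>k. LINT z|lborel. F k z * \<psi> z) \<longlonglongrightarrow> (LINT z|lborel. f z * \<psi> z)"
    "(\<lambda>k. LINT z|lborel. F k z * \<psi>1 z) \<longlonglongrightarrow> (LINT z|lborel. f z * \<psi>1 z)"
    "(\<lambda>k. LINT z|lborel. F k z * \<psi>2 z) \<longlonglongrightarrow> (LINT z|lborel. f z * \<psi>2 z)" if "conv1 F f" for F f
    by (rule conv1_integral[OF that m(1) M(1) supp] conv1_integral[OF that m(2) M(2) s12(1)]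
      conv1_integral[OF that m(3) M(3) s12(2)]; assumption)+
  show "(LINT z|lborel. g (v1 z, v2 z) * \<psi>1 z) = - (LINT z|lborel. (g1 (v1 z, v2 z) * a1 z + g2 (v1 z, v2 z) * b1 z) * \<psi> z)"
    using ci(2)[OF conv] tendsto_minus[OF ci(1)[OF conv'(1)]]
    unfolding ibp(1)[OF C] by (rule LIMSEQ_unique)
  show "(LINT z|lborel. g (v1 z, v2 z) * \<psi>2 z) = - (LINT z|lborel. (g1 (v1 z, v2 z) * a2 z + g2 (v1 z, v2 z) * b2 z) * \<psi> z)"
    using ci(3)[OF conv] tendsto_minus[OF ci(1)[OF conv'(2)]]
    unfolding ibp(2)[OF C] by (rule LIMSEQ_unique)
qed

end

lemma DERIV_pos_part_sq: "((\<lambda>s::real. (max 0 s)\<^sup>2) has_real_derivative 2 * max 0 s) (at s)"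
proof -
  consider "s > 0" | "s < 0" | "s = 0" by linarith
  then show ?thesis
  proof cases
    case 1
    have "((\<lambda>s. s\<^sup>2) has_real_derivative 2 * max 0 s) (at s)"
      using 1 by (auto intro!: derivative_eq_intros)
    moreover have "eventually (\<lambda>s. s\<^sup>2 = (max 0 s)\<^sup>2) (nhds s)"
      using 1 eventually_nhds_in_open[of "{0<..}" s] by (auto elim!: eventually_mono simp: max_def)
    ultimately show ?thesis by (subst (asm) DERIV_cong_ev) auto
  next
    case 2
    have "((\<lambda>s. 0) has_real_derivative 2 * max 0 s) (at s)"
      using 2 by (auto simp: max_def)
    moreover have "eventually (\<lambda>s. 0 = (max 0 s)\<^sup>2) (nhds s)"
      using 2 eventually_nhds_in_open[of "{..<0}" s] by (auto elim!: eventually_mono simp: max_def)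
    ultimately show ?thesis by (subst (asm) DERIV_cong_ev) auto
  next
    case 3
    have "((\<lambda>h. ((max 0 (0 + h))\<^sup>2 - (max 0 0)\<^sup>2) / h) \<longlongrightarrow> 0) (at (0::real))"
    proof (rule Lim_null_comparison)
      show "eventually (\<lambda>h. norm (((max 0 (0 + h))\<^sup>2 - (max 0 0)\<^sup>2) / h) \<le> \<bar>h\<bar>) (at (0::real))"
        by (intro always_eventually allI) (auto simp: max_def power2_eq_square)
      show "((\<lambda>h. \<bar>h\<bar>) \<longlongrightarrow> 0) (at (0::real))" by (intro tendsto_rabs_zero tendsto_ident_at)
    qed
    then show ?thesis by (simp add: 3 DERIV_def)
  qed
qed

text \<open>A \<open>C\<^sup>1\<close> function bounded away from zero that agrees with the identity on \<open>[c, \<infinity>)\<close>; it replaces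
  \<open>\<bar>v\<bar>\<^sup>2\<close> in denominators, since mollifications of \<open>v\<close> may vanish.\<close>

definition reg :: "real \<Rightarrow> real \<Rightarrow> real" where "reg c s = s + (max 0 (c - s))\<^sup>2 / c"
definition reg' :: "real \<Rightarrow> real \<Rightarrow> real" where "reg' c s = 1 - 2 * max 0 (c - s) / c"

lemma DERIV_reg: "(reg c has_real_derivative reg' c s) (at s)"
proof -
  have "((\<lambda>s. (max 0 (c - s))\<^sup>2) has_real_derivative 2 * max 0 (c - s) * - 1) (at s)"
    by (rule DERIV_chain2[OF DERIV_pos_part_sq]) (auto intro!: derivative_eq_intros)
  from DERIV_add[OF DERIV_ident DERIV_cdivide[OF this, of c]] show ?thesis
    unfolding reg_def[abs_def] reg'_def by simp
qed

lemma reg_id: "c \<le> s \<Longrightarrow> reg c s = s" "c \<le> s \<Longrightarrow> reg' c s = 1"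
  by (auto simp: reg_def reg'_def)

text \<open>For \<open>s < c\<close> the function is the parabola
  \<open>(s^2 - c s + c^2) / c\<close>, whose minimum \<open>3 c / 4\<close> is attained at
  \<open>s = c / 2\<close>.\<close>

lemma reg_ge:
  assumes "c > 0" shows "s \<le> reg c s" "3 * c / 4 \<le> reg c s"
proof -
  show "s \<le> reg c s" using assms by (simp add: reg_def)
  show "3 * c / 4 \<le> reg c s"
  proof (cases "c \<le> s")
    case False
    have "0 \<le> (2 * s - c)\<^sup>2" by simp
    then have "3 * c / 4 * c \<le> s * c + (c - s)\<^sup>2" by (simp add: power2_eq_square algebra_simps)
    then have "3 * c / 4 \<le> (s * c + (c - s)\<^sup>2) / c" using assms by (simp add: field_simps)
    then show ?thesis using False assms by (simp add: reg_def max_def add_divide_distrib)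
  qed (use assms in \<open>simp add: reg_id\<close>)
qed

lemma reg_pos: "c > 0 \<Longrightarrow> 0 < reg c s"
  using reg_ge(2)[of c s] by linarith

lemma reg'_bound: "c > 0 \<Longrightarrow> 0 \<le> s \<Longrightarrow> \<bar>reg' c s\<bar> \<le> 1"
  by (auto simp: reg'_def max_def field_simps)

lemma continuous_reg: "continuous_on S (reg c)" "continuous_on S (reg' c)"
  unfolding reg_def[abs_def] reg'_def[abs_def] by (cases "c = 0"; auto intro!: continuous_intros)+

lemma integral_cong_AE_measurable:
  fixes f g :: "real \<times> real \<Rightarrow> real"
  assumes "AE z in lborel. f z = g z" "f \<in> borel_measurable borel" "g \<in> borel_measurable borel"
  shows "(LINT z|lborel. f z) = (LINT z|lborel. g z)"
  using assms by (intro integral_cong_AE) auto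

lemma moll_cong_AE:
  assumes "AE z in lborel. f z = g z" "L1loc f" "L1loc g"
  shows "moll n i j f x = moll n i j g x"
proof -
  note [measurable] = L1loc_measurable[OF assms(2)] L1loc_measurable[OF assms(3)]
  have "AE z in lborel. f z * kern n i j (z - x) = g z * kern n i j (z - x)"
    using assms(1) by eventually_elim simp
  then show ?thesis
    unfolding moll_def by (rule integral_cong_AE_measurable) measurable
qed

lemma C1_zero_const:
  assumes "C1 u (\<lambda>_. 0) (\<lambda>_. 0)" shows "u z = u z'"
proof -
  have "(u has_derivative (\<lambda>h. 0)) (at x within UNIV)" for x
    using C1_has_derivative[OF assms, of x] by simp
  then obtain c where "\<And>x. u x = c"
    using has_derivative_zero_constant[of UNIV u] by auto
  then show ?thesis by simp
qed

text \<open>Each mollification has gradient zero and is constant; an almost everywhere limit of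
  constants is constant.\<close>

lemma AE_const_of_zero_gradient:
  assumes f: "L1loc f" and 0: "\<And>n x. moll n (Suc 0) 0 f x = 0" "\<And>n x. moll n 0 (Suc 0) f x = 0"
  shows "\<exists>c. AE z in lborel. f z = c"
proof -
  obtain r :: "nat \<Rightarrow> nat" where r: "AE z in lborel. (\<lambda>k. moll (r k) 0 0 f z) \<longlonglongrightarrow> f z"
    using conv1_AE_subseq[OF conv1_moll[OF f] conv1_moll[OF f]] by blast
  have "C1 (moll n 0 0 f) (\<lambda>_. 0) (\<lambda>_. 0)" for n
    using C1_moll[OF f, of n 0 0] by (simp add: 0)
  then have c: "moll n 0 0 f z = moll n 0 0 f 0" for n z by (rule C1_zero_const)
  have "AE z in lborel. f z = lim (\<lambda>k. moll (r k) 0 0 f 0)"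
    using r
  proof eventually_elim
    case (elim z)
    have "(\<lambda>k. moll (r k) 0 0 f z) = (\<lambda>k. moll (r k) 0 0 f 0)" by (rule ext) (rule c)
    with elim show ?case by (simp add: limI)
  qed
  then show ?thesis by blast
qed


text \<open>The dominating function may change with the box, just as the lower bound on
  \<open>|v|\<close> does.\<close>

lemma L2locI_AE:
  assumes m: "f \<in> borel_measurable borel"
    and "\<And>R. \<exists>g. L1loc g \<and> (AE z in lborel. z \<in> bx R \<longrightarrow> (f z)\<^sup>2 \<le> g z)"
  shows "L2loc f"
  unfolding L2loc_def L1loc_def
proof (intro conjI allI m)
  note [measurable] = m
  show "(\<lambda>z. (f z)\<^sup>2) \<in> borel_measurable borel" by measurable
  fix R
  obtain g where g: "L1loc g" "AE z in lborel. z \<in> bx R \<longrightarrow> (f z)\<^sup>2 \<le> g z" using assms(2) by blast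
  show "integrable lborel (\<lambda>z. indicator (bx R) z * (f z)\<^sup>2)"
  proof (rule Bochner_Integration.integrable_bound[OF integrable_bx_times[OF g(1), of R]])
    show "AE z in lborel. norm (indicator (bx R) z * (f z)\<^sup>2) \<le> norm (indicator (bx R) z * g z)"
      using g(2) by eventually_elim (auto simp: indicator_def)
  qed measurable
qed

lemma om_bound:
  fixes a b x y c :: real
  assumes c: "c > 0" "c \<le> x\<^sup>2 + y\<^sup>2"
  shows "((x * b - y * a) / (x\<^sup>2 + y\<^sup>2))\<^sup>2 \<le> (1 / c) * (a\<^sup>2 + b\<^sup>2)"
proof -
  have s: "0 < x\<^sup>2 + y\<^sup>2" using c by linarith
  \<comment> \<open>Lagrange's identity: the gap between the two sides is
    \<open>(x a + y b)^2\<close>.\<close>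
  have "(x * b - y * a)\<^sup>2 \<le> (x\<^sup>2 + y\<^sup>2) * (a\<^sup>2 + b\<^sup>2)"
    using zero_le_power2[of "x * a + y * b"] by (simp add: power2_eq_square algebra_simps)
  then have "((x * b - y * a) / (x\<^sup>2 + y\<^sup>2))\<^sup>2 \<le> (x\<^sup>2 + y\<^sup>2) * (a\<^sup>2 + b\<^sup>2) / (x\<^sup>2 + y\<^sup>2)\<^sup>2"
    by (simp add: power_divide divide_right_mono)
  also have "\<dots> = (a\<^sup>2 + b\<^sup>2) / (x\<^sup>2 + y\<^sup>2)" using s by (simp add: power2_eq_square)
  also have "\<dots> \<le> (a\<^sup>2 + b\<^sup>2) / c" using c by (intro divide_left_mono) (auto simp: mult_pos_pos s)
  finally show ?thesis by simp
qed

text \<open>The unit vector \<open>(x, y) / m\<close> is constant along rays, so its derivative in a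
  direction \<open>(a, b)\<close> parallel to \<open>(x, y)\<close> is zero. The terms are left in
  the form in which the product and chain rules deliver them.\<close>

lemma normalized_gradient_eq_0:
  fixes x y a b m :: real
  assumes m: "m > 0" "m * m = x\<^sup>2 + y\<^sup>2" and ab: "x * b = y * a"
  shows "(1 * (1 / m) + x * (- 1 / (2 * m ^ 3) * (2 * x))) * a + (0 * (1 / m) + x * (- 1 / (2 * m ^ 3) * (2 * y))) * b = 0"
    and "(0 * (1 / m) + y * (- 1 / (2 * m ^ 3) * (2 * x))) * a + (1 * (1 / m) + y * (- 1 / (2 * m ^ 3) * (2 * y))) * b = 0"
proof -
  have i: "1 / m = (m * m) / m ^ 3" using m(1) by (simp add: power3_eq_cube)
  have "(1 * (1 / m) + x * (- 1 / (2 * m ^ 3) * (2 * x))) * a + (0 * (1 / m) + x * (- 1 / (2 * m ^ 3) * (2 * y))) * b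
     = ((m * m) * a - x * x * a - y * (x * b)) / m ^ 3"
    unfolding i by (simp add: algebra_simps add_divide_distrib diff_divide_distrib)
  also have "\<dots> = 0" unfolding m(2) ab by (simp add: power2_eq_square algebra_simps)
  finally show "(1 * (1 / m) + x * (- 1 / (2 * m ^ 3) * (2 * x))) * a + (0 * (1 / m) + x * (- 1 / (2 * m ^ 3) * (2 * y))) * b = 0" .
  have "(0 * (1 / m) + y * (- 1 / (2 * m ^ 3) * (2 * x))) * a + (1 * (1 / m) + y * (- 1 / (2 * m ^ 3) * (2 * y))) * b
     = ((m * m) * b - x * (y * a) - y * y * b) / m ^ 3"
    unfolding i by (simp add: algebra_simps add_divide_distrib diff_divide_distrib)
  also have "\<dots> = 0" unfolding m(2) ab[symmetric] by (simp add: power2_eq_square algebra_simps)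
  finally show "(0 * (1 / m) + y * (- 1 / (2 * m ^ 3) * (2 * x))) * a + (1 * (1 / m) + y * (- 1 / (2 * m ^ 3) * (2 * y))) * b = 0" .
qed

lemma C1_fst: "C1 fst (\<lambda>_. 1) (\<lambda>_. 0)"
  by (rule C1I(1)) auto

lemma C1_snd: "C1 snd (\<lambda>_. 0) (\<lambda>_. 1)"
  by (rule C1I(1)) auto

lemma C1_norm_sq: "C1 (\<lambda>z. (fst z)\<^sup>2 + (snd z)\<^sup>2) (\<lambda>z. 2 * fst z) (\<lambda>z. 2 * snd z)"
  by (rule C1I(1)) (auto intro!: continuous_intros derivative_eq_intros)

lemma C1_inverse_reg:
  assumes c: "c > 0"
  shows "C1 (\<lambda>z. 1 / reg c ((fst z)\<^sup>2 + (snd z)\<^sup>2))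
    (\<lambda>z. - reg' c ((fst z)\<^sup>2 + (snd z)\<^sup>2) / (reg c ((fst z)\<^sup>2 + (snd z)\<^sup>2))\<^sup>2 * (2 * fst z))
    (\<lambda>z. - reg' c ((fst z)\<^sup>2 + (snd z)\<^sup>2) / (reg c ((fst z)\<^sup>2 + (snd z)\<^sup>2))\<^sup>2 * (2 * snd z))"
proof (rule C1_compose[OF C1_norm_sq])
  fix s
  have "reg c s \<noteq> 0" using reg_pos[OF c, of s] by simp
  then show "((\<lambda>s. 1 / reg c s) has_real_derivative - reg' c s / (reg c s)\<^sup>2) (at s)"
    by (auto intro!: derivative_eq_intros DERIV_reg simp: power2_eq_square)
next
  have "reg c s \<noteq> 0" for s using reg_pos[OF c, of s] by simp
  then show "continuous_on UNIV (\<lambda>s. - reg' c s / (reg c s)\<^sup>2)"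
    by (intro continuous_intros continuous_reg) auto
qed

section \<open>The angle form of a velocity field without stagnation points\<close>

locale weak_velocity =
  fixes v1 v2 a1 a2 b1 b2 :: "real \<times> real \<Rightarrow> real"
  assumes v1: "wgrad v1 a1 a2" and v2: "wgrad v2 b1 b2"
    and nostag: "\<And>R. \<exists>c>0. AE z in lborel. z \<in> bx R \<longrightarrow> c \<le> (v1 z)\<^sup>2 + (v2 z)\<^sup>2"
begin

lemmas meas [measurable] =
  wgradD(4-6)[OF v1, THEN L1loc_measurable] wgradD(4-6)[OF v2, THEN L1loc_measurable]

definition "sq z = (v1 z)\<^sup>2 + (v2 z)\<^sup>2"
definition "om1 z = (v1 z * b1 z - v2 z * a1 z) / sq z"
definition "om2 z = (v1 z * b2 z - v2 z * a2 z) / sq z"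

lemma sq_measurable [measurable]: "sq \<in> borel_measurable borel"
  unfolding sq_def by measurable

lemma om_measurable [measurable]: "om1 \<in> borel_measurable borel" "om2 \<in> borel_measurable borel"
  unfolding om1_def om2_def by measurable

lemma AE_sq_pos: "AE z in lborel. 0 < sq z"
proof -
  have "AE z in lborel. z \<in> bx (real n) \<longrightarrow> 0 < sq z" for n
  proof -
    obtain c where "c > 0" "AE z in lborel. z \<in> bx (real n) \<longrightarrow> c \<le> (v1 z)\<^sup>2 + (v2 z)\<^sup>2" using nostag by blast
    then show ?thesis by (auto elim!: eventually_mono simp: sq_def)
  qed
  then have "AE z in lborel. \<forall>n. z \<in> bx (real n) \<longrightarrow> 0 < sq z" unfolding AE_all_countable by blast
  then show ?thesis
  proof eventually_elim
    case (elim z)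
    obtain n where "norm z \<le> real n" using real_arch_simple by blast
    then have "z \<in> bx (real n)" using bx_self[of z] bx_mono[of "norm z" "real n"] by blast
    then show ?case using elim by blast
  qed
qed

lemma om_L2loc: "L2loc om1" "L2loc om2"
proof -
  have *: "\<exists>g. L1loc g \<and> (AE z in lborel. z \<in> bx R \<longrightarrow> ((v1 z * b z - v2 z * a z) / sq z)\<^sup>2 \<le> g z)"
    if "L2loc a" "L2loc b" for a b R
  proof -
    obtain c where c: "c > 0" "AE z in lborel. z \<in> bx R \<longrightarrow> c \<le> (v1 z)\<^sup>2 + (v2 z)\<^sup>2" using nostag by blast
    have "AE z in lborel. z \<in> bx R \<longrightarrow> ((v1 z * b z - v2 z * a z) / sq z)\<^sup>2 \<le> (1 / c) * ((a z)\<^sup>2 + (b z)\<^sup>2)"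
      using c(2) by eventually_elim (auto simp only: sq_def intro!: om_bound c(1))
    moreover have "L1loc (\<lambda>z. (1 / c) * ((a z)\<^sup>2 + (b z)\<^sup>2))"
      by (intro L1loc_cmult L1loc_add L2loc_sq that)
    ultimately show ?thesis by blast
  qed
  show "L2loc om1"
    by (rule L2locI_AE) (measurable, unfold om1_def, intro * wgradD[OF v1] wgradD[OF v2])
  show "L2loc om2"
    by (rule L2locI_AE) (measurable, unfold om2_def, intro * wgradD[OF v1] wgradD[OF v2])
qed

text \<open>The angle form is singular at the origin, so its factor \<open>1 / |z|^2\<close> is
  replaced by \<open>1 / reg c (|z|^2)\<close>, which makes it \<open>C^1\<close> with bounded
  coefficients. On the box carrying \<psi> one has \<open>|v|^2 \<ge> c\<close> almost everywhere;
  there the pulled-back form is unchanged and its curl coefficient \<open>h\<close>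
  vanishes.\<close>

lemma om_closed:
  assumes \<psi>: "C1 \<psi> \<psi>1 \<psi>2" and supp: "\<And>z. z \<notin> bx R \<Longrightarrow> \<psi> z = 0"
  shows "(LINT z|lborel. om1 z * \<psi>2 z) = (LINT z|lborel. om2 z * \<psi>1 z)"
proof -
  obtain c where c: "c > 0" "AE z in lborel. z \<in> bx R \<longrightarrow> c \<le> sq z" using nostag unfolding sq_def by blast
  define Q where "Q z = 1 / reg c ((fst z)\<^sup>2 + (snd z)\<^sup>2)" for z :: "real \<times> real"
  define Q' where "Q' z = - reg' c ((fst z)\<^sup>2 + (snd z)\<^sup>2) / (reg c ((fst z)\<^sup>2 + (snd z)\<^sup>2))\<^sup>2" for z :: "real \<times> real"
  have CQ: "C1 Q (\<lambda>z. Q' z * (2 * fst z)) (\<lambda>z. Q' z * (2 * snd z))"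
    unfolding Q_def Q'_def by (rule C1_inverse_reg[OF c(1)])
  define p where "p z = (-1 * snd z) * Q z" for z
  define r where "r z = fst z * Q z" for z
  have Cp: "C1 p (\<lambda>z. 0 * Q z + (-1 * snd z) * (Q' z * (2 * fst z))) (\<lambda>z. -1 * Q z + (-1 * snd z) * (Q' z * (2 * snd z)))"
    unfolding p_def
    by (intro C1_mult CQ C1I(1)) (auto intro!: derivative_eq_intros continuous_intros)
  have Cr: "C1 r (\<lambda>z. 1 * Q z + fst z * (Q' z * (2 * fst z))) (\<lambda>z. 0 * Q z + fst z * (Q' z * (2 * snd z)))"
    unfolding r_def by (intro C1_mult CQ C1_fst)
  \<comment> \<open>A common bound for the coefficients, at most \<open>4 / (3 c) + 1\<close>, and
    for the curl, at most \<open>16 / (3 c)\<close>.\<close>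
  define M where "M = 2 * (4 / (3 * c) + 1 + 4 / c)"
  have Qb: "0 \<le> Q z" "Q z \<le> 4 / (3 * c)" "((fst z)\<^sup>2 + (snd z)\<^sup>2) * Q z \<le> 1"
    "\<bar>((fst z)\<^sup>2 + (snd z)\<^sup>2) * Q' z\<bar> \<le> 4 / (3 * c)" for z
  proof -
    let ?s = "(fst z)\<^sup>2 + (snd z)\<^sup>2"
    have s: "0 \<le> ?s" by simp
    note rp = reg_pos[OF c(1), of ?s] and rg = reg_ge[OF c(1), of ?s]
    show "0 \<le> Q z" using rp by (simp add: Q_def)
    have "1 / reg c ?s \<le> 1 / (3 * c / 4)" using rg(2) c(1) rp by (intro divide_left_mono) (auto intro!: mult_pos_pos)
    then show Q43: "Q z \<le> 4 / (3 * c)" by (simp add: Q_def)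
    show Q1: "?s * Q z \<le> 1" using rg(1) rp by (simp add: Q_def field_simps)
    have "\<bar>?s * Q' z\<bar> = (?s * Q z) * (\<bar>reg' c ?s\<bar> * Q z)"
      using s rp by (simp add: Q_def Q'_def abs_mult power2_eq_square)
    also have "\<dots> \<le> 1 * (1 * (4 / (3 * c)))"
      using Q1 Q43 reg'_bound[OF c(1) s] \<open>0 \<le> Q z\<close> s
      by (intro mult_mono) (auto intro!: mult_nonneg_nonneg)
    finally show "\<bar>?s * Q' z\<bar> \<le> 4 / (3 * c)" by simp
  qed
  have lin: "\<bar>t\<bar> * Q z \<le> M" if "t\<^sup>2 \<le> (fst z)\<^sup>2 + (snd z)\<^sup>2" for t z
  proof -
    have "\<bar>t\<bar> \<le> 1 + t\<^sup>2" using zero_le_power2[of "\<bar>t\<bar> - 1"] by (simp add: power2_eq_square algebra_simps)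
    also have "\<dots> \<le> 1 + ((fst z)\<^sup>2 + (snd z)\<^sup>2)" using that by simp
    finally have "\<bar>t\<bar> * Q z \<le> (1 + ((fst z)\<^sup>2 + (snd z)\<^sup>2)) * Q z" using Qb(1) by (intro mult_right_mono)
    also have "\<dots> = Q z + ((fst z)\<^sup>2 + (snd z)\<^sup>2) * Q z" by (simp add: algebra_simps)
    also have "\<dots> \<le> 4 / (3 * c) + 1" by (intro add_mono Qb)
    also have "\<dots> \<le> M"
    proof -
      have "x + 1 \<le> 2 * (x + 1 + y)" if "0 \<le> x" "0 \<le> y" for x y :: real using that by simp
      from this[of "4 / (3 * c)" "4 / c"] show ?thesis using c(1) unfolding M_def by simp
    qed
    finally show ?thesis .
  qed
  have pb: "\<bar>p z\<bar> \<le> M" "\<bar>r z\<bar> \<le> M" for z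
    using lin[of "snd z" z] lin[of "fst z" z] Qb(1)[of z] by (auto simp: p_def r_def abs_mult)
  \<comment> \<open>With \<open>s = |z|^2\<close>, this is twice the derivative of
    \<open>s Q(s)\<close>, which is zero wherever \<open>Q(s) = 1 / s\<close>.\<close>
  define h where "h z = 2 * Q z + 2 * (((fst z)\<^sup>2 + (snd z)\<^sup>2) * Q' z)" for z
  have curl: "(1 * Q z + fst z * (Q' z * (2 * fst z))) - (-1 * Q z + (-1 * snd z) * (Q' z * (2 * snd z))) = h z" for z
    by (simp add: h_def power2_eq_square algebra_simps)
  have hb: "\<bar>(1 * Q z + fst z * (Q' z * (2 * fst z))) - (-1 * Q z + (-1 * snd z) * (Q' z * (2 * snd z)))\<bar> \<le> M" for z
  proof -
    have "\<bar>h z\<bar> \<le> 2 * (4 / (3 * c)) + 2 * (4 / (3 * c))"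
      using Qb(1,2,4)[of z] unfolding h_def by linarith
    also have "\<dots> \<le> M" using c(1) by (simp add: M_def field_simps)
    finally show ?thesis unfolding curl .
  qed
  have s12: "\<psi>1 z = 0" "\<psi>2 z = 0" if "z \<notin> bx R" for z using C1_support[OF \<psi> supp that] by auto
  have [measurable]: "\<psi> \<in> borel_measurable borel" "\<psi>1 \<in> borel_measurable borel" "\<psi>2 \<in> borel_measurable borel"
    by (intro borel_measurable_continuous_onI C1D[OF \<psi>])+
  have [measurable]: "Q \<in> borel_measurable borel" "h \<in> borel_measurable borel"
  proof -
    show "Q \<in> borel_measurable borel" by (intro borel_measurable_continuous_onI C1D(1)[OF CQ])
    have "h = (\<lambda>z. (1 * Q z + fst z * (Q' z * (2 * fst z))) - (-1 * Q z + (-1 * snd z) * (Q' z * (2 * snd z))))"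
      by (rule ext) (simp only: curl)
    with continuous_on_diff[OF C1D(2)[OF Cr] C1D(3)[OF Cp]] have "continuous_on UNIV h" by (simp only:)
    then show "h \<in> borel_measurable borel" by (rule borel_measurable_continuous_onI)
  qed
  have pQ: "p (v1 z, v2 z) = - (v2 z * Q (v1 z, v2 z))" "r (v1 z, v2 z) = v1 z * Q (v1 z, v2 z)" for z
    by (simp_all add: p_def r_def)
  have AEQ: "AE z in lborel. z \<in> bx R \<longrightarrow> Q (v1 z, v2 z) = 1 / sq z \<and> h (v1 z, v2 z) = 0"
    using c(2)
  proof eventually_elim
    case (elim z)
    show ?case
    proof
      assume "z \<in> bx R"
      then have cs: "c \<le> sq z" using elim by blast
      then have sp: "0 < sq z" using c(1) by linarith
      have "Q (v1 z, v2 z) = 1 / sq z" "Q' (v1 z, v2 z) = - 1 / (sq z)\<^sup>2"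
        using cs by (simp_all add: Q_def Q'_def sq_def[symmetric] reg_id)
      moreover have "h (v1 z, v2 z) = 2 * Q (v1 z, v2 z) + 2 * (sq z * Q' (v1 z, v2 z))"
        by (simp add: h_def sq_def)
      ultimately show "Q (v1 z, v2 z) = 1 / sq z \<and> h (v1 z, v2 z) = 0"
        using sp by (simp add: power2_eq_square)
    qed
  qed
  have "(LINT z|lborel. om1 z * \<psi>2 z) = (LINT z|lborel. (p (v1 z, v2 z) * a1 z + r (v1 z, v2 z) * b1 z) * \<psi>2 z)"
  proof (rule integral_cong_AE_measurable)
    show "AE z in lborel. om1 z * \<psi>2 z = (p (v1 z, v2 z) * a1 z + r (v1 z, v2 z) * b1 z) * \<psi>2 z"
      using AEQ
    proof eventually_elim
      case (elim z) then show ?case by (cases "z \<in> bx R") (simp_all add: s12 om1_def pQ diff_divide_distrib)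
    qed
  qed (unfold pQ, measurable)
  moreover have "(LINT z|lborel. om2 z * \<psi>1 z) = (LINT z|lborel. (p (v1 z, v2 z) * a2 z + r (v1 z, v2 z) * b2 z) * \<psi>1 z)"
  proof (rule integral_cong_AE_measurable)
    show "AE z in lborel. om2 z * \<psi>1 z = (p (v1 z, v2 z) * a2 z + r (v1 z, v2 z) * b2 z) * \<psi>1 z"
      using AEQ
    proof eventually_elim
      case (elim z) then show ?case by (cases "z \<in> bx R") (simp_all add: s12 om2_def pQ diff_divide_distrib)
    qed
  qed (unfold pQ, measurable)
  moreover have "(LINT z|lborel. h (v1 z, v2 z) * (a1 z * b2 z - a2 z * b1 z) * \<psi> z) = (LINT z|(lborel :: (real \<times> real) measure). 0)"
  proof (rule integral_cong_AE_measurable)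
    show "AE z in lborel. h (v1 z, v2 z) * (a1 z * b2 z - a2 z * b1 z) * \<psi> z = 0"
      using AEQ
    proof eventually_elim
      case (elim z) then show ?case by (cases "z \<in> bx R") (auto simp: supp)
    qed
  qed measurable
  moreover have "(LINT z|lborel. (p (v1 z, v2 z) * a1 z + r (v1 z, v2 z) * b1 z) * \<psi>2 z)
       - (LINT z|lborel. (p (v1 z, v2 z) * a2 z + r (v1 z, v2 z) * b2 z) * \<psi>1 z)
     = (LINT z|lborel. h (v1 z, v2 z) * (a1 z * b2 z - a2 z * b1 z) * \<psi> z)"
    unfolding curl[symmetric] by (rule weak_pullback[OF v1 v2 Cp pb(1) Cr pb(2) hb \<psi> supp])
  moreover have "(LINT z|(lborel :: (real \<times> real) measure). 0 :: real) = 0" by simp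
  ultimately show ?thesis by linarith
qed

lemma moll_om_closed: "moll n 0 (Suc 0) om1 x = moll n (Suc 0) 0 om2 x"
  unfolding moll_def
  by (rule om_closed[OF C1_kern, of "2 + norm x"]) (rule kern_shift_eq_0[OF bx_self])

lemma moll_om_C1: "\<exists>c1 c c2. C1 (moll n 0 0 om1) c1 c \<and> C1 (moll n 0 0 om2) c c2"
proof (intro exI conjI)
  show "C1 (moll n 0 0 om1) (\<lambda>x. - moll n (Suc 0) 0 om1 x) (\<lambda>x. - moll n 0 (Suc 0) om1 x)"
    by (rule C1_moll[OF L2loc_imp_L1loc[OF om_L2loc(1)]])
  show "C1 (moll n 0 0 om2) (\<lambda>x. - moll n 0 (Suc 0) om1 x) (\<lambda>x. - moll n 0 (Suc 0) om2 x)"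
    using C1_moll[OF L2loc_imp_L1loc[OF om_L2loc(2)], of n 0 0] by (simp only: moll_om_closed)
qed

text \<open>If \<omega> is zero, each partial derivative of \<open>v\<close> is parallel to
  \<open>v\<close>, and \<open>v / |v|\<close> does not react to such changes. The chain rule is
  applied with a regularised norm, chosen for the box that carries one kernel and equal to
  \<open>|v|\<close> almost everywhere there; the resulting statement on mollifications no longer
  contains the regularisation.\<close>

lemma direction_const:
  assumes om0: "AE z in lborel. om1 z = 0 \<and> om2 z = 0"
  shows "\<exists>c. AE z in lborel. v1 z / sqrt (sq z) = c" "\<exists>c. AE z in lborel. v2 z / sqrt (sq z) = c"
proof -
  \<comment> \<open>Both components at once: \<open>f\<close> is one of the coordinate functions,
    with partial derivatives \<open>f1\<close> and \<open>f2\<close>.\<close>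
  have key: "moll n (Suc 0) 0 (\<lambda>z. f (v1 z, v2 z) / sqrt (sq z)) x = 0 \<and> moll n 0 (Suc 0) (\<lambda>z. f (v1 z, v2 z) / sqrt (sq z)) x = 0"
    if f: "f = fst \<and> f1 = (\<lambda>_. 1) \<and> f2 = (\<lambda>_. 0) \<or> f = snd \<and> f1 = (\<lambda>_. 0) \<and> f2 = (\<lambda>_. 1)"
    for f f1 f2 :: "real \<times> real \<Rightarrow> real" and n x
  proof -
    define R where "R = 2 + norm x"
    obtain c where c: "c > 0" "AE z in lborel. z \<in> bx R \<longrightarrow> c \<le> sq z" using nostag unfolding sq_def by blast
    define Q where "Q z = 1 / sqrt (reg c ((fst z)\<^sup>2 + (snd z)\<^sup>2))" for z :: "real \<times> real"
    define Q' where "Q' z = - reg' c ((fst z)\<^sup>2 + (snd z)\<^sup>2) / (2 * (sqrt (reg c ((fst z)\<^sup>2 + (snd z)\<^sup>2))) ^ 3)" for z :: "real \<times> real"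
    have rp: "0 < reg c s" for s using reg_pos[OF c(1)] .
    have CQ: "C1 Q (\<lambda>z. Q' z * (2 * fst z)) (\<lambda>z. Q' z * (2 * snd z))"
      unfolding Q_def Q'_def
    proof (rule C1_compose[OF C1_norm_sq])
      show "((\<lambda>s. 1 / sqrt (reg c s)) has_real_derivative - reg' c s / (2 * sqrt (reg c s) ^ 3)) (at s)" for s
      proof -
        have D: "((\<lambda>s. sqrt (reg c s)) has_real_derivative (inverse (sqrt (reg c s)) / 2) * reg' c s) (at s)"
          by (rule DERIV_chain2[OF DERIV_real_sqrt[OF rp] DERIV_reg])
        have "sqrt (reg c s) \<noteq> 0" using rp[of s] by simp
        from DERIV_divide[OF DERIV_const[of 1] D this] show ?thesis
          by (rule DERIV_cong) (use \<open>sqrt (reg c s) \<noteq> 0\<close> in \<open>simp add: power3_eq_cube field_simps\<close>)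
      qed
      show "continuous_on UNIV (\<lambda>s. - reg' c s / (2 * sqrt (reg c s) ^ 3))"
      proof (intro continuous_intros continuous_reg ballI)
        fix s show "2 * sqrt (reg c s) ^ 3 \<noteq> 0" using rp[of s] by simp
      qed
    qed
    define g where "g z = f z * Q z" for z
    define g1 where "g1 z = f1 z * Q z + f z * (Q' z * (2 * fst z))" for z
    define g2 where "g2 z = f2 z * Q z + f z * (Q' z * (2 * snd z))" for z
    have Cf: "C1 f f1 f2" using f C1_fst C1_snd by auto
    have Cg: "C1 g g1 g2" unfolding g_def g1_def g2_def by (intro C1_mult Cf CQ)
    define M where "M = 1 + 3 * (1 / sqrt (3 * c / 4))"
    have bnd: "\<bar>f z * Q z\<bar> \<le> 1" "\<bar>f1 z * Q z\<bar> \<le> 1 / sqrt (3 * c / 4)" "\<bar>f2 z * Q z\<bar> \<le> 1 / sqrt (3 * c / 4)"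
      "\<bar>f z * (Q' z * (2 * fst z))\<bar> \<le> 1 / sqrt (3 * c / 4)" "\<bar>f z * (Q' z * (2 * snd z))\<bar> \<le> 1 / sqrt (3 * c / 4)" for z
    proof -
      let ?s = "(fst z)\<^sup>2 + (snd z)\<^sup>2"
      have s: "0 \<le> ?s" by simp
      note rg = reg_ge[OF c(1), of ?s]
      have lin: "\<bar>t\<bar> * Q z \<le> 1" if "t\<^sup>2 \<le> ?s" for t
      proof -
        have "\<bar>t\<bar> \<le> sqrt (reg c ?s)" using that rg(1) by (intro real_le_rsqrt) simp
        then show ?thesis using rp[of ?s] by (simp add: Q_def)
      qed
      have Q0: "0 \<le> Q z" using rp[of ?s] by (simp add: Q_def)
      have QM: "Q z \<le> 1 / sqrt (3 * c / 4)"
        unfolding Q_def using rg(2) c(1) rp[of ?s] by (intro divide_left_mono) (auto intro!: mult_pos_pos)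
      have f2s: "(f z)\<^sup>2 \<le> ?s" using f by auto
      show "\<bar>f z * Q z\<bar> \<le> 1" using lin[OF f2s] Q0 by (simp add: abs_mult)
      show "\<bar>f1 z * Q z\<bar> \<le> 1 / sqrt (3 * c / 4)" "\<bar>f2 z * Q z\<bar> \<le> 1 / sqrt (3 * c / 4)"
        using f QM Q0 c(1) by (auto simp del: real_sqrt_divide real_sqrt_mult)
      have quad: "\<bar>f z * (Q' z * (2 * t))\<bar> \<le> 1 / sqrt (3 * c / 4)" if "t\<^sup>2 \<le> ?s" for t
      proof -
        \<comment> \<open>Since \<open>Q\<close> is \<open>reg\<close> to the power
          \<open>-1/2\<close>, its derivative contains \<open>Q^3\<close>. One factor compensates
          \<open>f z\<close>, one compensates \<open>t\<close>, and the third is bounded by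
          \<open>1 / sqrt (3 c / 4)\<close>.\<close>
        have "Q' z * 2 = - reg' c ?s * (Q z * Q z * Q z)" by (simp add: Q_def Q'_def power3_eq_cube)
        then have "f z * t * (Q' z * 2) = - (f z * t * (reg' c ?s * (Q z * Q z * Q z)))"
          by (simp only: mult_minus_left mult_minus_right)
        moreover have "f z * (Q' z * (2 * t)) = f z * t * (Q' z * 2)" by (simp only: mult_ac)
        ultimately have "\<bar>f z * (Q' z * (2 * t))\<bar> = \<bar>f z * t * (reg' c ?s * (Q z * Q z * Q z))\<bar>"
          by (simp only: abs_minus_cancel)
        also have "\<dots> = (\<bar>f z\<bar> * Q z) * (\<bar>t\<bar> * Q z) * (\<bar>reg' c ?s\<bar> * Q z)" using Q0 by (simp add: abs_mult)
        also have "\<dots> \<le> 1 * 1 * (1 * (1 / sqrt (3 * c / 4)))"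
          using lin[OF f2s] lin[OF that] QM Q0 reg'_bound[OF c(1) s]
          by (intro mult_mono) (auto intro!: mult_nonneg_nonneg)
        finally show ?thesis by simp
      qed
      show "\<bar>f z * (Q' z * (2 * fst z))\<bar> \<le> 1 / sqrt (3 * c / 4)" "\<bar>f z * (Q' z * (2 * snd z))\<bar> \<le> 1 / sqrt (3 * c / 4)"
        by (intro quad; simp)+
    qed
    have pM: "0 \<le> 1 / sqrt (3 * c / 4)" using c(1) by simp
    have gM: "\<bar>g z\<bar> \<le> M" "\<bar>g1 z\<bar> \<le> M" "\<bar>g2 z\<bar> \<le> M" for z
    proof -
      show "\<bar>g z\<bar> \<le> M" using bnd(1)[of z] pM unfolding g_def M_def by linarith
      show "\<bar>g1 z\<bar> \<le> M" using bnd(2,4)[of z] pM unfolding g1_def M_def by linarith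
      show "\<bar>g2 z\<bar> \<le> M" using bnd(3,5)[of z] pM unfolding g2_def M_def by linarith
    qed
    have [measurable]: "g \<in> borel_measurable borel" "g1 \<in> borel_measurable borel" "g2 \<in> borel_measurable borel"
      "f \<in> borel_measurable borel"
      by (intro borel_measurable_continuous_onI C1D[OF Cg] C1D[OF Cf])+
    have supp: "kern n 0 0 (z - x) = 0" "kern n (Suc 0) 0 (z - x) = 0" "kern n 0 (Suc 0) (z - x) = 0" if "z \<notin> bx R" for z
      using that kern_shift_eq_0[OF bx_self] unfolding R_def by blast+
    have AE: "AE z in lborel. z \<in> bx R \<longrightarrow> g (v1 z, v2 z) = f (v1 z, v2 z) / sqrt (sq z) \<and>
        g1 (v1 z, v2 z) * a1 z + g2 (v1 z, v2 z) * b1 z = 0 \<and> g1 (v1 z, v2 z) * a2 z + g2 (v1 z, v2 z) * b2 z = 0"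
      using c(2) om0
    proof eventually_elim
      case (elim z)
      show ?case
      proof
        assume z: "z \<in> bx R"
        then have cs: "c \<le> sq z" and sp: "0 < sq z" using elim c(1) by (blast, force)
        have Qz: "Q (v1 z, v2 z) = 1 / sqrt (sq z)" using cs by (simp add: Q_def reg_id sq_def[symmetric])
        have Q'z: "Q' (v1 z, v2 z) = - 1 / (2 * (sqrt (sq z)) ^ 3)" using cs by (simp add: Q'_def reg_id sq_def[symmetric])
        have e: "v1 z * b1 z = v2 z * a1 z" "v1 z * b2 z = v2 z * a2 z" using elim(2) sp by (auto simp: om1_def om2_def)
        define m where "m = sqrt (sq z)"
        have m: "m > 0" "m * m = (v1 z)\<^sup>2 + (v2 z)\<^sup>2" using sp by (auto simp: m_def sq_def[symmetric] real_sqrt_mult_self)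
        have E: "g1 (v1 z, v2 z) * a + g2 (v1 z, v2 z) * b = 0" if ab: "v1 z * b = v2 z * a" for a b
          using f normalized_gradient_eq_0[OF m ab] unfolding g1_def g2_def Qz Q'z m_def[symmetric] by auto
        show "g (v1 z, v2 z) = f (v1 z, v2 z) / sqrt (sq z) \<and>
        g1 (v1 z, v2 z) * a1 z + g2 (v1 z, v2 z) * b1 z = 0 \<and> g1 (v1 z, v2 z) * a2 z + g2 (v1 z, v2 z) * b2 z = 0"
          using E e by (auto simp: g_def Qz)
      qed
    qed
    have *: "(LINT z|lborel. f (v1 z, v2 z) / sqrt (sq z) * k z) = (LINT z|lborel. g (v1 z, v2 z) * k z)"
      if [measurable]: "k \<in> borel_measurable borel" and "\<And>z. z \<notin> bx R \<Longrightarrow> k z = 0" for k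
    proof (rule integral_cong_AE_measurable)
      show "AE z in lborel. f (v1 z, v2 z) / sqrt (sq z) * k z = g (v1 z, v2 z) * k z"
        using AE
      proof eventually_elim
        case (elim z) then show ?case using that(2)[of z] by (cases "z \<in> bx R") auto
      qed
    qed measurable
    have **: "(LINT z|lborel. (g1 (v1 z, v2 z) * a z + g2 (v1 z, v2 z) * b z) * kern n 0 0 (z - x)) = 0"
      if "(a, b) = (a1, b1) \<or> (a, b) = (a2, b2)" for a b
    proof -
      have [measurable]: "a \<in> borel_measurable borel" "b \<in> borel_measurable borel" using that meas by auto
      have "(LINT z|lborel. (g1 (v1 z, v2 z) * a z + g2 (v1 z, v2 z) * b z) * kern n 0 0 (z - x)) = (LINT z|(lborel :: (real \<times> real) measure). 0)"
      proof (rule integral_cong_AE_measurable)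
        show "AE z in lborel. (g1 (v1 z, v2 z) * a z + g2 (v1 z, v2 z) * b z) * kern n 0 0 (z - x) = 0"
          using AE
        proof eventually_elim
          case (elim z) then show ?case using that supp(1)[of z] by (cases "z \<in> bx R") auto
        qed
      qed measurable
      then show ?thesis by simp
    qed
    have W: "(LINT z|lborel. g (v1 z, v2 z) * kern n (Suc 0) 0 (z - x))
        = - (LINT z|lborel. (g1 (v1 z, v2 z) * a1 z + g2 (v1 z, v2 z) * b1 z) * kern n 0 0 (z - x))"
      "(LINT z|lborel. g (v1 z, v2 z) * kern n 0 (Suc 0) (z - x))
        = - (LINT z|lborel. (g1 (v1 z, v2 z) * a2 z + g2 (v1 z, v2 z) * b2 z) * kern n 0 0 (z - x))"
      by (rule weak_chain_rule[OF v1 v2 Cg gM C1_kern[of n 0 0 x] supp(1)]; assumption)+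
    have "(LINT z|lborel. f (v1 z, v2 z) / sqrt (sq z) * kern n (Suc 0) 0 (z - x))
        = (LINT z|lborel. g (v1 z, v2 z) * kern n (Suc 0) 0 (z - x))"
      by (rule *) (measurable, rule supp(2))
    moreover have "(LINT z|lborel. f (v1 z, v2 z) / sqrt (sq z) * kern n 0 (Suc 0) (z - x))
        = (LINT z|lborel. g (v1 z, v2 z) * kern n 0 (Suc 0) (z - x))"
      by (rule *) (measurable, rule supp(3))
    ultimately show ?thesis
      unfolding moll_def using W **[of a1 b1] **[of a2 b2] by simp
  qed
  have L: "L1loc (\<lambda>z. f z / sqrt (sq z))" if "f = v1 \<or> f = v2" for f
  proof (rule L1loc_bound[OF L1loc_const[of 1]])
    have [measurable]: "f \<in> borel_measurable borel" using that meas by auto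
    show "(\<lambda>z. f z / sqrt (sq z)) \<in> borel_measurable borel" by measurable
    fix z
    have "\<bar>f z\<bar> \<le> sqrt (sq z)" using that by (intro real_le_rsqrt) (auto simp: sq_def)
    then show "\<bar>f z / sqrt (sq z)\<bar> \<le> 1"
      by (cases "sq z = 0") (auto simp: divide_le_eq_1 intro: order_trans[OF _ abs_ge_self])
  qed
  show "\<exists>c. AE z in lborel. v1 z / sqrt (sq z) = c"
    using key[of fst "\<lambda>_. 1" "\<lambda>_. 0"] by (intro AE_const_of_zero_gradient L) auto
  show "\<exists>c. AE z in lborel. v2 z / sqrt (sq z) = c"
    using key[of snd "\<lambda>_. 0" "\<lambda>_. 1"] by (intro AE_const_of_zero_gradient L) auto
qed

end

section \<open>Vanishing of the pressure gradient\<close>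

lemma fst_snd_borel [measurable]:
  "(fst :: real \<times> real \<Rightarrow> real) \<in> borel_measurable borel"
  "(snd :: real \<times> real \<Rightarrow> real) \<in> borel_measurable borel"
  by (intro borel_measurable_continuous_onI continuous_intros)+

text \<open>Values below \<open>t / R\<close> contribute the first term, which costs only
  \<open>4 t\<close> on a box of area \<open>4 R^2\<close>. For larger values
  \<open>a \<le> a^q (t / R)^(1 - q)\<close>, and \<open>R^(q - 1) \<le> R\<close> is where
  \<open>q \<le> 2\<close> enters.\<close>

lemma powr_split_bound:
  fixes a t R q y :: real
  assumes "0 \<le> a" "0 < t" "1 \<le> R" "1 \<le> q" "q \<le> 2" "0 \<le> y" "y \<le> R"
  shows "a * y / R\<^sup>2 \<le> t / R\<^sup>2 + t powr (1 - q) * (a powr q * (y / R))"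
proof (cases "a \<le> t / R")
  case True
  have "a * y \<le> (t / R) * R" using True assms by (intro mult_mono) auto
  also have "\<dots> = t" using assms by simp
  finally have "a * y / R\<^sup>2 \<le> t / R\<^sup>2" by (simp add: divide_right_mono)
  moreover have "0 \<le> t powr (1 - q) * (a powr q * (y / R))" using assms by (intro mult_nonneg_nonneg divide_nonneg_nonneg) auto
  ultimately show ?thesis by linarith
next
  case False
  have a: "0 < a" using False assms by (smt (verit) divide_pos_pos)
  have "a = a powr q * a powr (1 - q)" using a by (simp flip: powr_add)
  also have "\<dots> \<le> a powr q * (t / R) powr (1 - q)"
    using False assms a by (intro mult_left_mono powr_mono2') auto
  also have "(t / R) powr (1 - q) = t powr (1 - q) * R powr (q - 1)"
    using assms powr_minus_divide[of R "1 - q"] by (simp add: powr_divide)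
  also have "R powr (q - 1) \<le> R powr 1" using assms by (intro powr_mono) auto
  finally have "a \<le> a powr q * (t powr (1 - q) * R)" using assms by (simp add: mult_left_mono)
  then have "a * (y / R\<^sup>2) \<le> a powr q * (t powr (1 - q) * R) * (y / R\<^sup>2)"
    using assms by (intro mult_right_mono) auto
  also have "\<dots> = t powr (1 - q) * (a powr q * (y / R))" using assms by (simp add: power2_eq_square)
  finally have "a * y / R\<^sup>2 \<le> t powr (1 - q) * (a powr q * (y / R))" by simp
  moreover have "0 \<le> t / R\<^sup>2" using assms by simp
  ultimately show ?thesis by linarith
qed

lemma integral_indicator_bx: "0 \<le> R \<Longrightarrow> (LINT z|lborel. indicat_real (bx R) z) = 4 * R\<^sup>2"
proof -
  assume R: "0 \<le> R"
  have "indicat_real (bx R) (x, y) = indicator {-R..R} x * indicator {-R..R} y" for x y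
    by (auto simp: bx_def indicator_def abs_le_iff)
  then have "(LINT z|lborel. indicat_real (bx R) z) = (LINT x|lborel. indicator {-R..R} x * (LINT y|lborel. indicator {-R..R} y))"
    using integral_plane(1)[OF integrable_indicator_bx, of R] by simp
  also have "\<dots> = 4 * R\<^sup>2" using R by (simp add: power2_eq_square)
  finally show ?thesis .
qed

text \<open>The weight is the size of the cutoff's gradient. After the splitting, the factor
  \<open>max |z_i| / R\<close> next to \<open>F^q\<close> is at most 1 on the box and tends to zero
  pointwise, so dominated convergence gives decay even at \<open>q = 2\<close>.\<close>

lemma weighted_tail_small:
  fixes F :: "real \<times> real \<Rightarrow> real"
  assumes F: "F \<in> borel_measurable borel" "\<And>z. 0 \<le> F z" "L1loc F" "integrable lborel (\<lambda>z. F z powr q)"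
    and q: "1 \<le> q" "q \<le> 2" and e: "e > 0"
  shows "\<exists>R0\<ge>1. \<forall>R\<ge>R0. (LINT z|lborel. indicator (bx R) z * (F z * (max \<bar>fst z\<bar> \<bar>snd z\<bar> / R\<^sup>2))) < e"
proof -
  \<comment> \<open>The box has area \<open>4 R^2\<close>, so the small values of \<open>F\<close>
    contribute \<open>4 t = e / 4\<close>; the remaining term is kept below
    \<open>e / 2\<close>.\<close>
  define t where "t = e / 16"
  have t: "t > 0" using e by (simp add: t_def)
  note [measurable] = F(1)
  define J where "J R z = F z powr q * (indicator (bx R) z * (max \<bar>fst z\<bar> \<bar>snd z\<bar> / R))" for R and z :: "real \<times> real"
  have w: "0 \<le> indicator (bx R) z * (max \<bar>fst z\<bar> \<bar>snd z\<bar> / R)" "indicator (bx R) z * (max \<bar>fst z\<bar> \<bar>snd z\<bar> / R) \<le> 1" if "R \<ge> 1" for R z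
    using that by (auto simp: indicator_def bx_def)
  have Jm[measurable]: "J R \<in> borel_measurable borel" for R unfolding J_def by measurable
  have Jb: "norm (J R z) \<le> F z powr q" if "R \<ge> 1" for R z
  proof -
    have "norm (J R z) = F z powr q * (indicator (bx R) z * (max \<bar>fst z\<bar> \<bar>snd z\<bar> / R))"
      unfolding J_def real_norm_def by (rule abs_of_nonneg) (intro mult_nonneg_nonneg[OF _ w(1)[OF that]] powr_ge_zero)
    also have "\<dots> \<le> F z powr q" by (rule mult_left_le[OF w(2)[OF that] powr_ge_zero])
    finally show ?thesis .
  qed
  have Ji: "integrable lborel (J R)" if "R \<ge> 1" for R
    by (rule Bochner_Integration.integrable_bound[OF F(4)]) (use Jb[OF that] in auto)
  have "((\<lambda>R. LINT z|lborel. J R z) \<longlongrightarrow> (LINT z|(lborel :: (real \<times> real) measure). 0)) at_top"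
  proof (rule integral_dominated_convergence_at_top[where w="\<lambda>z. F z powr q"])
    show "AE z in lborel. ((\<lambda>R. J R z) \<longlongrightarrow> 0) at_top"
    proof (rule AE_I2)
      fix z :: "real \<times> real"
      have "((\<lambda>R. F z powr q * (max \<bar>fst z\<bar> \<bar>snd z\<bar> / R)) \<longlongrightarrow> 0) at_top"
        by (intro tendsto_mult_right_zero tendsto_divide_0[OF tendsto_const] filterlim_at_top_imp_at_infinity filterlim_ident)
      moreover have "norm (J R z) \<le> F z powr q * (max \<bar>fst z\<bar> \<bar>snd z\<bar> / R)" if "R \<ge> 1" for R
        using that by (auto simp: J_def indicator_def abs_mult)
      then have "eventually (\<lambda>R. norm (J R z) \<le> F z powr q * (max \<bar>fst z\<bar> \<bar>snd z\<bar> / R)) at_top"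
        by (rule eventually_mono[OF eventually_ge_at_top[of 1]])
      ultimately show "((\<lambda>R. J R z) \<longlongrightarrow> 0) at_top" by (rule Lim_null_comparison[rotated])
    qed
    show "\<forall>\<^sub>F R in at_top. AE z in lborel. norm (J R z) \<le> F z powr q"
      using eventually_ge_at_top[of 1] by eventually_elim (use Jb in auto)
  qed (use F(4) in auto)
  then have "((\<lambda>R. LINT z|lborel. J R z) \<longlongrightarrow> 0) at_top" by simp
  moreover have "0 < e / (2 * t powr (1 - q))" using e t by simp
  ultimately have "eventually (\<lambda>R. (LINT z|lborel. J R z) < e / (2 * t powr (1 - q))) at_top"
    by (rule order_tendstoD(2))
  then obtain R1 where R1: "\<And>R. R \<ge> R1 \<Longrightarrow> (LINT z|lborel. J R z) < e / (2 * t powr (1 - q))"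
    by (auto simp: eventually_at_top_linorder)
  have "(LINT z|lborel. indicator (bx R) z * (F z * (max \<bar>fst z\<bar> \<bar>snd z\<bar> / R\<^sup>2))) < e" if R: "R \<ge> max 1 R1" for R
  proof -
    have R': "R \<ge> 1" "R \<ge> R1" using R by auto
    have "(LINT z|lborel. indicator (bx R) z * (F z * (max \<bar>fst z\<bar> \<bar>snd z\<bar> / R\<^sup>2)))
       \<le> (LINT z|lborel. indicator (bx R) z * (t / R\<^sup>2) + t powr (1 - q) * J R z)"
    proof (rule integral_mono)
      have "L1loc (\<lambda>z. F z * (max \<bar>fst z\<bar> \<bar>snd z\<bar> / R\<^sup>2 * indicator (bx R) z))"
      proof (rule integrable_imp_L1loc, rule L1loc_times_bounded[OF F(3), where R=R and M="1 / R"])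
        show "\<bar>max \<bar>fst z\<bar> \<bar>snd z\<bar> / R\<^sup>2 * indicator (bx R) z\<bar> \<le> 1 / R" for z
          using R' by (auto simp: indicator_def bx_def power2_eq_square field_simps)
      qed auto
      from integrable_bx_times[OF this, of R]
      show "integrable lborel (\<lambda>z. indicator (bx R) z * (F z * (max \<bar>fst z\<bar> \<bar>snd z\<bar> / R\<^sup>2)))"
        by (rule Bochner_Integration.integrable_cong[THEN iffD1, rotated -1]) (auto simp: indicator_def)
      show "integrable lborel (\<lambda>z. indicator (bx R) z * (t / R\<^sup>2) + t powr (1 - q) * J R z)"
        by (intro Bochner_Integration.integrable_add integrable_mult_left integrable_mult_right integrable_indicator_bx Ji R')
      fix z :: "real \<times> real"
      show "indicator (bx R) z * (F z * (max \<bar>fst z\<bar> \<bar>snd z\<bar> / R\<^sup>2)) \<le> indicator (bx R) z * (t / R\<^sup>2) + t powr (1 - q) * J R z"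
        using powr_split_bound[of "F z" t R q "max \<bar>fst z\<bar> \<bar>snd z\<bar>"] F(2)[of z] t R' q
        by (cases "z \<in> bx R") (auto simp: J_def bx_def)
    qed
    also have "\<dots> = (LINT z|lborel. indicat_real (bx R) z) * (t / R\<^sup>2) + t powr (1 - q) * (LINT z|lborel. J R z)"
      using Ji[OF R'(1)] integrable_indicator_bx by simp
    also have "(LINT z|lborel. indicat_real (bx R) z) * (t / R\<^sup>2) = e / 4"
      using R' by (subst integral_indicator_bx) (auto simp: t_def)
    also have "t powr (1 - q) * (LINT z|lborel. J R z) < t powr (1 - q) * (e / (2 * t powr (1 - q)))"
      using R1[OF R'(2)] t by (intro mult_strict_left_mono) auto
    also have "\<dots> = e / 2" using t by simp
    finally show ?thesis using e by linarith
  qed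
  then show ?thesis by (intro exI[of _ "max 1 R1"]) auto
qed

text \<open>The square makes the truncated paraboloid \<open>C^1\<close>. Its gradient at
  \<open>z\<close> is \<open>cutoff_slope R z\<close> times \<open>z\<close>, hence of size at most
  \<open>4 |z| / R^2\<close> and small near the origin.\<close>

definition cutoff :: "real \<Rightarrow> real \<times> real \<Rightarrow> real" where
  "cutoff R z = (max 0 (1 - ((fst z)\<^sup>2 + (snd z)\<^sup>2) / R\<^sup>2))\<^sup>2"

definition cutoff_slope :: "real \<Rightarrow> real \<times> real \<Rightarrow> real" where
  "cutoff_slope R z = - 4 * max 0 (1 - ((fst z)\<^sup>2 + (snd z)\<^sup>2) / R\<^sup>2) / R\<^sup>2"

lemma C1_cutoff:
  assumes "R > 0"
  shows "C1 (cutoff R) (\<lambda>z. cutoff_slope R z * fst z) (\<lambda>z. cutoff_slope R z * snd z)"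
proof -
  have "((\<lambda>s. (max 0 (1 - s / R\<^sup>2))\<^sup>2) has_real_derivative 2 * max 0 (1 - s / R\<^sup>2) * (- 1 / R\<^sup>2)) (at s)" for s
    by (rule DERIV_chain2[OF DERIV_pos_part_sq])
       (rule DERIV_cong[OF DERIV_diff[OF DERIV_const DERIV_cdivide[OF DERIV_ident]]], simp)
  moreover have "continuous_on UNIV (\<lambda>s. 2 * max 0 (1 - s / R\<^sup>2) * (- 1 / R\<^sup>2))"
    using assms by (intro continuous_intros) auto
  ultimately have "C1 (\<lambda>z. (max 0 (1 - ((fst z)\<^sup>2 + (snd z)\<^sup>2) / R\<^sup>2))\<^sup>2)
      (\<lambda>z. 2 * max 0 (1 - ((fst z)\<^sup>2 + (snd z)\<^sup>2) / R\<^sup>2) * (- 1 / R\<^sup>2) * (2 * fst z))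
      (\<lambda>z. 2 * max 0 (1 - ((fst z)\<^sup>2 + (snd z)\<^sup>2) / R\<^sup>2) * (- 1 / R\<^sup>2) * (2 * snd z))"
    by (rule C1_compose[OF C1_norm_sq])
  then show ?thesis by (simp add: cutoff_def[abs_def] cutoff_slope_def mult.assoc)
qed

lemma cutoff_bounds:
  assumes "R > 0"
  shows "0 \<le> cutoff R z" "cutoff R z \<le> 1" "z \<notin> bx R \<Longrightarrow> cutoff R z = 0" "z \<notin> bx R \<Longrightarrow> cutoff_slope R z = 0"
    "\<bar>cutoff_slope R z\<bar> \<le> 4 / R\<^sup>2"
    and "z \<in> bx R' \<Longrightarrow> 0 \<le> R' \<Longrightarrow> 2 * R' \<le> R \<Longrightarrow> 1 / 4 \<le> cutoff R z"
proof -
  define m where "m = max 0 (1 - ((fst z)\<^sup>2 + (snd z)\<^sup>2) / R\<^sup>2)"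
  have m: "0 \<le> m" "m \<le> 1" by (auto simp: m_def)
  have c: "cutoff R z = m\<^sup>2" "cutoff_slope R z = - 4 * m / R\<^sup>2" by (auto simp: cutoff_def cutoff_slope_def m_def)
  show "0 \<le> cutoff R z" "cutoff R z \<le> 1" using m by (auto simp: c power_le_one)
  show "\<bar>cutoff_slope R z\<bar> \<le> 4 / R\<^sup>2" using m by (simp add: c abs_mult divide_right_mono)
  have "m = 0" if "z \<notin> bx R"
  proof -
    have "R\<^sup>2 \<le> (fst z)\<^sup>2 \<or> R\<^sup>2 \<le> (snd z)\<^sup>2"
      using that assms by (auto simp: bx_def abs_le_square_iff[symmetric])
    then have "R\<^sup>2 \<le> (fst z)\<^sup>2 + (snd z)\<^sup>2" by (auto intro: add_increasing add_increasing2)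
    then show ?thesis using assms by (simp add: m_def)
  qed
  then show "z \<notin> bx R \<Longrightarrow> cutoff R z = 0" "z \<notin> bx R \<Longrightarrow> cutoff_slope R z = 0" by (auto simp: c)
  show "1 / 4 \<le> cutoff R z" if "z \<in> bx R'" "0 \<le> R'" "2 * R' \<le> R"
  proof -
    have "(fst z)\<^sup>2 \<le> R'\<^sup>2" "(snd z)\<^sup>2 \<le> R'\<^sup>2" using that by (auto simp: bx_def abs_le_square_iff[symmetric])
    moreover have "(2 * R')\<^sup>2 \<le> R\<^sup>2" using that by (intro power_mono) auto
    ultimately have "(fst z)\<^sup>2 + (snd z)\<^sup>2 \<le> R\<^sup>2 / 2" by (simp add: power_mult_distrib)
    then have "((fst z)\<^sup>2 + (snd z)\<^sup>2) / R\<^sup>2 \<le> 1 / 2" using assms by (simp add: divide_le_eq)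
    then have "1 / 2 \<le> m" unfolding m_def by linarith
    then have "(1 / 2)\<^sup>2 \<le> m\<^sup>2" by (intro power_mono) auto
    then show ?thesis by (simp add: c power2_eq_square)
  qed
qed

lemma norm_sum_abs: "\<bar>a\<bar> \<le> norm (a, b)" "\<bar>b\<bar> \<le> norm (a, b)" for a b :: real
  using norm_fst_le[of a b] norm_snd_le[of b a] by auto

lemma AE_lborel_ex:
  fixes Q :: "'a::euclidean_space \<Rightarrow> bool"
  assumes "AE x in lborel. Q x" shows "\<exists>x. Q x"
proof (rule ccontr)
  assume "\<nexists>x. Q x"
  with assms have "AE x in (lborel :: 'a measure). False" by simp
  then have "emeasure (lborel :: 'a measure) UNIV = 0"
    by (subst (asm) AE_iff_measurable[of UNIV]) auto
  then show False by simp
qed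

lemma AE_lborel_fst:
  assumes "AE x in lborel. Q (x :: real)" shows "AE z in (lborel :: (real \<times> real) measure). Q (fst z)"
proof -
  from assms obtain N where N: "{x. \<not> Q x} \<subseteq> N" "N \<in> null_sets lborel"
    by (auto elim!: AE_E simp: null_sets_def)
  have "emeasure lborel (N \<times> (UNIV :: real set)) = emeasure lborel N * emeasure lborel (UNIV :: real set)"
    using N(2) by (subst lborel_prod[symmetric], intro lborel.emeasure_pair_measure_Times) auto
  then have "N \<times> UNIV \<in> null_sets (lborel :: (real \<times> real) measure)"
    using N(2) by (auto simp: null_sets_def lborel_prod[symmetric])
  then show ?thesis
    by (rule AE_I') (use N(1) in auto)
qed

lemma conv1_abs:
  assumes F: "conv1 F f" shows "conv1 (\<lambda>n z. \<bar>F n z\<bar>) (\<lambda>z. \<bar>f z\<bar>)"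
proof -
  have l: "L1loc (F n)" "L1loc f" for n using F by (auto simp: conv1_def)
  have "(\<lambda>n. LINT z|lborel. indicator (bx R) z * \<bar>\<bar>F n z\<bar> - \<bar>f z\<bar>\<bar>) \<longlonglongrightarrow> 0" for R
  proof (rule real_tendsto_sandwich[OF _ _ tendsto_const])
    show "(\<lambda>n. LINT z|lborel. indicator (bx R) z * \<bar>F n z - f z\<bar>) \<longlonglongrightarrow> 0" using F by (simp add: conv1_def)
    show "eventually (\<lambda>n. (LINT z|lborel. indicator (bx R) z * \<bar>\<bar>F n z\<bar> - \<bar>f z\<bar>\<bar>) \<le> (LINT z|lborel. indicator (bx R) z * \<bar>F n z - f z\<bar>)) sequentially"
      by (intro always_eventually allI integral_mono integrable_bx_times L1loc_abs L1loc_diff l mult_left_mono abs_triangle_ineq3) auto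
  qed auto
  then show ?thesis by (auto simp: conv1_def L1loc_abs l)
qed

section \<open>The Euler equations and the pressure\<close>

locale weak_euler = weak_velocity +
  fixes P p1 p2 :: "real \<times> real \<Rightarrow> real" and q :: real
  assumes P: "wgrad P p1 p2"
    and euler: "AE z in lborel. v1 z * a1 z + v2 z * a2 z + p1 z = 0 \<and> v1 z * b1 z + v2 z * b2 z + p2 z = 0"
    and div: "AE z in lborel. a1 z + b2 z = 0"
    and q: "1 \<le> q" "q \<le> 2"
    and Lq: "integrable lborel (\<lambda>z. norm (p1 z, p2 z) powr q)"
begin

lemmas measP [measurable] = wgradD(4-6)[OF P, THEN L1loc_measurable]

text \<open>Using incompressibility to replace \<open>a1\<close> by \<open>- b2\<close> in the first
  equation and \<open>b2\<close> by \<open>- a1\<close> in the second turns the convective term into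
  \<open>|v|^2\<close> times the rotated angle form.\<close>

lemma grad_P: "AE z in lborel. p1 z = sq z * om2 z \<and> p2 z = - (sq z * om1 z)"
  using euler div AE_sq_pos
proof eventually_elim
  case (elim z)
  have "p1 z = v1 z * b2 z - v2 z * a2 z"
  proof -
    have "a1 z = - b2 z" using elim by simp
    then show ?thesis using elim(1) by simp
  qed
  moreover have "p2 z = - (v1 z * b1 z - v2 z * a1 z)"
  proof -
    have "b2 z = - a1 z" using elim by simp
    then show ?thesis using elim(1) by simp
  qed
  ultimately show ?case using elim(3) by (simp add: om1_def om2_def)
qed

text \<open>Convergence of the mollified form in \<open>L^1\<close> on boxes does not control its
  line integrals. Summable errors do: on almost every line they are bounded uniformly in
  \<open>k\<close>. So the path that follows one good horizontal line and then a good vertical line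
  has bounded integrals, whatever its end point on the latter. The bound variable \<open>q\<close>
  is the height of the base line, not the exponent.\<close>

lemma potential_bounded:
  "\<exists>(r :: nat \<Rightarrow> nat) q. strict_mono r \<and> (AE z in lborel. \<exists>C k0. \<forall>k\<ge>k0.
     \<bar>slint (\<lambda>s. moll (r k) 0 0 om1 (s, q)) 0 (fst z) + slint (\<lambda>t. moll (r k) 0 0 om2 (fst z, t)) q (snd z)\<bar> \<le> C)"
proof -
  note om = om_L2loc[THEN L2loc_imp_L1loc]
  define D where "D n z = \<bar>moll n 0 0 om1 z - om1 z\<bar> + \<bar>moll n 0 0 om2 z - om2 z\<bar>" for n z
  have D: "L1loc (D n)" "0 \<le> D n z" for n z
    unfolding D_def by (auto intro!: L1loc_add L1loc_abs L1loc_diff L1loc_moll om)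
  have "(LINT z|lborel. indicator (bx R) z * D n z) = (LINT z|lborel. indicator (bx R) z * \<bar>moll n 0 0 om1 z - om1 z\<bar>)
      + (LINT z|lborel. indicator (bx R) z * \<bar>moll n 0 0 om2 z - om2 z\<bar>)" for R n
    unfolding D_def distrib_left
    by (intro Bochner_Integration.integral_add integrable_bx_times L1loc_abs L1loc_diff L1loc_moll om)
  then have "(\<lambda>n. LINT z|lborel. indicator (bx R) z * D n z) \<longlonglongrightarrow> 0" for R
    using conv1_moll[OF om(1)] conv1_moll[OF om(2)] by (auto intro!: tendsto_add_zero simp: conv1_def)
  from fast_subsequence[OF D this] obtain r :: "nat \<Rightarrow> nat" where r: "strict_mono r"
    "(\<integral>\<^sup>+z. (\<Sum>k. ennreal (indicator (bx (real k)) z * D (r k) z)) \<partial>lborel) < \<infinity>" by blast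
  note lines = fast_lines[of "\<lambda>k. D (r k)", OF D r(2)]
  have fin: "(\<integral>\<^sup>+z. ennreal (indicator (bx (real n)) z * \<bar>f z\<bar>) \<partial>lborel) < \<infinity>" if "L1loc f" for f n
    using integrable_bx_times[OF L1loc_abs[OF that], of "real n"]
    by (subst nn_integral_eq_integral) auto
  have "AE y in lborel. (\<integral>\<^sup>+x. ennreal (indicator (bx (real n)) (x, y) * \<bar>om1 (x, y)\<bar>) \<partial>lborel) \<noteq> \<infinity>" for n
  proof (rule nn_integral_PInf_AE)
    show "(\<lambda>y. \<integral>\<^sup>+x. ennreal (indicator (bx (real n)) (x, y) * \<bar>om1 (x, y)\<bar>) \<partial>lborel) \<in> borel_measurable lborel"
      by measurable
    show "(\<integral>\<^sup>+y. (\<integral>\<^sup>+x. ennreal (indicator (bx (real n)) (x, y) * \<bar>om1 (x, y)\<bar>) \<partial>lborel) \<partial>lborel) \<noteq> \<infinity>"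
      using fin[OF om(1), of n] nn_integral_plane(2)[of "\<lambda>z. ennreal (indicator (bx (real n)) z * \<bar>om1 z\<bar>)"] by simp
  qed
  then have "AE y in lborel. \<forall>n. (\<integral>\<^sup>+x. ennreal (indicator (bx (real n)) (x, y) * \<bar>om1 (x, y)\<bar>) \<partial>lborel) \<noteq> \<infinity>"
    unfolding AE_all_countable by blast
  with lines(1) have "AE y in lborel. (\<exists>C<\<infinity>. \<forall>R k. R \<le> real k \<and> \<bar>y\<bar> \<le> real k \<longrightarrow>
           (\<integral>\<^sup>+s. indicator {-R..R} s * ennreal (D (r k) (s, y)) \<partial>lborel) \<le> C) \<and>
      (\<forall>n. (\<integral>\<^sup>+x. ennreal (indicator (bx (real n)) (x, y) * \<bar>om1 (x, y)\<bar>) \<partial>lborel) \<noteq> \<infinity>)"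
    by (rule AE_conjI)
  \<comment> \<open>The potentials for all \<open>k\<close> share one base line, so a single height
    is picked at which both the error bound and the integrability of \<open>om1\<close>
    hold.\<close>
  from AE_lborel_ex[OF this] obtain y0 C0 where C0: "C0 < \<infinity>" "\<And>R k. R \<le> real k \<Longrightarrow> \<bar>y0\<bar> \<le> real k \<Longrightarrow>
           (\<integral>\<^sup>+s. indicator {-R..R} s * ennreal (D (r k) (s, y0)) \<partial>lborel) \<le> C0"
     "\<And>n. (\<integral>\<^sup>+x. ennreal (indicator (bx (real n)) (x, y0) * \<bar>om1 (x, y0)\<bar>) \<partial>lborel) \<noteq> \<infinity>"
    by blast
  have "AE x in lborel. (\<integral>\<^sup>+y. ennreal (indicator (bx (real n)) (x, y) * \<bar>om2 (x, y)\<bar>) \<partial>lborel) \<noteq> \<infinity>" for n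
  proof (rule nn_integral_PInf_AE)
    show "(\<lambda>x. \<integral>\<^sup>+y. ennreal (indicator (bx (real n)) (x, y) * \<bar>om2 (x, y)\<bar>) \<partial>lborel) \<in> borel_measurable lborel"
      by measurable
    show "(\<integral>\<^sup>+x. (\<integral>\<^sup>+y. ennreal (indicator (bx (real n)) (x, y) * \<bar>om2 (x, y)\<bar>) \<partial>lborel) \<partial>lborel) \<noteq> \<infinity>"
      using fin[OF om(2), of n] nn_integral_plane(1)[of "\<lambda>z. ennreal (indicator (bx (real n)) z * \<bar>om2 z\<bar>)"] by simp
  qed
  then have "AE x in lborel. \<forall>n. (\<integral>\<^sup>+y. ennreal (indicator (bx (real n)) (x, y) * \<bar>om2 (x, y)\<bar>) \<partial>lborel) \<noteq> \<infinity>"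
    unfolding AE_all_countable by blast
  with lines(2) have AEx: "AE x in lborel. (\<exists>C<\<infinity>. \<forall>R k. R \<le> real k \<and> \<bar>x\<bar> \<le> real k \<longrightarrow>
           (\<integral>\<^sup>+t. indicator {-R..R} t * ennreal (D (r k) (x, t)) \<partial>lborel) \<le> C) \<and>
      (\<forall>n. (\<integral>\<^sup>+y. ennreal (indicator (bx (real n)) (x, y) * \<bar>om2 (x, y)\<bar>) \<partial>lborel) \<noteq> \<infinity>)"
    by (rule AE_conjI)
  note [measurable] = L1loc_measurable[OF D(1)]
  \<comment> \<open>The bound starts at some \<open>k0\<close> because \<open>fast_lines\<close>
    controls index \<open>k\<close> only within the box of size \<open>k\<close>, which has to
    contain the segment.\<close>
  have line_bound: "\<exists>C k0. \<forall>k\<ge>k0. \<bar>slint (\<lambda>s. G k s) a b\<bar> \<le> C"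
    if G: "\<And>k. continuous_on UNIV (G k)" and g[measurable]: "g \<in> borel_measurable borel" "\<And>k. d k \<in> borel_measurable borel"
      and d: "\<And>k s. \<bar>G k s\<bar> \<le> d k s + \<bar>g s\<bar>" "\<And>k s. 0 \<le> d k s"
      and C: "C < \<infinity>" "\<And>R k. R \<le> real k \<Longrightarrow> \<bar>y\<bar> \<le> real k \<Longrightarrow> (\<integral>\<^sup>+s. indicator {-R..R} s * ennreal (d k s) \<partial>lborel) \<le> C"
      and fin: "\<And>R. (\<integral>\<^sup>+s. indicator {-R..R} s * ennreal \<bar>g s\<bar> \<partial>lborel) < \<infinity>"
    for G d g C y a b
  proof -
    define R where "R = max \<bar>a\<bar> \<bar>b\<bar>"
    define B where "B = C + (\<integral>\<^sup>+s. indicator {-R..R} s * ennreal \<bar>g s\<bar> \<partial>lborel)"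
    have "B < \<infinity>" using C(1) fin by (simp add: B_def)
    obtain k0 where k0: "max R \<bar>y\<bar> \<le> real k0" using real_arch_simple by blast
    have "\<bar>slint (G k) a b\<bar> \<le> enn2real B" if k: "k \<ge> k0" for k
    proof -
      have "ennreal \<bar>slint (G k) a b\<bar> \<le> (\<integral>\<^sup>+s. indicator {-R..R} s * ennreal \<bar>G k s\<bar> \<partial>lborel)"
        by (rule slint_bound[OF G]) (auto simp: R_def)
      also have "\<dots> \<le> (\<integral>\<^sup>+s. indicator {-R..R} s * ennreal (d k s) + indicator {-R..R} s * ennreal \<bar>g s\<bar> \<partial>lborel)"
        using d by (intro nn_integral_mono) (auto simp: indicator_def ennreal_plus[symmetric] simp del: ennreal_plus intro!: ennreal_leI)
      also have "\<dots> = (\<integral>\<^sup>+s. indicator {-R..R} s * ennreal (d k s) \<partial>lborel) + (\<integral>\<^sup>+s. indicator {-R..R} s * ennreal \<bar>g s\<bar> \<partial>lborel)"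
        by (rule nn_integral_add) measurable
      also have "\<dots> \<le> B" unfolding B_def using k0 k by (intro add_right_mono C(2)) auto
      also have "B = ennreal (enn2real B)" using \<open>B < \<infinity>\<close> by simp
      finally show ?thesis by (simp add: ennreal_le_iff)
    qed
    then show ?thesis by blast
  qed
  have cont: "continuous_on UNIV (\<lambda>s. moll n 0 0 om1 (s, y))" "continuous_on UNIV (\<lambda>s. moll n 0 0 om2 (x, s))" for n x y
    by (intro continuous_on_compose2[OF continuous_on_moll[OF om(1)]] continuous_on_compose2[OF continuous_on_moll[OF om(2)]] continuous_intros; simp)+
  have dle: "\<bar>moll n 0 0 om1 z\<bar> \<le> D n z + \<bar>om1 z\<bar>" "\<bar>moll n 0 0 om2 z\<bar> \<le> D n z + \<bar>om2 z\<bar>" for n z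
    unfolding D_def by linarith+
  have "AE x in lborel. \<forall>y. \<exists>C k0. \<forall>k\<ge>k0.
     \<bar>slint (\<lambda>s. moll (r k) 0 0 om1 (s, y0)) 0 x + slint (\<lambda>t. moll (r k) 0 0 om2 (x, t)) y0 y\<bar> \<le> C"
    using AEx
  proof eventually_elim
    case (elim x)
    then obtain C where C: "C < \<infinity>" "\<And>R k. R \<le> real k \<Longrightarrow> \<bar>x\<bar> \<le> real k \<Longrightarrow>
           (\<integral>\<^sup>+t. indicator {-R..R} t * ennreal (D (r k) (x, t)) \<partial>lborel) \<le> C" by blast
    have f1: "(\<integral>\<^sup>+s. indicator {-R..R} s * ennreal \<bar>om1 (s, y0)\<bar> \<partial>lborel) < \<infinity>" for R
    proof -
      obtain n where n: "max R \<bar>y0\<bar> \<le> real n" using real_arch_simple by blast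
      have "(\<integral>\<^sup>+s. indicator {-R..R} s * ennreal \<bar>om1 (s, y0)\<bar> \<partial>lborel) \<le> (\<integral>\<^sup>+x. ennreal (indicator (bx (real n)) (x, y0) * \<bar>om1 (x, y0)\<bar>) \<partial>lborel)"
        using n by (intro nn_integral_mono) (auto simp: indicator_def bx_def)
      also have "\<dots> < \<infinity>" using C0(3)[of n] by (simp add: less_top)
      finally show ?thesis .
    qed
    have f2: "(\<integral>\<^sup>+s. indicator {-R..R} s * ennreal \<bar>om2 (x, s)\<bar> \<partial>lborel) < \<infinity>" for R
    proof -
      obtain n where n: "max R \<bar>x\<bar> \<le> real n" using real_arch_simple by blast
      have "(\<integral>\<^sup>+s. indicator {-R..R} s * ennreal \<bar>om2 (x, s)\<bar> \<partial>lborel) \<le> (\<integral>\<^sup>+y. ennreal (indicator (bx (real n)) (x, y) * \<bar>om2 (x, y)\<bar>) \<partial>lborel)"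
        using n by (intro nn_integral_mono) (auto simp: indicator_def bx_def)
      also have "\<dots> < \<infinity>" using elim by (simp add: less_top)
      finally show ?thesis .
    qed
    show ?case
    proof
      fix y
      have "\<exists>A k1. \<forall>k\<ge>k1. \<bar>slint (\<lambda>s. moll (r k) 0 0 om1 (s, y0)) 0 x\<bar> \<le> A"
        by (rule line_bound[OF cont(1) _ _ dle(1) D(2) C0(1) _ f1]) (measurable, rule C0(2))
      then obtain A k1 where A: "\<And>k. k \<ge> k1 \<Longrightarrow> \<bar>slint (\<lambda>s. moll (r k) 0 0 om1 (s, y0)) 0 x\<bar> \<le> A" by blast
      have "\<exists>B k2. \<forall>k\<ge>k2. \<bar>slint (\<lambda>s. moll (r k) 0 0 om2 (x, s)) y0 y\<bar> \<le> B"
        by (rule line_bound[OF cont(2) _ _ dle(2) D(2) C(1) _ f2]) (measurable, rule C(2))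
      then obtain B k2 where B: "\<And>k. k \<ge> k2 \<Longrightarrow> \<bar>slint (\<lambda>s. moll (r k) 0 0 om2 (x, s)) y0 y\<bar> \<le> B" by blast
      have "\<forall>k\<ge>max k1 k2. \<bar>slint (\<lambda>s. moll (r k) 0 0 om1 (s, y0)) 0 x + slint (\<lambda>t. moll (r k) 0 0 om2 (x, t)) y0 y\<bar> \<le> A + B"
        using A B by (auto intro!: order_trans[OF abs_triangle_ineq] add_mono)
      then show "\<exists>C k0. \<forall>k\<ge>k0. \<bar>slint (\<lambda>s. moll (r k) 0 0 om1 (s, y0)) 0 x + slint (\<lambda>t. moll (r k) 0 0 om2 (x, t)) y0 y\<bar> \<le> C"
        by blast
    qed
  qed
  then have "AE z in lborel. \<exists>C k0. \<forall>k\<ge>k0.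
     \<bar>slint (\<lambda>s. moll (r k) 0 0 om1 (s, y0)) 0 (fst z) + slint (\<lambda>t. moll (r k) 0 0 om2 (fst z, t)) y0 (snd z)\<bar> \<le> C"
    by (rule AE_lborel_fst[THEN eventually_mono]) blast
  with r(1) show ?thesis by blast
qed

text \<open>The mollified density \<open>G k\<close> has no sign, so positivity is exploited for its
  limit \<open>D\<close>, at the price of an \<open>L^1\<close> error. The weights
  \<open>T k\<close> need not converge: it is enough that at almost every point they stay above a
  positive constant.\<close>

lemma pressure_gradient_eq_0: "AE z in lborel. p1 z = 0 \<and> p2 z = 0"
proof -
  note om = om_L2loc[THEN L2loc_imp_L1loc]
  obtain r :: "nat \<Rightarrow> nat" and y0 where r: "strict_mono r" "AE z in lborel. \<exists>C k0. \<forall>k\<ge>k0.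
     \<bar>slint (\<lambda>s. moll (r k) 0 0 om1 (s, y0)) 0 (fst z) + slint (\<lambda>t. moll (r k) 0 0 om2 (fst z, t)) y0 (snd z)\<bar> \<le> C"
    using potential_bounded by blast
  define \<phi> where "\<phi> k z = slint (\<lambda>s. moll (r k) 0 0 om1 (s, y0)) 0 (fst z) + slint (\<lambda>t. moll (r k) 0 0 om2 (fst z, t)) y0 (snd z)" for k z
  define A1 where "A1 k = moll (r k) 0 0 om1" for k
  define A2 where "A2 k = moll (r k) 0 0 om2" for k
  define Q1 where "Q1 k = moll (r k) 0 0 p1" for k
  define Q2 where "Q2 k = moll (r k) 0 0 p2" for k
  \<comment> \<open>The rotated pairing of the two closed fields. Its limit \<open>D\<close> equals
    \<open>|\<nabla>P|^2 / |v|^2\<close> by \<open>grad_P\<close>, so the weight never has to be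
    mollified.\<close>
  define G where "G k z = A2 k z * Q1 k z - A1 k z * Q2 k z" for k z
  define D where "D z = om2 z * p1 z - om1 z * p2 z" for z
  define T where "T k z = inverse (1 + (\<phi> k z)\<^sup>2)" for k z
  have C\<phi>: "C1 (\<phi> k) (A1 k) (A2 k)" for k
  proof -
    obtain c1 c c2 where "C1 (moll (r k) 0 0 om1) c1 c" "C1 (moll (r k) 0 0 om2) c c2" using moll_om_C1 by blast
    from closed_form_potential[OF this] show ?thesis unfolding \<phi>_def[abs_def] A1_def A2_def .
  qed
  have CT: "C1 (\<lambda>z. arctan (\<phi> k z)) (\<lambda>z. T k z * A1 k z) (\<lambda>z. T k z * A2 k z)" for k
    unfolding T_def
  proof (rule C1_compose[OF C\<phi> DERIV_arctan])
    have "1 + s\<^sup>2 \<noteq> 0" for s :: real using zero_le_power2[of s] by linarith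
    then show "continuous_on UNIV (\<lambda>s::real. inverse (1 + s\<^sup>2))" by (intro continuous_intros) auto
  qed
  have T: "0 < T k z" "T k z \<le> 1" for k z
    using zero_le_power2[of "\<phi> k z"] by (auto simp: T_def add_pos_nonneg inverse_le_1_iff)
  have Tc: "continuous_on UNIV (T k)" for k
  proof -
    have "1 + (\<phi> k z)\<^sup>2 \<noteq> 0" for z using zero_le_power2[of "\<phi> k z"] by linarith
    then show ?thesis unfolding T_def[abs_def] by (intro continuous_intros C1D(1)[OF C\<phi>]) auto
  qed
  have [measurable]: "T k \<in> borel_measurable borel" for k by (rule borel_measurable_continuous_onI[OF Tc])
  have Ac: "continuous_on UNIV (A1 k)" "continuous_on UNIV (A2 k)" "continuous_on UNIV (Q1 k)" "continuous_on UNIV (Q2 k)" for k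
    unfolding A1_def A2_def Q1_def Q2_def by (intro continuous_on_moll om wgradD[OF P])+
  have Gc: "continuous_on UNIV (G k)" for k unfolding G_def[abs_def] by (intro continuous_intros Ac)
  have [measurable]: "G k \<in> borel_measurable borel" for k by (rule borel_measurable_continuous_onI[OF Gc])
  have cG: "conv1 G D"
    unfolding G_def[abs_def] D_def[abs_def] A1_def A2_def Q1_def Q2_def
    by (intro conv1_diff conv1_mult conv2_subseq[OF conv2_moll r(1)] om_L2loc wgradD[OF P])
  have lD: "L1loc D" and lG: "L1loc (G k)" for k using cG by (auto simp: conv1_def)
  note [measurable] = L1loc_measurable[OF lD]
  have AED: "AE z in lborel. D z = ((p1 z)\<^sup>2 + (p2 z)\<^sup>2) / sq z \<and> 0 \<le> D z"
    using grad_P AE_sq_pos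
  proof eventually_elim
    case (elim z)
    then have "om2 z = p1 z / sq z" "om1 z = - p2 z / sq z" by (auto simp: field_simps)
    then have "D z = ((p1 z)\<^sup>2 + (p2 z)\<^sup>2) / sq z" by (simp add: D_def power2_eq_square add_divide_distrib)
    with elim show ?case by simp
  qed
  define F where "F z = norm (p1 z, p2 z)" for z
  have F: "\<bar>p1 z\<bar> \<le> F z" "\<bar>p2 z\<bar> \<le> F z" "0 \<le> F z" for z by (auto simp: F_def norm_sum_abs)
  have Fm[measurable]: "F \<in> borel_measurable borel" unfolding F_def norm_Pair by measurable
  have lF: "L1loc F"
  proof (rule L1loc_bound[OF L1loc_add[OF L1loc_abs L1loc_abs] Fm])
    show "\<bar>F z\<bar> \<le> \<bar>p1 z\<bar> + \<bar>p2 z\<bar>" for z using norm_Pair_le[of "p1 z" "p2 z"] by (simp add: F_def)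
  qed (rule wgradD[OF P])+
  define W where "W R z = indicator (bx R) z * (max \<bar>fst z\<bar> \<bar>snd z\<bar> / R\<^sup>2)" for R and z :: "real \<times> real"
  have Wm[measurable]: "W R \<in> borel_measurable borel" for R unfolding W_def[abs_def] by measurable
  have W: "0 \<le> W R z" "z \<notin> bx R \<Longrightarrow> W R z = 0" "R > 0 \<Longrightarrow> \<bar>W R z\<bar> \<le> 1 / R" for R z
    by (auto simp: W_def indicator_def bx_def power2_eq_square field_simps)
  \<comment> \<open>The closed field \<open>(Q1, Q2)\<close> is paired with the gradient of
    \<open>cutoff R\<close> times \<open>arctan \<phi>\<close>. The constant 8 is the product of
    \<open>|arctan| \<le> 2\<close> and \<open>|cutoff_slope| \<le> 4 / R^2\<close>.\<close>
  have main: "(LINT z|lborel. cutoff R z * (T k z * G k z)) \<le> 8 * (LINT z|lborel. \<bar>Q1 k z\<bar> * W R z) + 8 * (LINT z|lborel. \<bar>Q2 k z\<bar> * W R z)"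
    if R: "R > 0" for R k
  proof -
    note cb = cutoff_bounds[OF R]
    note Cw = C1_mult[OF CT[of k] C1_cutoff[OF R]]
    obtain c1 c c2 where b: "C1 (Q1 k) c1 c" "C1 (Q2 k) c c2"
      using wgrad_moll(2)[OF P, of "r k"] unfolding Q1_def Q2_def by blast
    have "(LINT z|lborel. Q2 k z * (T k z * A1 k z * cutoff R z + arctan (\<phi> k z) * (cutoff_slope R z * fst z))
        - Q1 k z * (T k z * A2 k z * cutoff R z + arctan (\<phi> k z) * (cutoff_slope R z * snd z))) = 0"
      by (rule curl_pairing_eq_0[OF Cw _ b, of R]) (simp add: cb)
    also have "(\<lambda>z. Q2 k z * (T k z * A1 k z * cutoff R z + arctan (\<phi> k z) * (cutoff_slope R z * fst z))
        - Q1 k z * (T k z * A2 k z * cutoff R z + arctan (\<phi> k z) * (cutoff_slope R z * snd z)))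
      = (\<lambda>z. arctan (\<phi> k z) * cutoff_slope R z * (fst z * Q2 k z - snd z * Q1 k z) - cutoff R z * (T k z * G k z))"
      by (rule ext) (simp add: G_def algebra_simps)
    finally have eq: "(LINT z|lborel. arctan (\<phi> k z) * cutoff_slope R z * (fst z * Q2 k z - snd z * Q1 k z) - cutoff R z * (T k z * G k z)) = 0" .
    have slc: "continuous_on UNIV (cutoff_slope R)"
      unfolding cutoff_slope_def[abs_def] using R by (intro continuous_intros) auto
    have i1: "integrable lborel (\<lambda>z. arctan (\<phi> k z) * cutoff_slope R z * (fst z * Q2 k z - snd z * Q1 k z))"
      by (rule continuous_supp_integrable[of _ R])
         (auto intro!: continuous_intros slc C1D(1)[OF CT] Ac simp: cb)
    have i2: "integrable lborel (\<lambda>z. cutoff R z * (T k z * G k z))"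
      by (rule continuous_supp_integrable[of _ R])
         (auto intro!: continuous_intros C1D(1)[OF C1_cutoff[OF R]] Tc Gc simp: cb)
    have i3: "integrable lborel (\<lambda>z. \<bar>f z\<bar> * W R z)" if "continuous_on UNIV f" for f
      by (rule L1loc_times_bounded[OF L1loc_abs[OF continuous_imp_L1loc[OF that]] Wm, of R "1 / R"]) (use W R in auto)
    from eq have "(LINT z|lborel. cutoff R z * (T k z * G k z)) = (LINT z|lborel. arctan (\<phi> k z) * cutoff_slope R z * (fst z * Q2 k z - snd z * Q1 k z))"
      using i1 i2 by simp
    also have "\<dots> \<le> (LINT z|lborel. 8 * (\<bar>Q1 k z\<bar> * W R z) + 8 * (\<bar>Q2 k z\<bar> * W R z))"
    proof (rule integral_mono[OF i1])
      show "integrable lborel (\<lambda>z. 8 * (\<bar>Q1 k z\<bar> * W R z) + 8 * (\<bar>Q2 k z\<bar> * W R z))"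
        by (intro Bochner_Integration.integrable_add integrable_mult_right i3 Ac)
      fix z :: "real \<times> real"
      show "arctan (\<phi> k z) * cutoff_slope R z * (fst z * Q2 k z - snd z * Q1 k z) \<le> 8 * (\<bar>Q1 k z\<bar> * W R z) + 8 * (\<bar>Q2 k z\<bar> * W R z)"
      proof (cases "z \<in> bx R")
        case True
        let ?m = "max \<bar>fst z\<bar> \<bar>snd z\<bar>"
        have "\<bar>arctan (\<phi> k z)\<bar> \<le> 2"
          using arctan_bounded[of "\<phi> k z"] pi_less_4 by (auto simp: abs_le_iff)
        moreover have "\<bar>fst z * Q2 k z - snd z * Q1 k z\<bar> \<le> ?m * \<bar>Q2 k z\<bar> + ?m * \<bar>Q1 k z\<bar>"
          by (intro order_trans[OF abs_triangle_ineq4] add_mono) (auto simp: abs_mult intro!: mult_right_mono)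
        ultimately have "\<bar>arctan (\<phi> k z)\<bar> * \<bar>cutoff_slope R z\<bar> * \<bar>fst z * Q2 k z - snd z * Q1 k z\<bar>
           \<le> 2 * (4 / R\<^sup>2) * (?m * \<bar>Q2 k z\<bar> + ?m * \<bar>Q1 k z\<bar>)"
          using cb(5)[of z] by (intro mult_mono) auto
        also have "\<dots> = 8 * (\<bar>Q1 k z\<bar> * W R z) + 8 * (\<bar>Q2 k z\<bar> * W R z)"
          using True by (simp add: W_def algebra_simps add_divide_distrib)
        finally show ?thesis by (simp only: abs_mult[symmetric] abs_le_iff)
      qed (simp add: cb W(1))
    qed
    also have "\<dots> = 8 * (LINT z|lborel. \<bar>Q1 k z\<bar> * W R z) + 8 * (LINT z|lborel. \<bar>Q2 k z\<bar> * W R z)"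
      using i3[OF Ac(3)] i3[OF Ac(4)] by simp
    finally show ?thesis .
  qed
  have zero: "AE z in lborel. z \<in> bx R0 \<longrightarrow> D z = 0" if R0: "R0 > 0" for R0
  proof -
    define L where "L k z = indicator (bx R0) z * (T k z * D z)" for k z
    have Lm[measurable]: "L k \<in> borel_measurable borel" for k unfolding L_def[abs_def] by measurable
    have TD: "L1loc (\<lambda>z. T k z * g z)" if "L1loc g" for g k
    proof (rule L1loc_bound[OF L1loc_abs[OF that]])
      note [measurable] = L1loc_measurable[OF that]
      show "(\<lambda>z. T k z * g z) \<in> borel_measurable borel" by measurable
      show "\<bar>T k z * g z\<bar> \<le> \<bar>g z\<bar>" for z
        using T[of k z] by (simp add: abs_mult mult_left_le_one_le less_imp_le)
    qed
    have L0: "AE z in lborel. 0 \<le> L k z" for k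
      using AED
    proof eventually_elim
      case (elim z)
      then have "0 \<le> T k z * D z" using T(1)[of k z] by (intro mult_nonneg_nonneg) auto
      then show ?case by (simp add: L_def)
    qed
    have Li: "integrable lborel (L k)" for k unfolding L_def[abs_def] by (intro integrable_bx_times TD lD)
    have small: "(\<integral>\<^sup>+z. liminf (\<lambda>k. ennreal (L k z)) \<partial>lborel) \<le> ennreal e" if e: "e > 0" for e
    proof -
      \<comment> \<open>A factor 4 is lost because the cutoff is only known to be at least
        \<open>1 / 4\<close> on \<open>bx R0\<close>, and a factor \<open>16 = 8 + 8\<close> comes
        from the two components in \<open>main\<close>.\<close>
      have "e / 64 > 0" using e by simp
      from weighted_tail_small[OF Fm F(3) lF Lq[folded F_def] q this] obtain R1 where R1: "R1 \<ge> 1"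
        "\<And>R. R \<ge> R1 \<Longrightarrow> (LINT z|lborel. indicator (bx R) z * (F z * (max \<bar>fst z\<bar> \<bar>snd z\<bar> / R\<^sup>2))) < e / 64" by blast
      define R where "R = max R1 (2 * R0)"
      have R: "R > 0" "2 * R0 \<le> R" "R1 \<le> R" using R1 R0 by (auto simp: R_def)
      note cb = cutoff_bounds[OF R(1)]
      define E where "E k = 8 * (LINT z|lborel. \<bar>Q1 k z\<bar> * W R z) + 8 * (LINT z|lborel. \<bar>Q2 k z\<bar> * W R z)" for k
      define E' where "E' = 8 * (LINT z|lborel. \<bar>p1 z\<bar> * W R z) + 8 * (LINT z|lborel. \<bar>p2 z\<bar> * W R z)"
      define Y where "Y k = (LINT z|lborel. indicator (bx R) z * \<bar>G k z - D z\<bar>)" for k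
      have ci: "(\<lambda>k. LINT z|lborel. \<bar>moll (r k) 0 0 p z\<bar> * W R z) \<longlonglongrightarrow> (LINT z|lborel. \<bar>p z\<bar> * W R z)" if "L2loc p" for p
        by (rule conv1_integral[OF conv1_abs[OF conv2_imp_conv1[OF conv2_subseq[OF conv2_moll[OF that] r(1)]]] Wm W(3)[OF R(1)] W(2)])
      have "E \<longlonglongrightarrow> E'"
        unfolding E_def[abs_def] E'_def Q1_def Q2_def by (intro tendsto_intros ci wgradD[OF P])
      moreover have "Y \<longlonglongrightarrow> 0" using cG unfolding Y_def[abs_def] conv1_def by blast
      ultimately have lim: "(\<lambda>k. ennreal (4 * (E k + Y k))) \<longlonglongrightarrow> ennreal (4 * (E' + 0))"
        by (intro tendsto_ennrealI tendsto_intros)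
      have iF: "integrable lborel (\<lambda>z. F z * W R z)"
        by (rule L1loc_times_bounded[OF lF Wm W(3)[OF R(1)] W(2)])
      have le: "(LINT z|lborel. \<bar>p z\<bar> * W R z) \<le> (LINT z|lborel. F z * W R z)" if "\<And>z. \<bar>p z\<bar> \<le> F z" "L1loc p" for p
        using that W(1)
        by (intro integral_mono iF L1loc_times_bounded[OF L1loc_abs[OF that(2)] Wm W(3)[OF R(1)] W(2)] mult_right_mono) auto
      have "E' \<le> 16 * (LINT z|lborel. F z * W R z)"
        using le[OF F(1) wgradD(5)[OF P]] le[OF F(2) wgradD(6)[OF P]] unfolding E'_def by linarith
      also have "(LINT z|lborel. F z * W R z) = (LINT z|lborel. indicator (bx R) z * (F z * (max \<bar>fst z\<bar> \<bar>snd z\<bar> / R\<^sup>2)))"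
        by (intro Bochner_Integration.integral_cong refl) (simp add: W_def mult.left_commute)
      finally have E': "4 * E' \<le> e" using R1(2)[OF R(3)] by linarith
      \<comment> \<open>As \<open>cutoff R\<close> times \<open>T k\<close> lies between 0 and the
        indicator of \<open>bx R\<close>, exchanging \<open>D\<close> for \<open>G k\<close> costs
        at most \<open>Y k\<close>; the remaining integral is the one bounded in
        \<open>main\<close>.\<close>
      have Lle: "(LINT z|lborel. L k z) \<le> 4 * (E k + Y k)" for k
      proof -
        have i1: "integrable lborel (\<lambda>z. cutoff R z * (T k z * D z))" "integrable lborel (\<lambda>z. cutoff R z * (T k z * G k z))"
        proof -
          have cm: "cutoff R \<in> borel_measurable borel" by (rule borel_measurable_continuous_onI[OF C1D(1)[OF C1_cutoff[OF R(1)]]])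
          have "integrable lborel (\<lambda>z. (T k z * D z) * cutoff R z)" "integrable lborel (\<lambda>z. (T k z * G k z) * cutoff R z)"
            by (rule L1loc_times_bounded[OF TD[OF lD] cm, of 1 R] L1loc_times_bounded[OF TD[OF lG] cm, of 1 R]; use cb in auto)+
          then show "integrable lborel (\<lambda>z. cutoff R z * (T k z * D z))" "integrable lborel (\<lambda>z. cutoff R z * (T k z * G k z))"
            by (simp_all only: mult.commute)
        qed
        have i2: "integrable lborel (\<lambda>z. indicator (bx R) z * \<bar>G k z - D z\<bar>)"
          by (intro integrable_bx_times L1loc_abs L1loc_diff lG lD)
        have "(LINT z|lborel. L k z) \<le> (LINT z|lborel. 4 * (cutoff R z * (T k z * D z)))"
        proof (rule integral_mono_AE[OF Li])
          show "AE z in lborel. L k z \<le> 4 * (cutoff R z * (T k z * D z))"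
            using AED
          proof eventually_elim
            case (elim z)
            then have TD0: "0 \<le> T k z * D z" using T(1)[of k z] by (intro mult_nonneg_nonneg) auto
            show ?case
            proof (cases "z \<in> bx R0")
              case True
              then have "1 / 4 \<le> cutoff R z" using cb(6)[of z R0] R0 R by simp
              from mult_right_mono[OF this TD0] show ?thesis using True by (simp add: L_def)
            qed (use TD0 cb(1)[of z] in \<open>simp add: L_def\<close>)
          qed
        qed (intro integrable_mult_right i1)
        also have "\<dots> = 4 * (LINT z|lborel. cutoff R z * (T k z * D z))" by simp
        also have "(LINT z|lborel. cutoff R z * (T k z * D z)) \<le> (LINT z|lborel. cutoff R z * (T k z * G k z) + indicator (bx R) z * \<bar>G k z - D z\<bar>)"
        proof (rule integral_mono[OF i1(1)])
          fix z
          have "cutoff R z * T k z * (D z - G k z) \<le> \<bar>cutoff R z * T k z\<bar> * \<bar>G k z - D z\<bar>"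
            using abs_ge_self[of "cutoff R z * T k z * (D z - G k z)"]
            by (simp only: abs_mult abs_minus_commute[of "D z"])
          also have "\<dots> \<le> indicator (bx R) z * \<bar>G k z - D z\<bar>"
          proof (rule mult_right_mono)
            show "\<bar>cutoff R z * T k z\<bar> \<le> indicator (bx R) z"
              using cb(1-3)[of z] T[of k z] by (cases "z \<in> bx R") (auto simp: abs_mult intro: mult_le_one)
          qed simp
          finally show "cutoff R z * (T k z * D z) \<le> cutoff R z * (T k z * G k z) + indicator (bx R) z * \<bar>G k z - D z\<bar>"
            by (simp add: algebra_simps)
        qed (intro Bochner_Integration.integrable_add i1 i2)
        also have "\<dots> = (LINT z|lborel. cutoff R z * (T k z * G k z)) + Y k" using i1 i2 by (simp add: Y_def)
        also have "\<dots> \<le> E k + Y k" using main[OF R(1), of k] by (simp add: E_def)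
        finally show ?thesis by simp
      qed
      \<comment> \<open>Fatou's lemma, since \<open>L k\<close> has no known limit; the upper bounds
        on its integrals do converge.\<close>
      have "(\<integral>\<^sup>+z. liminf (\<lambda>k. ennreal (L k z)) \<partial>lborel) \<le> liminf (\<lambda>k. \<integral>\<^sup>+z. ennreal (L k z) \<partial>lborel)"
        by (rule nn_integral_liminf) measurable
      also have "\<dots> = liminf (\<lambda>k. ennreal (LINT z|lborel. L k z))"
        by (simp add: nn_integral_eq_integral[OF Li L0])
      also have "\<dots> \<le> liminf (\<lambda>k. ennreal (4 * (E k + Y k)))"
        by (intro Liminf_mono always_eventually allI ennreal_leI Lle)
      also have "\<dots> = ennreal (4 * (E' + 0))" by (rule lim_imp_Liminf[OF _ lim]) simp
      also have "\<dots> \<le> ennreal e" using E' by (intro ennreal_leI) simp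
      finally show ?thesis .
    qed
    have "(\<integral>\<^sup>+z. liminf (\<lambda>k. ennreal (L k z)) \<partial>lborel) \<le> 0"
    proof (rule ennreal_le_epsilon)
      fix e :: real assume "0 < e"
      from small[OF this] show "(\<integral>\<^sup>+z. liminf (\<lambda>k. ennreal (L k z)) \<partial>lborel) \<le> 0 + ennreal e" by simp
    qed
    then have "(\<integral>\<^sup>+z. liminf (\<lambda>k. ennreal (L k z)) \<partial>lborel) = 0" by simp
    moreover have "(\<lambda>z. liminf (\<lambda>k. ennreal (L k z))) \<in> borel_measurable lborel" by measurable
    ultimately have "AE z in lborel. liminf (\<lambda>k. ennreal (L k z)) = 0"
      by (simp only: nn_integral_0_iff_AE)
    then show ?thesis
      using r(2) AED
    proof eventually_elim
      case (elim z)
      from elim(2) obtain C k0 where C: "\<forall>k\<ge>k0. \<bar>\<phi> k z\<bar> \<le> C" unfolding \<phi>_def by blast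
      show ?case
      proof (rule impI, rule ccontr)
        assume z: "z \<in> bx R0" and "D z \<noteq> 0"
        moreover have "0 \<le> D z" using elim by blast
        ultimately have D: "D z > 0" by linarith
        \<comment> \<open>Where the potentials are bounded by \<open>C\<close>, the weight is at
          least \<open>1 / (1 + C^2)\<close> for large \<open>k\<close>, so a vanishing lower limit
          forces \<open>D z = 0\<close>.\<close>
        have "inverse (1 + C\<^sup>2) * D z \<le> L k z" if "k \<ge> k0" for k
        proof -
          have "(\<phi> k z)\<^sup>2 \<le> C\<^sup>2" using C that abs_le_square_iff[of "\<phi> k z" C] by fastforce
          then have "inverse (1 + C\<^sup>2) \<le> T k z" unfolding T_def
            using zero_le_power2[of "\<phi> k z"] by (intro le_imp_inverse_le) (auto intro: add_pos_nonneg)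
          then show ?thesis using z D by (simp add: L_def mult_right_mono)
        qed
        then have "ennreal (inverse (1 + C\<^sup>2) * D z) \<le> liminf (\<lambda>k. ennreal (L k z))"
          by (intro Liminf_bounded eventually_sequentiallyI[of k0] ennreal_leI)
        then have "inverse (1 + C\<^sup>2) * D z \<le> 0" using elim(1) by (simp add: ennreal_eq_0_iff)
        moreover have "0 < inverse (1 + C\<^sup>2) * D z" using D by (intro mult_pos_pos) (auto intro: add_pos_nonneg)
        ultimately show False by linarith
      qed
    qed
  qed
  have "AE z in lborel. \<forall>n. z \<in> bx (real (Suc n)) \<longrightarrow> D z = 0"
    unfolding AE_all_countable by (intro allI zero) simp
  then show ?thesis
    using AED AE_sq_pos
  proof eventually_elim
    case (elim z)
    obtain n where "norm z \<le> real n" using real_arch_simple by blast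
    then have "norm z \<le> real (Suc n)" by simp
    then have "z \<in> bx (real (Suc n))" using bx_self[of z] bx_mono[of "norm z" "real (Suc n)"] by blast
    then have "D z = 0" using elim by blast
    moreover have "D z = ((p1 z)\<^sup>2 + (p2 z)\<^sup>2) / sq z" "0 < sq z" using elim by blast+
    ultimately have "(p1 z)\<^sup>2 + (p2 z)\<^sup>2 = 0" by simp
    then show ?case by (simp add: sum_power2_eq_zero_iff)
  qed
qed

end

section \<open>Parallel shear flows\<close>

lemma gradient_zero_imp_const:
  assumes f: "wgrad f g1 g2" and 0: "AE z in lborel. g1 z = 0 \<and> g2 z = 0"
  shows "\<exists>c. AE z in lborel. f z = c"
proof (rule AE_const_of_zero_gradient[OF wgradD(4)[OF f]])
  have z: "moll n 0 0 g x = 0" if "AE z in lborel. g z = 0" "L1loc g" for g n x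
    using moll_cong_AE[OF that(1) that(2) L1loc_const] moll_const[of n 0 x] by simp
  have eq: "moll n (Suc 0) 0 f x = - moll n 0 0 g1 x" "moll n 0 (Suc 0) f x = - moll n 0 0 g2 x" for n x
    using f unfolding wgrad_def by blast+
  have "AE z in lborel. g1 z = 0" "AE z in lborel. g2 z = 0" using 0 by auto
  then show "moll n (Suc 0) 0 f x = 0" "moll n 0 (Suc 0) f x = 0" for n x
    using z wgradD[OF f] unfolding eq by simp_all
qed

lemma perp_decomposition:
  assumes "norm e = 1" shows "x = (x \<bullet> e) *\<^sub>R e + (x \<bullet> perp e) *\<^sub>R perp e"
proof -
  have "fst e * fst e + snd e * snd e = 1"
    using assms by (simp add: norm_eq_1 inner_prod_def)
  then have "fst x = fst x * (fst e * fst e + snd e * snd e)" "snd x = snd x * (fst e * fst e + snd e * snd e)" by simp_all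
  then show ?thesis
    by (intro prod_eqI) (simp_all add: perp_def inner_prod_def algebra_simps)
qed

context weak_euler
begin

theorem pressure_const: "\<exists>c. AE z in lborel. P z = c"
  by (rule gradient_zero_imp_const[OF P pressure_gradient_eq_0])

text \<open>With a constant direction \<open>e\<close>, the velocity is a scalar \<open>w\<close>
  times \<open>e\<close>, and \<open>div v = 0\<close> says that \<open>w\<close> does not change
  along \<open>e\<close>. This is derived for the mollifications, which are then literally constant
  on the lines parallel to \<open>e\<close>.\<close>

theorem shear_flow:
  "\<exists>e V. norm e = 1 \<and> (AE z in lborel. (v1 z, v2 z) = V (z \<bullet> perp e) *\<^sub>R e)"
proof -
  have "AE z in lborel. om1 z = 0 \<and> om2 z = 0"
    using pressure_gradient_eq_0 grad_P AE_sq_pos by eventually_elim auto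
  from direction_const[OF this] obtain e1 e2 where e: "AE z in lborel. v1 z / sqrt (sq z) = e1" "AE z in lborel. v2 z / sqrt (sq z) = e2"
    by blast
  have AEe: "AE z in lborel. v1 z = sqrt (sq z) * e1 \<and> v2 z = sqrt (sq z) * e2 \<and> e1\<^sup>2 + e2\<^sup>2 = 1"
    using e AE_sq_pos
  proof eventually_elim
    case (elim z)
    have "e1\<^sup>2 + e2\<^sup>2 = ((v1 z)\<^sup>2 + (v2 z)\<^sup>2) / sq z"
      using elim by (simp add: elim(1,2)[symmetric] power_divide add_divide_distrib)
    also have "\<dots> = 1" using elim(3) unfolding sq_def[symmetric] by simp
    finally show ?case using elim by auto
  qed
  have e12: "e1\<^sup>2 + e2\<^sup>2 = 1" using AE_lborel_ex[OF AEe] by blast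
  \<comment> \<open>The component along the constant direction, equal to \<open>|v|\<close> almost
    everywhere; being linear in \<open>v\<close>, it is locally integrable at once.\<close>
  define w where "w z = e1 * v1 z + e2 * v2 z" for z
  note l = wgradD[OF v1] wgradD[OF v2]
  have wl: "L1loc w" unfolding w_def[abs_def] by (intro L1loc_add L1loc_cmult l)
  have wv: "AE z in lborel. e1 * w z = v1 z" "AE z in lborel. e2 * w z = v2 z"
  proof -
    have "AE z in lborel. w z = sqrt (sq z)"
      using AEe
    proof eventually_elim
      case (elim z)
      then have "w z = e1 * (sqrt (sq z) * e1) + e2 * (sqrt (sq z) * e2)" by (simp add: w_def)
      also have "\<dots> = sqrt (sq z) * (e1\<^sup>2 + e2\<^sup>2)" by (simp add: power2_eq_square distrib_left)
      finally show ?case by (simp add: e12)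
    qed
    then show "AE z in lborel. e1 * w z = v1 z" "AE z in lborel. e2 * w z = v2 z"
      using AEe by (eventually_elim, auto)+
  qed
  have dir: "e1 * moll n (Suc 0) 0 w x + e2 * moll n 0 (Suc 0) w x = 0" for n x
  proof -
    have "e1 * moll n (Suc 0) 0 w x = moll n (Suc 0) 0 v1 x"
      using moll_cong_AE[OF wv(1) L1loc_cmult[OF wl] l(4)] by (simp add: moll_cmult)
    moreover have "e2 * moll n 0 (Suc 0) w x = moll n 0 (Suc 0) v2 x"
      using moll_cong_AE[OF wv(2) L1loc_cmult[OF wl] l(10)] by (simp add: moll_cmult)
    moreover have "moll n (Suc 0) 0 v1 x = - moll n 0 0 a1 x" "moll n 0 (Suc 0) v2 x = - moll n 0 0 b2 x"
      using v1 v2 unfolding wgrad_def by blast+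
    moreover have "moll n 0 0 a1 x + moll n 0 0 b2 x = 0"
      using moll_cong_AE[OF div L1loc_add[OF l(5) l(12)] L1loc_const, of n 0 0 x] moll_const[of n 0 x]
      by (simp add: moll_add l)
    ultimately show ?thesis by simp
  qed
  define e where "e = (e1, e2)"
  have ne: "norm e = 1" using e12 by (simp add: e_def norm_Pair)
  have const: "moll n 0 0 w x = moll n 0 0 w ((x \<bullet> perp e) *\<^sub>R perp e)" for n x
  proof -
    let ?y = "(x \<bullet> perp e) *\<^sub>R perp e"
    have D: "((\<lambda>t. moll n 0 0 w (?y + t *\<^sub>R e)) has_real_derivative 0) (at t)" for t
    proof -
      have "fst e * moll n (Suc 0) 0 w z + snd e * moll n 0 (Suc 0) w z = 0" for z
        using dir[of n z] by (simp add: e_def)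
      with DERIV_moll_line[OF wl, of n 0 0 ?y e t] show ?thesis by (simp only: minus_zero)
    qed
    have "moll n 0 0 w (?y + (x \<bullet> e) *\<^sub>R e) = moll n 0 0 w (?y + 0 *\<^sub>R e)"
      using D by (intro DERIV_isconst_all[of "\<lambda>t. moll n 0 0 w (?y + t *\<^sub>R e)"]) auto
    then show ?thesis using perp_decomposition[OF ne, of x] by (simp add: add.commute)
  qed
  obtain r :: "nat \<Rightarrow> nat" where r: "AE z in lborel. (\<lambda>k. moll (r k) 0 0 w z) \<longlonglongrightarrow> w z"
    using conv1_AE_subseq[OF conv1_moll[OF wl] conv1_moll[OF wl]] by blast
  \<comment> \<open>The profile is read off on the line through the origin spanned by
    \<open>perp e\<close>. That line is a null set, but for almost every \<open>z\<close> the
    sequence at its projection coincides with the convergent sequence at \<open>z\<close>.\<close>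
  define V where "V s = lim (\<lambda>k. moll (r k) 0 0 w (s *\<^sub>R perp e))" for s
  have "AE z in lborel. (v1 z, v2 z) = V (z \<bullet> perp e) *\<^sub>R e"
    using r wv
  proof eventually_elim
    case (elim z)
    have "(\<lambda>k. moll (r k) 0 0 w z) = (\<lambda>k. moll (r k) 0 0 w ((z \<bullet> perp e) *\<^sub>R perp e))" by (rule ext) (rule const)
    with elim(1) have "V (z \<bullet> perp e) = w z" unfolding V_def by (simp add: limI)
    with elim show ?case by (simp add: e_def mult.commute)
  qed
  with ne show ?thesis by blast
qed

end

section \<open>Weak derivatives on open sets\<close>

lemma AE_lebesgue_on_iff:
  "U \<in> sets lebesgue \<Longrightarrow> (AE x in lebesgue_on U. Q x) \<longleftrightarrow> (AE x in lborel. x \<in> U \<longrightarrow> Q x)"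
  by (simp add: AE_restrict_space_iff AE_completion_iff)

lemma integral_lebesgue_on_eq:
  fixes f :: "'a::euclidean_space \<Rightarrow> real"
  assumes U: "U \<in> sets lebesgue" and h: "h \<in> borel_measurable borel"
    and eq: "AE x in lborel. indicator U x * f x = h x"
  shows "(LINT x|lebesgue_on U. f x) = (LINT x|lborel. h x)"
proof -
  have "(LINT x|lebesgue_on U. f x) = (LINT x|lebesgue. indicator U x *\<^sub>R f x)"
    using U by (intro integral_restrict_space) auto
  also have "\<dots> = (LINT x|lebesgue. h x)"
  proof (rule integral_cong_AE)
    have AE: "AE x in lebesgue. h x = indicator U x *\<^sub>R f x" using eq by (simp add: AE_completion_iff eq_commute)
    have hm: "h \<in> borel_measurable lebesgue" using h by (simp add: measurable_completion)
    show "(\<lambda>x. indicator U x *\<^sub>R f x) \<in> borel_measurable lebesgue"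
      by (rule borel_measurable_AE[OF hm AE])
    show "h \<in> borel_measurable lebesgue" by (rule hm)
    show "AE x in lebesgue. indicator U x *\<^sub>R f x = h x" using eq by (simp add: AE_completion_iff)
  qed
  also have "\<dots> = (LINT x|lborel. h x)" using h by (intro integral_completion) auto
  finally show ?thesis .
qed

lemma integrable_lebesgue_on_iff:
  fixes f :: "'a::euclidean_space \<Rightarrow> real"
  assumes U: "U \<in> sets lebesgue" and h: "h \<in> borel_measurable borel"
    and eq: "AE x in lborel. indicator U x * f x = h x"
  shows "integrable (lebesgue_on U) f \<longleftrightarrow> integrable lborel h"
proof -
  have AE: "AE x in lebesgue. h x = indicator U x *\<^sub>R f x" using eq by (simp add: AE_completion_iff eq_commute)
  have hm: "h \<in> borel_measurable lebesgue" using h by (simp add: measurable_completion)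
  have fm: "(\<lambda>x. indicator U x *\<^sub>R f x) \<in> borel_measurable lebesgue" by (rule borel_measurable_AE[OF hm AE])
  have "integrable (lebesgue_on U) f \<longleftrightarrow> integrable lebesgue (\<lambda>x. indicator U x *\<^sub>R f x)"
    using U by (intro integrable_restrict_space) auto
  also have "\<dots> \<longleftrightarrow> integrable lebesgue h"
    using AE by (intro integrable_cong_AE fm hm) (auto simp: eq_commute)
  also have "\<dots> \<longleftrightarrow> integrable lborel h" using h by (intro integrable_completion) auto
  finally show ?thesis .
qed

text \<open>The bridge from functions that are Lebesgue measurable on \<open>U\<close>, as in the
  statement, to Borel functions on the plane: a version equal almost everywhere on \<open>U\<close>
  and extended by zero.\<close>

definition borel_rep :: "(real \<times> real) set \<Rightarrow> (real \<times> real \<Rightarrow> real) \<Rightarrow> (real \<times> real \<Rightarrow> real) \<Rightarrow> bool" where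
  "borel_rep U f h \<longleftrightarrow> h \<in> borel_measurable borel \<and> (\<forall>x. x \<notin> U \<longrightarrow> h x = 0) \<and> (AE x in lborel. x \<in> U \<longrightarrow> h x = f x)"

lemma borel_rep_exists:
  assumes U: "U \<in> sets borel" and f: "f \<in> borel_measurable (lebesgue_on U)"
  shows "\<exists>h. borel_rep U f h"
proof -
  have "(\<lambda>x. indicator U x *\<^sub>R f x) \<in> borel_measurable lebesgue"
    using f U by (subst (asm) borel_measurable_restrict_space_iff) auto
  then obtain h where h: "h \<in> borel_measurable lborel" "AE x in lborel. indicator U x *\<^sub>R f x = h x"
    using completion_ex_borel_measurable_real[of "\<lambda>x. indicator U x *\<^sub>R f x" lborel] by auto
  have [measurable]: "h \<in> borel_measurable borel" "U \<in> sets borel" using h U by auto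
  have "borel_rep U f (\<lambda>x. indicator U x * h x)"
    unfolding borel_rep_def using h(2) by (auto simp: indicator_def elim!: eventually_mono)
  then show ?thesis by blast
qed

lemma borel_repD:
  assumes "borel_rep U f h"
  shows "h \<in> borel_measurable borel" "x \<notin> U \<Longrightarrow> h x = 0" "AE x in lborel. x \<in> U \<longrightarrow> h x = f x"
    "AE x in lborel. indicator U x * f x = h x"
proof -
  show "h \<in> borel_measurable borel" "x \<notin> U \<Longrightarrow> h x = 0" and AE: "AE x in lborel. x \<in> U \<longrightarrow> h x = f x"
    using assms unfolding borel_rep_def by blast+
  have "\<forall>x. x \<notin> U \<longrightarrow> h x = 0" using assms unfolding borel_rep_def by blast
  with AE show "AE x in lborel. indicator U x * f x = h x"
    by (auto simp: indicator_def elim!: eventually_mono)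
qed

lemma borel_rep_mult:
  assumes h: "borel_rep U f h" and w: "w \<in> borel_measurable borel" and U: "U \<in> sets borel"
  shows "(LINT x|lebesgue_on U. f x * w x) = (LINT x|lborel. h x * w x)"
    and "integrable (lebesgue_on U) (\<lambda>x. f x * w x) \<longleftrightarrow> integrable lborel (\<lambda>x. h x * w x)"
proof -
  note [measurable] = borel_repD(1)[OF h] w
  have AE: "AE x in lborel. indicator U x * (f x * w x) = h x * w x"
    using borel_repD(4)[OF h] by eventually_elim (simp add: mult.assoc[symmetric])
  show "(LINT x|lebesgue_on U. f x * w x) = (LINT x|lborel. h x * w x)"
    using U by (intro integral_lebesgue_on_eq AE) auto
  show "integrable (lebesgue_on U) (\<lambda>x. f x * w x) \<longleftrightarrow> integrable lborel (\<lambda>x. h x * w x)"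
    using U by (intro integrable_lebesgue_on_iff AE) auto
qed

lemma borel_rep_sq:
  assumes h: "borel_rep U f h" and U: "U \<in> sets borel" and V: "V \<in> sets borel" "V \<subseteq> U"
  shows "integrable (lebesgue_on V) (\<lambda>x. (f x)\<^sup>2) \<longleftrightarrow> integrable lborel (\<lambda>x. indicator V x * (h x)\<^sup>2)"
proof -
  note [measurable] = borel_repD(1)[OF h] V(1)
  have AE: "AE x in lborel. indicator V x * (f x)\<^sup>2 = indicator V x * (h x)\<^sup>2"
    using borel_repD(3)[OF h] by eventually_elim (use V in \<open>auto simp: indicator_def\<close>)
  show ?thesis using V by (intro integrable_lebesgue_on_iff AE) auto
qed

lemma C_infinity_C1:
  assumes "C_infinity \<psi>"
  shows "C1 \<psi> (partial_deriv (1, 0) \<psi>) (partial_deriv (0, 1) \<psi>)"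
proof (rule has_derivative_imp_C1)
  have "C_k (Suc 0) \<psi>" using assms by (simp add: C_infinity_def del: C_k.simps)
  then have d: "\<forall>z. \<psi> differentiable (at z)" unfolding C_k.simps by blast
  fix z
  have d: "\<psi> differentiable (at z)" using d by blast
  then have D: "(\<psi> has_derivative frechet_derivative \<psi> (at z)) (at z)" by (simp add: frechet_derivative_works)
  then interpret bounded_linear "frechet_derivative \<psi> (at z)" by (rule has_derivative_bounded_linear)
  have "frechet_derivative \<psi> (at z) h = partial_deriv (1, 0) \<psi> z * fst h + partial_deriv (0, 1) \<psi> z * snd h" for h
  proof -
    have "h = fst h *\<^sub>R (1, 0) + snd h *\<^sub>R (0, 1)" by (simp add: prod_eq_iff)
    then have "frechet_derivative \<psi> (at z) h = frechet_derivative \<psi> (at z) (fst h *\<^sub>R (1, 0) + snd h *\<^sub>R (0, 1))" by simp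
    also have "\<dots> = partial_deriv (1, 0) \<psi> z * fst h + partial_deriv (0, 1) \<psi> z * snd h"
      by (simp only: add scaleR partial_deriv_def) simp
    finally show ?thesis .
  qed
  then have "frechet_derivative \<psi> (at z) = (\<lambda>h. partial_deriv (1, 0) \<psi> z * fst h + partial_deriv (0, 1) \<psi> z * snd h)"
    by (rule ext)
  with D show "(\<psi> has_derivative (\<lambda>h. partial_deriv (1, 0) \<psi> z * fst h + partial_deriv (0, 1) \<psi> z * snd h)) (at z)"
    by (simp only: )
next
  have "C_k (Suc 0) \<psi>" using assms by (simp add: C_infinity_def del: C_k.simps)
  then show "continuous_on UNIV (partial_deriv (1, 0) \<psi>)" "continuous_on UNIV (partial_deriv (0, 1) \<psi>)"
    by (auto simp: Basis_plane)
qed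

lemma outside_support:
  fixes \<psi> :: "real \<times> real \<Rightarrow> real"
  assumes x: "x \<notin> closure {x. \<psi> x \<noteq> 0}"
  shows "\<psi> x = 0" "partial_deriv b \<psi> x = 0"
proof -
  have z: "\<psi> y = 0" if "y \<in> - closure {x. \<psi> x \<noteq> 0}" for y
  proof (rule ccontr)
    assume "\<psi> y \<noteq> 0"
    then have "y \<in> closure {x. \<psi> x \<noteq> 0}" by (intro closure_subset[THEN subsetD] CollectI)
    with that show False by simp
  qed
  have x': "x \<in> - closure {x. \<psi> x \<noteq> 0}" unfolding Compl_iff by (rule x)
  show "\<psi> x = 0" by (rule z[OF x'])
  have "((\<lambda>_. 0 :: real) has_derivative (\<lambda>_. 0)) (at x)" by (rule has_derivative_const)
  then have "(\<psi> has_derivative (\<lambda>_. 0)) (at x)"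
  proof (rule has_derivative_transform_within_open)
    show "open (- closure {x. \<psi> x \<noteq> 0})" by (rule open_Compl[OF closed_closure])
    show "x \<in> - closure {x. \<psi> x \<noteq> 0}" by (rule x')
    show "0 = \<psi> y" if "y \<in> - closure {x. \<psi> x \<noteq> 0}" for y by (rule z[OF that, symmetric])
  qed
  then have "(\<lambda>_. 0) = frechet_derivative \<psi> (at x)" by (rule frechet_derivative_at)
  from fun_cong[OF this, of b] show "partial_deriv b \<psi> x = 0" by (simp only: partial_deriv_def)
qed

lemma test_functionD:
  fixes U :: "(real \<times> real) set"
  assumes \<psi>: "\<psi> \<in> test_functions U"
  shows "C1 \<psi> (partial_deriv (1, 0) \<psi>) (partial_deriv (0, 1) \<psi>)"
    "x \<notin> U \<Longrightarrow> \<psi> x = 0" "x \<notin> U \<Longrightarrow> partial_deriv b \<psi> x = 0"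
proof -
  have *: "C_infinity \<psi>" "closure {x. \<psi> x \<noteq> 0} \<subseteq> U" using \<psi> unfolding test_functions_def by blast+
  show "C1 \<psi> (partial_deriv (1, 0) \<psi>) (partial_deriv (0, 1) \<psi>)" by (rule C_infinity_C1[OF *(1)])
  show "\<psi> x = 0" "partial_deriv b \<psi> x = 0" if "x \<notin> U"
    by (rule outside_support, rule contra_subsetD[OF *(2) that])+
qed

section \<open>Uniqueness of weak derivatives\<close>

lemma loc_integrable_measurable_on:
  fixes f :: "real \<times> real \<Rightarrow> real"
  assumes "f absolutely_integrable_on K" "compact K"
  shows "f \<in> borel_measurable (lebesgue_on K)"
proof -
  have "K \<in> sets lebesgue" using assms(2) by (simp add: borel_compact)
  moreover have "(\<lambda>x. indicator K x *\<^sub>R f x) \<in> borel_measurable lebesgue"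
    using assms(1) unfolding set_integrable_def by (rule borel_measurable_integrable)
  ultimately show ?thesis by (simp add: borel_measurable_restrict_space_iff)
qed

text \<open>The fundamental lemma of the calculus of variations. On each member of a compact
  exhaustion, kernels of large index are supported in the next member and are admissible test
  functions, so the mollifications of both functions agree there, and so do their limits.\<close>

theorem weak_function_unique:
  fixes g h :: "real \<times> real \<Rightarrow> real"
  assumes U: "open U" and g: "loc_integrable_on g U" and h: "loc_integrable_on h U"
    and eq: "\<And>\<psi>. \<psi> \<in> test_functions U \<Longrightarrow> (LINT x|lebesgue_on U. g x * \<psi> x) = (LINT x|lebesgue_on U. h x * \<psi> x)"
  shows "AE x in lborel. x \<in> U \<longrightarrow> g x = h x"
proof -
  have "\<exists>C :: nat \<Rightarrow> (real \<times> real) set. (\<forall>n. compact (C n)) \<and> (\<forall>n. C n \<subseteq> U) \<and>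
      (\<forall>n. C n \<subseteq> interior (C (Suc n))) \<and> \<Union>(range C) = U"
  proof (rule open_Union_compact_subsets[OF U])
    fix C assume "\<And>n. compact (C n)" "\<And>n. C n \<subseteq> U" "\<And>n. C n \<subseteq> interior (C (Suc n))" "\<Union>(range C) = U"
    then show ?thesis by (intro exI[of _ C]) simp
  qed
  then obtain C where "(\<forall>n. compact (C n)) \<and> (\<forall>n. C n \<subseteq> U) \<and>
      (\<forall>n. C n \<subseteq> interior (C (Suc n))) \<and> \<Union>(range C) = U" ..
  then have C: "\<And>n. compact (C n)" "\<And>n. C n \<subseteq> U" "\<And>n. C n \<subseteq> interior (C (Suc n))" "\<Union>(range C) = U"
    by simp_all
  have "AE x in lborel. x \<in> C m \<longrightarrow> g x = h x" for m
  proof -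
    let ?K = "C (Suc m)"
    have K: "?K \<in> sets borel" using C(1) by (simp add: borel_compact)
    obtain d where d: "d > 0" "(\<Union>x\<in>C m. ball x d) \<subseteq> interior ?K"
      by (rule compact_subset_open_imp_ball_epsilon_subset[OF C(1)[of m] open_interior C(3)[of m]])
    have ai: "g absolutely_integrable_on ?K" "h absolutely_integrable_on ?K"
      using g h C(1,2) by (auto simp: loc_integrable_on_def)
    from borel_rep_exists[OF K loc_integrable_measurable_on[OF ai(1) C(1)]]
    obtain g' where g': "borel_rep ?K g g'" ..
    from borel_rep_exists[OF K loc_integrable_measurable_on[OF ai(2) C(1)]]
    obtain h' where h': "borel_rep ?K h h'" ..
    have ig: "integrable (lebesgue_on ?K) g" "integrable (lebesgue_on ?K) h"
      using ai K unfolding set_integrable_def by (auto simp: integrable_restrict_space)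
    have i': "integrable lborel g'" "integrable lborel h'"
      using borel_rep_mult(2)[OF g', of "\<lambda>_. 1"] borel_rep_mult(2)[OF h', of "\<lambda>_. 1"] ig K by auto
    have l': "L1loc g'" "L1loc h'" using i' by (auto intro: integrable_imp_L1loc)
    obtain r :: "nat \<Rightarrow> nat" where r: "strict_mono r" "AE z in lborel. (\<lambda>k. moll (r k) 0 0 g' z) \<longlonglongrightarrow> g' z"
      "AE z in lborel. (\<lambda>k. moll (r k) 0 0 h' z) \<longlonglongrightarrow> h' z"
      using conv1_AE_subseq[OF conv1_moll[OF l'(1)] conv1_moll[OF l'(2)]] by blast
    \<comment> \<open>A displacement within the kernel's support has length at most
      \<open>4 / (n+1)\<close>, which must be smaller than the margin \<open>d\<close> between
      consecutive compact sets.\<close>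
    obtain N where N: "4 / d < real N" using reals_Archimedean2 by blast
    have meq: "moll n 0 0 g' x = moll n 0 0 h' x" if x: "x \<in> C m" and n: "n \<ge> N" for n x
    proof -
      have "4 / d < real (Suc n)" using N n by linarith
      then have n4: "4 / real (Suc n) < d" using d(1) by (simp add: field_simps)
      let ?\<psi> = "\<lambda>y. kern n 0 0 (y - x)"
      have inK: "y \<in> ?K" if "1 / real (Suc n) \<le> fst y - fst x" "fst y - fst x \<le> 2 / real (Suc n)"
         "1 / real (Suc n) \<le> snd y - snd x" "snd y - snd x \<le> 2 / real (Suc n)" for y
      proof -
        have p: "0 < 1 / real (Suc n)" by simp
        have "norm (y - x) \<le> \<bar>fst (y - x)\<bar> + \<bar>snd (y - x)\<bar>"
          using norm_Pair_le[of "fst (y - x)" "snd (y - x)"] by (simp del: fst_diff snd_diff)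
        also have "\<dots> \<le> 2 / real (Suc n) + 2 / real (Suc n)"
          using that p unfolding fst_diff snd_diff by (intro add_mono) linarith+
        also have "\<dots> < d" using n4 by simp
        finally have "y \<in> ball x d" by (simp add: dist_norm norm_minus_commute)
        then show ?thesis using d(2) x interior_subset[of ?K] by blast
      qed
      have t: "?\<psi> \<in> test_functions U"
        by (rule kern_test_function, rule subsetD[OF C(2)], rule inK)
      have z: "?\<psi> y = 0" if "y \<notin> ?K" for y
      proof (rule kern_eq_0, rule notI)
        assume c: "1 / real (Suc n) < fst (y - x) \<and> fst (y - x) < 2 / real (Suc n) \<and>
          1 / real (Suc n) < snd (y - x) \<and> snd (y - x) < 2 / real (Suc n)"
        have "y \<in> ?K" by (rule inK) (use c in \<open>simp_all del: of_nat_Suc\<close>)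
        with that show False by blast
      qed
      have conv: "(LINT y|lebesgue_on U. f y * ?\<psi> y) = moll n 0 0 f' x" if f': "borel_rep ?K f f'" for f f'
      proof -
        have "(LINT y|lebesgue_on U. f y * ?\<psi> y) = (LINT y|lborel. f' y * ?\<psi> y)"
        proof (rule integral_lebesgue_on_eq)
          show "U \<in> sets lebesgue" using U by auto
          note [measurable] = borel_repD(1)[OF f']
          show "(\<lambda>y. f' y * ?\<psi> y) \<in> borel_measurable borel" by measurable
          show "AE y in lborel. indicator U y * (f y * ?\<psi> y) = f' y * ?\<psi> y"
            using borel_repD(3)[OF f']
          proof eventually_elim
            case (elim y)
            then show ?case using z[of y] C(2)[of "Suc m"] by (cases "y \<in> ?K") auto
          qed
        qed
        then show ?thesis by (simp add: moll_def)
      qed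
      show ?thesis using eq[OF t] conv[OF g'] conv[OF h'] by simp
    qed
    show ?thesis
      using r(2,3) borel_repD(3)[OF g'] borel_repD(3)[OF h']
    proof eventually_elim
      case (elim x)
      show ?case
      proof
        assume x: "x \<in> C m"
        have "eventually (\<lambda>k. moll (r k) 0 0 g' x = moll (r k) 0 0 h' x) sequentially"
          proof (rule eventually_sequentiallyI[of N])
          fix k assume "N \<le> k"
          then have "N \<le> r k" using seq_suble[OF r(1), of k] by simp
          then show "moll (r k) 0 0 g' x = moll (r k) 0 0 h' x" by (rule meq[OF x])
        qed
        with elim(1) have "(\<lambda>k. moll (r k) 0 0 h' x) \<longlonglongrightarrow> g' x" by (rule Lim_transform_eventually)
        from LIMSEQ_unique[OF this elim(2)] have "g' x = h' x" .
        moreover have "x \<in> ?K" using x C(3)[of m] interior_subset[of ?K] by blast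
        ultimately show "g x = h x" using elim(3,4) by simp
      qed
    qed
  qed
  then have "AE x in lborel. \<forall>m. x \<in> C m \<longrightarrow> g x = h x" unfolding AE_all_countable by blast
  then show ?thesis
  proof eventually_elim
    case (elim x)
    show ?case
    proof
      assume "x \<in> U"
      then obtain m where "x \<in> C m" unfolding C(4)[symmetric] by blast
      with elim show "g x = h x" by blast
    qed
  qed
qed

lemma integral_lebesgue_on_subset:
  fixes k :: "real \<times> real \<Rightarrow> real"
  assumes "open U" "open V" "V \<subseteq> U" "\<And>x. x \<notin> V \<Longrightarrow> k x = 0"
  shows "(LINT x|lebesgue_on U. k x) = (LINT x|lebesgue_on V. k x)"
proof -
  have "(LINT x|lebesgue_on U. k x) = (LINT x|lebesgue. indicator U x *\<^sub>R k x)"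
    using assms(1) by (intro integral_restrict_space) auto
  also have "(\<lambda>x. indicator U x *\<^sub>R k x) = (\<lambda>x. indicator V x *\<^sub>R k x)"
    using assms(3,4) by (auto simp: fun_eq_iff indicator_def)
  also have "(LINT x|lebesgue. indicator V x *\<^sub>R k x) = (LINT x|lebesgue_on V. k x)"
    using assms(2) by (intro integral_restrict_space[symmetric]) auto
  finally show ?thesis .
qed

lemma has_weak_partial_subset:
  fixes U V :: "(real \<times> real) set"
  assumes w: "has_weak_partial U b f g" and V: "open V" "V \<subseteq> U" and U: "open U"
  shows "has_weak_partial V b f g"
proof -
  have test: "\<psi> \<in> test_functions V \<Longrightarrow> \<psi> \<in> test_functions U" for \<psi>
    using V by (auto simp: test_functions_def)
  note restr = integral_lebesgue_on_subset[OF U V]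
  have "(LINT x|lebesgue_on V. f x * partial_deriv b \<psi> x) = - (LINT x|lebesgue_on V. g x * \<psi> x)"
    if \<psi>: "\<psi> \<in> test_functions V" for \<psi>
  proof -
    have "(LINT x|lebesgue_on V. f x * partial_deriv b \<psi> x) = (LINT x|lebesgue_on U. f x * partial_deriv b \<psi> x)"
      by (rule restr[symmetric]) (simp add: test_functionD(3)[OF \<psi>])
    also have "\<dots> = - (LINT x|lebesgue_on U. g x * \<psi> x)"
      using w test[OF \<psi>] by (simp add: has_weak_partial_def)
    also have "(LINT x|lebesgue_on U. g x * \<psi> x) = (LINT x|lebesgue_on V. g x * \<psi> x)"
      by (rule restr) (simp add: test_functionD(2)[OF \<psi>])
    finally show ?thesis .
  qed
  moreover have "loc_integrable_on f V" "loc_integrable_on g V"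
    using w V(2) by (auto simp: has_weak_partial_def loc_integrable_on_def)
  ultimately show ?thesis by (simp add: has_weak_partial_def)
qed

text \<open>Different derivatives of one function occur: \<open>weak_partial\<close> picks some
  derivative on the whole domain, while \<open>H1\<close> provides one on each truncated domain.
  This identifies them.\<close>

lemma weak_partial_unique:
  fixes U :: "(real \<times> real) set"
  assumes "has_weak_partial U b f g" "has_weak_partial U b f h" "open U"
  shows "AE x in lborel. x \<in> U \<longrightarrow> g x = h x"
proof (rule weak_function_unique[OF assms(3)])
  show "loc_integrable_on g U" "loc_integrable_on h U" using assms by (auto simp: has_weak_partial_def)
  fix \<psi> assume \<psi>: "\<psi> \<in> test_functions U"
  have "\<forall>\<psi>\<in>test_functions U. (LINT x|lebesgue_on U. f x * partial_deriv b \<psi> x) = - (LINT x|lebesgue_on U. g x * \<psi> x)"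
    "\<forall>\<psi>\<in>test_functions U. (LINT x|lebesgue_on U. f x * partial_deriv b \<psi> x) = - (LINT x|lebesgue_on U. h x * \<psi> x)"
    using assms(1,2) unfolding has_weak_partial_def by blast+
  from bspec[OF this(1) \<psi>] bspec[OF this(2) \<psi>] show "(LINT x|lebesgue_on U. g x * \<psi> x) = (LINT x|lebesgue_on U. h x * \<psi> x)" by simp
qed

section \<open>Gluing local derivatives and local representatives\<close>

lemma abs_powr_2: "\<bar>x :: real\<bar> powr 2 = x\<^sup>2"
  by (cases "x = 0") (simp_all add: powr_numeral)

lemma Lp_2_borel_rep:
  fixes g :: "real \<times> real \<Rightarrow> real"
  assumes g: "g \<in> Lp_space 2 V" and V: "V \<in> sets borel"
  shows "\<exists>h. borel_rep V g h \<and> integrable lborel (\<lambda>x. (h x)\<^sup>2)"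
proof -
  have m: "g \<in> borel_measurable (lebesgue_on V)" and i: "integrable (lebesgue_on V) (\<lambda>x. (g x)\<^sup>2)"
    using g by (auto simp: Lp_space_def abs_powr_2)
  from borel_rep_exists[OF V m] obtain h where h: "borel_rep V g h" ..
  have "(\<lambda>x. indicator V x * (h x)\<^sup>2) = (\<lambda>x. (h x)\<^sup>2)"
    using borel_repD(2)[OF h] by (auto simp: fun_eq_iff indicator_def)
  with i borel_rep_sq[OF h V V order_refl] h show ?thesis by auto
qed

lemma borel_rep_cong:
  assumes h: "borel_rep V f h" and eq: "AE x in lborel. x \<in> V \<longrightarrow> f x = g x"
  shows "borel_rep V g h"
proof -
  have "AE x in lborel. x \<in> V \<longrightarrow> h x = g x"
    using borel_repD(3)[OF h] eq by eventually_elim simp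
  with h show ?thesis unfolding borel_rep_def by blast
qed

text \<open>Truncations of \<open>f\<close> to growing balls are measurable and converge pointwise,
  so \<open>f\<close> has one representative on all of \<Omega>. Every box meets \<Omega> within one
  of the truncated domains, so square integrability holds up to the boundary.\<close>

lemma borel_rep_glue:
  assumes \<Omega>: "open \<Omega>"
    and loc: "\<And>n::nat. \<exists>h. borel_rep (\<Omega> \<inter> ball 0 (real n)) f h \<and> integrable lborel (\<lambda>x. (h x)\<^sup>2)"
  shows "\<exists>H. borel_rep \<Omega> f H \<and> L2loc H"
proof -
  define B where "B n = \<Omega> \<inter> ball 0 (real n)" for n :: nat
  have inB: "\<exists>n0. \<forall>n\<ge>n0. x \<in> \<Omega> \<longrightarrow> x \<in> B n" for x
  proof -
    obtain n0 :: nat where "norm x < real n0" using reals_Archimedean2 by blast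
    then show ?thesis by (intro exI[of _ n0]) (auto simp: B_def)
  qed
  have m: "(\<lambda>x. indicator (B n) x * f x) \<in> borel_measurable lebesgue" for n
  proof -
    from loc[of n] obtain h where h: "borel_rep (B n) f h" unfolding B_def by blast
    have hm: "h \<in> borel_measurable lebesgue" using borel_repD(1)[OF h] by (simp add: measurable_completion)
    show ?thesis
      by (rule borel_measurable_AE[OF hm]) (use borel_repD(4)[OF h] in \<open>simp add: AE_completion_iff eq_commute\<close>)
  qed
  have "(\<lambda>x. indicator \<Omega> x * f x) \<in> borel_measurable lebesgue"
  proof (rule borel_measurable_LIMSEQ_real[OF _ m])
    fix x
    obtain n0 where "\<forall>n\<ge>n0. x \<in> \<Omega> \<longrightarrow> x \<in> B n" using inB by blast
    then show "(\<lambda>n. indicator (B n) x * f x) \<longlonglongrightarrow> indicator \<Omega> x * f x"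
      by (intro tendsto_eventually eventually_sequentiallyI[of n0]) (auto simp: indicator_def B_def)
  qed
  then have "f \<in> borel_measurable (lebesgue_on \<Omega>)"
    using \<Omega> by (subst borel_measurable_restrict_space_iff) auto
  from borel_rep_exists[OF borel_open[OF \<Omega>] this] obtain H where H: "borel_rep \<Omega> f H" ..
  note [measurable] = borel_repD(1)[OF H]
  have "integrable lborel (\<lambda>z. indicator (bx R) z * (H z)\<^sup>2)" for R
  proof -
    have "bounded (bx R)" using compact_bx by (rule compact_imp_bounded)
    then obtain r where r: "\<And>x. x \<in> bx R \<Longrightarrow> norm x \<le> r" unfolding bounded_iff by blast
    obtain n :: nat where n: "r < real n" using reals_Archimedean2 by blast
    from loc[of n] obtain h where h: "borel_rep (B n) f h" "integrable lborel (\<lambda>x. (h x)\<^sup>2)" unfolding B_def by blast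
    show ?thesis
    proof (rule Bochner_Integration.integrable_bound[OF h(2)])
      show "AE z in lborel. norm (indicator (bx R) z * (H z)\<^sup>2) \<le> norm ((h z)\<^sup>2)"
        using borel_repD(3)[OF H] borel_repD(3)[OF h(1)]
      proof eventually_elim
        case (elim z)
        show ?case
        proof (cases "z \<in> bx R \<and> z \<in> \<Omega>")
          case True
          then have "z \<in> B n" using r[of z] n by (auto simp: B_def)
          with elim True have "H z = h z" by simp
          with True show ?thesis by simp
        next
          case False
          then have "indicator (bx R) z * (H z)\<^sup>2 = 0" using borel_repD(2)[OF H, of z] by (auto simp: indicator_def)
          then show ?thesis by (simp only: norm_zero norm_ge_zero)
        qed
      qed
    qed measurable
  qed
  then have "L2loc H" unfolding L2loc_def L1loc_def by auto
  with H show ?thesis by blast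
qed

lemma absolutely_integrable_cong_AE:
  fixes f g :: "real \<times> real \<Rightarrow> real"
  assumes f: "f absolutely_integrable_on K" and eq: "AE x in lborel. x \<in> K \<longrightarrow> f x = g x"
  shows "g absolutely_integrable_on K"
proof -
  have i: "integrable lebesgue (\<lambda>x. indicator K x *\<^sub>R f x)" using f unfolding set_integrable_def .
  have AE: "AE x in lebesgue. indicator K x *\<^sub>R f x = indicator K x *\<^sub>R g x"
    unfolding AE_completion_iff using eq by eventually_elim (auto simp: indicator_def)
  have "(\<lambda>x. indicator K x *\<^sub>R g x) \<in> borel_measurable lebesgue"
    by (rule borel_measurable_AE[OF borel_measurable_integrable[OF i] AE])
  from integrable_cong_AE_imp[OF i this AE] show ?thesis
    unfolding set_integrable_def .
qed

text \<open>Each truncated domain comes with its own derivative; uniqueness on overlaps glues them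
  into one on \<Omega>. Its existence makes the choice in \<open>weak_partial\<close> a genuine
  derivative, and uniqueness once more hands the local square integrability to that choice.\<close>

theorem H1_loc_weak_partial:
  assumes \<Omega>: "open \<Omega>" and f: "f \<in> H1_loc_closure \<Omega>" and b: "b \<in> Basis"
  shows "has_weak_partial \<Omega> b f (weak_partial \<Omega> b f)"
    and "\<exists>H. borel_rep \<Omega> (weak_partial \<Omega> b f) H \<and> L2loc H"
proof -
  define B where "B n = \<Omega> \<inter> ball 0 (real n)" for n :: nat
  have oB: "open (B n)" "B n \<subseteq> \<Omega>" "B n \<in> sets borel" for n using \<Omega> by (auto simp: B_def intro!: borel_open)
  have Bm: "B m \<subseteq> B n" if "m \<le> n" for m n using that by (auto simp: B_def)
  have "\<forall>n. \<exists>g. g \<in> Lp_space 2 (B n) \<and> has_weak_partial (B n) b f g"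
  proof
    fix n
    have "f \<in> H1 (B n)" using f unfolding H1_loc_closure_def B_def by blast
    with b show "\<exists>g. g \<in> Lp_space 2 (B n) \<and> has_weak_partial (B n) b f g" unfolding H1_def by blast
  qed
  from choice[OF this] obtain g where "\<forall>n. g n \<in> Lp_space 2 (B n) \<and> has_weak_partial (B n) b f (g n)" ..
  then have g: "\<And>n. g n \<in> Lp_space 2 (B n)" "\<And>n. has_weak_partial (B n) b f (g n)" by simp_all
  \<comment> \<open>Off a null set all pieces defined at \<open>x\<close> agree, there being only
    countably many pairs to compare, so the piece on the smallest truncated domain stands for all of
    them.\<close>
  define G where "G x = g (LEAST n. x \<in> B n) x" for x
  have "AE x in lborel. x \<in> B m \<longrightarrow> g m x = g (m + k) x" for m k
    by (rule weak_partial_unique[OF g(2) has_weak_partial_subset[OF g(2) oB(1)] oB(1)])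
       (rule Bm, simp, rule oB(1))
  then have "AE x in lborel. \<forall>m k. x \<in> B m \<longrightarrow> g m x = g (m + k) x" unfolding AE_all_countable by blast
  then have G: "AE x in lborel. \<forall>n. x \<in> B n \<longrightarrow> g n x = G x"
  proof eventually_elim
    case (elim x)
    show ?case
    proof (intro allI impI)
      fix n assume n: "x \<in> B n"
      let ?l = "LEAST n. x \<in> B n"
      have "x \<in> B ?l" "?l \<le> n" using n by (auto intro: LeastI Least_le)
      with elim have "g ?l x = g (?l + (n - ?l)) x" by blast
      with \<open>?l \<le> n\<close> show "g n x = G x" by (simp add: G_def)
    qed
  qed
  have Gn: "AE x in lborel. x \<in> B n \<longrightarrow> g n x = G x" for n using G by eventually_elim simp
  have KB: "\<exists>n. K \<subseteq> B n" if K: "compact K" "K \<subseteq> \<Omega>" for K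
  proof -
    obtain r where r: "\<And>x. x \<in> K \<Longrightarrow> norm x \<le> r" using compact_imp_bounded[OF K(1)] unfolding bounded_iff by blast
    obtain n :: nat where n: "r < real n" using reals_Archimedean2 by blast
    have "K \<subseteq> B n"
    proof
      fix x assume "x \<in> K"
      with r[of x] n K(2) show "x \<in> B n" by (auto simp: B_def)
    qed
    then show ?thesis ..
  qed
  have "has_weak_partial \<Omega> b f G"
    unfolding has_weak_partial_def
  proof (intro conjI ballI)
    show "loc_integrable_on f \<Omega>"
      unfolding loc_integrable_on_def
    proof (intro allI impI, elim conjE)
      fix K assume K: "compact K" "K \<subseteq> \<Omega>"
      from KB[OF this] obtain n where "K \<subseteq> B n" ..
      with g(2)[of n] K show "f absolutely_integrable_on K" by (simp add: has_weak_partial_def loc_integrable_on_def)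
    qed
    show "loc_integrable_on G \<Omega>"
      unfolding loc_integrable_on_def
    proof (intro allI impI, elim conjE)
      fix K assume K: "compact K" "K \<subseteq> \<Omega>"
      from KB[OF this] obtain n where n: "K \<subseteq> B n" ..
      have "g n absolutely_integrable_on K" using g(2)[of n] K n by (simp add: has_weak_partial_def loc_integrable_on_def)
      then show "G absolutely_integrable_on K"
      proof (rule absolutely_integrable_cong_AE)
        show "AE x in lborel. x \<in> K \<longrightarrow> g n x = G x"
          using Gn[of n] by eventually_elim (use n in blast)
      qed
    qed
    fix \<psi> assume \<psi>: "\<psi> \<in> test_functions \<Omega>"
    then have "compact (closure {x. \<psi> x \<noteq> 0})" "closure {x. \<psi> x \<noteq> 0} \<subseteq> \<Omega>" unfolding test_functions_def by blast+
    \<comment> \<open>A compact support fits into one truncated domain, where the derivative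
      \<open>g n\<close> can be used.\<close>
    from KB[OF this] obtain n where n: "closure {x. \<psi> x \<noteq> 0} \<subseteq> B n" ..
    with \<psi> have \<psi>n: "\<psi> \<in> test_functions (B n)" unfolding test_functions_def by blast
    from Lp_2_borel_rep[OF g(1) oB(3)] obtain h where h: "borel_rep (B n) (g n) h" by blast
    note h' = borel_rep_cong[OF h Gn]
    have \<psi>m: "\<psi> \<in> borel_measurable borel"
      by (rule borel_measurable_continuous_onI[OF C1D(1)[OF test_functionD(1)[OF \<psi>]]])
    have "(LINT x|lebesgue_on \<Omega>. f x * partial_deriv b \<psi> x) = (LINT x|lebesgue_on (B n). f x * partial_deriv b \<psi> x)"
      by (rule integral_lebesgue_on_subset[OF \<Omega> oB(1,2)]) (simp add: test_functionD(3)[OF \<psi>n])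
    also have "\<dots> = - (LINT x|lebesgue_on (B n). g n x * \<psi> x)"
      using g(2)[of n] \<psi>n by (simp add: has_weak_partial_def)
    also have "(LINT x|lebesgue_on (B n). g n x * \<psi> x) = (LINT x|lebesgue_on (B n). G x * \<psi> x)"
      using borel_rep_mult(1)[OF h \<psi>m oB(3)] borel_rep_mult(1)[OF h' \<psi>m oB(3)] by simp
    also have "\<dots> = (LINT x|lebesgue_on \<Omega>. G x * \<psi> x)"
      by (rule integral_lebesgue_on_subset[OF \<Omega> oB(1,2), symmetric]) (simp add: test_functionD(2)[OF \<psi>n])
    finally show "(LINT x|lebesgue_on \<Omega>. f x * partial_deriv b \<psi> x) = - (LINT x|lebesgue_on \<Omega>. G x * \<psi> x)" .
  qed
  then show W: "has_weak_partial \<Omega> b f (weak_partial \<Omega> b f)"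
    unfolding weak_partial_def by (rule someI[of "has_weak_partial \<Omega> b f"])
  show "\<exists>H. borel_rep \<Omega> (weak_partial \<Omega> b f) H \<and> L2loc H"
  proof (rule borel_rep_glue[OF \<Omega>])
    fix n
    from Lp_2_borel_rep[OF g(1)[of n] oB(3)] obtain h where h: "borel_rep (B n) (g n) h" "integrable lborel (\<lambda>x. (h x)\<^sup>2)" by blast
    have "AE x in lborel. x \<in> B n \<longrightarrow> g n x = weak_partial \<Omega> b f x"
      by (rule weak_partial_unique[OF g(2) has_weak_partial_subset[OF W oB(1,2) \<Omega>] oB(1)])
    from borel_rep_cong[OF h(1) this] h(2)
    show "\<exists>h. borel_rep (\<Omega> \<inter> ball 0 (real n)) (weak_partial \<Omega> b f) h \<and> integrable lborel (\<lambda>x. (h x)\<^sup>2)"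
      unfolding B_def by blast
  qed
qed

lemma H1_loc_borel_rep:
  assumes \<Omega>: "open \<Omega>" and f: "f \<in> H1_loc_closure \<Omega>"
  shows "\<exists>H. borel_rep \<Omega> f H \<and> L2loc H"
proof (rule borel_rep_glue[OF \<Omega>])
  fix n :: nat
  have "f \<in> Lp_space 2 (\<Omega> \<inter> ball 0 (real n))" using f unfolding H1_loc_closure_def H1_def by blast
  then show "\<exists>h. borel_rep (\<Omega> \<inter> ball 0 (real n)) f h \<and> integrable lborel (\<lambda>x. (h x)\<^sup>2)"
    by (rule Lp_2_borel_rep) (use \<Omega> in \<open>auto intro!: borel_open\<close>)
qed

text \<open>The kernel at \<open>x\<close> lives in the open quadrant above and to the right of \<open>x\<close>, which explains the
  condition under which mollification commutes with differentiation.\<close>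

definition H1_data :: "(real \<times> real) set \<Rightarrow> (real \<times> real \<Rightarrow> real) \<Rightarrow> (real \<times> real \<Rightarrow> real) \<Rightarrow>
    (real \<times> real \<Rightarrow> real) \<Rightarrow> (real \<times> real \<Rightarrow> real) \<Rightarrow> bool" where
  "H1_data \<Omega> f F G1 G2 \<longleftrightarrow> borel_rep \<Omega> f F \<and> borel_rep \<Omega> (weak_partial \<Omega> (1, 0) f) G1 \<and>
     borel_rep \<Omega> (weak_partial \<Omega> (0, 1) f) G2 \<and> L2loc F \<and> L2loc G1 \<and> L2loc G2 \<and>
     (\<forall>n i j x. (\<forall>y. fst x < fst y \<longrightarrow> snd x < snd y \<longrightarrow> y \<in> \<Omega>) \<longrightarrow>
       moll n (Suc i) j F x = - moll n i j G1 x \<and> moll n i (Suc j) F x = - moll n i j G2 x)"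

theorem H1_data_exists:
  assumes \<Omega>: "open \<Omega>" and f: "f \<in> H1_loc_closure \<Omega>"
  shows "\<exists>F G1 G2. H1_data \<Omega> f F G1 G2"
proof -
  have B: "(1, 0) \<in> (Basis :: (real \<times> real) set)" "(0, 1) \<in> (Basis :: (real \<times> real) set)" by (auto simp: Basis_plane)
  note W = H1_loc_weak_partial[OF \<Omega> f]
  from H1_loc_borel_rep[OF \<Omega> f] obtain F where F: "borel_rep \<Omega> f F" "L2loc F" by blast
  from W(2)[OF B(1)] obtain G1 where G1: "borel_rep \<Omega> (weak_partial \<Omega> (1, 0) f) G1" "L2loc G1" by blast
  from W(2)[OF B(2)] obtain G2 where G2: "borel_rep \<Omega> (weak_partial \<Omega> (0, 1) f) G2" "L2loc G2" by blast
  have \<Omega>b: "\<Omega> \<in> sets borel" using \<Omega> by (rule borel_open)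
  have km: "(\<lambda>y. kern n i j (y - x)) \<in> borel_measurable borel" for n i j x by measurable
  have "moll n (Suc i) j F x = - moll n i j G1 x \<and> moll n i (Suc j) F x = - moll n i j G2 x"
    if x: "\<forall>y. fst x < fst y \<longrightarrow> snd x < snd y \<longrightarrow> y \<in> \<Omega>" for n i j x
  proof -
    have t: "(\<lambda>y. kern n i j (y - x)) \<in> test_functions \<Omega>"
    proof (rule kern_test_function)
      fix y assume a: "1 / real (Suc n) \<le> fst y - fst x" "1 / real (Suc n) \<le> snd y - snd x"
      have "0 < 1 / real (Suc n)" by simp
      with a have "fst x < fst y" "snd x < snd y" by linarith+
      with x show "y \<in> \<Omega>" by blast
    qed
    have "(LINT y|lebesgue_on \<Omega>. f y * partial_deriv (1, 0) (\<lambda>y. kern n i j (y - x)) y) = - (LINT y|lebesgue_on \<Omega>. weak_partial \<Omega> (1, 0) f y * kern n i j (y - x))"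
      "(LINT y|lebesgue_on \<Omega>. f y * partial_deriv (0, 1) (\<lambda>y. kern n i j (y - x)) y) = - (LINT y|lebesgue_on \<Omega>. weak_partial \<Omega> (0, 1) f y * kern n i j (y - x))"
      using W(1)[OF B(1)] W(1)[OF B(2)] t unfolding has_weak_partial_def by blast+
    then show ?thesis
      unfolding partial_deriv_kern borel_rep_mult(1)[OF F(1) km \<Omega>b] borel_rep_mult(1)[OF G1(1) km \<Omega>b]
        borel_rep_mult(1)[OF G2(1) km \<Omega>b] moll_def by blast
  qed
  with F G1 G2 show ?thesis unfolding H1_data_def by blast
qed

section \<open>The half-plane\<close>

definition rf :: "real \<times> real \<Rightarrow> real \<times> real" where "rf z = (fst z, - snd z)"

lemma rf_simps [simp]: "fst (rf z) = fst z" "snd (rf z) = - snd z" "rf (rf z) = z" "rf (x, y) = (x, - y)"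
  by (simp_all add: rf_def)

lemma rf_measurable [measurable]: "rf \<in> borel_measurable borel"
  unfolding rf_def[abs_def] by (intro borel_measurable_continuous_onI continuous_intros)

lemma nn_integral_rf:
  fixes f :: "real \<times> real \<Rightarrow> ennreal"
  assumes [measurable]: "f \<in> borel_measurable borel"
  shows "(\<integral>\<^sup>+z. f (rf z) \<partial>lborel) = (\<integral>\<^sup>+z. f z \<partial>lborel)"
proof -
  have "(\<integral>\<^sup>+y. f (x, - y) \<partial>lborel) = (\<integral>\<^sup>+y. f (x, y) \<partial>lborel)" for x
    using nn_integral_reflect_shift[of "\<lambda>y. f (x, y)" "-1" "0::real"] by simp
  then show ?thesis
    using nn_integral_plane(1)[of "\<lambda>z. f (rf z)"] nn_integral_plane(1)[of f] by simp
qed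

lemma distr_rf: "distr lborel borel rf = lborel"
proof (rule measure_eqI)
  fix A assume "A \<in> sets (distr lborel borel rf)"
  then have A[measurable]: "A \<in> sets borel" by simp
  have "emeasure (distr lborel borel rf) A = (\<integral>\<^sup>+z. indicator A z \<partial>distr lborel borel rf)" by simp
  also have "\<dots> = (\<integral>\<^sup>+z. indicator A (rf z) \<partial>lborel)" by (rule nn_integral_distr) measurable
  also have "\<dots> = (\<integral>\<^sup>+z. indicator A z \<partial>lborel)" by (rule nn_integral_rf) measurable
  also have "\<dots> = emeasure lborel A" by simp
  finally show "emeasure (distr lborel borel rf) A = emeasure lborel A" .
qed simp

lemma integral_rf:
  fixes f :: "real \<times> real \<Rightarrow> real"
  assumes f: "f \<in> borel_measurable borel"
  shows "(LINT z|lborel. f (rf z)) = (LINT z|lborel. f z)" "integrable lborel (\<lambda>z. f (rf z)) \<longleftrightarrow> integrable lborel f"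
  using integral_distr[of rf lborel borel f] integrable_distr_eq[of rf lborel borel f] f
  by (simp_all add: distr_rf)

lemma AE_rf:
  fixes Q :: "real \<times> real \<Rightarrow> bool"
  assumes "AE z in lborel. Q z" shows "AE z in lborel. Q (rf z)"
proof -
  have "rf \<in> measurable lborel borel" by measurable
  moreover have "AE z in distr lborel borel rf. Q z" using assms unfolding distr_rf .
  ultimately show ?thesis by (rule AE_distrD)
qed

lemma bx_rf: "rf z \<in> bx R \<longleftrightarrow> z \<in> bx R"
  by (simp add: bx_def)

lemma L2loc_rf: assumes "L2loc f" shows "L2loc (\<lambda>z. f (rf z))"
proof -
  have [measurable]: "f \<in> borel_measurable borel" using assms by (rule L2loc_measurable)
  have "integrable lborel (\<lambda>z. indicator (bx R) z * (f (rf z))\<^sup>2)" for R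
    using integral_rf(2)[of "\<lambda>z. indicator (bx R) z * (f z)\<^sup>2"] integrable_bx_times[OF L2loc_sq[OF assms], of R]
    by (simp add: indicator_def bx_rf)
  then show ?thesis unfolding L2loc_def L1loc_def by simp
qed

lemma C1_rf:
  assumes "C1 \<psi> \<psi>1 \<psi>2" shows "C1 (\<lambda>z. \<psi> (rf z)) (\<lambda>z. \<psi>1 (rf z)) (\<lambda>z. - \<psi>2 (rf z))"
proof -
  have "C1 (\<lambda>z. - snd z) (\<lambda>_. 0) (\<lambda>_. -1)" by (rule C1I(1)) (auto intro!: derivative_eq_intros)
  from C1_compose_pair[OF C1_fst this assms] show ?thesis by (simp add: rf_def)
qed

lemma C1_cmult: assumes "C1 u u1 u2" shows "C1 (\<lambda>z. c * u z) (\<lambda>z. c * u1 z) (\<lambda>z. c * u2 z)"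
  using C1_mult[OF _ assms, of "\<lambda>_. c" "\<lambda>_. 0" "\<lambda>_. 0"] C1I(1)[of "\<lambda>_. 0" "\<lambda>_. 0" "\<lambda>_. c"] by simp

text \<open>For \<open>F\<close> supported in the upper half-plane, \<sigma> = 1 gives the even and
  \<sigma> = -1 the odd extension. The reflection is moved onto the test function: for the vertical
  derivative it becomes \<open>\<psi> - \<sigma> * \<psi> \<circ> rf\<close>. In the even case this
  vanishes on the axis, so no boundary value of \<open>F\<close> is involved; in the odd case it
  need not vanish, and the trace of \<open>F\<close> has to do the work.\<close>

lemma wgrad_reflect:
  assumes l: "L2loc F" "L2loc G1" "L2loc G2"
    and ibp1: "\<And>\<psi> \<psi>1 \<psi>2 R. C1 \<psi> \<psi>1 \<psi>2 \<Longrightarrow> (\<And>z. z \<notin> bx R \<Longrightarrow> \<psi> z = 0) \<Longrightarrow>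
      (LINT z|lborel. F z * \<psi>1 z) = - (LINT z|lborel. G1 z * \<psi> z)"
    and ibp2: "\<And>\<psi> \<psi>1 \<psi>2 R. C1 \<psi> \<psi>1 \<psi>2 \<Longrightarrow> (\<And>z. z \<notin> bx R \<Longrightarrow> \<psi> z = 0) \<Longrightarrow> (\<And>s. \<sigma> = 1 \<Longrightarrow> \<psi> (s, 0) = 0) \<Longrightarrow>
      (LINT z|lborel. F z * \<psi>2 z) = - (LINT z|lborel. G2 z * \<psi> z)"
  shows "wgrad (\<lambda>z. F z + \<sigma> * F (rf z)) (\<lambda>z. G1 z + \<sigma> * G1 (rf z)) (\<lambda>z. G2 z + - \<sigma> * G2 (rf z))"
proof (rule wgradI)
  show "L2loc (\<lambda>z. F z + \<sigma> * F (rf z))" "L2loc (\<lambda>z. G1 z + \<sigma> * G1 (rf z))" "L2loc (\<lambda>z. G2 z + - \<sigma> * G2 (rf z))"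
    by (intro L2loc_add L2loc_cmult L2loc_rf l)+
  fix \<psi> \<psi>1 \<psi>2 R
  assume \<psi>: "C1 \<psi> \<psi>1 \<psi>2" and supp: "\<And>z. z \<notin> bx R \<Longrightarrow> \<psi> z = 0"
  have s12: "\<psi>1 z = 0" "\<psi>2 z = 0" if "z \<notin> bx R" for z using C1_support[OF \<psi> supp that] by auto
  have move: "(LINT z|lborel. (f z + c * f (rf z)) * w z) = (LINT z|lborel. f z * (w z + c * w (rf z)))"
    if f: "L2loc f" and w: "continuous_on UNIV w" and w0: "\<And>z. z \<notin> bx R \<Longrightarrow> w z = 0" for f w c
  proof -
    obtain M where M: "\<And>z. \<bar>w z\<bar> \<le> M" using continuous_supp_bounded[OF w w0] by blast
    have wm: "w \<in> borel_measurable borel" by (rule borel_measurable_continuous_onI[OF w])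
    have fm: "f \<in> borel_measurable borel" using f by (rule L2loc_measurable)
    have wr: "(\<lambda>z. w (rf z)) \<in> borel_measurable borel" using wm by measurable
    note [measurable] = wm fm
    have i1: "integrable lborel (\<lambda>z. f z * w z)"
      by (rule L1loc_times_bounded[OF L2loc_imp_L1loc[OF f] wm M w0])
    have i2: "integrable lborel (\<lambda>z. f (rf z) * w z)"
      by (rule L1loc_times_bounded[OF L2loc_imp_L1loc[OF L2loc_rf[OF f]] wm M w0])
    have i3: "integrable lborel (\<lambda>z. f z * w (rf z))"
      by (rule L1loc_times_bounded[OF L2loc_imp_L1loc[OF f] wr M]) (rule w0, simp add: bx_rf)
    have "(LINT z|lborel. f (rf z) * w z) = (LINT z|lborel. f z * w (rf z))"
      using integral_rf(1)[of "\<lambda>z. f z * w (rf z)"] by simp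
    then show ?thesis using i1 i2 i3 by (simp add: distrib_left distrib_right mult.assoc mult.left_commute[of _ c])
  qed
  have Cr: "C1 (\<lambda>z. \<psi> z + c * \<psi> (rf z)) (\<lambda>z. \<psi>1 z + c * \<psi>1 (rf z)) (\<lambda>z. \<psi>2 z + c * - \<psi>2 (rf z))" for c
    by (intro C1_add C1_cmult C1_rf \<psi>)
  have suppr: "\<psi> z + c * \<psi> (rf z) = 0" if "z \<notin> bx R" for z c
    using supp[of z] supp[of "rf z"] that by (simp add: bx_rf)
  show "(LINT z|lborel. (F z + \<sigma> * F (rf z)) * \<psi>1 z) = - (LINT z|lborel. (G1 z + \<sigma> * G1 (rf z)) * \<psi> z) \<and>
      (LINT z|lborel. (F z + \<sigma> * F (rf z)) * \<psi>2 z) = - (LINT z|lborel. (G2 z + - \<sigma> * G2 (rf z)) * \<psi> z)"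
  proof
    have "(LINT z|lborel. F z * (\<psi>1 z + \<sigma> * \<psi>1 (rf z))) = - (LINT z|lborel. G1 z * (\<psi> z + \<sigma> * \<psi> (rf z)))"
      by (rule ibp1[OF Cr suppr])
    then show "(LINT z|lborel. (F z + \<sigma> * F (rf z)) * \<psi>1 z) = - (LINT z|lborel. (G1 z + \<sigma> * G1 (rf z)) * \<psi> z)"
      using move[OF l(1) C1D(2)[OF \<psi>] s12(1), of \<sigma>] move[OF l(2) C1D(1)[OF \<psi>] supp, of \<sigma>] by simp
    have "(LINT z|lborel. F z * (\<psi>2 z + - \<sigma> * - \<psi>2 (rf z))) = - (LINT z|lborel. G2 z * (\<psi> z + - \<sigma> * \<psi> (rf z)))"
      by (rule ibp2[OF Cr suppr]) simp_all
    then show "(LINT z|lborel. (F z + \<sigma> * F (rf z)) * \<psi>2 z) = - (LINT z|lborel. (G2 z + - \<sigma> * G2 (rf z)) * \<psi> z)"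
      using move[OF l(1) C1D(3)[OF \<psi>] s12(2), of \<sigma>] move[OF l(3) C1D(1)[OF \<psi>] supp, of "- \<sigma>"] by simp
  qed
qed

section \<open>Integration by parts for Sobolev functions on the half-plane\<close>

lemma half_plane_iff: "z \<in> half_plane \<longleftrightarrow> 0 < snd z"
  by (cases z) (simp add: half_plane_def)

lemma open_half_plane: "open half_plane"
  unfolding half_plane_def by (intro open_Times) auto

lemma H1_dataD:
  assumes "H1_data \<Omega> f F G1 G2"
  shows "borel_rep \<Omega> f F" "borel_rep \<Omega> (weak_partial \<Omega> (1, 0) f) G1" "borel_rep \<Omega> (weak_partial \<Omega> (0, 1) f) G2"
    "L2loc F" "L2loc G1" "L2loc G2"
    "(\<And>y. fst x < fst y \<Longrightarrow> snd x < snd y \<Longrightarrow> y \<in> \<Omega>) \<Longrightarrow> moll n (Suc i) j F x = - moll n i j G1 x"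
    "(\<And>y. fst x < fst y \<Longrightarrow> snd x < snd y \<Longrightarrow> y \<in> \<Omega>) \<Longrightarrow> moll n i (Suc j) F x = - moll n i j G2 x"
  using assms unfolding H1_data_def by blast+

text \<open>Since the kernel looks upward, the mollifications of the zero extension have the
  mollified weak derivatives as gradients on the open half-plane. Classical integration by parts
  there, followed by the limit, avoids any jump across the axis; its boundary term is removed by the
  vanishing of \<psi>.\<close>

lemma half_plane_parts:
  assumes D: "H1_data half_plane f F G1 G2"
    and \<psi>: "C1 \<psi> \<psi>1 \<psi>2" and supp: "\<And>z. z \<notin> bx R \<Longrightarrow> \<psi> z = 0"
  shows "(LINT z|lborel. F z * \<psi>1 z) = - (LINT z|lborel. G1 z * \<psi> z)"
    and "(\<And>s. \<psi> (s, 0) = 0) \<Longrightarrow> (LINT z|lborel. F z * \<psi>2 z) = - (LINT z|lborel. G2 z * \<psi> z)"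
proof -
  let ?h = "\<lambda>z :: real \<times> real. indicat_real {0<..} (snd z)"
  note l = H1_dataD(4-6)[OF D, THEN L2loc_imp_L1loc]
  have s12: "\<psi>1 z = 0" "\<psi>2 z = 0" if "z \<notin> bx R" for z using C1_support[OF \<psi> supp that] by auto
  have out: "F z * ?h z = F z" "G1 z * ?h z = G1 z" "G2 z * ?h z = G2 z" for z
    using borel_repD(2)[OF H1_dataD(1)[OF D], of z] borel_repD(2)[OF H1_dataD(2)[OF D], of z]
      borel_repD(2)[OF H1_dataD(3)[OF D], of z] by (cases "0 < snd z"; simp add: half_plane_iff)+
  have ci: "(\<lambda>n. LINT z|lborel. moll n 0 0 g z * (?h z * w z)) \<longlonglongrightarrow> (LINT z|lborel. g z * (?h z * w z))"
    if g: "L1loc g" and w: "continuous_on UNIV w" and w0: "\<And>z. z \<notin> bx R \<Longrightarrow> w z = 0" for g w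
  proof -
    obtain M where M: "\<And>z. \<bar>w z\<bar> \<le> M" using continuous_supp_bounded[OF w w0] by blast
    have [measurable]: "w \<in> borel_measurable borel" by (rule borel_measurable_continuous_onI[OF w])
    show ?thesis
    proof (rule conv1_integral[OF conv1_moll[OF g]])
      show "(\<lambda>z. ?h z * w z) \<in> borel_measurable borel" by (intro borel_measurable_times half_measurable) measurable
      show "\<bar>?h z * w z\<bar> \<le> max M 0" for z using M[of z] by (auto simp: indicator_def)
      show "?h z * w z = 0" if "z \<notin> bx R" for z using w0[OF that] by simp
    qed
  qed
  note C = C1_moll[OF l(1), of _ 0 0]
  have swap: "h * (x * y) = (x * h) * y" for h x y :: real by simp
  have lc: "?h z * (x * y) = x * (?h z * y)" for x y z by (rule mult.left_commute)
  have eqn: "- moll n (Suc 0) 0 F z * ?h z = moll n 0 0 G1 z * ?h z" "- moll n 0 (Suc 0) F z * ?h z = moll n 0 0 G2 z * ?h z" for n z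
    using H1_dataD(7)[OF D, of z n 0 0] H1_dataD(8)[OF D, of z n 0 0] by (auto simp: indicator_def half_plane_iff)
  have a: "(LINT z|lborel. moll n 0 0 F z * (?h z * \<psi>1 z)) = - (LINT z|lborel. moll n 0 0 G1 z * (?h z * \<psi> z))" for n
  proof -
    have "(LINT z|lborel. ?h z * (moll n 0 0 F z * \<psi>1 z)) = - (LINT z|lborel. ?h z * (- moll n (Suc 0) 0 F z * \<psi> z))"
      by (rule integration_by_parts_plane(3)[OF C \<psi> supp])
    moreover have "?h z * (- moll n (Suc 0) 0 F z * \<psi> z) = moll n 0 0 G1 z * (?h z * \<psi> z)" for z
    proof -
      have "?h z * (- moll n (Suc 0) 0 F z * \<psi> z) = (- moll n (Suc 0) 0 F z * ?h z) * \<psi> z"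
        by (rule swap)
      also have "\<dots> = moll n 0 0 G1 z * (?h z * \<psi> z)" by (simp only: eqn mult.assoc)
      finally show ?thesis .
    qed
    ultimately show ?thesis by (simp only: lc)
  qed
  have "(LINT z|lborel. F z * (?h z * \<psi>1 z)) = - (LINT z|lborel. G1 z * (?h z * \<psi> z))"
    using ci[OF l(1) C1D(2)[OF \<psi>] s12(1)] tendsto_minus[OF ci[OF l(2) C1D(1)[OF \<psi>] supp]]
    unfolding a by (rule LIMSEQ_unique)
  then show "(LINT z|lborel. F z * \<psi>1 z) = - (LINT z|lborel. G1 z * \<psi> z)"
    by (simp only: mult.assoc[symmetric] out)
  assume z0: "\<And>s. \<psi> (s, 0) = 0"
  have b: "(LINT z|lborel. moll n 0 0 F z * (?h z * \<psi>2 z)) = - (LINT z|lborel. moll n 0 0 G2 z * (?h z * \<psi> z))" for n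
  proof -
    have "(LINT z|lborel. ?h z * (moll n 0 0 F z * \<psi>2 z)) = - (LINT z|lborel. ?h z * (- moll n 0 (Suc 0) F z * \<psi> z))
       - (LINT s|lborel. moll n 0 0 F (s, 0) * \<psi> (s, 0))"
      by (rule integration_by_parts_plane(4)[OF C \<psi> supp])
    moreover have "?h z * (- moll n 0 (Suc 0) F z * \<psi> z) = moll n 0 0 G2 z * (?h z * \<psi> z)" for z
    proof -
      have "?h z * (- moll n 0 (Suc 0) F z * \<psi> z) = (- moll n 0 (Suc 0) F z * ?h z) * \<psi> z"
        by (rule swap)
      also have "\<dots> = moll n 0 0 G2 z * (?h z * \<psi> z)" by (simp only: eqn mult.assoc)
      finally show ?thesis .
    qed
    ultimately show ?thesis by (simp only: lc z0 mult_zero_right Bochner_Integration.integral_zero diff_zero)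
  qed
  have "(LINT z|lborel. F z * (?h z * \<psi>2 z)) = - (LINT z|lborel. G2 z * (?h z * \<psi> z))"
    using ci[OF l(1) C1D(3)[OF \<psi>] s12(2)] tendsto_minus[OF ci[OF l(3) C1D(1)[OF \<psi>] supp]]
    unfolding b by (rule LIMSEQ_unique)
  then show "(LINT z|lborel. F z * \<psi>2 z) = - (LINT z|lborel. G2 z * \<psi> z)"
    by (simp only: mult.assoc[symmetric] out)
qed

text \<open>Translates the convergence on half-balls in \<open>has_trace\<close> to the whole plane:
  both sides are extended by zero below the axis, and every box lies in a ball.\<close>

lemma conv2_half_plane:
  assumes w: "borel_rep half_plane w W" "L2loc W" and k: "\<And>n. continuous_on UNIV (k n)"
    and lim: "\<And>c r. (\<lambda>n. LINT x|lebesgue_on (half_plane \<inter> ball c r). (k n x - w x)\<^sup>2) \<longlonglongrightarrow> 0"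
  shows "conv2 (\<lambda>n z. indicator {0<..} (snd z) * k n z) W"
proof -
  let ?h = "\<lambda>z :: real \<times> real. indicat_real {0<..} (snd z)"
  note [measurable] = borel_repD(1)[OF w(1)]
  have km[measurable]: "k n \<in> borel_measurable borel" for n by (rule borel_measurable_continuous_onI[OF k])
  have hk: "L2loc (\<lambda>z. ?h z * k n z)" for n
  proof (rule L2loc_bound[OF continuous_imp_L2loc[OF k[of n]]])
    show "(\<lambda>z. ?h z * k n z) \<in> borel_measurable borel" by (intro borel_measurable_times half_measurable km)
  qed (auto simp: indicator_def)
  have "(\<lambda>n. LINT z|lborel. indicator (bx R) z * (?h z * k n z - W z)\<^sup>2) \<longlonglongrightarrow> 0" for R
  proof -
    have "bounded (bx R)" using compact_bx by (rule compact_imp_bounded)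
    then obtain r where r: "\<And>x. x \<in> bx R \<Longrightarrow> norm x \<le> r" unfolding bounded_iff by blast
    define B where "B = half_plane \<inter> ball 0 (r + 1)"
    have B: "B \<in> sets borel" unfolding B_def by (intro borel_open open_Int open_half_plane open_ball)
    have limB: "(\<lambda>n. LINT x|lebesgue_on B. (k n x - w x)\<^sup>2) \<longlonglongrightarrow> 0" unfolding B_def by (rule lim)
    have "(LINT z|lborel. indicator (bx R) z * (?h z * k n z - W z)\<^sup>2) \<le> (LINT x|lebesgue_on B. (k n x - w x)\<^sup>2)" for n
    proof -
      have "(LINT x|lebesgue_on B. (k n x - w x)\<^sup>2) = (LINT x|lborel. indicator B x * (k n x - W x)\<^sup>2)"
      proof (rule integral_lebesgue_on_eq)
        show "(\<lambda>x. indicator B x * (k n x - W x)\<^sup>2) \<in> borel_measurable borel" using B by measurable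
        show "AE x in lborel. indicator B x * (k n x - w x)\<^sup>2 = indicator B x * (k n x - W x)\<^sup>2"
          using borel_repD(3)[OF w(1)] by eventually_elim (auto simp: indicator_def B_def)
      qed (use B in auto)
      also have "\<dots> \<ge> (LINT z|lborel. indicator (bx R) z * (?h z * k n z - W z)\<^sup>2)"
      proof (rule integral_mono)
        show "integrable lborel (\<lambda>z. indicator (bx R) z * (?h z * k n z - W z)\<^sup>2)"
          by (intro integrable_bx_times L2loc_sq L2loc_diff hk w)
        have i: "integrable lborel (\<lambda>x. indicator (bx (r + 1)) x * (k n x - W x)\<^sup>2)"
          by (intro integrable_bx_times L2loc_sq L2loc_diff continuous_imp_L2loc k w)
        show "integrable lborel (\<lambda>x. indicator B x * (k n x - W x)\<^sup>2)"
        proof (rule Bochner_Integration.integrable_bound[OF i])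
          show "AE x in lborel. norm (indicator B x * (k n x - W x)\<^sup>2) \<le> norm (indicator (bx (r + 1)) x * (k n x - W x)\<^sup>2)"
          proof (rule AE_I2)
            fix x
            have "x \<in> B \<Longrightarrow> x \<in> bx (r + 1)"
              using bx_self[of x] bx_mono[of "norm x" "r + 1"] by (auto simp: B_def)
            then show "norm (indicator B x * (k n x - W x)\<^sup>2) \<le> norm (indicator (bx (r + 1)) x * (k n x - W x)\<^sup>2)"
              by (auto simp: indicator_def)
          qed
        qed (use B in measurable)
        fix z
        show "indicator (bx R) z * (?h z * k n z - W z)\<^sup>2 \<le> indicator B z * (k n z - W z)\<^sup>2"
        proof (cases "z \<in> bx R \<and> 0 < snd z")
          case True
          then have "z \<in> B" using r[of z] by (auto simp: B_def half_plane_iff)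
          with True show ?thesis by simp
        next
          case False
          then have "indicator (bx R) z * (?h z * k n z - W z)\<^sup>2 = 0"
            using borel_repD(2)[OF w(1), of z] by (auto simp: half_plane_iff indicator_def)
          then show ?thesis by (simp only:) simp
        qed
      qed
      finally show ?thesis .
    qed
    then have ev: "eventually (\<lambda>n. (LINT z|lborel. indicator (bx R) z * (?h z * k n z - W z)\<^sup>2) \<le> (LINT x|lebesgue_on B. (k n x - w x)\<^sup>2)) sequentially"
      by (rule always_eventually[OF allI])
    have e0: "eventually (\<lambda>n. 0 \<le> (LINT z|lborel. indicator (bx R) z * (?h z * k n z - W z)\<^sup>2)) sequentially"
      by (intro always_eventually allI Bochner_Integration.integral_nonneg) auto
    show ?thesis by (rule real_tendsto_sandwich[OF e0 ev tendsto_const limB])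
  qed
  then show ?thesis using hk w by (simp add: conv2_def)
qed

lemma boundary_term_tendsto_0:
  fixes b :: "nat \<Rightarrow> real \<Rightarrow> real" and w :: "real \<Rightarrow> real"
  assumes b: "\<And>n. continuous_on UNIV (b n)" and w: "continuous_on UNIV w"
    and M: "\<And>s. \<bar>w s\<bar> \<le> M" and w0: "\<And>s. s \<notin> {-R..R} \<Longrightarrow> w s = 0" and R: "R > 0"
    and lim: "(\<lambda>n. LINT s|lebesgue_on {-R..R}. (b n s)\<^sup>2) \<longlonglongrightarrow> 0"
  shows "(\<lambda>n. LINT s|lborel. b n s * w s) \<longlonglongrightarrow> 0"
proof (rule LIMSEQ_I)
  fix e :: real assume e: "e > 0"
  have bm[measurable]: "b n \<in> borel_measurable borel" "w \<in> borel_measurable borel" for n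
    by (rule borel_measurable_continuous_onI, rule b w)+
  have M0: "0 \<le> M" using M[of 0] by linarith
  \<comment> \<open>A positive bound even when \<open>w\<close> is zero, so it may be divided by.
    With the \<open>t\<close> below, the fixed term is at most \<open>e / 2\<close>, and the
    threshold \<open>e * t / (2 * m)\<close> for \<beta> makes the other less than
    \<open>e / 2\<close>.\<close>
  define m where "m = M + 1"
  have m: "m > 0" "M \<le> m" using M0 by (auto simp: m_def)
  define \<beta> where "\<beta> n = (LINT s|lborel. indicator {-R..R} s * (b n s)\<^sup>2)" for n
  have "(LINT s|lebesgue_on {-R..R}. (b n s)\<^sup>2) = \<beta> n" for n
    unfolding \<beta>_def by (rule integral_lebesgue_on_eq) auto
  with lim have \<beta>: "\<beta> \<longlonglongrightarrow> 0" by simp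
  define t where "t = e / (4 * m * R)"
  have t: "t > 0" using e m R by (simp add: t_def)
  have "e * t / (2 * m) > 0" using e t m by simp
  from LIMSEQ_D[OF \<beta> this] obtain N where N: "\<And>n. n \<ge> N \<Longrightarrow> \<bar>\<beta> n\<bar> < e * t / (2 * m)" by auto
  have "norm ((LINT s|lborel. b n s * w s) - 0) < e" if "n \<ge> N" for n
  proof -
    have i0: "integrable lborel (\<lambda>s. indicator {-R..R} s * (b n s)\<^sup>2)" "integrable lborel (\<lambda>s. indicator {-R..R} s * (b n s * w s))"
      using borel_integrable_atLeastAtMost'[of "-R" R "\<lambda>s. (b n s)\<^sup>2"] borel_integrable_atLeastAtMost'[of "-R" R "\<lambda>s. b n s * w s"]
        continuous_on_subset[OF b] continuous_on_subset[OF w]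
      by (auto simp: set_integrable_def intro!: continuous_intros)
    have eq: "(\<lambda>s. indicator {-R..R} s * (b n s * w s)) = (\<lambda>s. b n s * w s)"
      using w0 by (auto simp: fun_eq_iff indicator_def)
    have "norm (LINT s|lborel. b n s * w s) \<le> (LINT s|lborel. norm (b n s * w s))" by (rule integral_norm_bound)
    also have "\<dots> \<le> (LINT s|lborel. (M * t) * indicator {-R..R} s + (M / t) * (indicator {-R..R} s * (b n s)\<^sup>2))"
    proof (rule integral_mono)
      show "integrable lborel (\<lambda>s. norm (b n s * w s))" using i0(2) unfolding eq by (rule integrable_norm)
      show "integrable lborel (\<lambda>s. (M * t) * indicator {-R..R} s + (M / t) * (indicator {-R..R} s * (b n s)\<^sup>2))"
        by (intro Bochner_Integration.integrable_add integrable_mult_right i0) (use R in \<open>simp add: integrable_indicator_iff\<close>)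
      fix s
      show "norm (b n s * w s) \<le> (M * t) * indicator {-R..R} s + (M / t) * (indicator {-R..R} s * (b n s)\<^sup>2)"
      proof (cases "s \<in> {-R..R}")
        case True
        have "\<bar>b n s\<bar> \<le> t + (b n s)\<^sup>2 / t" using abs_mult_le_sq[OF t, of 1 "b n s"] by simp
        then have "\<bar>w s\<bar> * \<bar>b n s\<bar> \<le> M * (t + (b n s)\<^sup>2 / t)" using M[of s] M0 by (intro mult_mono) auto
        with True show ?thesis by (simp add: abs_mult mult.commute distrib_left)
      qed (simp add: w0)
    qed
    also have "\<dots> = (M * t) * (2 * R) + (M / t) * \<beta> n" using i0(1) R unfolding \<beta>_def by simp
    also have "(M * t) * (2 * R) \<le> e / 2"
    proof -
      have "(M * t) * (2 * R) \<le> (m * t) * (2 * R)" using t R m by (intro mult_right_mono) auto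
      also have "\<dots> = e / 2" using R m by (simp add: t_def)
      finally show ?thesis .
    qed
    also have "(M / t) * \<beta> n \<le> (m / t) * \<bar>\<beta> n\<bar>"
      using M0 m t by (intro mult_mono divide_right_mono) (auto simp: \<beta>_def)
    also have "\<dots> < (m / t) * (e * t / (2 * m))" using N[OF that] m t by (intro mult_strict_left_mono) auto
    also have "\<dots> = e / 2" using m t by simp
    finally show ?thesis by simp
  qed
  then show "\<exists>no. \<forall>n\<ge>no. norm ((LINT s|lborel. b n s * w s) - 0) < e" by blast
qed

text \<open>Here \<psi> is free on the axis, and the boundary term disappears for another reason:
  the smooth approximants of \<open>has_trace\<close> tend to zero in \<open>L^2\<close> on
  intervals of the axis, while their values and derivatives converge above it.\<close>

lemma half_plane_parts_trace:
  assumes D: "H1_data half_plane f F G1 G2" and tr: "has_trace f (\<lambda>_. 0)"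
    and \<psi>: "C1 \<psi> \<psi>1 \<psi>2" and supp: "\<And>z. z \<notin> bx R \<Longrightarrow> \<psi> z = 0"
  shows "(LINT z|lborel. F z * \<psi>2 z) = - (LINT z|lborel. G2 z * \<psi> z)"
proof -
  let ?h = "\<lambda>z :: real \<times> real. indicat_real {0<..} (snd z)"
  obtain u :: "nat \<Rightarrow> real \<times> real \<Rightarrow> real" where u: "\<And>n. C_infinity (u n)"
    "\<And>c r. (\<lambda>n. LINT x|lebesgue_on (half_plane \<inter> ball c r). (u n x - f x)\<^sup>2) \<longlonglongrightarrow> 0"
    "\<And>b c r. b \<in> Basis \<Longrightarrow> (\<lambda>n. LINT x|lebesgue_on (half_plane \<inter> ball c r).
              (partial_deriv b (u n) x - weak_partial half_plane b f x)\<^sup>2) \<longlonglongrightarrow> 0"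
    "\<And>r. (\<lambda>n. LINT s|lebesgue_on {-r..r}. (u n (s, 0) - 0)\<^sup>2) \<longlonglongrightarrow> 0"
  proof -
    from tr[unfolded has_trace_def, THEN conjunct2, THEN conjunct2] obtain u where *: "(\<forall>n. C_infinity (u n)) \<and> (\<forall>c r.
           (\<lambda>n. LINT x|lebesgue_on (half_plane \<inter> ball c r). (u n x - f x)\<^sup>2) \<longlonglongrightarrow> 0 \<and>
           (\<forall>b\<in>Basis. (\<lambda>n. LINT x|lebesgue_on (half_plane \<inter> ball c r).
              (partial_deriv b (u n) x - weak_partial half_plane b f x)\<^sup>2) \<longlonglongrightarrow> 0)) \<and>
        (\<forall>r. (\<lambda>n. LINT s|lebesgue_on {-r..r}. (u n (s, 0) - 0)\<^sup>2) \<longlonglongrightarrow> 0)" ..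
    note U1 = conjunct1[OF *] and U2 = conjunct1[OF conjunct2[OF *]] and U3 = conjunct2[OF conjunct2[OF *]]
    show thesis
      by (rule that[of u])
         (rule spec[OF U1] conjunct1[OF spec[OF spec[OF U2]]] spec[OF U3] |
          rule bspec[OF conjunct2[OF spec[OF spec[OF U2]]]], assumption)+
  qed
  note C = C_infinity_C1[OF u(1)]
  have B: "(0, 1) \<in> (Basis :: (real \<times> real) set)" by (simp add: Basis_plane)
  have c1: "conv1 (\<lambda>n z. ?h z * u n z) F"
    by (rule conv2_imp_conv1[OF conv2_half_plane[OF H1_dataD(1,4)[OF D] C1D(1)[OF C] u(2)]])
  have c2: "conv1 (\<lambda>n z. ?h z * partial_deriv (0, 1) (u n) z) G2"
    by (rule conv2_imp_conv1[OF conv2_half_plane[OF H1_dataD(3,6)[OF D] C1D(3)[OF C] u(3)[OF B]]])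
  have s2: "\<psi>2 z = 0" if "z \<notin> bx R" for z using C1_support[OF \<psi> supp that] by auto
  obtain M0 where M0: "\<And>z. \<bar>\<psi> z\<bar> \<le> M0" using continuous_supp_bounded[OF C1D(1)[OF \<psi>] supp] by blast
  obtain M2 where M2: "\<And>z. \<bar>\<psi>2 z\<bar> \<le> M2" using continuous_supp_bounded[OF C1D(3)[OF \<psi>] s2] by blast
  have m: "\<psi> \<in> borel_measurable borel" "\<psi>2 \<in> borel_measurable borel"
    by (intro borel_measurable_continuous_onI C1D[OF \<psi>])+
  have l1: "(\<lambda>n. LINT z|lborel. (?h z * u n z) * \<psi>2 z) \<longlonglongrightarrow> (LINT z|lborel. F z * \<psi>2 z)"
    by (rule conv1_integral[OF c1 m(2) M2 s2])
  have l2: "(\<lambda>n. LINT z|lborel. (?h z * partial_deriv (0, 1) (u n) z) * \<psi> z) \<longlonglongrightarrow> (LINT z|lborel. G2 z * \<psi> z)"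
    by (rule conv1_integral[OF c2 m(1) M0 supp])
  define S where "S = max R 1"
  have S: "S > 0" "R \<le> S" by (auto simp: S_def)
  have l3: "(\<lambda>n. LINT s|lborel. u n (s, 0) * \<psi> (s, 0)) \<longlonglongrightarrow> 0"
  proof (rule boundary_term_tendsto_0[OF _ _ M0 _ S(1)])
    show "continuous_on UNIV (\<lambda>s. u n (s, 0))" for n
      by (intro continuous_on_compose2[OF C1D(1)[OF C, of UNIV]] continuous_intros) auto
    show "continuous_on UNIV (\<lambda>s. \<psi> (s, 0))"
      by (intro continuous_on_compose2[OF C1D(1)[OF \<psi>, of UNIV]] continuous_intros) auto
    show "\<psi> (s, 0) = 0" if "s \<notin> {-S..S}" for s
      using that S by (intro supp) (auto simp: bx_def)
    show "(\<lambda>n. LINT s|lebesgue_on {-S..S}. (u n (s, 0))\<^sup>2) \<longlonglongrightarrow> 0" using u(4)[of S] by simp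
  qed
  have eq: "(LINT z|lborel. (?h z * u n z) * \<psi>2 z) = - (LINT z|lborel. (?h z * partial_deriv (0, 1) (u n) z) * \<psi> z)
      - (LINT s|lborel. u n (s, 0) * \<psi> (s, 0))" for n
    unfolding mult.assoc by (rule integration_by_parts_plane(4)[OF C \<psi> supp])
  have "(\<lambda>n. - (LINT z|lborel. (?h z * partial_deriv (0, 1) (u n) z) * \<psi> z)
      - (LINT s|lborel. u n (s, 0) * \<psi> (s, 0))) \<longlonglongrightarrow> - (LINT z|lborel. G2 z * \<psi> z) - 0"
    by (intro tendsto_diff tendsto_minus l2 l3)
  from LIMSEQ_unique[OF l1[unfolded eq] this] show ?thesis by simp
qed

text \<open>Rewrites the equations, the absence of stagnation and the integrability of the pressure
  gradient in terms of Borel representatives extended by zero. The stagnation bound holds up to the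
  boundary because the compact sets tested lie in the closure of \<Omega>.\<close>

lemma borel_data:
  fixes \<Omega> :: "(real \<times> real) set" and v :: "real \<times> real \<Rightarrow> real \<times> real" and P :: "real \<times> real \<Rightarrow> real" and q :: real
  assumes \<Omega>: "open \<Omega>"
    and D1: "H1_data \<Omega> (\<lambda>x. fst (v x)) V1 A1 A2" and D2: "H1_data \<Omega> (\<lambda>x. snd (v x)) V2 B1 B2"
    and DP: "H1_data \<Omega> P Q P1 P2"
    and eu: "steady_euler \<Omega> v P" and ns: "no_essential_stagnation \<Omega> v" and Lp: "weak_grad \<Omega> P \<in> Lp_space q \<Omega>"
  shows "AE z in lborel. z \<in> \<Omega> \<longrightarrow> v z = (V1 z, V2 z) \<and> Q z = P z \<and> V1 z * A1 z + V2 z * A2 z + P1 z = 0 \<and>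
      V1 z * B1 z + V2 z * B2 z + P2 z = 0 \<and> A1 z + B2 z = 0"
    and "\<exists>c>0. AE z in lborel. z \<in> bx R \<longrightarrow> z \<in> \<Omega> \<longrightarrow> c \<le> (V1 z)\<^sup>2 + (V2 z)\<^sup>2"
    and "integrable lborel (\<lambda>z. norm (P1 z, P2 z) powr q)"
proof -
  have \<Omega>l: "\<Omega> \<in> sets lebesgue" using \<Omega> by auto
  note r1 = H1_dataD(1-3)[OF D1, THEN borel_repD(3)] and r2 = H1_dataD(1-3)[OF D2, THEN borel_repD(3)]
    and rP = H1_dataD(1-3)[OF DP, THEN borel_repD(3)]
  have f: "(\<lambda>y. v y \<bullet> (1, 0)) = (\<lambda>x. fst (v x))" "(\<lambda>y. v y \<bullet> (0, 1)) = (\<lambda>x. snd (v x))"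
    by (simp_all add: fun_eq_iff inner_prod_def)
  have ne: "(1, 0) \<noteq> ((0, 1) :: real \<times> real)" by simp
  have e1: "AE z in lborel. z \<in> \<Omega> \<longrightarrow> (\<forall>j\<in>Basis. (\<Sum>i\<in>Basis. (v z \<bullet> i) * weak_partial \<Omega> i (\<lambda>y. v y \<bullet> j) z) + weak_partial \<Omega> j P z = 0)"
    and e2: "AE z in lborel. z \<in> \<Omega> \<longrightarrow> (\<Sum>i\<in>Basis. weak_partial \<Omega> i (\<lambda>y. v y \<bullet> i) z) = 0"
    using eu unfolding steady_euler_def AE_lebesgue_on_iff[OF \<Omega>l] by blast+
  show main: "AE z in lborel. z \<in> \<Omega> \<longrightarrow> v z = (V1 z, V2 z) \<and> Q z = P z \<and> V1 z * A1 z + V2 z * A2 z + P1 z = 0 \<and>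
      V1 z * B1 z + V2 z * B2 z + P2 z = 0 \<and> A1 z + B2 z = 0"
    using e1 e2 r1 r2 rP
  proof eventually_elim
    case (elim z)
    show ?case
    proof
      assume z: "z \<in> \<Omega>"
      note reps = elim(3-)[rule_format, OF z]
      have E: "fst (v z) * weak_partial \<Omega> (1, 0) (\<lambda>x. fst (v x)) z + snd (v z) * weak_partial \<Omega> (0, 1) (\<lambda>x. fst (v x)) z + weak_partial \<Omega> (1, 0) P z = 0"
        "fst (v z) * weak_partial \<Omega> (1, 0) (\<lambda>x. snd (v x)) z + snd (v z) * weak_partial \<Omega> (0, 1) (\<lambda>x. snd (v x)) z + weak_partial \<Omega> (0, 1) P z = 0"
        "weak_partial \<Omega> (1, 0) (\<lambda>x. fst (v x)) z + weak_partial \<Omega> (0, 1) (\<lambda>x. snd (v x)) z = 0"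
        using elim(1)[rule_format, OF z, of "(1, 0)"] elim(1)[rule_format, OF z, of "(0, 1)"] elim(2)[rule_format, OF z] ne
        by (simp_all add: Basis_plane f fun_cong[OF f(1)] fun_cong[OF f(2)])
      show "v z = (V1 z, V2 z) \<and> Q z = P z \<and> V1 z * A1 z + V2 z * A2 z + P1 z = 0 \<and>
        V1 z * B1 z + V2 z * B2 z + P2 z = 0 \<and> A1 z + B2 z = 0"
        using E by (simp add: reps)
    qed
  qed
  show "\<exists>c>0. AE z in lborel. z \<in> bx R \<longrightarrow> z \<in> \<Omega> \<longrightarrow> c \<le> (V1 z)\<^sup>2 + (V2 z)\<^sup>2"
  proof -
    let ?K = "bx R \<inter> closure \<Omega>"
    have K: "compact ?K" using compact_bx by (rule compact_Int_closed) simp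
    then obtain c where c: "c > 0" "AE z in lebesgue_on ?K. c \<le> norm (v z)"
      using ns unfolding no_essential_stagnation_def by blast
    have "?K \<in> sets lebesgue" using K by (simp add: borel_compact)
    from c(2)[unfolded AE_lebesgue_on_iff[OF this]] main
    have "AE z in lborel. z \<in> bx R \<longrightarrow> z \<in> \<Omega> \<longrightarrow> c\<^sup>2 \<le> (V1 z)\<^sup>2 + (V2 z)\<^sup>2"
    proof eventually_elim
      case (elim z)
      show ?case
      proof (intro impI)
        assume z: "z \<in> bx R" "z \<in> \<Omega>"
        then have "c \<le> norm (v z)" "v z = (V1 z, V2 z)" using elim closure_subset[of \<Omega>] by blast+
        then have "c \<le> sqrt ((V1 z)\<^sup>2 + (V2 z)\<^sup>2)" by (simp add: norm_Pair)
        then have "c\<^sup>2 \<le> (sqrt ((V1 z)\<^sup>2 + (V2 z)\<^sup>2))\<^sup>2" using c(1) by (intro power_mono) auto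
        then show "c\<^sup>2 \<le> (V1 z)\<^sup>2 + (V2 z)\<^sup>2" by simp
      qed
    qed
    then show ?thesis using c(1) by (intro exI[of _ "c\<^sup>2"]) simp
  qed
  have i: "integrable (lebesgue_on \<Omega>) (\<lambda>x. norm (weak_grad \<Omega> P x) powr q)" using Lp by (simp add: Lp_space_def)
  have [measurable]: "P1 \<in> borel_measurable borel" "P2 \<in> borel_measurable borel"
    using H1_dataD(2,3)[OF DP] by (auto dest: borel_repD(1))
  have "integrable (lebesgue_on \<Omega>) (\<lambda>x. norm (weak_grad \<Omega> P x) powr q) \<longleftrightarrow> integrable lborel (\<lambda>z. norm (P1 z, P2 z) powr q)"
  proof (rule integrable_lebesgue_on_iff[OF \<Omega>l])
    show "(\<lambda>z. norm (P1 z, P2 z) powr q) \<in> borel_measurable borel" unfolding norm_Pair by measurable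
    show "AE z in lborel. indicator \<Omega> z * norm (weak_grad \<Omega> P z) powr q = norm (P1 z, P2 z) powr q"
      using rP
    proof eventually_elim
      case (elim z)
      show ?case
      proof (cases "z \<in> \<Omega>")
        case True
        have "weak_grad \<Omega> P z = (weak_partial \<Omega> (1, 0) P z, weak_partial \<Omega> (0, 1) P z)"
          using ne by (simp add: weak_grad_def Basis_plane)
        with elim True show ?thesis by simp
      next
        case False
        then have "P1 z = 0" "P2 z = 0"
          by (auto intro: borel_repD(2)[OF H1_dataD(2)[OF DP]] borel_repD(2)[OF H1_dataD(3)[OF DP]])
        with False show ?thesis by (simp add: zero_prod_def[symmetric])
      qed
    qed
  qed
  with i show "integrable lborel (\<lambda>z. norm (P1 z, P2 z) powr q)" by simp
qed

section \<open>The two domains\<close>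

lemma AE_snd_nonzero: "AE z in (lborel :: (real \<times> real) measure). snd z \<noteq> 0"
proof -
  have "emeasure lborel ((UNIV :: real set) \<times> {0 :: real}) = emeasure lborel (UNIV :: real set) * emeasure lborel {0 :: real}"
    by (subst lborel_prod[symmetric], intro lborel.emeasure_pair_measure_Times) auto
  then have "(UNIV :: real set) \<times> {0 :: real} \<in> null_sets lborel"
    by (simp add: null_sets_def borel_Times)
  then show ?thesis by (rule AE_I') auto
qed

theorem theorem1p2:
  fixes \<Omega> :: "(real \<times> real) set"
    and v :: "real \<times> real \<Rightarrow> real \<times> real"
    and P :: "real \<times> real \<Rightarrow> real"
    and q :: real
  assumes "\<Omega> = UNIV \<or> \<Omega> = half_plane"
    and "(\<lambda>x. fst (v x)) \<in> H1_loc_closure \<Omega>"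
    and "(\<lambda>x. snd (v x)) \<in> H1_loc_closure \<Omega>"
    and "P \<in> H1_loc_closure \<Omega>"
    and "steady_euler \<Omega> v P"
    and "\<Omega> = half_plane \<Longrightarrow> has_trace (\<lambda>x. snd (v x)) (\<lambda>_. 0)"
    and "no_essential_stagnation \<Omega> v"
    and "1 \<le> q" and "q \<le> 2"
    and "weak_grad \<Omega> P \<in> Lp_space q \<Omega>"
  shows "(\<exists>c. AE x in lebesgue_on \<Omega>. P x = c)
       \<and> parallel_shear_flow \<Omega> v
       \<and> (\<Omega> = half_plane \<longrightarrow> (\<exists>V. AE x in lebesgue_on \<Omega>. v x = (V (snd x), 0)))"
proof -
  have \<Omega>: "open \<Omega>" using assms(1) open_half_plane by auto
  then have \<Omega>l: "\<Omega> \<in> sets lebesgue" by auto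
  from H1_data_exists[OF \<Omega> assms(2)] obtain V1 A1 A2 where D1: "H1_data \<Omega> (\<lambda>x. fst (v x)) V1 A1 A2" by (elim exE)
  from H1_data_exists[OF \<Omega> assms(3)] obtain V2 B1 B2 where D2: "H1_data \<Omega> (\<lambda>x. snd (v x)) V2 B1 B2" by (elim exE)
  from H1_data_exists[OF \<Omega> assms(4)] obtain Q P1 P2 where DP: "H1_data \<Omega> P Q P1 P2" by (elim exE)
  note bd = borel_data[OF \<Omega> D1 D2 DP assms(5) assms(7) assms(10)]
  show ?thesis
  proof (cases "\<Omega> = UNIV")
    case True
    have wg: "wgrad F G1 G2" if D: "H1_data \<Omega> f F G1 G2" for f F G1 G2
      using H1_dataD(4-8)[OF D] True unfolding wgrad_def by simp
    interpret weak_euler V1 V2 A1 A2 B1 B2 Q P1 P2 q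
    proof
      show "wgrad V1 A1 A2" "wgrad V2 B1 B2" "wgrad Q P1 P2" by (rule wg[OF D1] wg[OF D2] wg[OF DP])+
      show "\<exists>c>0. AE z in lborel. z \<in> bx R \<longrightarrow> c \<le> (V1 z)\<^sup>2 + (V2 z)\<^sup>2" for R
        using bd(2)[of R] True by simp
      show "AE z in lborel. V1 z * A1 z + V2 z * A2 z + P1 z = 0 \<and> V1 z * B1 z + V2 z * B2 z + P2 z = 0"
        using bd(1) by eventually_elim (simp add: True)
      show "AE z in lborel. A1 z + B2 z = 0" using bd(1) by eventually_elim (simp add: True)
      show "1 \<le> q" "q \<le> 2" "integrable lborel (\<lambda>z. norm (P1 z, P2 z) powr q)" by fact+
    qed
    from pressure_const obtain c where c: "AE z in lborel. Q z = c" ..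
    from shear_flow obtain e V where e: "norm e = 1" "AE z in lborel. (V1 z, V2 z) = V (z \<bullet> perp e) *\<^sub>R e" by (elim exE conjE)
    have "AE x in lborel. x \<in> \<Omega> \<longrightarrow> P x = c" using c bd(1) by eventually_elim simp
    moreover have "AE x in lborel. x \<in> \<Omega> \<longrightarrow> v x = V (x \<bullet> perp e) *\<^sub>R e" using e(2) bd(1) by eventually_elim simp
    \<comment> \<open>On the whole plane the last conjunct is thereby vacuous.\<close>
    moreover have "\<Omega> \<noteq> half_plane" using True half_plane_iff[of 0] by auto
    ultimately show ?thesis
      unfolding parallel_shear_flow_def AE_lebesgue_on_iff[OF \<Omega>l] using e(1) by blast
  next
    case False
    then have H: "\<Omega> = half_plane" using assms(1) by simp
    note D1 = D1[unfolded H] and D2 = D2[unfolded H] and DP = DP[unfolded H] and bd = bd[unfolded H]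
    have even: "wgrad (\<lambda>z. F z + 1 * F (rf z)) (\<lambda>z. G1 z + 1 * G1 (rf z)) (\<lambda>z. G2 z + - 1 * G2 (rf z))"
      if D: "H1_data half_plane f F G1 G2" for f F G1 G2
      by (rule wgrad_reflect[OF H1_dataD(4-6)[OF D]])
         (rule half_plane_parts(1)[OF D]; assumption | rule half_plane_parts(2)[OF D]; simp)+
    have odd: "wgrad (\<lambda>z. V2 z + - 1 * V2 (rf z)) (\<lambda>z. B1 z + - 1 * B1 (rf z)) (\<lambda>z. B2 z + - (- 1) * B2 (rf z))"
      by (rule wgrad_reflect[OF H1_dataD(4-6)[OF D2]])
         (rule half_plane_parts(1)[OF D2]; assumption | rule half_plane_parts_trace[OF D2 assms(6)[OF H]]; assumption)+
    have zero: "V1 z = 0" "V2 z = 0" "A1 z = 0" "A2 z = 0" "B1 z = 0" "B2 z = 0" "Q z = 0" "P1 z = 0" "P2 z = 0"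
      if "snd z \<le> 0" for z
      using that half_plane_iff[of z]
      by (auto intro: H1_dataD(1-3)[OF D1, THEN borel_repD(2)] H1_dataD(1-3)[OF D2, THEN borel_repD(2)] H1_dataD(1-3)[OF DP, THEN borel_repD(2)])
    \<comment> \<open>The representatives vanish on and below the axis, so off the axis at most one
      summand is nonzero and these sums are the even and odd extensions. Differentiation across the
      axis flips the parity, which fixes the choice for every derivative. The factors
      \<open>1\<close> and \<open>- 1\<close> match \<open>wgrad_reflect\<close>.\<close>
    define Ev where "Ev F z = F z + 1 * F (rf z)" for F :: "real \<times> real \<Rightarrow> real" and z
    define Od where "Od F z = F z + - 1 * F (rf z)" for F :: "real \<times> real \<Rightarrow> real" and z
    have bd1: "AE z in lborel. 0 < snd z \<longrightarrow> v z = (V1 z, V2 z) \<and> Q z = P z \<and> V1 z * A1 z + V2 z * A2 z + P1 z = 0 \<and>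
      V1 z * B1 z + V2 z * B2 z + P2 z = 0 \<and> A1 z + B2 z = 0" using bd(1) by (simp add: half_plane_iff)
    \<comment> \<open>One of the two gradients is zero off the axis and contributes nothing, as
      \<open>0 powr q = 0\<close>.\<close>
    have PQ: "norm (Ev P1 z, Od P2 z) powr q = norm (P1 z, P2 z) powr q + norm (P1 (rf z), P2 (rf z)) powr q" if "snd z \<noteq> 0" for z
    proof (cases "0 < snd z")
      case True
      then show ?thesis using zero[of "rf z"] by (simp add: Ev_def Od_def zero_prod_def[symmetric])
    next
      case False
      then show ?thesis using zero[of z] by (simp add: Ev_def Od_def norm_Pair zero_prod_def[symmetric])
    qed
    have Pm[measurable]: "P1 \<in> borel_measurable borel" "P2 \<in> borel_measurable borel"
      using H1_dataD(5,6)[OF DP] by (auto dest: L2loc_measurable)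
    interpret weak_euler "Ev V1" "Od V2" "Ev A1" "Od A2" "Od B1" "Ev B2" "Ev Q" "Ev P1" "Od P2" q
    proof
      show "wgrad (Ev V1) (Ev A1) (Od A2)" "wgrad (Ev Q) (Ev P1) (Od P2)"
        using even[OF D1] even[OF DP] unfolding Ev_def[abs_def] Od_def[abs_def] .
      show "wgrad (Od V2) (Od B1) (Ev B2)" using odd unfolding Ev_def[abs_def] Od_def[abs_def] by simp
      show "\<exists>c>0. AE z in lborel. z \<in> bx R \<longrightarrow> c \<le> (Ev V1 z)\<^sup>2 + (Od V2 z)\<^sup>2" for R
      proof -
        from bd(2)[of R] obtain c where c: "c > 0" "AE z in lborel. z \<in> bx R \<longrightarrow> z \<in> half_plane \<longrightarrow> c \<le> (V1 z)\<^sup>2 + (V2 z)\<^sup>2" by blast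
        have "AE z in lborel. z \<in> bx R \<longrightarrow> c \<le> (Ev V1 z)\<^sup>2 + (Od V2 z)\<^sup>2"
          using c(2) AE_rf[OF c(2)] AE_snd_nonzero
        proof eventually_elim
          case (elim z)
          show ?case
          proof (cases "0 < snd z")
            case True
            then show ?thesis using elim zero[of "rf z"] by (simp add: Ev_def Od_def half_plane_iff)
          next
            case False
            then show ?thesis using elim zero[of z] by (simp add: Ev_def Od_def half_plane_iff bx_rf)
          qed
        qed
        with c(1) show ?thesis by blast
      qed
      have E: "AE z in lborel. (Ev V1 z * Ev A1 z + Od V2 z * Od A2 z + Ev P1 z = 0 \<and> Ev V1 z * Od B1 z + Od V2 z * Ev B2 z + Od P2 z = 0)
          \<and> Ev A1 z + Ev B2 z = 0"
        using bd1 AE_rf[OF bd1] AE_snd_nonzero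
      proof eventually_elim
        case (elim z)
        show ?case
        proof (cases "0 < snd z")
          case True
          then show ?thesis using elim zero[of "rf z"] by (simp add: Ev_def Od_def)
        next
          case False
          then have *: "0 < snd (rf z)" using elim(3) by simp
          note e = elim(2)[rule_format, OF *]
          \<comment> \<open>Below the axis the second momentum equation appears with all terms
            negated; the first one and the divergence are unchanged by the reflection.\<close>
          have "- (V1 (rf z) * B1 (rf z)) - V2 (rf z) * B2 (rf z) - P2 (rf z) = 0" using e by linarith
          then show ?thesis using e False zero[of z] by (simp add: Ev_def Od_def)
        qed
      qed
      show "AE z in lborel. Ev V1 z * Ev A1 z + Od V2 z * Od A2 z + Ev P1 z = 0 \<and> Ev V1 z * Od B1 z + Od V2 z * Ev B2 z + Od P2 z = 0"
        using E by eventually_elim simp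
      show "AE z in lborel. Ev A1 z + Ev B2 z = 0" using E by eventually_elim simp
      have hm: "(\<lambda>z. norm (P1 z, P2 z) powr q) \<in> borel_measurable borel" unfolding norm_Pair by measurable
      have i: "integrable lborel (\<lambda>z. norm (P1 z, P2 z) powr q + norm (P1 (rf z), P2 (rf z)) powr q)"
        using bd(3) integral_rf(2)[OF hm] by (intro Bochner_Integration.integrable_add) simp_all
      show "integrable lborel (\<lambda>z. norm (Ev P1 z, Od P2 z) powr q)"
      proof (rule integrable_cong_AE_imp[OF i])
        show "(\<lambda>z. norm (Ev P1 z, Od P2 z) powr q) \<in> borel_measurable lborel"
          unfolding norm_Pair Ev_def Od_def by measurable
        show "AE z in lborel. norm (P1 z, P2 z) powr q + norm (P1 (rf z), P2 (rf z)) powr q = norm (Ev P1 z, Od P2 z) powr q"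
          using AE_snd_nonzero by eventually_elim (simp add: PQ)
      qed
      show "1 \<le> q" "q \<le> 2" by fact+
    qed
    from pressure_const obtain c where c: "AE z in lborel. Ev Q z = c" ..
    from shear_flow obtain e V where e: "norm e = 1" "AE z in lborel. (Ev V1 z, Od V2 z) = V (z \<bullet> perp e) *\<^sub>R e" by (elim exE conjE)
    have up: "Ev F z = F z" "Od F z = F z" if "0 < snd z" "F (rf z) = 0" for F z
      using that by (simp_all add: Ev_def Od_def)
    have Pc: "AE x in lborel. x \<in> half_plane \<longrightarrow> P x = c"
      using c bd1
    proof eventually_elim
      case (elim z)
      then show ?case using up(1)[of z Q] zero(7)[of "rf z"] by (auto simp: half_plane_iff)
    qed
    have vV: "AE x in lborel. x \<in> half_plane \<longrightarrow> v x = V (x \<bullet> perp e) *\<^sub>R e"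
      using e(2) bd1
    proof eventually_elim
      case (elim z)
      then show ?case using up(1)[of z V1] up(2)[of z V2] zero(1,2)[of "rf z"] by (auto simp: half_plane_iff)
    qed
    \<comment> \<open>The extended flow is symmetric under \<open>rf\<close>, which maps a direction
      \<open>(e1, e2)\<close> to \<open>(e1, -e2)\<close>. If \<open>snd e\<close> were nonzero, the
      speeds \<open>a\<close> at \<open>z\<close> and \<open>b\<close> at its mirror image would
      satisfy \<open>a = - b\<close>. They also satisfy \<open>a = b\<close>: by the first
      components if \<open>fst e\<close> is nonzero, and otherwise because the reflection leaves the
      coordinate across the flow unchanged. So the velocity would vanish.\<close>
    have "AE z in (lborel :: (real \<times> real) measure). snd e = 0"
      using e(2) AE_rf[OF e(2)] AE_sq_pos
    proof eventually_elim
      case (elim z)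
      define a where "a = V (z \<bullet> perp e)"
      define b where "b = V (rf z \<bullet> perp e)"
      have za: "Ev V1 z = a * fst e" "Od V2 z = a * snd e" using elim(1) by (simp_all add: a_def prod_eq_iff)
      have zb: "Ev V1 z = b * fst e" "Od V2 z = - (b * snd e)"
      proof -
        have "Ev V1 (rf z) = Ev V1 z" "Od V2 (rf z) = - Od V2 z" by (simp_all add: Ev_def Od_def)
        moreover have "Ev V1 (rf z) = b * fst e" "Od V2 (rf z) = b * snd e"
          using elim(2) by (simp_all add: b_def prod_eq_iff)
        ultimately show "Ev V1 z = b * fst e" "Od V2 z = - (b * snd e)" by linarith+
      qed
      show "snd e = 0"
      proof (rule ccontr)
        assume s: "snd e \<noteq> 0"
        have "a * snd e = (- b) * snd e" using za(2) zb(2) by simp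
        then have ab: "a = - b" using s by (simp only: mult_cancel_right) simp
        have "a = 0"
        proof (cases "fst e = 0")
          case True
          then have "rf z \<bullet> perp e = z \<bullet> perp e" by (simp add: perp_def inner_prod_def)
          then have "a = b" by (simp add: a_def b_def)
          with ab show ?thesis by simp
        next
          case False
          then have "a = b" using za(1) zb(1) by simp
          with ab show ?thesis by simp
        qed
        then have "sq z = 0" using za by (simp add: sq_def)
        with elim(3) show False by simp
      qed
    qed
    from AE_lborel_ex[OF this] have s0: "snd e = 0" by simp
    \<comment> \<open>Now \<open>fst e\<close> is 1 or -1 and \<open>perp e\<close> is
      \<open>(0, fst e)\<close>; the sign is absorbed into the profile.\<close>
    have "AE x in lborel. x \<in> half_plane \<longrightarrow> v x = (V (fst e * snd x) * fst e, 0)"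
      using vV
    proof eventually_elim
      case (elim z)
      show ?case
      proof
        assume "z \<in> half_plane"
        with elim have "v z = V (z \<bullet> perp e) *\<^sub>R e" by blast
        also have "z \<bullet> perp e = fst e * snd z" using s0 by (simp add: perp_def inner_prod_def)
        finally show "v z = (V (fst e * snd z) * fst e, 0)" by (simp add: prod_eq_iff s0)
      qed
    qed
    then have "\<exists>W. AE x in lborel. x \<in> half_plane \<longrightarrow> v x = (W (snd x), 0)"
      by (intro exI[of _ "\<lambda>s. V (fst e * s) * fst e"])
    moreover have "\<exists>e V. norm e = 1 \<and> (AE x in lborel. x \<in> half_plane \<longrightarrow> v x = V (x \<bullet> perp e) *\<^sub>R e)"
      using e(1) vV by (intro exI[of _ e] exI[of _ V] conjI)
    moreover have "\<exists>c. AE x in lborel. x \<in> half_plane \<longrightarrow> P x = c" using Pc by (intro exI[of _ c])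
    ultimately show ?thesis
      unfolding parallel_shear_flow_def AE_lebesgue_on_iff[OF \<Omega>l] unfolding H by simp
  qed
qed

end
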